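(* Let $L$ be a linear ordinary differential operator of order $6$ on an interval $I\subset\mathbb{R}$, and let $X_L^\perp\subset\bigwedge^3V_L$ be the annihilator of the space $X_L\subset\bigwedge^3V_L^*$ (with $m=3$). Then the following statements hold. (1) If $\dim X_L^\perp\le 5$, then the degree of the Wronski map $\mathrm{Wr}_{L,3}$ is equal to $1$. (2) If $\dim X_L^\perp=6$, then the degree of the Wronski map $\mathrm{Wr}_{L,3}$ exceeds $1$ if and only if $L$ is equivalent to a self-adjoint linear ordinary differential operator.
   Context: A linear ordinary differential operator (ODO) of order $n$ on an interval $I\subset\mathbb{R}$ is $L\,x(t)=x^{(n)}(t)+a_{n-1}(t)x^{(n-1)}(t)+\cdots+a_0(t)x(t)$, where $a_0,\dots,a_{n-1}$ are smooth complex-valued functions on $I$. $V_L$ is the $n$-dimensional complex vector space of complex-valued solutions of $Lx=0$. The Wronskian of $f_1,\dots,f_m$ is $\mathrm{Wr}(f_1,\dots,f_m)=\det\bigl(f_j^{(i-1)}(t)\bigr)_{i,j=1}^m$. For $1\le m\le n-1$, the Wronski map $\mathrm{Wr}_{L,m}\colon\mathrm{Gr}_mV_L\to\mathbb{P}C^\infty(I)$ sends an $m$-dimensional subspace $\Lambda\subset V_L$ with basis $f_1,\dots,f_m$ to the line spanned by $\mathrm{Wr}(f_1,\dots,f_m)$, which is not identically zero and up to a nonzero scalar depends only on $\Lambda$. The map is induced by the linear map $\bigwedge^mV_L\to C^\infty(I)$, $f_1\wedge\cdots\wedge f_m\mapsto\mathrm{Wr}(f_1,\dots,f_m)$, so it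 takes values in a finite-dimensional projective space and its image is a projective variety. The degree of the Wronski map is its degree as a map onto its image: the constant number of points in the preimage of a point $y$, for $y$ in an open dense subset of the image. Given a basis $f_1,\dots,f_n$ of $V_L$ with dual basis $f_1^*,\dots,f_n^*$ of $V_L^*$, put $c^{(j)}(t)=\sum_{i=1}^nf_i^{(j)}(t)f_i^*\in V_L^*$ for $t\in I$, $j\ge0$ (with $c=c^{(0)}$). For fixed $m$, $X_L=\bigl\langle c(t)\wedge c'(t)\wedge\cdots\wedge c^{(m-1)}(t)\mid t\in I\bigr\rangle\subset\bigwedge^mV_L^*$ (linear span), and $X_L^\perp=\{w\in\bigwedge^mV_L\mid w(v)=0\ \ \forall v\in X_L\}$ under the natural pairing of $\bigwedge^mV_L$ with $\bigwedge^mV_L^*$. Dimensions are vector space dimensions. The (formal) adjoint of $L$ is $L^*x(t)=(-1)^nx^{(n)}(t)+\sum_{i=0}^{n-1}(-1)^i(a_ix)^{(i)}(t)$, and $L$ is self-adjoint if $L^*=L$. Two linear ODOs $L,\widetilde L$ on $I$ are equivalent if there is a smooth nonvanishing (complex-valued) function $\mu$ on $I$ with $\widetilde Lx=\frac1\mu L(\mu x)$. *)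

theory Defs
  imports "HOL-Analysis.Analysis" "HOL-Library.Function_Algebras"
    "Jordan_Normal_Form.Determinant"
begin

section \<open>Complex-valued functions as a complex vector space\<close>

text \<open>
  Smooth functions, linear functionals, multilinear forms and elements of exterior powers are all
  complex-valued functions on some type, so one scalar multiplication serves for all of them.
  Where a function is only meaningful on part of its type, it is set to 0 elsewhere; thus equality
  of functions is the intended equality and \<open>dim\<close> is the intended dimension.
\<close>

definition fscale :: "complex \<Rightarrow> ('a \<Rightarrow> complex) \<Rightarrow> 'a \<Rightarrow> complex" where
  "fscale c f = (\<lambda>x. c * f x)"

global_interpretation cfun: vector_space fscale
  by unfold_locales (auto simp: fscale_def fun_eq_iff algebra_simps)

definition basis_list :: "('a \<Rightarrow> complex) list \<Rightarrow> ('a \<Rightarrow> complex) set \<Rightarrow> bool" where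
  "basis_list fs V \<longleftrightarrow> distinct fs \<and> cfun.independent (set fs) \<and> cfun.span (set fs) = V"

text \<open>The functional \<open>f\<^sub>i\<^sup>*\<close> of the basis dual to \<open>fs\<close>; it is 0 off the span of \<open>fs\<close>.\<close>

definition dual_basis :: "('a \<Rightarrow> complex) list \<Rightarrow> nat \<Rightarrow> ('a \<Rightarrow> complex) \<Rightarrow> complex" where
  "dual_basis fs i = (\<lambda>v. cfun.representation (set fs) v (fs ! i))"

definition grassmannian :: "nat \<Rightarrow> ('a \<Rightarrow> complex) set \<Rightarrow> ('a \<Rightarrow> complex) set set" where
  "grassmannian m V = {\<Lambda>. \<Lambda> \<subseteq> V \<and> (\<exists>fs. length fs = m \<and> basis_list fs \<Lambda>)}"


section \<open>Exterior powers\<close>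

text \<open>
  For finite-dimensional \<open>V\<close> the \<open>m\<close>-th exterior power of the dual of \<open>V\<close> is the space of
  alternating \<open>m\<close>-linear forms on \<open>V\<close>, with
  \<open>\<phi>\<^sub>1 \<and> \<dots> \<and> \<phi>\<^sub>m = ((v\<^sub>1, \<dots>, v\<^sub>m) \<mapsto> det (\<phi>\<^sub>i (v\<^sub>j)))\<close>.  Tuples are lists; a form is 0 on lists that
  are not in \<open>V\<^sup>m\<close>.
\<close>

definition alternating_forms ::
  "nat \<Rightarrow> ('a \<Rightarrow> complex) set \<Rightarrow> (('a \<Rightarrow> complex) list \<Rightarrow> complex) set" where
  "alternating_forms m V = {\<alpha>.
     (\<forall>vs. \<not> (length vs = m \<and> set vs \<subseteq> V) \<longrightarrow> \<alpha> vs = 0) \<and>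
     (\<forall>vs i x y a b. length vs = m \<and> set vs \<subseteq> V \<and> i < m \<and> x \<in> V \<and> y \<in> V \<longrightarrow>
        \<alpha> (vs[i := fscale a x + fscale b y]) = a * \<alpha> (vs[i := x]) + b * \<alpha> (vs[i := y])) \<and>
     (\<forall>vs. length vs = m \<and> set vs \<subseteq> V \<and> \<not> distinct vs \<longrightarrow> \<alpha> vs = 0)}"

definition wedge_functionals ::
  "('a \<Rightarrow> complex) set \<Rightarrow> (('a \<Rightarrow> complex) \<Rightarrow> complex) list \<Rightarrow> ('a \<Rightarrow> complex) list \<Rightarrow> complex" where
  "wedge_functionals V \<phi>s = (\<lambda>vs.
     if length vs = length \<phi>s \<and> set vs \<subseteq> V
     then Determinant.det
            (Matrix.mat (length \<phi>s) (length \<phi>s) (\<lambda>(i, j). (\<phi>s ! i) (vs ! j)))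
     else 0)"

text \<open>
  The \<open>m\<close>-th exterior power of \<open>V\<close> is spanned by the vectors \<open>v\<^sub>1 \<and> \<dots> \<and> v\<^sub>m\<close>, realised as the
  functionals \<open>\<alpha> \<mapsto> \<alpha> (v\<^sub>1, \<dots>, v\<^sub>m)\<close> on alternating \<open>m\<close>-linear forms.  With these models the natural
  pairing of \<open>w\<close> in the exterior power of \<open>V\<close> with \<open>\<alpha>\<close> in that of the dual is the value \<open>w \<alpha>\<close>; on
  decomposable elements it is \<open>det (\<phi>\<^sub>i (v\<^sub>j))\<close>.
\<close>

definition wedge ::
  "('a \<Rightarrow> complex) set \<Rightarrow> ('a \<Rightarrow> complex) list \<Rightarrow> (('a \<Rightarrow> complex) list \<Rightarrow> complex) \<Rightarrow> complex" where
  "wedge V vs = (\<lambda>\<alpha>. if \<alpha> \<in> alternating_forms (length vs) V then \<alpha> vs else 0)"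

definition exterior_power ::
  "nat \<Rightarrow> ('a \<Rightarrow> complex) set \<Rightarrow> ((('a \<Rightarrow> complex) list \<Rightarrow> complex) \<Rightarrow> complex) set" where
  "exterior_power m V = cfun.span {wedge V vs | vs. length vs = m \<and> set vs \<subseteq> V}"

lemma wedge_functionals_alternating:
  assumes V: "cfun.subspace V"
    and lin: "\<And>\<phi> x y a b. \<phi> \<in> set \<phi>s \<Longrightarrow> x \<in> V \<Longrightarrow> y \<in> V \<Longrightarrow>
      \<phi> (fscale a x + fscale b y) = a * \<phi> x + b * \<phi> y"
  shows "wedge_functionals V \<phi>s \<in> alternating_forms (length \<phi>s) V"
proof -
  define n where "n = length \<phi>s"
  define A where "A vs = Matrix.mat n n (\<lambda>(i, j). (\<phi>s ! i) (vs ! j))" for vs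
  have A: "A vs \<in> carrier_mat n n" for vs
    by (simp add: A_def)
  have w: "wedge_functionals V \<phi>s vs = Determinant.det (A vs)" if "length vs = n" "set vs \<subseteq> V" for vs
    using that by (simp add: wedge_functionals_def A_def n_def)
  have linear: "wedge_functionals V \<phi>s (vs[k := fscale a x + fscale b y]) =
      a * wedge_functionals V \<phi>s (vs[k := x]) + b * wedge_functionals V \<phi>s (vs[k := y])"
    if vs: "length vs = n" "set vs \<subseteq> V" "k < n" "x \<in> V" "y \<in> V" for vs k x y a b
  proof -
    have xy: "fscale a x + fscale b y \<in> V"
      using V vs by (simp add: cfun.subspace_add cfun.subspace_scale)
    have upd: "wedge_functionals V \<phi>s (vs[k := z]) = (\<Sum>i<n. (\<phi>s ! i) z * cofactor (A vs) i k)"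
      if "z \<in> V" for z
    proof -
      have "set (vs[k := z]) \<subseteq> V"
        using vs(2) \<open>z \<in> V\<close> set_update_subset_insert[of vs k z] by blast
      then have "wedge_functionals V \<phi>s (vs[k := z]) =
          (\<Sum>i<n. A (vs[k := z]) $$ (i, k) * cofactor (A (vs[k := z])) i k)"
        using w vs laplace_expansion_column[OF A vs(3)] by simp
      also have "\<dots> = (\<Sum>i<n. (\<phi>s ! i) z * cofactor (A vs) i k)"
      proof (intro sum.cong refl arg_cong2[where f = "(*)"])
        fix i assume "i \<in> {..<n}"
        then show "A (vs[k := z]) $$ (i, k) = (\<phi>s ! i) z"
          using vs by (simp add: A_def)
        have "mat_delete (A (vs[k := z])) i k = mat_delete (A vs) i k"
        proof (rule eq_matI)
          fix p q
          assume "p < dim_row (mat_delete (A vs) i k)" "q < dim_col (mat_delete (A vs) i k)"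
          then have pq: "p < n - 1" "q < n - 1"
            by (simp_all add: mat_delete_def A_def)
          define p' where "p' = (if p < i then p else Suc p)"
          define q' where "q' = (if q < k then q else Suc q)"
          have "p' < n" "q' < n" "q' \<noteq> k"
            using pq by (auto simp: p'_def q'_def)
          then have "A (vs[k := z]) $$ (p', q') = A vs $$ (p', q')"
            by (simp add: A_def)
          moreover have "mat_delete (A us) i k $$ (p, q) = A us $$ (p', q')" for us
            using pq A[of us] unfolding p'_def q'_def mat_delete_def by simp
          ultimately show "mat_delete (A (vs[k := z])) i k $$ (p, q) = mat_delete (A vs) i k $$ (p, q)"
            by simp
        qed (simp_all add: mat_delete_def A_def)
        then show "cofactor (A (vs[k := z])) i k = cofactor (A vs) i k"
          by (simp add: cofactor_def)
      qed
      finally show ?thesis .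
    qed
    have "(\<Sum>i<n. (\<phi>s ! i) (fscale a x + fscale b y) * cofactor (A vs) i k) =
        (\<Sum>i<n. a * ((\<phi>s ! i) x * cofactor (A vs) i k) + b * ((\<phi>s ! i) y * cofactor (A vs) i k))"
    proof (rule sum.cong[OF refl])
      fix i assume "i \<in> {..<n}"
      then have "(\<phi>s ! i) (fscale a x + fscale b y) = a * (\<phi>s ! i) x + b * (\<phi>s ! i) y"
        using lin[of "\<phi>s ! i" x y a b] vs by (simp add: n_def)
      then show "(\<phi>s ! i) (fscale a x + fscale b y) * cofactor (A vs) i k =
          a * ((\<phi>s ! i) x * cofactor (A vs) i k) + b * ((\<phi>s ! i) y * cofactor (A vs) i k)"
        by (simp only: distrib_right mult.assoc)
    qed
    then show ?thesis
      unfolding upd[OF xy] upd[OF vs(4)] upd[OF vs(5)] sum.distrib sum_distrib_left .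
  qed
  have alternating: "wedge_functionals V \<phi>s vs = 0"
    if vs: "length vs = n" "set vs \<subseteq> V" "\<not> distinct vs" for vs
  proof -
    obtain i j where ij: "i < n" "j < n" "i \<noteq> j" "vs ! i = vs ! j"
      using vs by (auto simp: distinct_conv_nth)
    then have "Matrix.col (A vs) i = Matrix.col (A vs) j"
      by (intro eq_vecI) (auto simp: A_def)
    then have "Determinant.det (A vs) = 0"
      using det_identical_columns[OF A ij(3,1,2)] by simp
    then show ?thesis
      using w vs by simp
  qed
  show ?thesis
    unfolding alternating_forms_def n_def[symmetric]
  proof (intro CollectI conjI allI impI; (elim conjE)?)
    fix vs assume "\<not> (length vs = n \<and> set vs \<subseteq> V)"
    then show "wedge_functionals V \<phi>s vs = 0"
      by (auto simp: wedge_functionals_def n_def)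
  qed (fact linear alternating)+
qed

lemma wedge_pairing:
  assumes "cfun.subspace V"
    and "\<And>\<phi> x y a b. \<phi> \<in> set \<phi>s \<Longrightarrow> x \<in> V \<Longrightarrow> y \<in> V \<Longrightarrow>
      \<phi> (fscale a x + fscale b y) = a * \<phi> x + b * \<phi> y"
    and "length vs = length \<phi>s" "set vs \<subseteq> V"
  shows "wedge V vs (wedge_functionals V \<phi>s) = Determinant.det
    (Matrix.mat (length \<phi>s) (length \<phi>s) (\<lambda>(i, j). (\<phi>s ! i) (vs ! j)))"
proof -
  have "wedge_functionals V \<phi>s \<in> alternating_forms (length vs) V"
    unfolding assms(3) by (rule wedge_functionals_alternating) (fact assms(1), rule assms(2))
  then have "wedge V vs (wedge_functionals V \<phi>s) = wedge_functionals V \<phi>s vs"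
    unfolding wedge_def by (simp only: if_True)
  also have "\<dots> = Determinant.det
      (Matrix.mat (length \<phi>s) (length \<phi>s) (\<lambda>(i, j). (\<phi>s ! i) (vs ! j)))"
    unfolding wedge_functionals_def using assms(3,4) by (simp only: simp_thms if_True)
  finally show ?thesis .
qed


section \<open>Smooth functions on an interval\<close>

text \<open>The interval may contain its endpoints; derivatives there are one-sided.\<close>

definition deriv_on :: "real set \<Rightarrow> (real \<Rightarrow> complex) \<Rightarrow> real \<Rightarrow> complex" where
  "deriv_on I f t = (if t \<in> I then vector_derivative f (at t within I) else 0)"

abbreviation nderiv_on :: "real set \<Rightarrow> nat \<Rightarrow> (real \<Rightarrow> complex) \<Rightarrow> real \<Rightarrow> complex" where
  "nderiv_on I k f \<equiv> (deriv_on I ^^ k) f"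

definition smooth_on :: "real set \<Rightarrow> (real \<Rightarrow> complex) \<Rightarrow> bool" where
  "smooth_on I f \<longleftrightarrow> (\<forall>k. \<forall>t\<in>I. nderiv_on I k f differentiable (at t within I))"

text \<open>\<open>C\<^sup>\<infinity>(I)\<close>\<close>

definition smooth_functions :: "real set \<Rightarrow> (real \<Rightarrow> complex) set" where
  "smooth_functions I = {f. smooth_on I f \<and> (\<forall>t. t \<notin> I \<longrightarrow> f t = 0)}"


section \<open>Linear ordinary differential operators\<close>

text \<open>
  The operator of order \<open>n\<close> with leading coefficient 1 and coefficients \<open>a\<^sub>0, \<dots>, a\<^sub>n\<^sub>-\<^sub>1\<close>; the
  coefficient function is only relevant at indices below the order and at points of the interval.
\<close>

datatype odo = ODO (odo_order: nat) (odo_coeff: "nat \<Rightarrow> real \<Rightarrow> complex")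

definition is_odo :: "real set \<Rightarrow> odo \<Rightarrow> bool" where
  "is_odo I L \<longleftrightarrow> (\<forall>i<odo_order L. smooth_on I (odo_coeff L i))"

definition odo_apply :: "real set \<Rightarrow> odo \<Rightarrow> (real \<Rightarrow> complex) \<Rightarrow> real \<Rightarrow> complex" where
  "odo_apply I L x t =
     nderiv_on I (odo_order L) x t + (\<Sum>i<odo_order L. odo_coeff L i t * nderiv_on I i x t)"

definition solutions :: "real set \<Rightarrow> odo \<Rightarrow> (real \<Rightarrow> complex) set" where
  "solutions I L = {x \<in> smooth_functions I. \<forall>t\<in>I. odo_apply I L x t = 0}"

definition adjoint_apply :: "real set \<Rightarrow> odo \<Rightarrow> (real \<Rightarrow> complex) \<Rightarrow> real \<Rightarrow> complex" where
  "adjoint_apply I L x t =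
     (- 1) ^ odo_order L * nderiv_on I (odo_order L) x t +
     (\<Sum>i<odo_order L. (- 1) ^ i * nderiv_on I i (\<lambda>s. odo_coeff L i s * x s) t)"

definition self_adjoint :: "real set \<Rightarrow> odo \<Rightarrow> bool" where
  "self_adjoint I L \<longleftrightarrow>
     (\<forall>x\<in>smooth_functions I. \<forall>t\<in>I. adjoint_apply I L x t = odo_apply I L x t)"

definition equivalent_odo :: "real set \<Rightarrow> odo \<Rightarrow> odo \<Rightarrow> bool" where
  "equivalent_odo I L M \<longleftrightarrow>
     (\<exists>\<mu>. smooth_on I \<mu> \<and> (\<forall>t\<in>I. \<mu> t \<noteq> 0) \<and>
       (\<forall>x\<in>smooth_functions I. \<forall>t\<in>I.
          odo_apply I M x t = (1 / \<mu> t) * odo_apply I L (\<lambda>s. \<mu> s * x s) t))"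


section \<open>The Wronski map and its degree\<close>

definition wronskian :: "real set \<Rightarrow> (real \<Rightarrow> complex) list \<Rightarrow> real \<Rightarrow> complex" where
  "wronskian I fs t =
     Determinant.det (Matrix.mat (length fs) (length fs) (\<lambda>(i, j). nderiv_on I i (fs ! j) t))"

text \<open>
  Points of the projective space of \<open>C\<^sup>\<infinity>(I)\<close> are one-dimensional subspaces.  The line does not
  depend on the chosen basis of \<open>\<Lambda>\<close>.
\<close>

definition wronski_map :: "real set \<Rightarrow> (real \<Rightarrow> complex) set \<Rightarrow> (real \<Rightarrow> complex) set" where
  "wronski_map I \<Lambda> = cfun.span {wronskian I (SOME fs. basis_list fs \<Lambda>)}"

text \<open>
  For a set \<open>Y\<close> of lines in a finite-dimensional space of functions, \<open>U\<close> is open and dense in \<open>Y\<close>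
  for the topology of projective space, i.e. the quotient topology, iff the union of the punctured
  lines in \<open>U\<close> is open and dense in that of \<open>Y\<close>.  The topology on functions is that of pointwise
  convergence, which induces the standard topology on every finite-dimensional subspace.
\<close>

definition punctured_cone :: "(real \<Rightarrow> complex) set set \<Rightarrow> (real \<Rightarrow> complex) set" where
  "punctured_cone Y = \<Union> Y - {0}"

definition open_dense_in :: "(real \<Rightarrow> complex) set set \<Rightarrow> (real \<Rightarrow> complex) set set \<Rightarrow> bool" where
  "open_dense_in Y U \<longleftrightarrow> U \<subseteq> Y \<and>
     openin (top_of_set (punctured_cone Y)) (punctured_cone U) \<and>
     punctured_cone Y \<subseteq> closure (punctured_cone U)"

definition has_wronski_degree :: "real set \<Rightarrow> odo \<Rightarrow> nat \<Rightarrow> nat \<Rightarrow> bool" where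
  "has_wronski_degree I L m d \<longleftrightarrow>
     (let G = grassmannian m (solutions I L) in
      \<exists>U. open_dense_in (wronski_map I ` G) U \<and>
          (\<forall>y\<in>U. finite {\<Lambda> \<in> G. wronski_map I \<Lambda> = y} \<and>
                 card {\<Lambda> \<in> G. wronski_map I \<Lambda> = y} = d))"

lemma open_dense_in_Int_nonempty:
  assumes "open_dense_in Y U" "open_dense_in Y U'" and "punctured_cone Y \<noteq> {}"
  shows "punctured_cone U \<inter> punctured_cone U' \<noteq> {}"
proof -
  obtain w where w: "w \<in> punctured_cone U"
    using assms(1,3) by (fastforce simp: open_dense_in_def)
  obtain T where T: "open T" "punctured_cone U = punctured_cone Y \<inter> T"
    using assms(1) by (auto simp: open_dense_in_def openin_open)
  have "w \<in> closure (punctured_cone U')" "w \<in> T"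
    using w T assms(2) by (auto simp: open_dense_in_def)
  then obtain z where z: "z \<in> punctured_cone U'" "z \<in> T"
    using T(1) by (meson disjoint_iff open_Int_closure_eq_empty)
  moreover have "z \<in> punctured_cone Y"
    using z assms(2) by (auto simp: open_dense_in_def punctured_cone_def)
  ultimately show ?thesis
    using T(2) by blast
qed

lemma line_eqI:
  assumes "z \<in> cfun.span {u}" "z \<in> cfun.span {v}" "z \<noteq> 0"
  shows "cfun.span {u} = cfun.span {v}"
proof -
  have *: "cfun.span {u} = cfun.span {z}" if "z \<in> cfun.span {u}" for u
  proof -
    obtain c where c: "z = fscale c u"
      using \<open>z \<in> cfun.span {u}\<close> by (auto simp: cfun.span_singleton)
    have "c \<noteq> 0"
      using c assms(3) by auto
    then have "u = fscale (1 / c) z"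
      by (simp add: c)
    then have "u \<in> cfun.span {z}"
      by (auto simp: cfun.span_singleton)
    then show ?thesis
      using that by (metis cfun.span_eq empty_subsetI insert_subset)
  qed
  show ?thesis
    using * assms by metis
qed

lemma has_wronski_degree_unique:
  assumes "has_wronski_degree I L m d" "has_wronski_degree I L m d'"
    and "punctured_cone (wronski_map I ` grassmannian m (solutions I L)) \<noteq> {}"
  shows "d = d'"
proof -
  let ?G = "grassmannian m (solutions I L)"
  obtain U U' where
    U: "open_dense_in (wronski_map I ` ?G) U" "\<And>y. y \<in> U \<Longrightarrow> card {\<Lambda> \<in> ?G. wronski_map I \<Lambda> = y} = d"
    and
    U': "open_dense_in (wronski_map I ` ?G) U'" "\<And>y. y \<in> U' \<Longrightarrow> card {\<Lambda> \<in> ?G. wronski_map I \<Lambda> = y} = d'"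
    using assms(1,2) unfolding has_wronski_degree_def Let_def by blast
  obtain z y y' where z: "z \<noteq> 0" "z \<in> y" "y \<in> U" "z \<in> y'" "y' \<in> U'"
    using open_dense_in_Int_nonempty[OF U(1) U'(1) assms(3)] by (auto simp: punctured_cone_def)
  have "y \<in> wronski_map I ` ?G" "y' \<in> wronski_map I ` ?G"
    using z U(1) U'(1) by (auto simp: open_dense_in_def)
  then have "y = y'"
    using z line_eqI unfolding wronski_map_def by blast
  then show ?thesis
    using U(2) U'(2) z by metis
qed


section \<open>The space \<open>X\<^sub>L\<close> and its annihilator\<close>

text \<open>\<open>c\<^sup>(\<^sup>j\<^sup>)(t) = \<Sum>\<^sub>i f\<^sub>i\<^sup>(\<^sup>j\<^sup>)(t) f\<^sub>i\<^sup>*\<close>\<close>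

definition dual_curve ::
  "real set \<Rightarrow> (real \<Rightarrow> complex) list \<Rightarrow> nat \<Rightarrow> real \<Rightarrow> (real \<Rightarrow> complex) \<Rightarrow> complex" where
  "dual_curve I fs j t = (\<Sum>i<length fs. fscale (nderiv_on I j (fs ! i) t) (dual_basis fs i))"

text \<open>
  The basis of \<open>V\<^sub>L\<close> used to define \<open>X\<^sub>L\<close> is an arbitrary one; the result is independent of it by
  \<open>X_space_eq\<close> below.
\<close>

definition X_space :: "real set \<Rightarrow> odo \<Rightarrow> nat \<Rightarrow> ((real \<Rightarrow> complex) list \<Rightarrow> complex) set" where
  "X_space I L m =
     (let fs = (SOME fs. basis_list fs (solutions I L)) in
      cfun.span
        {wedge_functionals (solutions I L) (map (\<lambda>j. dual_curve I fs j t) [0..<m]) | t. t \<in> I})"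

definition X_perp ::
  "real set \<Rightarrow> odo \<Rightarrow> nat \<Rightarrow> (((real \<Rightarrow> complex) list \<Rightarrow> complex) \<Rightarrow> complex) set" where
  "X_perp I L m = {w \<in> exterior_power m (solutions I L). \<forall>v\<in>X_space I L m. w v = 0}"

lemma nontrivial_limit_interval:
  fixes I :: "real set"
  assumes "is_interval I" "interior I \<noteq> {}" "t \<in> I"
  shows "at t within I \<noteq> bot"
proof -
  have "I \<noteq> {x}" for x
    using assms(2) interior_singleton by metis
  then show ?thesis
    using connected_imp_perfect[of I t] assms is_interval_connected trivial_limit_within by blast
qed

lemma deriv_on_cong:
  assumes "\<And>s. s \<in> I \<Longrightarrow> f s = g s"
  shows "deriv_on I f = deriv_on I g"
proof
  fix t
  show "deriv_on I f t = deriv_on I g t"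
  proof (cases "t \<in> I")
    case True
    have "(f has_vector_derivative D) (at t within I) \<longleftrightarrow> (g has_vector_derivative D) (at t within I)"
      for D
      using has_vector_derivative_transform[OF True] assms by metis
    then show ?thesis
      by (simp add: deriv_on_def vector_derivative_def)
  qed (simp add: deriv_on_def)
qed

lemma nderiv_on_sum:
  assumes I: "is_interval I" "interior I \<noteq> {}"
    and S: "finite S" "\<And>i. i \<in> S \<Longrightarrow> smooth_on I (f i)"
    and t: "t \<in> I"
  shows "nderiv_on I k (\<lambda>s. \<Sum>i\<in>S. c i * f i s) t = (\<Sum>i\<in>S. c i * nderiv_on I k (f i) t)"
  using t
proof (induction k arbitrary: t)
  case (Suc k)
  have "deriv_on I (nderiv_on I k (\<lambda>s. \<Sum>i\<in>S. c i * f i s)) =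
        deriv_on I (\<lambda>s. \<Sum>i\<in>S. c i * nderiv_on I k (f i) s)"
    by (rule deriv_on_cong) (rule Suc.IH)
  moreover have "deriv_on I (\<lambda>s. \<Sum>i\<in>S. c i * nderiv_on I k (f i) s) t =
      (\<Sum>i\<in>S. c i * nderiv_on I (Suc k) (f i) t)"
  proof -
    have "((\<lambda>s. \<Sum>i\<in>S. c i * nderiv_on I k (f i) s) has_vector_derivative
        (\<Sum>i\<in>S. c i * nderiv_on I (Suc k) (f i) t)) (at t within I)"
    proof (intro has_vector_derivative_sum has_vector_derivative_mult_right)
      fix i assume "i \<in> S"
      then have "nderiv_on I k (f i) differentiable (at t within I)"
        using S(2) Suc.prems by (auto simp: smooth_on_def)
      then show "(nderiv_on I k (f i) has_vector_derivative nderiv_on I (Suc k) (f i) t) (at t within I)"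
        using Suc.prems by (simp add: deriv_on_def vector_derivative_works)
    qed
    then show ?thesis
      using vector_derivative_within[OF nontrivial_limit_interval[OF I Suc.prems]] Suc.prems
      unfolding deriv_on_def[of I "\<lambda>s. \<Sum>i\<in>S. c i * nderiv_on I k (f i) s"] by simp
  qed
  ultimately show ?case
    by simp
qed simp

lemma dual_curve_eq:
  assumes I: "is_interval I" "interior I \<noteq> {}" and t: "t \<in> I"
    and fs: "basis_list fs V" and V: "V \<subseteq> smooth_functions I"
  shows "dual_curve I fs j t = (\<lambda>v. if v \<in> V then nderiv_on I j v t else 0)"
proof
  fix v
  have fs': "distinct fs" "cfun.independent (set fs)" "cfun.span (set fs) = V"
    using fs by (auto simp: basis_list_def)
  have apply_sum: "(\<Sum>i\<in>S. h i) x = (\<Sum>i\<in>S. h i x)"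
    for S and h :: "'i \<Rightarrow> 'x \<Rightarrow> complex" and x
    by (induction S rule: infinite_finite_induct) auto
  have eq: "dual_curve I fs j t v =
      (\<Sum>f\<in>set fs. cfun.representation (set fs) v f * nderiv_on I j f t)"
    using sum.reindex_bij_betw[OF bij_betw_nth[OF fs'(1) refl refl],
        of "\<lambda>f. cfun.representation (set fs) v f * nderiv_on I j f t"]
    by (simp add: dual_curve_def apply_sum dual_basis_def fscale_def[of _ "dual_basis fs _"]
        fscale_def[of _ "\<lambda>v. cfun.representation (set fs) v _"] mult.commute)
  show "dual_curve I fs j t v = (if v \<in> V then nderiv_on I j v t else 0)"
  proof (cases "v \<in> V")
    case True
    have "v = (\<Sum>f\<in>set fs. fscale (cfun.representation (set fs) v f) f)"
      using cfun.sum_representation_eq[of "set fs" v "set fs"] fs' True by simp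
    then have v: "v = (\<lambda>s. \<Sum>f\<in>set fs. cfun.representation (set fs) v f * f s)"
      by (auto simp: fun_eq_iff apply_sum fscale_def)
    have "smooth_on I f" if "f \<in> set fs" for f
      using that V fs'(3) cfun.span_base by (fastforce simp: smooth_functions_def)
    then have "nderiv_on I j (\<lambda>s. \<Sum>f\<in>set fs. cfun.representation (set fs) v f * f s) t =
        (\<Sum>f\<in>set fs. cfun.representation (set fs) v f * nderiv_on I j f t)"
      using nderiv_on_sum[OF I, of "set fs" "\<lambda>f. f" t j] t by simp
    then show ?thesis
      using True eq v by metis
  next
    case False
    then show ?thesis
      using eq fs'(3) by (simp add: cfun.representation_def)
  qed
qed

lemma X_space_eq:
  assumes "is_interval I" "interior I \<noteq> {}" and fs: "basis_list fs (solutions I L)"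
  shows "X_space I L m = cfun.span
    {wedge_functionals (solutions I L) (map (\<lambda>j. dual_curve I fs j t) [0..<m]) | t. t \<in> I}"
proof -
  have *: "basis_list (SOME fs. basis_list fs (solutions I L)) (solutions I L)"
    using fs by (rule someI)
  have "dual_curve I (SOME fs. basis_list fs (solutions I L)) j t = dual_curve I fs j t"
    if "t \<in> I" for j t
    using dual_curve_eq[OF assms(1,2) that] fs * by (simp add: solutions_def)
  then have "(\<lambda>t. wedge_functionals (solutions I L)
        (map (\<lambda>j. dual_curve I (SOME fs. basis_list fs (solutions I L)) j t) [0..<m])) ` I =
      (\<lambda>t. wedge_functionals (solutions I L) (map (\<lambda>j. dual_curve I fs j t) [0..<m])) ` I"
    by (intro image_cong refl) simp
  then show ?thesis
    unfolding X_space_def Let_def Setcompr_eq_image by simp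
qed

end

theory Submission
  imports Defs
begin

text \<open>
 Why the theorem holds. The jet at a base point identifies \<open>V_L\<close> with \<open>\<complex>\<^sup>6\<close>, and a trivector \<open>k\<close> of \<open>V_L\<close>
 has the Wronskian \<open>WR k t = k (c t, c' t, c'' t)\<close>. Hence \<open>X_L\<^sup>\<bottom>\<close> is the kernel \<open>K\<close> of \<open>WR\<close>
 (\<open>X_perp_eq\<close>), and the Wronski map is the linear projection \<open>WR\<close> restricted to the cone of
 decomposable trivectors, which meets \<open>K\<close> only in \<open>0\<close> (\<open>wronskian_nonzero\<close>). By compactness this
 restriction is a closed map, and the degree is the number of decomposables in a generic fibre
 (\<open>degree_criterion\<close>).

 Two decomposables with the same Wronskian differ by an element of \<open>K\<close>, and when such pairs collide
 a tangent vector of the cone lies in \<open>K\<close> (\<open>closure_ambiguous_type\<close>). How much freedom is there for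
 such a \<open>k \<in> K\<close>? The endomorphism \<open>Bb k k\<close>, quadratic in \<open>k\<close>, recovers the three-dimensional space
 of the decomposable as an image, unless \<open>k\<close> has a linear factor \<open>v\<close>; then the space contains \<open>v\<close>
 and lies in the hyperplane of a covector \<open>\<theta>\<close>, where \<open>v\<close> and \<open>\<theta>\<close> are determined by \<open>k\<close>
 (\<open>classify_secant\<close>, \<open>classify_tangent\<close>). The first type depends on too few parameters to matter when
 \<open>dim K \<le> 6\<close>. The spaces of the second type form, for each \<open>k\<close>, a four-dimensional family, so that the
 nine-dimensional Grassmannian is filled only if the elements of \<open>K\<close> with a factor fill a projective
 space of dimension five. They do not if \<open>dim K \<le> 5\<close>, nor if \<open>dim K = 6\<close> and some element has no
 factor; nor is the Grassmannian filled if all elements share \<open>v\<close> or \<open>\<theta>\<close>. In these cases the generic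
 fibre is a single point. Dimensions are compared through Lebesgue measure: a differentiable image
 of a space of smaller real dimension, or of a null set in one of equal dimension, is a null set.

 There remains \<open>dim K = 6\<close> with every element having a factor, no factor or covector being common, and
 no element decomposable. Then \<open>K = {p \<and> \<omega> | p}\<close> for one bivector \<open>\<omega>\<close> (\<open>bivector_exists\<close>).
 As a form on the dual space \<open>\<omega>\<close> satisfies \<open>\<omega> (c\<^sup>(\<^sup>i\<^sup>), c\<^sup>(\<^sup>j\<^sup>)) = 0\<close> for \<open>i + j < 5\<close>, and differentiating
 these relations gives \<open>3 g' = - a\<^sub>5 g\<close> for \<open>g = \<omega> (c, c\<^sup>(\<^sup>5\<^sup>))\<close>. Conjugation by \<open>\<mu>\<close> with
 \<open>6 \<mu>' = - a\<^sub>5 \<mu>\<close> makes the form constant along the curve, and an operator with such a form is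
 self-adjoint (\<open>self_adjoint_of_form\<close>).

 Conversely a self-adjoint operator carries a nondegenerate skew form \<open>\<beta>\<close> of this kind
 (\<open>form_of_self_adjoint\<close>), and the relations \<open>i + j < 5\<close> survive conjugation. They put \<open>p \<and> \<beta>\<close> into \<open>K\<close>
 for every \<open>p\<close>; as \<open>dim K = 6\<close>, these are all elements of \<open>K\<close>. For a decomposable \<open>g\<close> the only
 possible \<open>p \<noteq> 0\<close> with \<open>g - p \<and> \<beta>\<close> decomposable is the contraction of \<open>g\<close> with the inverse form, and it
 does work if it is nonzero. So the generic fibre has two points (\<open>degree_two\<close>).
\<close>

no_notation Matrix.vec_index (infixl "$" 100)
no_notation Matrix.scalar_prod (infix "\<bullet>" 70)
hide_fact (open) Matrix.vec_eq_iff

section \<open>Linear systems of ordinary differential equations\<close>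

text \<open>The estimate behind the Picard series: each integration gains a factor \<open>M (t - a) / n\<close>.\<close>

lemma iterated_derivative_bound:
 fixes A :: "real \<Rightarrow> 'a::real_normed_vector \<Rightarrow> 'a" and y :: "nat \<Rightarrow> real \<Rightarrow> 'a"
 assumes M: "\<And>t v. t \<in> {a..b} \<Longrightarrow> norm (A t v) \<le> M * norm v"
  and y0: "\<And>t. t \<in> {a..b} \<Longrightarrow> norm (y 0 t) \<le> C"
  and ya: "\<And>n. y (Suc n) a = 0"
  and yd: "\<And>n t. t \<in> {a..b} \<Longrightarrow>
   (y (Suc n) has_vector_derivative A t (y n t)) (at t within {a..b})"
  and M0: "M \<ge> 0"
 shows "t \<in> {a..b} \<Longrightarrow> norm (y n t) \<le> C * (M * (t - a)) ^ n / fact n"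
proof (induction n arbitrary: t)
 case 0
 then show ?case using y0 by simp
next
 case (Suc n)
 define \<phi> where "\<phi> = (\<lambda>t. C * (M * (t - a)) ^ Suc n / fact (Suc n))"
 show ?case
 proof (cases "t = a")
  case True
  then show ?thesis using ya by simp
 next
  case False
  then have at: "a < t" "t \<le> b" using Suc.prems by auto
  have "norm (y (Suc n) t - y (Suc n) a) \<le> \<phi> t - \<phi> a"
  proof (rule differentiable_bound_general[OF at(1)])
   show "continuous_on {a..t} (y (Suc n))"
    by (rule continuous_on_subset[OF continuous_on_vector_derivative[OF yd]]) (use at in auto)
   show "continuous_on {a..t} \<phi>" unfolding \<phi>_def by (intro continuous_intros) auto
   fix x assume x: "a < x" "x < t"
   then have "x \<in> {a..b}" "x \<in> interior {a..b}" using at by auto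
   then show "(y (Suc n) has_vector_derivative A x (y n x)) (at x)"
    using yd at_within_interior by metis
   have "((\<lambda>t. C * (M * (t - a)) ^ Suc n / fact (Suc n)) has_real_derivative
     C * (real (Suc n) * (M * (x - a)) ^ n * M) / fact (Suc n)) (at x)"
    by (rule derivative_eq_intros refl | simp)+
   moreover have "C * (real (Suc n) * (M * (x - a)) ^ n * M) / fact (Suc n) =
     M * (C * (M * (x - a)) ^ n / fact n)"
    by (simp add: field_simps del: of_nat_Suc)
   ultimately show "(\<phi> has_vector_derivative M * (C * (M * (x - a)) ^ n / fact n)) (at x)"
    unfolding \<phi>_def by (simp only: has_real_derivative_iff_has_vector_derivative)
   have "norm (A x (y n x)) \<le> M * norm (y n x)" using M \<open>x \<in> {a..b}\<close> by blast
   also have "\<dots> \<le> M * (C * (M * (x - a)) ^ n / fact n)"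
    using Suc.IH[OF \<open>x \<in> {a..b}\<close>] M0 by (rule mult_left_mono)
   finally show "norm (A x (y n x)) \<le> M * (C * (M * (x - a)) ^ n / fact n)" .
  qed
  then show ?thesis using ya by (simp add: \<phi>_def)
 qed
qed

lemma linear_ode_unique_right:
 fixes A :: "real \<Rightarrow> 'a::real_normed_vector \<Rightarrow> 'a"
 assumes M: "\<And>t v. t \<in> {a..b} \<Longrightarrow> norm (A t v) \<le> M * norm v"
  and yd: "\<And>t. t \<in> {a..b} \<Longrightarrow> (y has_vector_derivative A t (y t)) (at t within {a..b})"
  and ya: "y a = 0" and t: "t \<in> {a..b}" and M0: "M \<ge> 0"
 shows "y t = 0"
proof -
 have "compact (y ` {a..b})"
  using yd by (intro compact_continuous_image continuous_on_vector_derivative) auto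
 then obtain C where C: "\<And>t. t \<in> {a..b} \<Longrightarrow> norm (y t) \<le> C"
  by (meson bounded_iff compact_imp_bounded imageI)
 have "norm (y t) \<le> C * (M * (t - a)) ^ n / fact n" for n
  using iterated_derivative_bound[where y = "\<lambda>_. y", OF M C ya yd M0 t] by blast
 moreover have "(\<lambda>n. C * ((M * (t - a)) ^ n / fact n)) \<longlonglongrightarrow> C * 0"
  using summable_LIMSEQ_zero[OF summable_exp[of "M * (t - a)"]]
  by (intro tendsto_mult tendsto_const) (simp add: divide_inverse mult.commute)
 ultimately have "norm (y t) \<le> 0"
  by (intro LIMSEQ_le_const[of "\<lambda>n. C * ((M * (t - a)) ^ n / fact n)"]) auto
 then show ?thesis by simp
qed

text \<open>The solution is the Picard series \<open>\<Sum>n. y n\<close> with \<open>y 0 = c\<close> and \<open>y (Suc n) = \<integral> A (y n)\<close>; the factorial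
 bound makes it and its derivative converge uniformly.\<close>

lemma linear_ode_exists_left_endpoint:
 fixes A :: "real \<Rightarrow> 'a::banach \<Rightarrow> 'a"
 assumes ab: "a \<le> b" and M0: "M \<ge> 0"
  and lin: "\<And>t. t \<in> {a..b} \<Longrightarrow> bounded_linear (A t)"
  and M: "\<And>t v. t \<in> {a..b} \<Longrightarrow> norm (A t v) \<le> M * norm v"
  and cont: "\<And>y. continuous_on {a..b} y \<Longrightarrow> continuous_on {a..b} (\<lambda>t. A t (y t))"
 shows "\<exists>y. y a = c \<and> (\<forall>t\<in>{a..b}. (y has_vector_derivative A t (y t)) (at t within {a..b}))"
proof -
 define d where "d = rec_nat (\<lambda>t::real. c) (\<lambda>n z t. integral {a..t} (\<lambda>s. A s (z s)))"
 have d0: "d 0 = (\<lambda>t. c)" and dS: "d (Suc n) = (\<lambda>t. integral {a..t} (\<lambda>s. A s (d n s)))" for n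
  by (simp_all add: d_def)
 have dc: "continuous_on {a..b} (d n)" for n
 proof (induction n)
  case (Suc n)
  show ?case unfolding dS
   using integral_has_vector_derivative[OF cont[OF Suc]]
   by (rule continuous_on_vector_derivative)
 qed (simp add: d0)
 have dd: "(d (Suc n) has_vector_derivative A t (d n t)) (at t within {a..b})"
  if "t \<in> {a..b}" for n t
  unfolding dS using integral_has_vector_derivative[OF cont[OF dc]] that by blast
 have da: "d (Suc n) a = 0" for n by (simp add: dS)
 define K where "K = (\<lambda>n. norm c * ((M * (b - a)) ^ n / fact n))"
 have dK: "norm (d n t) \<le> K n" if t: "t \<in> {a..b}" for n t
 proof -
  have "norm (d n t) \<le> norm c * (M * (t - a)) ^ n / fact n"
   by (rule iterated_derivative_bound[where A = A and b = b]) (use M d0 da dd M0 t in auto)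
  also have "\<dots> \<le> K n"
   using t M0 by (auto simp: K_def intro!: mult_left_mono divide_right_mono power_mono)
  finally show ?thesis .
 qed
 have "summable K"
  unfolding K_def using summable_exp[of "M * (b - a)"]
  by (intro summable_mult) (simp add: field_simps)
 define y where "y = (\<lambda>t. \<Sum>n. d n t)"
 have ul: "uniform_limit {a..b} (\<lambda>n t. \<Sum>i<n. d i t) y sequentially"
  unfolding y_def using dK \<open>summable K\<close> by (intro Weierstrass_m_test)
 have yc: "continuous_on {a..b} y"
  by (rule uniform_limit_theorem[OF _ ul]) (auto intro!: always_eventually continuous_on_sum dc)
 have yt: "y t = c + integral {a..t} (\<lambda>s. A s (y s))" if t: "t \<in> {a..b}" for t
 proof -
  have sub: "{a..t} \<subseteq> {a..b}" using t by auto
  have ulA: "uniform_limit {a..t} (\<lambda>n s. A s (\<Sum>i<n. d i s)) (\<lambda>s. A s (y s)) sequentially"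
  proof (rule uniform_limitI)
   fix e :: real assume "e > 0"
   then have "e / (M + 1) > 0" using M0 by simp
   then have "\<forall>\<^sub>F n in sequentially. \<forall>s\<in>{a..b}. dist (\<Sum>i<n. d i s) (y s) < e / (M + 1)"
    using ul by (simp add: uniform_limit_iff)
   then show "\<forall>\<^sub>F n in sequentially. \<forall>s\<in>{a..t}. dist (A s (\<Sum>i<n. d i s)) (A s (y s)) < e"
   proof (rule eventually_mono, intro ballI)
    fix n s assume n: "\<forall>s\<in>{a..b}. dist (\<Sum>i<n. d i s) (y s) < e / (M + 1)" and s: "s \<in> {a..t}"
    have s': "s \<in> {a..b}" using s sub by blast
    interpret bounded_linear "A s" by (rule lin[OF s'])
    have "dist (A s (\<Sum>i<n. d i s)) (A s (y s)) \<le> M * dist (\<Sum>i<n. d i s) (y s)"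
     using M[OF s'] by (simp add: dist_norm diff[symmetric])
    also have "\<dots> \<le> (M + 1) * dist (\<Sum>i<n. d i s) (y s)" by (simp add: mult_right_mono)
    also have "\<dots> < (M + 1) * (e / (M + 1))"
     using n s' M0 by (intro mult_strict_left_mono) auto
    also have "\<dots> = e" using M0 by simp
    finally show "dist (A s (\<Sum>i<n. d i s)) (A s (y s)) < e" .
   qed
  qed
  have "continuous_on {a..t} (\<lambda>s. A s (\<Sum>i<n. d i s))" for n
   by (rule continuous_on_subset[OF cont sub]) (intro continuous_on_sum dc)
  from uniform_limit_integral[OF ulA this sequentially_bot] obtain I J where
   I: "\<And>n. ((\<lambda>s. A s (\<Sum>i<n. d i s)) has_integral I n) {a..t}"
   and J: "((\<lambda>s. A s (y s)) has_integral J) {a..t}" and IJ: "I \<longlonglongrightarrow> J" by metis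
  have In: "(\<Sum>i<Suc n. d i t) = c + I n" for n
  proof -
   have *: "A s (\<Sum>i<n. d i s) = (\<Sum>i<n. A s (d i s))" if "s \<in> {a..t}" for s
   proof -
    interpret bounded_linear "A s" using lin that sub by blast
    show ?thesis by (rule sum)
   qed
   have "I n = integral {a..t} (\<lambda>s. \<Sum>i<n. A s (d i s))"
    using I[of n] * by (metis (mono_tags, lifting) integral_cong integral_unique)
   also have "\<dots> = (\<Sum>i<n. integral {a..t} (\<lambda>s. A s (d i s)))"
    using continuous_on_subset[OF cont[OF dc] sub]
    by (intro integral_sum) (auto intro!: integrable_continuous_real)
   finally have "I n = (\<Sum>i<n. d (Suc i) t)" by (simp add: dS)
   then show ?thesis by (simp add: sum.lessThan_Suc_shift d0 del: sum.lessThan_Suc)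
  qed
  have "(\<lambda>n. \<Sum>i<Suc n. d i t) \<longlonglongrightarrow> c + J"
   unfolding In using IJ by (intro tendsto_add tendsto_const)
  moreover have "(\<lambda>n. \<Sum>i<Suc n. d i t) \<longlonglongrightarrow> y t"
   using tendsto_uniform_limitI[OF ul t] LIMSEQ_Suc by blast
  ultimately have "y t = c + J" using LIMSEQ_unique by blast
  then show ?thesis using J by (simp add: integral_unique)
 qed
 have "(y has_vector_derivative A t (y t)) (at t within {a..b})" if t: "t \<in> {a..b}" for t
 proof (rule has_vector_derivative_transform[OF t])
  show "((\<lambda>t. c + integral {a..t} (\<lambda>s. A s (y s))) has_vector_derivative A t (y t)) (at t within {a..b})"
   using integral_has_vector_derivative[OF cont[OF yc] t]
   by (auto intro!: derivative_eq_intros)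
 qed (simp add: yt)
 moreover have "y a = c" using yt[of a] ab by simp
 ultimately show ?thesis by blast
qed

text \<open>Continuity of \<open>A\<close> is asked for only along continuous curves, which is what the Picard iteration uses and
 is easy to verify for matrices given by their entries.\<close>

definition linear_system :: "real set \<Rightarrow> (real \<Rightarrow> 'a::euclidean_space \<Rightarrow> 'a) \<Rightarrow> bool" where
 "linear_system I A \<longleftrightarrow> is_interval I \<and> (\<forall>t\<in>I. linear (A t)) \<and>
   (\<forall>y. continuous_on I y \<longrightarrow> continuous_on I (\<lambda>t. A t (y t)))"

lemma linear_systemD:
 assumes "linear_system I A"
 shows "is_interval I" and "t \<in> I \<Longrightarrow> linear (A t)"
  and "continuous_on I y \<Longrightarrow> continuous_on I (\<lambda>t. A t (y t))"
 using assms unfolding linear_system_def by blast+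

lemma linear_system_bound:
 fixes A :: "real \<Rightarrow> 'a::euclidean_space \<Rightarrow> 'a"
 assumes A: "linear_system I A" "{a..b} \<subseteq> I"
 shows "\<exists>M\<ge>0. \<forall>t\<in>{a..b}. \<forall>v. norm (A t v) \<le> M * norm v"
proof -
 have "\<exists>N. \<forall>t\<in>{a..b}. norm (A t e) \<le> N" for e
 proof -
  have "compact ((\<lambda>t. A t e) ` {a..b})"
   by (intro compact_continuous_image continuous_on_subset[OF linear_systemD(3)[OF A(1) continuous_on_const] A(2)] compact_Icc)
  then show ?thesis by (meson bounded_iff compact_imp_bounded imageI)
 qed
 then obtain N where N: "\<And>e t. t \<in> {a..b} \<Longrightarrow> norm (A t e) \<le> N e" by metis
 have "norm (A t v) \<le> (\<Sum>e\<in>Basis. \<bar>N e\<bar>) * norm v" if t: "t \<in> {a..b}" for t v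
 proof -
  have "linear (A t)" using linear_systemD(2)[OF A(1)] A(2) t by blast
  then have "A t (\<Sum>e\<in>Basis. (v \<bullet> e) *\<^sub>R e) = (\<Sum>e\<in>Basis. (v \<bullet> e) *\<^sub>R A t e)" by (simp add: linear_sum linear_scale)
  then have "A t v = (\<Sum>e\<in>Basis. (v \<bullet> e) *\<^sub>R A t e)" by (simp only: euclidean_representation)
  then have "norm (A t v) \<le> (\<Sum>e\<in>Basis. norm ((v \<bullet> e) *\<^sub>R A t e))"
   using norm_sum[of "\<lambda>e. (v \<bullet> e) *\<^sub>R A t e" Basis] by metis
  also have "\<dots> \<le> (\<Sum>e\<in>Basis. \<bar>N e\<bar> * norm v)"
  proof (rule sum_mono)
   fix e :: 'a assume "e \<in> Basis"
   then have "\<bar>v \<bullet> e\<bar> * norm (A t e) \<le> norm v * \<bar>N e\<bar>"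
    using N[OF t, of e] by (intro mult_mono Basis_le_norm) auto
   then show "norm ((v \<bullet> e) *\<^sub>R A t e) \<le> \<bar>N e\<bar> * norm v" by (simp add: mult.commute)
  qed
  finally show ?thesis by (simp add: sum_distrib_right)
 qed
 then show ?thesis by (intro exI[of _ "\<Sum>e\<in>Basis. \<bar>N e\<bar>"]) (auto intro: sum_nonneg)
qed

definition solves_system :: "real set \<Rightarrow> (real \<Rightarrow> 'a::euclidean_space \<Rightarrow> 'a) \<Rightarrow> (real \<Rightarrow> 'a) \<Rightarrow> bool" where
 "solves_system S A y \<longleftrightarrow> (\<forall>t\<in>S. (y has_vector_derivative A t (y t)) (at t within S))"

lemma solves_system_subset: "solves_system S A y \<Longrightarrow> T \<subseteq> S \<Longrightarrow> solves_system T A y"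
 unfolding solves_system_def using has_vector_derivative_within_subset by blast

lemma solves_system_reflect:
 assumes "solves_system {a..b} A y"
 shows "solves_system {-b..-a} (\<lambda>t v. - A (-t) v) (\<lambda>t. y (-t))"
 unfolding solves_system_def
proof
 fix t assume t: "t \<in> {-b..-a}"
 have im: "uminus ` {-b..-a} = {a..b}" by (simp add: image_uminus_atLeastAtMost)
 have "(y has_vector_derivative A (-t) (y (-t))) (at (-t) within uminus ` {-b..-a})"
  unfolding im using assms t by (simp add: solves_system_def)
 moreover have "(uminus has_vector_derivative (-1)) (at t within {-b..-a})"
  by (auto intro!: derivative_eq_intros)
 ultimately have "((y \<circ> uminus) has_vector_derivative (-1) *\<^sub>R A (-t) (y (-t))) (at t within {-b..-a})"
  by (rule vector_diff_chain_within[rotated])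
 then show "((\<lambda>t. y (-t)) has_vector_derivative - A (-t) (y (-t))) (at t within {-b..-a})"
  by (simp add: o_def)
qed

lemma linear_system_unique:
 assumes A: "linear_system I A" and y: "solves_system I A y" and t: "t \<in> I" "t0 \<in> I"
  and y0: "y t0 = 0"
 shows "y t = 0"
proof (cases "t0 \<le> t")
 case True
 then have sub: "{t0..t} \<subseteq> I"
  using mem_is_interval_1_I[OF linear_systemD(1)[OF A] t(2,1)] by auto
 then obtain M where "M \<ge> 0" "\<And>s v. s \<in> {t0..t} \<Longrightarrow> norm (A s v) \<le> M * norm v"
  using linear_system_bound[OF A sub] by blast
 then show ?thesis
  using linear_ode_unique_right[of t0 t A M y t] solves_system_subset[OF y sub] y0 True
  by (auto simp: solves_system_def)
next
 case False
 then have sub: "{t..t0} \<subseteq> I"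
  using mem_is_interval_1_I[OF linear_systemD(1)[OF A] t] by auto
 then obtain M where "M \<ge> 0" "\<And>s v. s \<in> {t..t0} \<Longrightarrow> norm (A s v) \<le> M * norm v"
  using linear_system_bound[OF A sub] by blast
 then have "(\<lambda>t. y (-t)) (-t) = 0"
  using linear_ode_unique_right[of "-t0" "-t" "\<lambda>t v. - A (-t) v" M "\<lambda>t. y (-t)" "-t"]
   solves_system_reflect[OF solves_system_subset[OF y sub]] y0 False
  by (auto simp: solves_system_def)
 then show ?thesis by simp
qed

lemma linear_system_subset:
 assumes A: "linear_system I A" and ab: "{a..b} \<subseteq> I"
 shows "linear_system {a..b} A"
 unfolding linear_system_def
proof (intro conjI ballI allI impI)
 show "is_interval {a..b}" by (rule is_interval_cc)
 show "linear (A t)" if "t \<in> {a..b}" for t using linear_systemD(2)[OF A] ab that by blast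
 fix y :: "real \<Rightarrow> 'a" assume y: "continuous_on {a..b} y"
 show "continuous_on {a..b} (\<lambda>t. A t (y t))"
 proof (cases "a \<le> b")
  case True
  define z where "z = (\<lambda>t. y (max a (min b t)))"
  have "continuous_on I z" unfolding z_def
   by (rule continuous_on_compose2[OF y]) (use True in \<open>auto intro!: continuous_intros\<close>)
  then have "continuous_on {a..b} (\<lambda>t. A t (z t))"
   using linear_systemD(3)[OF A] ab continuous_on_subset by blast
  then show ?thesis
   by (rule continuous_on_eq) (simp add: z_def min_absorb2 max_absorb2)
 qed simp
qed

lemma linear_system_exists_compact:
 fixes A :: "real \<Rightarrow> 'a::euclidean_space \<Rightarrow> 'a"
 assumes A: "linear_system {a..b} A" and t0: "t0 \<in> {a..b}"
 shows "\<exists>y. y t0 = c \<and> solves_system {a..b} A y"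
proof -
 have ab: "a \<le> b" "a \<in> {a..b}" using t0 by auto
 obtain M where M: "M \<ge> 0" "\<And>t v. t \<in> {a..b} \<Longrightarrow> norm (A t v) \<le> M * norm v"
  using linear_system_bound[OF A order_refl] by blast
 have lin: "linear (A t)" if "t \<in> {a..b}" for t using linear_systemD(2)[OF A] that by blast
 have "\<exists>y. y a = c \<and> (\<forall>t\<in>{a..b}. (y has_vector_derivative A t (y t)) (at t within {a..b}))" for c
  by (rule linear_ode_exists_left_endpoint[OF ab(1) M(1) _ M(2) linear_systemD(3)[OF A]])
   (use lin in \<open>simp add: linear_conv_bounded_linear\<close>)
 then obtain Y where Y: "\<And>c. Y c a = c" "\<And>c. solves_system {a..b} A (Y c)"
  unfolding solves_system_def by metis
 have eq: "y s = z s" if "solves_system {a..b} A y" "solves_system {a..b} A z" "y t = z t"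
  "t \<in> {a..b}" "s \<in> {a..b}" for y z s t
 proof -
  have "solves_system {a..b} A (\<lambda>t. y t - z t)"
   using that(1,2) lin unfolding solves_system_def
   by (auto simp: linear_diff intro!: has_vector_derivative_diff)
  then show ?thesis using linear_system_unique[OF A _ that(5,4)] that(3) by fastforce
 qed
 \<comment> \<open>Solutions are determined by their value at any point, so the linear map from the value at the
  left endpoint to the value at \<open>t0\<close> is injective, hence surjective.\<close>
 define P where "P = (\<lambda>c. Y c t0)"
 have "linear P"
 proof (rule linearI)
  fix c d :: 'a and r :: real
  have "solves_system {a..b} A (\<lambda>t. Y c t + Y d t)"
   using Y(2)[of c] Y(2)[of d] lin unfolding solves_system_def
   by (auto simp: linear_add intro!: has_vector_derivative_add)
  from eq[OF Y(2)[of "c + d"] this _ ab(2) t0] show "P (c + d) = P c + P d"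
   by (simp add: P_def Y(1))
  have "solves_system {a..b} A (\<lambda>t. r *\<^sub>R Y c t)"
   using Y(2)[of c] lin unfolding solves_system_def
   by (auto simp: linear_cmul intro!: derivative_eq_intros)
  from eq[OF Y(2)[of "r *\<^sub>R c"] this _ ab(2) t0] show "P (r *\<^sub>R c) = r *\<^sub>R P c"
   by (simp add: P_def Y(1))
 qed
 moreover have "inj P"
 proof (rule injI)
  fix c d assume "P c = P d"
  from eq[OF Y(2) Y(2) this[unfolded P_def] t0 ab(2)] show "c = d" by (simp add: Y(1))
 qed
 ultimately have "surj P" by (rule linear_injective_imp_surjective) simp
 then obtain d where "Y d t0 = c" unfolding P_def by (metis surjD)
 then show ?thesis using Y(2) by blast
qed

lemma compact_neighbourhood_in_interval:
 fixes I :: "real set"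
 assumes "is_interval I" "t \<in> I" "t0 \<in> I"
 obtains a b where "{a..b} \<subseteq> I" "t \<in> {a..b}" "t0 \<in> {a..b}" "at t within I = at t within {a..b}"
proof -
 have "\<exists>a\<in>I. a \<le> t \<and> a \<le> t0 \<and> ((\<forall>s\<in>I. t \<le> s) \<or> a < t)"
 proof (cases "\<forall>s\<in>I. t \<le> s")
  case True
  then show ?thesis using assms by (intro bexI[of _ t]) auto
 next
  case False
  then obtain s where "s \<in> I" "s < t" by force
  then show ?thesis using assms by (intro bexI[of _ "min s t0"]) (auto simp: min_def)
 qed
 then obtain a where a: "a \<in> I" "a \<le> t" "a \<le> t0" "(\<forall>s\<in>I. t \<le> s) \<or> a < t" by blast
 have "\<exists>b\<in>I. t \<le> b \<and> t0 \<le> b \<and> ((\<forall>s\<in>I. s \<le> t) \<or> t < b)"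
 proof (cases "\<forall>s\<in>I. s \<le> t")
  case True
  then show ?thesis using assms by (intro bexI[of _ t]) auto
 next
  case False
  then obtain s where "s \<in> I" "t < s" by force
  then show ?thesis using assms by (intro bexI[of _ "max s t0"]) (auto simp: max_def)
 qed
 then obtain b where b: "b \<in> I" "t \<le> b" "t0 \<le> b" "(\<forall>s\<in>I. s \<le> t) \<or> t < b" by blast
 have sub: "{a..b} \<subseteq> I" using mem_is_interval_1_I[OF assms(1) a(1) b(1)] by auto
 define l where "l = (if a < t then a else t - 1)"
 define r where "r = (if t < b then b else t + 1)"
 have "at t within I = at t within {a..b}"
 proof (rule at_within_nhd)
  show "t \<in> {l<..<r}" using a b by (auto simp: l_def r_def)
  have "x \<in> {a..b}" if x: "x \<in> I" "x \<in> {l<..<r}" for x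
  proof -
   have "a \<le> x" using a(2,4) x by (cases "a < t") (auto simp: l_def)
   moreover have "x \<le> b" using b(2,4) x by (cases "t < b") (auto simp: r_def)
   ultimately show ?thesis by simp
  qed
  then show "I \<inter> {l<..<r} - {t} = {a..b} \<inter> {l<..<r} - {t}"
   using sub by blast
 qed simp
 moreover have "t \<in> {a..b}" "t0 \<in> {a..b}" using a b by auto
 ultimately show ?thesis using that sub by blast
qed

text \<open>On each compact subinterval that contains \<open>t0\<close> there is exactly one solution with the given
 value at \<open>t0\<close>; uniqueness makes these solutions fit together, whatever the shape of the interval.\<close>

theorem linear_system_exists:
 fixes A :: "real \<Rightarrow> 'a::euclidean_space \<Rightarrow> 'a"
 assumes A: "linear_system I A" and t0: "t0 \<in> I"
 shows "\<exists>y. y t0 = c \<and> solves_system I A y"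
proof -
 have int: "is_interval I" using linear_systemD(1)[OF A] .
 define Y where "Y = (\<lambda>a b. SOME y. y t0 = c \<and> solves_system {a..b} A y)"
 have Y: "Y a b t0 = c \<and> solves_system {a..b} A (Y a b)" if "{a..b} \<subseteq> I" "t0 \<in> {a..b}" for a b
  unfolding Y_def using someI_ex[OF linear_system_exists_compact[OF linear_system_subset[OF A that(1)] that(2)]] .
 define y where "y = (\<lambda>t. Y (min t t0) (max t t0) t)"
 have y: "y t = Y a b t" if ab: "{a..b} \<subseteq> I" "t0 \<in> {a..b}" "t \<in> {a..b}" for a b t
 proof -
  let ?a = "min t t0" and ?b = "max t t0"
  have sub1: "{?a..?b} \<subseteq> {a..b}" using ab by auto
  then have sub: "{?a..?b} \<subseteq> {a..b}" "{?a..?b} \<subseteq> I" using ab by blast+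
  note A' = linear_system_subset[OF A sub(2)]
  have "solves_system {?a..?b} A (\<lambda>s. Y ?a ?b s - Y a b s)"
   using Y[OF sub(2)] solves_system_subset[OF _ sub(1)] Y[OF ab(1,2)] linear_systemD(2)[OF A']
   unfolding solves_system_def
   by (auto simp: linear_diff intro!: has_vector_derivative_diff)
  from linear_system_unique[OF A' this, of t t0]
  show ?thesis using Y[OF sub(2)] Y[OF ab(1,2)] by (auto simp: y_def)
 qed
 have "(y has_vector_derivative A t (y t)) (at t within I)" if t: "t \<in> I" for t
 proof -
  obtain a b where ab: "{a..b} \<subseteq> I" "t \<in> {a..b}" "t0 \<in> {a..b}" "at t within I = at t within {a..b}"
   using compact_neighbourhood_in_interval[OF int t t0] by blast
  have "(Y a b has_vector_derivative A t (Y a b t)) (at t within {a..b})"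
   using Y[OF ab(1,3)] ab(2) by (simp add: solves_system_def)
  then have "(y has_vector_derivative A t (Y a b t)) (at t within {a..b})"
   by (rule has_vector_derivative_transform[OF ab(2), rotated]) (use y ab in auto)
  then show ?thesis using ab y by simp
 qed
 moreover have "y t0 = c" using y[of t0 t0 t0] Y[of t0 t0] t0 by auto
 ultimately show ?thesis unfolding solves_system_def by blast
qed

section \<open>Calculus of smooth functions on an interval\<close>

lemma has_derivative_vec_lambda:
 fixes f :: "'a::real_normed_vector \<Rightarrow> 'n::finite \<Rightarrow> 'b::euclidean_space"
 assumes "\<And>i. ((\<lambda>x. f x i) has_derivative (\<lambda>h. f' h i)) (at x within S)"
 shows "((\<lambda>x. \<chi> i. f x i) has_derivative (\<lambda>h. \<chi> i. f' h i)) (at x within S)"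
proof (subst has_derivative_componentwise_within, intro ballI)
 fix b :: "'b ^ 'n" assume "b \<in> Basis"
 then obtain i u where b: "b = axis i u" by (auto simp: Basis_vec_def)
 show "((\<lambda>x. inner (\<chi> i. f x i) b) has_derivative (\<lambda>h. inner (\<chi> i. f' h i) b)) (at x within S)"
  using has_derivative_inner_left[OF assms[of i], of u] by (simp add: b inner_axis)
qed

lemma has_vector_derivative_vec_lambda:
 fixes f :: "real \<Rightarrow> 'n::finite \<Rightarrow> 'b::euclidean_space"
 assumes "\<And>i. ((\<lambda>t. f t i) has_vector_derivative f' i) (at t within S)"
 shows "((\<lambda>t. \<chi> i. f t i) has_vector_derivative (\<chi> i. f' i)) (at t within S)"
proof -
 have "((\<lambda>t. \<chi> i. f t i) has_derivative (\<lambda>h. \<chi> i. h *\<^sub>R f' i)) (at t within S)"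
  by (rule has_derivative_vec_lambda) (use assms in \<open>simp add: has_vector_derivative_def\<close>)
 moreover have "(\<lambda>h. \<chi> i. h *\<^sub>R f' i) = (\<lambda>h. h *\<^sub>R (\<chi> i. f' i))"
  by (simp add: fun_eq_iff vec_eq_iff)
 ultimately show ?thesis by (simp add: has_vector_derivative_def)
qed

locale real_interval =
 fixes I :: "real set"
 assumes interval: "is_interval I" and interior_nonempty: "interior I \<noteq> {}"
begin

lemma deriv_on_eqI:
 assumes "(f has_vector_derivative D) (at t within I)" "t \<in> I"
 shows "deriv_on I f t = D"
 using vector_derivative_within[OF nontrivial_limit_interval[OF interval interior_nonempty assms(2)] assms(1)]
  assms(2) by (simp add: deriv_on_def)

lemma has_deriv_on:
 assumes "f differentiable (at t within I)" "t \<in> I"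
 shows "(f has_vector_derivative deriv_on I f t) (at t within I)"
 using assms by (simp add: deriv_on_def vector_derivative_works)

lemma nderiv_on_Suc_shift: "nderiv_on I (Suc k) f = nderiv_on I k (deriv_on I f)"
 by (simp add: funpow_swap1)

lemma nderiv_on_cong:
 assumes "\<And>s. s \<in> I \<Longrightarrow> f s = g s" "t \<in> I"
 shows "nderiv_on I k f t = nderiv_on I k g t"
proof (cases k)
 case (Suc n)
 then show ?thesis using deriv_on_cong[of I f g, OF assms(1)] by (simp add: nderiv_on_Suc_shift del: funpow.simps)
qed (use assms in simp)

lemma differentiable_on_interval_cong:
 assumes "\<And>s. s \<in> I \<Longrightarrow> f s = g s" "t \<in> I" "f differentiable (at t within I)"
 shows "g differentiable (at t within I)"
 using assms(3) has_derivative_transform[OF assms(2), of g f] assms(1)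
 unfolding differentiable_def by metis

lemma smooth_on_cong:
 assumes "\<And>s. s \<in> I \<Longrightarrow> f s = g s" "smooth_on I f"
 shows "smooth_on I g"
 using assms nderiv_on_cong[of f g] differentiable_on_interval_cong unfolding smooth_on_def
 by (metis (no_types, lifting))

lemma smooth_on_coinduct:
 assumes "P f"
  and step: "\<And>f. P f \<Longrightarrow> \<exists>g. P g \<and> (\<forall>t\<in>I. (f has_vector_derivative g t) (at t within I))"
 shows "smooth_on I f"
proof -
 have "nderiv_on I k f differentiable (at t within I)" if "P f" "t \<in> I" for k t f
  using that
 proof (induction k arbitrary: f)
  case 0
  then show ?case using step by (auto intro: differentiableI_vector)
 next
  case (Suc k)
  obtain g where g: "P g" "\<And>t. t \<in> I \<Longrightarrow> (f has_vector_derivative g t) (at t within I)"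
   using step Suc.prems by blast
  have eq: "g s = deriv_on I f s" if "s \<in> I" for s using deriv_on_eqI[OF g(2)] that by simp
  have "nderiv_on I k g s = nderiv_on I k (deriv_on I f) s" if "s \<in> I" for s
   by (rule nderiv_on_cong[OF eq that])
  then show ?case
   using differentiable_on_interval_cong[OF _ Suc.prems(2) Suc.IH[OF g(1) Suc.prems(2)]]
   by (simp add: nderiv_on_Suc_shift del: funpow.simps)
 qed
 then show ?thesis using assms(1) by (simp add: smooth_on_def)
qed

lemma smooth_on_nderiv: "smooth_on I f \<Longrightarrow> smooth_on I (nderiv_on I k f)"
 unfolding smooth_on_def by (metis comp_apply funpow_add)

lemma smooth_on_has_derivative:
 assumes "smooth_on I f" "t \<in> I"
 shows "(nderiv_on I k f has_vector_derivative nderiv_on I (Suc k) f t) (at t within I)"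
 using has_deriv_on[of "nderiv_on I k f" t] assms by (simp add: smooth_on_def)

lemma smooth_on_has_derivative0:
 assumes "smooth_on I f" "t \<in> I"
 shows "(f has_vector_derivative deriv_on I f t) (at t within I)"
 using smooth_on_has_derivative[OF assms, of 0] by simp

lemma smooth_on_deriv: "smooth_on I f \<Longrightarrow> smooth_on I (deriv_on I f)"
 using smooth_on_nderiv[of f 1] by simp

lemma smooth_on_continuous: "smooth_on I f \<Longrightarrow> continuous_on I f"
 using smooth_on_has_derivative0 by (rule continuous_on_vector_derivative)

text \<open>Smoothness of a family of functions that satisfy algebraic differential equations over the
 smooth functions: the algebra they generate is closed under differentiation.\<close>

inductive fun_alg :: "(real \<Rightarrow> complex) set \<Rightarrow> (real \<Rightarrow> complex) \<Rightarrow> bool" for B where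
 base: "b \<in> B \<Longrightarrow> fun_alg B b"
| add: "fun_alg B f \<Longrightarrow> fun_alg B g \<Longrightarrow> fun_alg B (\<lambda>t. f t + g t)"
| mult: "fun_alg B f \<Longrightarrow> fun_alg B g \<Longrightarrow> fun_alg B (\<lambda>t. f t * g t)"

lemma smooth_on_fun_alg:
 assumes B: "\<And>b. b \<in> B \<Longrightarrow> \<exists>b'. fun_alg B b' \<and> (\<forall>t\<in>I. (b has_vector_derivative b' t) (at t within I))"
  and f: "fun_alg B f"
 shows "smooth_on I f"
proof (rule smooth_on_coinduct[where P = "fun_alg B", OF f])
 fix f assume "fun_alg B f"
 then show "\<exists>g. fun_alg B g \<and> (\<forall>t\<in>I. (f has_vector_derivative g t) (at t within I))"
 proof induction
  case (base b)
  then show ?case by (rule B)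
 next
  case (add f g)
  then obtain f' g' where "fun_alg B f'" "fun_alg B g'"
   "\<forall>t\<in>I. (f has_vector_derivative f' t) (at t within I)"
   "\<forall>t\<in>I. (g has_vector_derivative g' t) (at t within I)" by blast
  then show ?case
   by (intro exI[of _ "\<lambda>t. f' t + g' t"] conjI fun_alg.add ballI has_vector_derivative_add) auto
 next
  case (mult f g)
  then obtain f' g' where *: "fun_alg B f'" "fun_alg B g'"
   "\<forall>t\<in>I. (f has_vector_derivative f' t) (at t within I)"
   "\<forall>t\<in>I. (g has_vector_derivative g' t) (at t within I)" by blast
  show ?case
   using * mult.hyps by (intro exI[of _ "\<lambda>t. f t * g' t + f' t * g t"] conjI fun_alg.add fun_alg.mult
     ballI has_vector_derivative_mult) auto
 qed
qed

lemma smooth_on_const [simp]: "smooth_on I (\<lambda>t. c)"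
 by (rule smooth_on_coinduct[where P = "\<lambda>f. \<exists>c. f = (\<lambda>t. c)"]) (auto intro!: exI[of _ "\<lambda>t. 0"])

lemma smooth_on_alg:
 assumes "fun_alg {f. smooth_on I f} f"
 shows "smooth_on I f"
 using smooth_on_fun_alg[OF _ assms] smooth_on_deriv smooth_on_has_derivative0 fun_alg.base
 by (metis mem_Collect_eq)

lemma smooth_on_add [simp]: "smooth_on I f \<Longrightarrow> smooth_on I g \<Longrightarrow> smooth_on I (\<lambda>t. f t + g t)"
 and smooth_on_mult [simp]: "smooth_on I f \<Longrightarrow> smooth_on I g \<Longrightarrow> smooth_on I (\<lambda>t. f t * g t)"
 by (rule smooth_on_alg; auto intro: fun_alg.intros)+

lemma smooth_on_uminus [simp]: "smooth_on I f \<Longrightarrow> smooth_on I (\<lambda>t. - f t)"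
 using smooth_on_mult[OF smooth_on_const[of "-1"]] by fastforce

lemma smooth_on_sum [simp]: "(\<And>i. i \<in> S \<Longrightarrow> smooth_on I (f i)) \<Longrightarrow> smooth_on I (\<lambda>t. \<Sum>i\<in>S. f i t)"
 by (induction S rule: infinite_finite_induct) auto

lemma smooth_on_inverse:
 assumes f: "smooth_on I f" and nz: "\<And>t. t \<in> I \<Longrightarrow> f t \<noteq> 0"
 shows "smooth_on I (\<lambda>t. 1 / f t)"
proof (rule smooth_on_fun_alg[where B = "insert (\<lambda>t. 1 / f t) {f. smooth_on I f}"])
 let ?B = "insert (\<lambda>t. 1 / f t) {f. smooth_on I f}"
 fix b assume "b \<in> ?B"
 then show "\<exists>b'. fun_alg ?B b' \<and> (\<forall>t\<in>I. (b has_vector_derivative b' t) (at t within I))"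
 proof
  assume b: "b = (\<lambda>t. 1 / f t)"
  have "fun_alg ?B (\<lambda>t. (- deriv_on I f t) * ((1 / f t) * (1 / f t)))"
   using smooth_on_deriv[OF f] by (intro fun_alg.mult fun_alg.base) auto
  moreover have "(b has_vector_derivative (- deriv_on I f t) * ((1 / f t) * (1 / f t))) (at t within I)"
   if t: "t \<in> I" for t
  proof -
   have "((\<lambda>t. inverse (f t)) has_derivative
     (\<lambda>h. - (inverse (f t) * (h *\<^sub>R deriv_on I f t) * inverse (f t)))) (at t within I)"
    using smooth_on_has_derivative0[OF f t] nz[OF t]
    unfolding has_vector_derivative_def by (intro Deriv.has_derivative_inverse) auto
   then show ?thesis
    unfolding b has_vector_derivative_def by (simp add: field_simps scaleR_conv_of_real)
  qed
  ultimately show ?thesis by blast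
 next
  assume "b \<in> {f. smooth_on I f}"
  then show ?thesis
   using smooth_on_deriv smooth_on_has_derivative0
   by (intro exI[of _ "deriv_on I b"]) (auto intro: fun_alg.base)
 qed
qed (auto intro: fun_alg.base)

lemma nderiv_on_add:
 assumes "smooth_on I f" "smooth_on I g" "t \<in> I"
 shows "nderiv_on I k (\<lambda>t. f t + g t) t = nderiv_on I k f t + nderiv_on I k g t"
 using nderiv_on_sum[OF interval interior_nonempty,
   where S = "{False, True}" and f = "\<lambda>b. if b then g else f" and c = "\<lambda>_. 1" and t = t and k = k] assms
 by simp

lemma nderiv_on_cmult:
 assumes "smooth_on I f" "t \<in> I"
 shows "nderiv_on I k (\<lambda>t. c * f t) t = c * nderiv_on I k f t"
 using nderiv_on_sum[OF interval interior_nonempty,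
   where S = "{()}" and f = "\<lambda>_. f" and c = "\<lambda>_. c" and t = t and k = k] assms by simp

lemma deriv_on_mult:
 assumes "smooth_on I f" "smooth_on I g" "t \<in> I"
 shows "deriv_on I (\<lambda>t. f t * g t) t = f t * deriv_on I g t + deriv_on I f t * g t"
 by (rule deriv_on_eqI[OF has_vector_derivative_mult assms(3)])
  (auto intro: smooth_on_has_derivative0 assms)

lemma nderiv_on_mult:
 assumes "smooth_on I f" "smooth_on I g" "t \<in> I"
 shows "nderiv_on I n (\<lambda>t. f t * g t) t =
  (\<Sum>k\<le>n. of_nat (n choose k) * nderiv_on I k f t * nderiv_on I (n - k) g t)"
 using assms
proof (induction n arbitrary: f g)
 case (Suc n)
 note sm = smooth_on_deriv[OF Suc.prems(1)] smooth_on_deriv[OF Suc.prems(2)]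
 have "nderiv_on I (Suc n) (\<lambda>t. f t * g t) t =
   nderiv_on I n (\<lambda>t. f t * deriv_on I g t + deriv_on I f t * g t) t"
  unfolding nderiv_on_Suc_shift
  by (rule nderiv_on_cong) (use deriv_on_mult Suc.prems in auto)
 also have "\<dots> = (\<Sum>k\<le>n. of_nat (n choose k) * nderiv_on I k f t * nderiv_on I (Suc n - k) g t) +
   (\<Sum>k\<le>n. of_nat (n choose k) * nderiv_on I (Suc k) f t * nderiv_on I (n - k) g t)"
 proof -
  have "nderiv_on I (n - k) (deriv_on I g) = nderiv_on I (Suc n - k) g" if "k \<le> n" for k
   using that by (simp add: Suc_diff_le nderiv_on_Suc_shift del: funpow.simps)
  then show ?thesis
   using Suc.prems sm
   by (simp add: nderiv_on_add Suc.IH nderiv_on_Suc_shift[of _ f] del: funpow.simps)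
 qed
 also have "(\<Sum>k\<le>n. of_nat (n choose k) * nderiv_on I (Suc k) f t * nderiv_on I (n - k) g t) =
   (\<Sum>k\<in>{1..Suc n}. of_nat (n choose (k - 1)) * nderiv_on I k f t * nderiv_on I (Suc n - k) g t)"
  by (rule sum.reindex_bij_witness[of _ "\<lambda>k. k - 1" Suc]) auto
 also have "(\<Sum>k\<le>n. of_nat (n choose k) * nderiv_on I k f t * nderiv_on I (Suc n - k) g t) =
   (\<Sum>k\<le>Suc n. of_nat (n choose k) * nderiv_on I k f t * nderiv_on I (Suc n - k) g t)"
  by simp
 also have "(\<Sum>k\<in>{1..Suc n}. of_nat (n choose (k - 1)) * nderiv_on I k f t * nderiv_on I (Suc n - k) g t) =
   (\<Sum>k\<le>Suc n. (if k = 0 then 0 else of_nat (n choose (k - 1))) * nderiv_on I k f t * nderiv_on I (Suc n - k) g t)"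
  by (rule sum.mono_neutral_cong_left) auto
 finally have "nderiv_on I (Suc n) (\<lambda>t. f t * g t) t = (\<Sum>k\<le>Suc n.
   of_nat (n choose k) * nderiv_on I k f t * nderiv_on I (Suc n - k) g t +
   (if k = 0 then 0 else of_nat (n choose (k - 1))) * nderiv_on I k f t * nderiv_on I (Suc n - k) g t)"
  by (simp only: sum.distrib)
 also have "\<dots> = (\<Sum>k\<le>Suc n. of_nat (Suc n choose k) * nderiv_on I k f t * nderiv_on I (Suc n - k) g t)"
 proof (rule sum.cong[OF refl])
  fix k show "of_nat (n choose k) * nderiv_on I k f t * nderiv_on I (Suc n - k) g t +
   (if k = 0 then 0 else of_nat (n choose (k - 1))) * nderiv_on I k f t * nderiv_on I (Suc n - k) g t =
   of_nat (Suc n choose k) * nderiv_on I k f t * nderiv_on I (Suc n - k) g t"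
   by (cases k) (simp_all add: algebra_simps del: funpow.simps)
 qed
 finally show ?case .
qed simp

end

section \<open>The solution space of an operator of order six\<close>

definition ix :: "nat \<Rightarrow> 6" where
 "ix = (SOME h. bij_betw h {..<6} UNIV)"

definition rk :: "6 \<Rightarrow> nat" where
 "rk = the_inv_into {..<6} ix"

lemma bij_ix: "bij_betw ix {..<6} UNIV"
proof -
 have "\<exists>h :: nat \<Rightarrow> 6. bij_betw h {..<6} UNIV"
  using ex_bij_betw_nat_finite[of "UNIV :: 6 set"] by (simp add: atLeast0LessThan)
 then show ?thesis unfolding ix_def by (rule someI_ex)
qed

lemma rk_less [simp]: "rk i < 6"
 using bij_betw_the_inv_into[OF bij_ix] unfolding rk_def by (auto simp: bij_betw_def)

lemma ix_rk [simp]: "ix (rk i) = i"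
 using bij_ix unfolding rk_def by (simp add: bij_betw_def f_the_inv_into_f)

lemma rk_ix [simp]: "j < 6 \<Longrightarrow> rk (ix j) = j"
 using bij_ix unfolding rk_def by (simp add: bij_betw_def the_inv_into_f_f)

lemma ix_eq_iff: "j < 6 \<Longrightarrow> k < 6 \<Longrightarrow> ix j = ix k \<longleftrightarrow> j = k"
 using rk_ix by metis

lemma sum_ix: "(\<Sum>i\<in>UNIV. F i) = (\<Sum>j<6. F (ix j))"
 using sum.reindex_bij_betw[OF bij_ix, of F] by simp

definition companion :: "(nat \<Rightarrow> real \<Rightarrow> complex) \<Rightarrow> real \<Rightarrow> complex ^ 6 \<Rightarrow> complex ^ 6" where
 "companion a t v = (\<chi> i. if rk i < 5 then v $ ix (Suc (rk i)) else - (\<Sum>j<6. a j t * v $ ix j))"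

lemma (in real_interval) linear_system_companion:
 assumes a: "\<And>j. j < 6 \<Longrightarrow> continuous_on I (a j)"
 shows "linear_system I (companion a)"
 unfolding linear_system_def
proof (intro conjI ballI allI impI)
 show "linear (companion a t)" for t
  by (rule linearI) (auto simp: companion_def vec_eq_iff distrib_left sum.distrib scaleR_sum_right)
 fix y :: "real \<Rightarrow> complex ^ 6" assume y: "continuous_on I y"
 have "continuous_on I (\<lambda>t. if rk i < 5 then y t $ ix (Suc (rk i)) else - (\<Sum>j<6. a j t * y t $ ix j))" for i
  using a by (cases "rk i < 5") (auto intro!: continuous_intros y)
 then show "continuous_on I (\<lambda>t. companion a t (y t))"
  unfolding companion_def by (rule continuous_on_vec_lambda)
qed (rule interval)

locale odo6 = real_interval +
 fixes L :: odo
 assumes is_odo: "is_odo I L" and order6: "odo_order L = 6"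
begin

abbreviation a :: "nat \<Rightarrow> real \<Rightarrow> complex" where "a \<equiv> odo_coeff L"

lemma smooth_coeff: "j < 6 \<Longrightarrow> smooth_on I (a j)"
 using is_odo order6 by (simp add: is_odo_def)

lemma system: "linear_system I (companion a)"
 by (rule linear_system_companion) (simp add: smooth_coeff smooth_on_continuous)

lemma solutionsD:
 assumes "x \<in> solutions I L"
 shows "smooth_on I x" "x \<in> smooth_functions I"
  and "t \<in> I \<Longrightarrow> nderiv_on I 6 x t = - (\<Sum>j<6. a j t * nderiv_on I j x t)"
 using assms by (auto simp: solutions_def smooth_functions_def odo_apply_def order6 eq_neg_iff_add_eq_0)

lemma solution_solves_system:
 assumes x: "x \<in> solutions I L"
 shows "solves_system I (companion a) (\<lambda>t. \<chi> i. nderiv_on I (rk i) x t)"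
 unfolding solves_system_def
proof
 fix t assume t: "t \<in> I"
 have "((\<lambda>t. \<chi> i. nderiv_on I (rk i) x t) has_vector_derivative (\<chi> i. nderiv_on I (Suc (rk i)) x t)) (at t within I)"
  by (rule has_vector_derivative_vec_lambda) (rule smooth_on_has_derivative[OF solutionsD(1)[OF x] t])
 moreover have "(\<chi> i. nderiv_on I (Suc (rk i)) x t) = companion a t (\<chi> i. nderiv_on I (rk i) x t)"
 proof -
  have "nderiv_on I (Suc (rk i)) x t = - (\<Sum>j<6. a j t * nderiv_on I (rk (ix j)) x t)" if "\<not> rk i < 5" for i :: 6
  proof -
   have "Suc (rk i) = 6" using that rk_less[of i] by linarith
   then show ?thesis using solutionsD(3)[OF x t] by (simp del: funpow.simps)
  qed
  then show ?thesis by (auto simp: companion_def vec_eq_iff simp del: funpow.simps)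
 qed
 ultimately show "((\<lambda>t. \<chi> i. nderiv_on I (rk i) x t) has_vector_derivative
   companion a t (\<chi> i. nderiv_on I (rk i) x t)) (at t within I)" by simp
qed

lemma solution_unique:
 assumes x: "x \<in> solutions I L" and t0: "t0 \<in> I" and 0: "\<And>j. j < 6 \<Longrightarrow> nderiv_on I j x t0 = 0"
 shows "x = (\<lambda>t. 0)"
proof
 fix t
 show "x t = 0"
 proof (cases "t \<in> I")
  case True
  have "(\<chi> i. nderiv_on I (rk i) x t0) = (0 :: complex ^ 6)" by (simp add: vec_eq_iff 0)
  from linear_system_unique[OF system solution_solves_system[OF x] True t0 this]
  have "nderiv_on I (rk (ix 0)) x t = 0" by (metis vec_lambda_beta zero_index)
  then show ?thesis by simp
 next
  case False
  then show ?thesis using solutionsD(2)[OF x] by (simp add: smooth_functions_def)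
 qed
qed

lemma solution_exists:
 assumes t0: "t0 \<in> I"
 shows "\<exists>x\<in>solutions I L. \<forall>j<6. nderiv_on I j x t0 = v $ ix j"
proof -
 obtain y where y0: "y t0 = v" and y: "solves_system I (companion a) y"
  using linear_system_exists[OF system t0] by blast
 have yd: "((\<lambda>t. y t $ i) has_vector_derivative companion a t (y t) $ i) (at t within I)" if "t \<in> I" for t i
 proof -
  have "(y has_vector_derivative companion a t (y t)) (at t within I)"
   using y that by (simp add: solves_system_def)
  from bounded_linear.has_vector_derivative[OF bounded_linear_vec_nth this] show ?thesis .
 qed
 define x where "x = (\<lambda>t. if t \<in> I then y t $ ix 0 else 0)"
 have xj: "nderiv_on I j x t = y t $ ix j" if "j < 6" "t \<in> I" for j t
  using that
 proof (induction j arbitrary: t)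
  case (Suc j)
  have "deriv_on I (nderiv_on I j x) t = deriv_on I (\<lambda>t. y t $ ix j) t"
   using deriv_on_cong[of I "nderiv_on I j x" "\<lambda>t. y t $ ix j"] Suc by simp
  also have "\<dots> = companion a t (y t) $ ix j"
   by (rule deriv_on_eqI[OF yd]) (use Suc in auto)
  also have "\<dots> = y t $ ix (Suc j)" using Suc.prems by (simp add: companion_def)
  finally show ?case by simp
 qed (simp add: x_def)
 have x6: "nderiv_on I 6 x t = - (\<Sum>j<6. a j t * nderiv_on I j x t)" if t: "t \<in> I" for t
 proof -
  have "nderiv_on I 6 x t = deriv_on I (nderiv_on I 5 x) t" by (simp add: eval_nat_numeral)
  also have "deriv_on I (nderiv_on I 5 x) = deriv_on I (\<lambda>t. y t $ ix 5)"
   by (rule deriv_on_cong) (simp add: xj)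
  also have "deriv_on I (\<lambda>t. y t $ ix 5) t = companion a t (y t) $ ix 5"
   by (rule deriv_on_eqI[OF yd]) (use t in auto)
  also have "\<dots> = - (\<Sum>j<6. a j t * nderiv_on I j x t)" using xj t by (simp add: companion_def)
  finally show ?thesis by simp
 qed
 define B where "B = {f. smooth_on I f} \<union> range (\<lambda>i t. y t $ i)"
 have base: "fun_alg B (\<lambda>t. y t $ i)" "smooth_on I f \<Longrightarrow> fun_alg B f" for i f
  by (auto simp: B_def intro: fun_alg.base)
 have sums: "fun_alg B (\<lambda>t. \<Sum>j\<in>S. h j t)" if "\<And>j. j \<in> S \<Longrightarrow> fun_alg B (h j)" "finite S" for S :: "nat set" and h
  using that(2,1) by induction (auto intro: base fun_alg.add)
 have "smooth_on I (\<lambda>t. y t $ ix 0)"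
 proof (rule smooth_on_fun_alg[OF _ base(1)])
  fix b assume "b \<in> B"
  then consider "smooth_on I b" | i where "b = (\<lambda>t. y t $ i)" by (auto simp: B_def)
  then show "\<exists>b'. fun_alg B b' \<and> (\<forall>t\<in>I. (b has_vector_derivative b' t) (at t within I))"
  proof cases
   case 1
   then show ?thesis
    using smooth_on_deriv smooth_on_has_derivative0 base(2) by blast
  next
   case (2 i)
   have "fun_alg B (\<lambda>t. companion a t (y t) $ i)"
   proof (cases "rk i < 5")
    case True
    then show ?thesis using base(1)[of "ix (Suc (rk i))"] by (simp add: companion_def)
   next
    case False
    have "fun_alg B (\<lambda>t. \<Sum>j<6. (- a j t) * y t $ ix j)"
     by (intro sums fun_alg.mult base smooth_on_uminus smooth_coeff) auto
    then show ?thesis using False by (simp add: companion_def sum_negf)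
   qed
   then show ?thesis using 2 yd by blast
  qed
 qed
 then have "smooth_on I x" by (rule smooth_on_cong[rotated]) (simp add: x_def)
 then have "x \<in> solutions I L"
  using x6 by (simp add: solutions_def smooth_functions_def odo_apply_def order6 x_def)
 then show ?thesis using xj[OF _ t0] y0 by blast
qed

end

section \<open>Dual systems of vectors\<close>

definition pair :: "complex ^ 'n \<Rightarrow> complex ^ 'n \<Rightarrow> complex" (infixl "\<cdot>" 75) where
 "x \<cdot> u = (\<Sum>i\<in>UNIV. x $ i * u $ i)"

lemma pair_simps [simp]:
 "(x + y) \<cdot> u = x \<cdot> u + y \<cdot> u" "(x - y) \<cdot> u = x \<cdot> u - y \<cdot> u" "(c *s x) \<cdot> u = c * (x \<cdot> u)"
 "x \<cdot> (u + w) = x \<cdot> u + x \<cdot> w" "x \<cdot> (u - w) = x \<cdot> u - x \<cdot> w" "x \<cdot> (c *s u) = c * (x \<cdot> u)"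
 "0 \<cdot> u = 0" "x \<cdot> 0 = 0" "(- x) \<cdot> u = - (x \<cdot> u)" "x \<cdot> (- u) = - (x \<cdot> u)"
 by (simp_all add: pair_def sum.distrib sum_subtractf sum_distrib_left algebra_simps sum_negf)

lemma pair_sum: "(\<Sum>i\<in>S. f i) \<cdot> u = (\<Sum>i\<in>S. f i \<cdot> u)" "x \<cdot> (\<Sum>i\<in>S. f i) = (\<Sum>i\<in>S. x \<cdot> f i)"
 by (induction S rule: infinite_finite_induct) auto

lemma pair_axis [simp]: "x \<cdot> axis i 1 = x $ i" "axis i 1 \<cdot> u = u $ i"
 by (simp_all add: pair_def axis_def if_distrib if_distribR cong: if_cong)

lemma pair_commute: "x \<cdot> u = u \<cdot> x"
 by (simp add: pair_def mult.commute)

lemma pair_eqI: "(\<And>u. x \<cdot> u = y \<cdot> u) \<Longrightarrow> x = y"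
 by (metis pair_axis(1) vec_eq_iff)

lemma pair_nonzero: "x \<noteq> 0 \<Longrightarrow> \<exists>u. x \<cdot> u = 1"
proof -
 assume "x \<noteq> 0"
 then obtain i where "x $ i \<noteq> 0" by (auto simp: vec_eq_iff)
 then have "x \<cdot> ((1 / x $ i) *s axis i 1) = 1" by simp
 then show ?thesis by blast
qed

definition dual :: "(complex ^ 'n) list \<Rightarrow> (nat \<Rightarrow> complex ^ 'n) \<Rightarrow> bool" where
 "dual xs E \<longleftrightarrow> (\<forall>i<length xs. \<forall>j<length xs. xs ! i \<cdot> E j = (if i = j then 1 else 0))"

text \<open>Having a dual system is the form in which linear independence is used: coordinates are then read off
 by pairing with \<open>E\<close>.\<close>

definition indep :: "(complex ^ 'n) list \<Rightarrow> bool" where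
 "indep xs \<longleftrightarrow> (\<exists>E. dual xs E)"

lemma dual_Nil: "dual [] E" by (simp add: dual_def)

lemma indep_or_relation:
 "indep xs \<or> (\<exists>c. (\<exists>i<length xs. c i \<noteq> 0) \<and> (\<Sum>i<length xs. c i *s xs ! i) = 0)"
proof (induction xs rule: rev_induct)
 case Nil
 then show ?case by (auto simp: indep_def dual_Nil)
next
 case (snoc y xs)
 let ?n = "length xs"
 from snoc consider E where "dual xs E" | c i where "i < ?n" "c i \<noteq> 0" "(\<Sum>i<?n. c i *s xs ! i) = 0"
  by (auto simp: indep_def)
 then show ?case
 proof cases
  case (1 E)
  define y' where "y' = y - (\<Sum>i<?n. (y \<cdot> E i) *s xs ! i)"
  have E: "xs ! i \<cdot> E j = (if i = j then 1 else 0)" if "i < ?n" "j < ?n" for i j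
   using 1 that by (simp add: dual_def)
  show ?thesis
  proof (cases "y' = 0")
   case True
   define c where "c = (\<lambda>i. if i = ?n then 1 else - (y \<cdot> E i))"
   have "(\<Sum>i<?n. c i *s (xs @ [y]) ! i) = - (\<Sum>i<?n. (y \<cdot> E i) *s xs ! i)"
    unfolding sum_negf[symmetric] by (rule sum.cong) (auto simp: c_def nth_append)
   then have "(\<Sum>i<Suc ?n. c i *s (xs @ [y]) ! i) = 0"
    using True by (simp add: c_def y'_def)
   moreover have "c ?n \<noteq> 0" by (simp add: c_def)
   ultimately show ?thesis by (intro disjI2 exI[of _ c]) auto
  next
   case False
   then obtain u where u: "y' \<cdot> u = 1" using pair_nonzero by blast
   define u' where "u' = u - (\<Sum>i<?n. (xs ! i \<cdot> u) *s E i)"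
   have xu: "xs ! i \<cdot> u' = 0" if "i < ?n" for i
   proof -
    have "(\<Sum>j<?n. (xs ! j \<cdot> u) * (xs ! i \<cdot> E j)) = (\<Sum>j<?n. if j = i then xs ! i \<cdot> u else 0)"
     by (rule sum.cong) (use E that in auto)
    then show ?thesis using that by (simp add: u'_def pair_sum)
   qed
   have yE: "y' \<cdot> E j = 0" if "j < ?n" for j
   proof -
    have "(\<Sum>i<?n. (y \<cdot> E i) * (xs ! i \<cdot> E j)) = (\<Sum>i<?n. if i = j then y \<cdot> E j else 0)"
     by (rule sum.cong) (use E that in auto)
    then show ?thesis using that by (simp add: y'_def pair_sum)
   qed
   have yu: "y' \<cdot> u' = 1" using u yE by (simp add: u'_def pair_sum)
   then have yu': "y \<cdot> u' = 1" using xu by (simp add: y'_def pair_sum)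
   define E' where "E' = (\<lambda>j. if j = ?n then u' else E j - (y \<cdot> E j) *s u')"
   have "dual (xs @ [y]) E'"
    unfolding dual_def using E xu yu' by (auto simp: E'_def nth_append less_Suc_eq)
   then show ?thesis by (auto simp: indep_def)
  qed
 next
  case (2 c i)
  define c' where "c' = (\<lambda>i. if i < ?n then c i else 0)"
  have "(\<Sum>i<?n. c' i *s (xs @ [y]) ! i) = (\<Sum>i<?n. c i *s xs ! i)"
   by (rule sum.cong) (auto simp: c'_def nth_append)
  then have "(\<Sum>i<Suc ?n. c' i *s (xs @ [y]) ! i) = 0" using 2 by (simp add: c'_def)
  moreover have "c' i \<noteq> 0" using 2 by (simp add: c'_def)
  moreover have "i < Suc ?n" using 2(1) by simp
  ultimately have "\<exists>i<Suc ?n. c' i \<noteq> 0" "(\<Sum>i<Suc ?n. c' i *s (xs @ [y]) ! i) = 0" by blast+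
  then show ?thesis unfolding length_append_singleton by blast
 qed
qed

lemma indep_select:
 assumes "dual xs E" "distinct js" "\<And>j. j \<in> set js \<Longrightarrow> j < length xs"
 shows "dual (map ((!) xs) js) (\<lambda>i. E (js ! i))"
 using assms by (auto simp: dual_def nth_eq_iff_index_eq)

lemma all_less_numeral:
 fixes P :: "nat \<Rightarrow> bool"
 shows "(\<forall>i<2. P i) \<longleftrightarrow> P 0 \<and> P 1" "(\<forall>i<3. P i) \<longleftrightarrow> P 0 \<and> P 1 \<and> P 2"
  "(\<forall>i<5. P i) \<longleftrightarrow> P 0 \<and> P 1 \<and> P 2 \<and> P 3 \<and> P 4"
  "(\<forall>i<6. P i) \<longleftrightarrow> P 0 \<and> P 1 \<and> P 2 \<and> P 3 \<and> P 4 \<and> P 5"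
 by (simp_all only: eval_nat_numeral All_less_Suc BitM.simps not_less0 simp_thms One_nat_def conj_ac)

lemma ex_less_numeral:
 fixes P :: "nat \<Rightarrow> bool"
 shows "(\<exists>i<2. P i) \<longleftrightarrow> P 0 \<or> P 1" "(\<exists>i<3. P i) \<longleftrightarrow> P 0 \<or> P 1 \<or> P 2"
 using all_less_numeral(1,2)[of "\<lambda>i. \<not> P i"] by blast+

lemma sum_less_numeral:
 fixes F :: "nat \<Rightarrow> 'a::comm_monoid_add"
 shows "(\<Sum>i<2. F i) = F 0 + F 1" "(\<Sum>i<3. F i) = F 0 + F 1 + F 2"
  "(\<Sum>i<5. F i) = F 0 + F 1 + F 2 + F 3 + F 4" "(\<Sum>i<6. F i) = F 0 + F 1 + F 2 + F 3 + F 4 + F 5"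
 by (simp_all add: eval_nat_numeral)

lemma length_lists:
 "length [a, b] = 2" "length [a, b, c] = 3" "length [a, b, c, d, e] = 5" "length [a, b, c, d, e, f] = 6"
 by simp_all

lemma dual_2: "dual [x, y] E \<longleftrightarrow> x \<cdot> E 0 = 1 \<and> x \<cdot> E 1 = 0 \<and> y \<cdot> E 0 = 0 \<and> y \<cdot> E 1 = 1"
 unfolding dual_def length_lists all_less_numeral by simp

lemma dual_3: "dual [x, y, z] E \<longleftrightarrow> x \<cdot> E 0 = 1 \<and> x \<cdot> E 1 = 0 \<and> x \<cdot> E 2 = 0 \<and>
  y \<cdot> E 0 = 0 \<and> y \<cdot> E 1 = 1 \<and> y \<cdot> E 2 = 0 \<and> z \<cdot> E 0 = 0 \<and> z \<cdot> E 1 = 0 \<and> z \<cdot> E 2 = 1"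
 unfolding dual_def length_lists all_less_numeral by simp

lemma dual_5: "dual [x, y, z, y', z'] E \<longleftrightarrow>
  x \<cdot> E 0 = 1 \<and> x \<cdot> E 1 = 0 \<and> x \<cdot> E 2 = 0 \<and> x \<cdot> E 3 = 0 \<and> x \<cdot> E 4 = 0 \<and>
  y \<cdot> E 0 = 0 \<and> y \<cdot> E 1 = 1 \<and> y \<cdot> E 2 = 0 \<and> y \<cdot> E 3 = 0 \<and> y \<cdot> E 4 = 0 \<and>
  z \<cdot> E 0 = 0 \<and> z \<cdot> E 1 = 0 \<and> z \<cdot> E 2 = 1 \<and> z \<cdot> E 3 = 0 \<and> z \<cdot> E 4 = 0 \<and>
  y' \<cdot> E 0 = 0 \<and> y' \<cdot> E 1 = 0 \<and> y' \<cdot> E 2 = 0 \<and> y' \<cdot> E 3 = 1 \<and> y' \<cdot> E 4 = 0 \<and>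
  z' \<cdot> E 0 = 0 \<and> z' \<cdot> E 1 = 0 \<and> z' \<cdot> E 2 = 0 \<and> z' \<cdot> E 3 = 0 \<and> z' \<cdot> E 4 = 1"
 unfolding dual_def length_lists all_less_numeral by simp

lemma dual_6: "dual [x, y, z, y', z', w] E \<longleftrightarrow>
  x \<cdot> E 0 = 1 \<and> x \<cdot> E 1 = 0 \<and> x \<cdot> E 2 = 0 \<and> x \<cdot> E 3 = 0 \<and> x \<cdot> E 4 = 0 \<and> x \<cdot> E 5 = 0 \<and>
  y \<cdot> E 0 = 0 \<and> y \<cdot> E 1 = 1 \<and> y \<cdot> E 2 = 0 \<and> y \<cdot> E 3 = 0 \<and> y \<cdot> E 4 = 0 \<and> y \<cdot> E 5 = 0 \<and>
  z \<cdot> E 0 = 0 \<and> z \<cdot> E 1 = 0 \<and> z \<cdot> E 2 = 1 \<and> z \<cdot> E 3 = 0 \<and> z \<cdot> E 4 = 0 \<and> z \<cdot> E 5 = 0 \<and>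
  y' \<cdot> E 0 = 0 \<and> y' \<cdot> E 1 = 0 \<and> y' \<cdot> E 2 = 0 \<and> y' \<cdot> E 3 = 1 \<and> y' \<cdot> E 4 = 0 \<and> y' \<cdot> E 5 = 0 \<and>
  z' \<cdot> E 0 = 0 \<and> z' \<cdot> E 1 = 0 \<and> z' \<cdot> E 2 = 0 \<and> z' \<cdot> E 3 = 0 \<and> z' \<cdot> E 4 = 1 \<and> z' \<cdot> E 5 = 0 \<and>
  w \<cdot> E 0 = 0 \<and> w \<cdot> E 1 = 0 \<and> w \<cdot> E 2 = 0 \<and> w \<cdot> E 3 = 0 \<and> w \<cdot> E 4 = 0 \<and> w \<cdot> E 5 = 1"
 unfolding dual_def length_lists all_less_numeral by simp

text \<open>In square systems dependence means a common annihilating covector.\<close>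

lemma six_vectors:
 fixes xs :: "(complex ^ 6) list"
 assumes "length xs = 6"
 shows "indep xs \<or> (\<exists>\<theta>. \<theta> \<noteq> 0 \<and> (\<forall>x\<in>set xs. x \<cdot> \<theta> = 0))"
proof -
 define X :: "complex ^ 6 ^ 6" where "X = (\<chi> i. xs ! rk i)"
 have Xv: "(X *v u) $ i = xs ! rk i \<cdot> u" for u i
  by (simp add: X_def matrix_vector_mult_def pair_def)
 show ?thesis
 proof (cases "\<exists>Y. Y ** X = Finite_Cartesian_Product.mat 1")
  case True
  then obtain Y where "X ** Y = Finite_Cartesian_Product.mat 1" using matrix_left_right_inverse by metis
  then have "(X ** Y) $ i $ j = (if i = j then 1 else 0)" for i j by (simp add: Finite_Cartesian_Product.mat_def)
  then have "xs ! rk i \<cdot> (\<chi> k. Y $ k $ j) = (if i = j then 1 else 0)" for i j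
   by (simp add: matrix_matrix_mult_def X_def pair_def)
  from this[of "ix _" "ix _"] have "dual xs (\<lambda>j. \<chi> k. Y $ k $ ix j)"
   unfolding dual_def using assms by (metis (lifting) rk_ix)
  then show ?thesis by (auto simp: indep_def)
 next
  case False
  then obtain \<theta> where "\<theta> \<noteq> 0" "X *v \<theta> = 0" unfolding matrix_left_invertible_ker by blast
  then have "xs ! j \<cdot> \<theta> = 0" if "j < 6" for j
   using Xv[of \<theta> "ix j"] that by (simp del: matrix_vector_mult_0)
  then show ?thesis using \<open>\<theta> \<noteq> 0\<close> assms by (metis in_set_conv_nth)
 qed
qed

text \<open>Six vectors with a dual system form a basis, on either side of the pairing.\<close>

lemma dual_expansion:
 fixes xs :: "(complex ^ 6) list"
 assumes "dual xs E" "length xs = 6"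
 shows "p = (\<Sum>i<6. (p \<cdot> E i) *s xs ! i)" "q = (\<Sum>i<6. (xs ! i \<cdot> q) *s E i)"
proof -
 define X :: "complex ^ 6 ^ 6" where "X = (\<chi> i. xs ! rk i)"
 define Y :: "complex ^ 6 ^ 6" where "Y = (\<chi> k j. E (rk j) $ k)"
 have "(X ** Y) $ i $ j = (if i = j then 1 else 0)" for i j
 proof -
  have "(X ** Y) $ i $ j = xs ! rk i \<cdot> E (rk j)"
   by (simp add: X_def Y_def matrix_matrix_mult_def pair_def)
  also have "\<dots> = (if rk i = rk j then 1 else 0)" using assms by (simp add: dual_def)
  also have "rk i = rk j \<longleftrightarrow> i = j" by (metis ix_rk)
  finally show ?thesis .
 qed
 then have "X ** Y = Finite_Cartesian_Product.mat 1"
  by (simp add: Finite_Cartesian_Product.mat_def vec_eq_iff)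
 then have YX: "Y ** X = Finite_Cartesian_Product.mat 1" using matrix_left_right_inverse by blast
 have YX': "(\<Sum>m\<in>UNIV. E (rk m) $ k * xs ! rk m $ l) = (if k = l then 1 else 0)" for k l
  using arg_cong[OF YX, of "\<lambda>M. M $ k $ l"] by (simp add: X_def Y_def matrix_matrix_mult_def Finite_Cartesian_Product.mat_def)
 have swap: "(\<Sum>m\<in>UNIV. (\<Sum>k\<in>UNIV. f k * E (rk m) $ k) * xs ! rk m $ l) = f l"
  "(\<Sum>m\<in>UNIV. (\<Sum>k\<in>UNIV. f k * xs ! rk m $ k) * E (rk m) $ l) = f l" for l and f :: "6 \<Rightarrow> complex"
 proof -
  have "(\<Sum>m\<in>UNIV. (\<Sum>k\<in>UNIV. f k * E (rk m) $ k) * xs ! rk m $ l) =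
    (\<Sum>k\<in>UNIV. \<Sum>m\<in>UNIV. f k * (E (rk m) $ k * xs ! rk m $ l))"
   by (subst sum.swap) (simp add: sum_distrib_right mult.assoc)
  also have "\<dots> = (\<Sum>k\<in>UNIV. f k * (if k = l then 1 else 0))"
   by (simp only: sum_distrib_left[symmetric] YX')
  finally show "(\<Sum>m\<in>UNIV. (\<Sum>k\<in>UNIV. f k * E (rk m) $ k) * xs ! rk m $ l) = f l"
   by (simp add: if_distrib cong: if_cong)
  have "(\<Sum>m\<in>UNIV. (\<Sum>k\<in>UNIV. f k * xs ! rk m $ k) * E (rk m) $ l) =
    (\<Sum>k\<in>UNIV. \<Sum>m\<in>UNIV. f k * (E (rk m) $ l * xs ! rk m $ k))"
   by (subst sum.swap) (simp add: sum_distrib_left mult_ac)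
  also have "\<dots> = (\<Sum>k\<in>UNIV. f k * (if l = k then 1 else 0))"
   by (simp only: sum_distrib_left[symmetric] YX')
  finally show "(\<Sum>m\<in>UNIV. (\<Sum>k\<in>UNIV. f k * xs ! rk m $ k) * E (rk m) $ l) = f l"
   by (simp add: if_distrib cong: if_cong)
 qed
 have "(\<Sum>i<6. (p \<cdot> E i) *s xs ! i) = (\<Sum>m\<in>UNIV. (p \<cdot> E (rk m)) *s xs ! rk m)"
  "(\<Sum>i<6. (xs ! i \<cdot> q) *s E i) = (\<Sum>m\<in>UNIV. (q \<cdot> xs ! rk m) *s E (rk m))"
  unfolding sum_ix by (simp_all add: pair_commute[of q])
 moreover have "(\<Sum>m\<in>UNIV. (p \<cdot> E (rk m)) *s xs ! rk m) $ l = p $ l"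
  "(\<Sum>m\<in>UNIV. (q \<cdot> xs ! rk m) *s E (rk m)) $ l = q $ l" for l
  unfolding sum_component vector_smult_component pair_def by (rule swap)+
 ultimately show "p = (\<Sum>i<6. (p \<cdot> E i) *s xs ! i)" "q = (\<Sum>i<6. (xs ! i \<cdot> q) *s E i)"
  unfolding vec_eq_iff by metis+
qed

lemma ex_annihilator:
 fixes xs :: "(complex ^ 6) list"
 assumes "length xs < 6"
 shows "\<exists>\<theta>. \<theta> \<noteq> 0 \<and> (\<forall>x\<in>set xs. x \<cdot> \<theta> = 0)"
proof -
 let ?ys = "xs @ replicate (6 - length xs) 0"
 have "\<not> indep ?ys"
 proof
  assume "indep ?ys"
  then obtain E where "dual ?ys E" by (auto simp: indep_def)
  then have "?ys ! length xs \<cdot> E (length xs) = 1" using assms by (simp add: dual_def del: nth_append_length)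
  then show False using assms by (simp add: nth_append)
 qed
 then show ?thesis using six_vectors[of ?ys] assms by auto
qed

lemma indep_extend:
 fixes xs :: "(complex ^ 6) list"
 assumes "indep xs" "length xs < 6"
 shows "\<exists>w. indep (xs @ [w])"
proof -
 obtain \<theta> where \<theta>: "\<theta> \<noteq> 0" "\<And>x. x \<in> set xs \<Longrightarrow> x \<cdot> \<theta> = 0" using ex_annihilator[OF assms(2)] by blast
 obtain w where "\<theta> \<cdot> w = 1" using pair_nonzero[OF \<theta>(1)] by blast
 then have w: "w \<cdot> \<theta> = 1" by (simp add: pair_commute)
 obtain E where E: "dual xs E" using assms(1) by (auto simp: indep_def)
 have "dual (xs @ [w]) (\<lambda>j. if j = length xs then \<theta> else E j - (w \<cdot> E j) *s \<theta>)"
  using E w \<theta>(2) by (auto simp: dual_def nth_append less_Suc_eq)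
 then show ?thesis by (auto simp: indep_def)
qed

lemma annihilator_line:
 fixes xs :: "(complex ^ 6) list"
 assumes "indep xs" "length xs = 5"
 shows "\<exists>\<theta>. \<theta> \<noteq> 0 \<and> (\<forall>x\<in>set xs. x \<cdot> \<theta> = 0) \<and> (\<forall>p. (\<forall>x\<in>set xs. x \<cdot> p = 0) \<longrightarrow> (\<exists>\<alpha>. p = \<alpha> *s \<theta>))"
proof -
 obtain w E where E: "dual (xs @ [w]) E" using indep_extend assms by (force simp: indep_def)
 have "p = (w \<cdot> p) *s E 5" if "\<forall>x\<in>set xs. x \<cdot> p = 0" for p
 proof -
  have "p = (\<Sum>i<Suc 5. ((xs @ [w]) ! i \<cdot> p) *s E i)" using dual_expansion(2)[OF E] assms(2) by simp
  also have "\<dots> = (\<Sum>i<5. 0) + (w \<cdot> p) *s E 5"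
   unfolding sum.lessThan_Suc using that assms(2)
   by (intro arg_cong2[where f = "(+)"] sum.cong) (auto simp: nth_append)
  finally show ?thesis by simp
 qed
 moreover have E': "(xs @ [w]) ! i \<cdot> E j = (if i = j then 1 else 0)" if "i < 6" "j < 6" for i j
  using E that assms(2) by (simp add: dual_def)
 have "x \<cdot> E 5 = 0" if x: "x \<in> set xs" for x
 proof -
  obtain i where "i < 5" "x = xs ! i" using x assms(2) by (auto simp: in_set_conv_nth)
  then show ?thesis using E'[of i 5] assms(2) by (simp add: nth_append)
 qed
 moreover have "E 5 \<noteq> 0"
 proof
  assume "E 5 = 0"
  moreover have "w \<cdot> E 5 = 1" using E'[of 5 5] assms(2) by (simp add: nth_append)
  ultimately show False by simp
 qed
 ultimately show ?thesis by blast
qed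

lemma relation_2:
 assumes "\<not> indep [x, y]"
 shows "\<exists>c :: nat \<Rightarrow> complex. (c 0 \<noteq> 0 \<or> c 1 \<noteq> 0) \<and> c 0 *s x + c 1 *s y = 0"
 using indep_or_relation[of "[x, y]"] assms
 unfolding length_lists ex_less_numeral sum_less_numeral by simp

lemma relation_3:
 assumes "\<not> indep [x, y, z]"
 shows "\<exists>c :: nat \<Rightarrow> complex. (c 0 \<noteq> 0 \<or> c 1 \<noteq> 0 \<or> c 2 \<noteq> 0) \<and> c 0 *s x + c 1 *s y + c 2 *s z = 0"
 using indep_or_relation[of "[x, y, z]"] assms
 unfolding length_lists ex_less_numeral sum_less_numeral by simp

section \<open>Trivectors\<close>

declare One_nat_def [simp del]

type_synonym vec6 = "complex ^ 6"
type_synonym trivec = "complex ^ (6 \<times> 6 \<times> 6)"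

text \<open>A trivector of the solution space is recorded by its 216 coordinates; \<open>tri k\<close> is the trilinear
 form on the dual space that it defines.\<close>

definition tri :: "trivec \<Rightarrow> vec6 \<Rightarrow> vec6 \<Rightarrow> vec6 \<Rightarrow> complex" where
 "tri k u v w = (\<Sum>p\<in>UNIV. k $ p * (u $ fst p * v $ fst (snd p) * w $ snd (snd p)))"

definition alt :: "trivec \<Rightarrow> bool" where
 "alt k \<longleftrightarrow> (\<forall>a b c. k $ (b, a, c) = - k $ (a, b, c) \<and> k $ (a, c, b) = - k $ (a, b, c))"

lemma tri_add [simp]:
 "tri (k + l) u v w = tri k u v w + tri l u v w"
 "tri k (u + u') v w = tri k u v w + tri k u' v w"
 "tri k u (v + v') w = tri k u v w + tri k u v' w"
 "tri k u v (w + w') = tri k u v w + tri k u v w'"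
 unfolding tri_def sum.distrib[symmetric] by (rule sum.cong, rule refl, simp add: ring_distribs)+

lemma tri_scale [simp]:
 "tri (c *s k) u v w = c * tri k u v w" "tri k (c *s u) v w = c * tri k u v w"
 "tri k u (c *s v) w = c * tri k u v w" "tri k u v (c *s w) = c * tri k u v w"
 unfolding tri_def sum_distrib_left by (rule sum.cong, rule refl, simp add: mult_ac)+

lemma tri_zero [simp]: "tri 0 u v w = 0" "tri k 0 v w = 0" "tri k u 0 w = 0" "tri k u v 0 = 0"
 by (simp_all add: tri_def)

lemma tri_diff [simp]:
 "tri (k - l) u v w = tri k u v w - tri l u v w" "tri (- k) u v w = - tri k u v w"
 "tri k (u - u') v w = tri k u v w - tri k u' v w"
 "tri k u (v - v') w = tri k u v w - tri k u v' w"
 "tri k u v (w - w') = tri k u v w - tri k u v w'"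
 unfolding tri_def sum_subtractf[symmetric] sum_negf[symmetric]
 by (rule sum.cong, rule refl, simp add: ring_distribs)+

lemma tri_sum:
 "tri (\<Sum>i\<in>S. f i) u v w = (\<Sum>i\<in>S. tri (f i) u v w)"
 "tri k (\<Sum>i\<in>S. g i) v w = (\<Sum>i\<in>S. tri k (g i) v w)"
 "tri k u (\<Sum>i\<in>S. g i) w = (\<Sum>i\<in>S. tri k u (g i) w)"
 "tri k u v (\<Sum>i\<in>S. g i) = (\<Sum>i\<in>S. tri k u v (g i))"
 by (induction S rule: infinite_finite_induct) auto

lemma tri_axis: "tri k (axis a 1) (axis b 1) (axis c 1) = k $ (a, b, c)"
proof -
 have "k $ p * (axis a 1 $ fst p * axis b 1 $ fst (snd p) * axis c 1 $ snd (snd p)) =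
   (if p = (a, b, c) then k $ (a, b, c) else 0)" for p
  by (cases p) (simp add: axis_def)
 then show ?thesis by (simp add: tri_def)
qed

lemma tri_eqI: "(\<And>u v w. tri k u v w = tri l u v w) \<Longrightarrow> k = l"
proof -
 assume *: "\<And>u v w. tri k u v w = tri l u v w"
 have "k $ (a, b, c) = l $ (a, b, c)" for a b c
  using *[of "axis a 1" "axis b 1" "axis c 1"] by (simp add: tri_axis)
 then show "k = l" by (auto simp: vec_eq_iff)
qed

lemma tri_swap:
 assumes "alt k"
 shows "tri k v u w = - tri k u v w" "tri k u w v = - tri k u v w"
proof -
 have k: "k $ (b, a, c) = - k $ (a, b, c)" "k $ (a, c, b) = - k $ (a, b, c)" for a b c
  using assms unfolding alt_def by blast+
 show "tri k v u w = - tri k u v w"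
  unfolding tri_def sum_negf[symmetric]
 proof (rule sum.reindex_bij_witness[of _ "\<lambda>(a, b, c). (b, a, c)" "\<lambda>(a, b, c). (b, a, c)"])
  fix p :: "6 \<times> 6 \<times> 6"
  obtain a b c where p: "p = (a, b, c)" by (cases p)
  show "- (k $ (case p of (a, b, c) \<Rightarrow> (b, a, c)) * (u $ fst (case p of (a, b, c) \<Rightarrow> (b, a, c)) *
   v $ fst (snd (case p of (a, b, c) \<Rightarrow> (b, a, c))) * w $ snd (snd (case p of (a, b, c) \<Rightarrow> (b, a, c))))) =
   k $ p * (v $ fst p * u $ fst (snd p) * w $ snd (snd p))"
   unfolding p using k(1)[of b a c] by simp
 qed auto
 show "tri k u w v = - tri k u v w"
  unfolding tri_def sum_negf[symmetric]
 proof (rule sum.reindex_bij_witness[of _ "\<lambda>(a, b, c). (a, c, b)" "\<lambda>(a, b, c). (a, c, b)"])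
  fix p :: "6 \<times> 6 \<times> 6"
  obtain a b c where p: "p = (a, b, c)" by (cases p)
  show "- (k $ (case p of (a, b, c) \<Rightarrow> (a, c, b)) * (u $ fst (case p of (a, b, c) \<Rightarrow> (a, c, b)) *
   v $ fst (snd (case p of (a, b, c) \<Rightarrow> (a, c, b))) * w $ snd (snd (case p of (a, b, c) \<Rightarrow> (a, c, b))))) =
   k $ p * (u $ fst p * w $ fst (snd p) * v $ snd (snd p))"
   unfolding p using k(2)[of a c b] by simp
 qed auto
qed

lemma tri_rotate: "alt k \<Longrightarrow> tri k v w u = tri k u v w"
 using tri_swap(2)[of k v u w] tri_swap(1)[of k u v w] by simp

lemma tri_same:
 assumes "alt k" shows "tri k u u w = 0" "tri k w u u = 0" "tri k u w u = 0"
 using tri_swap(1)[OF assms, of u u w] tri_swap(2)[OF assms, of w u u]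
  tri_swap(1)[OF assms, of u u w] tri_swap(2)[OF assms, of u w u] by simp_all

lemma altI: "(\<And>u v w. tri k v u w = - tri k u v w) \<Longrightarrow> (\<And>u v w. tri k u w v = - tri k u v w) \<Longrightarrow> alt k"
 unfolding alt_def tri_axis[symmetric] by blast

lemma altD: "alt k \<Longrightarrow> k $ (b, a, c) = - k $ (a, b, c)" "alt k \<Longrightarrow> k $ (a, c, b) = - k $ (a, b, c)"
 unfolding alt_def by blast+

lemma alt_lin [simp]:
 shows "alt 0" and "alt k \<Longrightarrow> alt l \<Longrightarrow> alt (k + l)" and "alt k \<Longrightarrow> alt l \<Longrightarrow> alt (k - l)"
  and "alt k \<Longrightarrow> alt (d *s k)"
proof -
 show "alt 0" by (simp add: alt_def)
 show "alt (k + l)" if "alt k" "alt l"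
  unfolding alt_def
 proof (intro allI)
  fix a b c
  show "(k + l) $ (b, a, c) = - (k + l) $ (a, b, c) \<and> (k + l) $ (a, c, b) = - (k + l) $ (a, b, c)"
   using altD[OF that(1), of b a c] altD[OF that(2), of b a c]
    altD[OF that(1), of a c b] altD[OF that(2), of a c b] by simp
 qed
 show "alt (k - l)" if "alt k" "alt l"
  unfolding alt_def
 proof (intro allI)
  fix a b c
  show "(k - l) $ (b, a, c) = - (k - l) $ (a, b, c) \<and> (k - l) $ (a, c, b) = - (k - l) $ (a, b, c)"
   using altD[OF that(1), of b a c] altD[OF that(2), of b a c]
    altD[OF that(1), of a c b] altD[OF that(2), of a c b] by simp
 qed
 show "alt (d *s k)" if "alt k"
  unfolding alt_def
 proof (intro allI)
  fix a b c
  show "(d *s k) $ (b, a, c) = - (d *s k) $ (a, b, c) \<and> (d *s k) $ (a, c, b) = - (d *s k) $ (a, b, c)"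
   using altD[OF that, of b a c] altD[OF that, of a c b] by simp
 qed
qed

text \<open>A function of three covectors that is trilinear is determined by its values on the axes.\<close>

definition tri_of :: "(vec6 \<Rightarrow> vec6 \<Rightarrow> vec6 \<Rightarrow> complex) \<Rightarrow> trivec" where
 "tri_of F = (\<chi> p. F (axis (fst p) 1) (axis (fst (snd p)) 1) (axis (snd (snd p)) 1))"

definition linear6 :: "(vec6 \<Rightarrow> complex) \<Rightarrow> bool" where
 "linear6 f \<longleftrightarrow> (\<forall>u v. f (u + v) = f u + f v) \<and> (\<forall>c u. f (c *s u) = c * f u)"

lemma linear6_expand: "linear6 f \<Longrightarrow> f u = (\<Sum>i\<in>UNIV. u $ i * f (axis i 1))"
proof -
 assume f: "linear6 f"
 have f0: "f 0 = 0" using f unfolding linear6_def by (metis mult_zero_left vector_smult_lzero)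
 have "f (\<Sum>i\<in>S. u $ i *s axis i 1) = (\<Sum>i\<in>S. u $ i * f (axis i 1))" if "finite S" for S
  using that by induction (use f f0 in \<open>simp_all add: linear6_def\<close>)
 from this[of UNIV] show ?thesis by (simp add: basis_expansion)
qed

definition vec_of :: "(vec6 \<Rightarrow> complex) \<Rightarrow> vec6" where
 "vec_of f = (\<chi> i. f (axis i 1))"

lemma pair_vec_of: "linear6 f \<Longrightarrow> vec_of f \<cdot> u = f u"
 using linear6_expand[of f u] by (simp add: vec_of_def pair_def mult.commute)

lemma tri_tri_of:
 assumes "\<And>v w. linear6 (\<lambda>u. F u v w)" "\<And>u w. linear6 (\<lambda>v. F u v w)" "\<And>u v. linear6 (\<lambda>w. F u v w)"
 shows "tri (tri_of F) u v w = F u v w"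
proof -
 have "F u v w = (\<Sum>a\<in>UNIV. u $ a * F (axis a 1) v w)"
  by (rule linear6_expand[OF assms(1)])
 also have "\<dots> = (\<Sum>a\<in>UNIV. u $ a * (\<Sum>b\<in>UNIV. v $ b * F (axis a 1) (axis b 1) w))"
  by (intro sum.cong refl arg_cong2[where f = "(*)"] linear6_expand[OF assms(2)])
 also have "\<dots> = (\<Sum>a\<in>UNIV. u $ a * (\<Sum>b\<in>UNIV. v $ b *
   (\<Sum>c\<in>UNIV. w $ c * F (axis a 1) (axis b 1) (axis c 1))))"
  by (intro sum.cong refl arg_cong2[where f = "(*)"] linear6_expand[OF assms(3)])
 also have "\<dots> = (\<Sum>a\<in>UNIV. \<Sum>b\<in>UNIV. \<Sum>c\<in>UNIV.
   F (axis a 1) (axis b 1) (axis c 1) * (u $ a * v $ b * w $ c))"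
  by (simp add: sum_distrib_left mult_ac)
 also have "\<dots> = tri (tri_of F) u v w"
  by (simp add: tri_def tri_of_def sum.cartesian_product case_prod_beta UNIV_Times_UNIV[symmetric] del: UNIV_Times_UNIV)
 finally show ?thesis by simp
qed

text \<open>The exterior product \<open>x \<and> y \<and> z\<close>.\<close>

definition T3 :: "vec6 \<Rightarrow> vec6 \<Rightarrow> vec6 \<Rightarrow> trivec" where
 "T3 x y z = tri_of (\<lambda>u v w. x \<cdot> u * (y \<cdot> v * z \<cdot> w - y \<cdot> w * z \<cdot> v)
   - x \<cdot> v * (y \<cdot> u * z \<cdot> w - y \<cdot> w * z \<cdot> u) + x \<cdot> w * (y \<cdot> u * z \<cdot> v - y \<cdot> v * z \<cdot> u))"

lemma tri_T3: "tri (T3 x y z) u v w = x \<cdot> u * (y \<cdot> v * z \<cdot> w - y \<cdot> w * z \<cdot> v)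
   - x \<cdot> v * (y \<cdot> u * z \<cdot> w - y \<cdot> w * z \<cdot> u) + x \<cdot> w * (y \<cdot> u * z \<cdot> v - y \<cdot> v * z \<cdot> u)"
 unfolding T3_def by (rule tri_tri_of) (auto simp: linear6_def algebra_simps)

lemma alt_T3 [simp]: "alt (T3 x y z)"
 by (rule altI) (simp_all add: tri_T3 algebra_simps)

lemma T3_lin:
 "T3 (x + x') y z = T3 x y z + T3 x' y z" "T3 x (y + y') z = T3 x y z + T3 x y' z"
 "T3 x y (z + z') = T3 x y z + T3 x y z'"
 "T3 (x - x') y z = T3 x y z - T3 x' y z" "T3 x (y - y') z = T3 x y z - T3 x y' z"
 "T3 x y (z - z') = T3 x y z - T3 x y z'"
 "T3 (c *s x) y z = c *s T3 x y z" "T3 x (c *s y) z = c *s T3 x y z" "T3 x y (c *s z) = c *s T3 x y z"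
 "T3 0 y z = 0" "T3 x 0 z = 0" "T3 x y 0 = 0"
 by (rule tri_eqI; simp add: tri_T3 algebra_simps)+

lemma T3_swap: "T3 y x z = - T3 x y z" "T3 x z y = - T3 x y z"
 by (rule tri_eqI; simp add: tri_T3 algebra_simps)+

lemma T3_permutations:
 "T3 y x z = - T3 x y z" "T3 x z y = - T3 x y z" "T3 z y x = - T3 x y z" "T3 y z x = T3 x y z" "T3 z x y = T3 x y z"
 by (rule tri_eqI; simp add: tri_T3 algebra_simps)+

lemma T3_same [simp]: "T3 x x z = 0" "T3 x z z = 0" "T3 x z x = 0"
 by (rule tri_eqI; simp add: tri_T3 algebra_simps)+

lemma T3_nonzero_iff: "T3 x y z \<noteq> 0 \<longleftrightarrow> indep [x, y, z]"
proof
 assume "indep [x, y, z]"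
 then obtain E where "dual [x, y, z] E" by (auto simp: indep_def)
 then have "tri (T3 x y z) (E 0) (E 1) (E 2) = 1" by (simp add: tri_T3 dual_3)
 then show "T3 x y z \<noteq> 0" by auto
next
 assume nz: "T3 x y z \<noteq> 0"
 show "indep [x, y, z]"
 proof (rule ccontr)
  assume "\<not> indep [x, y, z]"
  then obtain c :: "nat \<Rightarrow> complex" where
   c: "c 0 \<noteq> 0 \<or> c 1 \<noteq> 0 \<or> c 2 \<noteq> 0" "c 0 *s x + c 1 *s y + c 2 *s z = 0"
   using relation_3 by blast
  have "T3 (c 0 *s x + c 1 *s y + c 2 *s z) y z = c 0 *s T3 x y z"
   "T3 x (c 0 *s x + c 1 *s y + c 2 *s z) z = c 1 *s T3 x y z"
   "T3 x y (c 0 *s x + c 1 *s y + c 2 *s z) = c 2 *s T3 x y z"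
   by (simp_all only: T3_lin T3_same vec.scale_zero_right add_0_left add_0_right)
  then have "c 0 *s T3 x y z = 0" "c 1 *s T3 x y z = 0" "c 2 *s T3 x y z = 0"
   by (simp_all only: c(2) T3_lin)
  then show False using c(1) nz unfolding vec.scale_eq_0_iff by blast
 qed
qed

text \<open>\<open>w4 v k\<close> is the exterior product of a vector with a trivector.\<close>

definition w4 :: "vec6 \<Rightarrow> trivec \<Rightarrow> vec6 \<Rightarrow> vec6 \<Rightarrow> vec6 \<Rightarrow> vec6 \<Rightarrow> complex" where
 "w4 v k p q r s = v \<cdot> p * tri k q r s - v \<cdot> q * tri k p r s + v \<cdot> r * tri k p q s - v \<cdot> s * tri k p q r"

definition kills :: "vec6 \<Rightarrow> trivec \<Rightarrow> bool" where
 "kills v k \<longleftrightarrow> (\<forall>p q r s. w4 v k p q r s = 0)"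

lemma w4_lin [simp]:
 "w4 (v + v') k p q r s = w4 v k p q r s + w4 v' k p q r s"
 "w4 (v - v') k p q r s = w4 v k p q r s - w4 v' k p q r s"
 "w4 (c *s v) k p q r s = c * w4 v k p q r s" "w4 0 k p q r s = 0" "w4 v 0 p q r s = 0"
 "w4 v (k + k') p q r s = w4 v k p q r s + w4 v k' p q r s"
 "w4 v (k - k') p q r s = w4 v k p q r s - w4 v k' p q r s"
 "w4 v (c *s k) p q r s = c * w4 v k p q r s"
 by (simp_all add: w4_def algebra_simps)

lemma kills_T3: "kills x (T3 x y z)" "kills y (T3 x y z)" "kills z (T3 x y z)"
 by (simp_all add: kills_def w4_def tri_T3 algebra_simps)

text \<open>Division: a trivector killed by two independent vectors is decomposable.\<close>

lemma kills_expand: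
 assumes "kills v k" "v \<cdot> u = 1"
 shows "tri k p q r = v \<cdot> p * tri k u q r - v \<cdot> q * tri k u p r + v \<cdot> r * tri k u p q"
proof -
 have "w4 v k u p q r = 0" using assms(1) by (simp add: kills_def)
 then show ?thesis by (simp add: w4_def assms(2) algebra_simps)
qed

lemma kills_two:
 assumes k: "alt k" "kills v k" "kills v' k" and ind: "indep [v, v']"
 shows "\<exists>y. k = T3 v v' y"
proof -
 obtain E where E: "dual [v, v'] E" using ind by (auto simp: indep_def)
 define y where "y = vec_of (\<lambda>r. tri k (E 0) (E 1) r)"
 have y: "y \<cdot> r = tri k (E 0) (E 1) r" for r
  unfolding y_def by (rule pair_vec_of) (simp add: linear6_def)
 have v: "v \<cdot> E 0 = 1" "v' \<cdot> E 0 = 0" "v \<cdot> E 1 = 0" "v' \<cdot> E 1 = 1" using E by (simp_all add: dual_2)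
 have *: "tri k (E 0) q r = v' \<cdot> q * y \<cdot> r - v' \<cdot> r * y \<cdot> q" for q r
  using kills_expand[OF k(3) v(4), of "E 0" q r] v
  by (simp add: y tri_swap(1)[OF k(1), where v = "E 1" and u = "E 0"])
 have "tri k p q r = tri (T3 v v' y) p q r" for p q r
  using kills_expand[OF k(2) v(1), of p q r] by (simp add: * tri_T3 algebra_simps)
 then show ?thesis using tri_eqI by blast
qed

section \<open>Partially decomposable trivectors\<close>

text \<open>One step of the reduction of a skew form to a sum of products \<open>y \<and> z\<close>. The last clause keeps the radical
 of \<open>f\<close>, so that a second step stays in the same five-dimensional quotient.\<close>

lemma bilinear_skew_split:
 fixes f :: "vec6 \<Rightarrow> vec6 \<Rightarrow> complex"
 assumes lin: "\<And>p. linear6 (f p)" and skew: "\<And>p q. f q p = - f p q" and nz: "f p0 q0 \<noteq> 0"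
 shows "\<exists>y z g. (\<forall>p q. f p q = y \<cdot> p * z \<cdot> q - y \<cdot> q * z \<cdot> p + g p q) \<and> (\<forall>p. linear6 (g p)) \<and>
  (\<forall>p q. g q p = - g p q) \<and> (\<forall>q. g p0 q = 0) \<and> (\<forall>q. g q0 q = 0) \<and>
  y \<cdot> p0 = 0 \<and> y \<cdot> q0 = 1 \<and> z \<cdot> p0 \<noteq> 0 \<and> z \<cdot> q0 = 0 \<and>
  (\<forall>u. (\<forall>q. f u q = 0) \<longrightarrow> y \<cdot> u = 0 \<and> z \<cdot> u = 0 \<and> (\<forall>q. g u q = 0))"
proof -
 define c where "c = f p0 q0"
 define y where "y = vec_of (\<lambda>q. f p0 q / c)"
 define z where "z = vec_of (f q0)"
 have y: "y \<cdot> q = f p0 q / c" for q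
  unfolding y_def using lin[of p0] by (intro pair_vec_of) (auto simp: linear6_def add_divide_distrib)
 have z: "z \<cdot> q = f q0 q" for q
  unfolding z_def by (rule pair_vec_of[OF lin])
 have self: "f p p = 0" for p using skew[of p p] by simp
 define g where "g = (\<lambda>p q. f p q - (y \<cdot> p * z \<cdot> q - y \<cdot> q * z \<cdot> p))"
 have c: "c \<noteq> 0" using nz by (simp add: c_def)
 have "linear6 (g p)" for p
  using lin[of p] by (auto simp: linear6_def g_def algebra_simps)
 moreover have "g q p = - g p q" for p q using skew[of q p] by (simp add: g_def)
 moreover have "g p0 q = 0" for q
  using c skew[of p0 q0] by (simp add: g_def y z self c_def)
 moreover have "g q0 q = 0" for q
  using c by (simp add: g_def y z self c_def)
 moreover have "y \<cdot> p0 = 0" "y \<cdot> q0 = 1" "z \<cdot> p0 \<noteq> 0" "z \<cdot> q0 = 0"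
  using c skew[of p0 q0] by (simp_all add: y z self c_def)
 moreover have "y \<cdot> u = 0 \<and> z \<cdot> u = 0 \<and> (\<forall>q. g u q = 0)" if "\<forall>q. f u q = 0" for u
  using that skew[of u p0] skew[of u q0] by (simp add: g_def y z)
 moreover have "f p q = y \<cdot> p * z \<cdot> q - y \<cdot> q * z \<cdot> p + g p q" for p q by (simp add: g_def)
 ultimately show ?thesis by blast
qed

lemma linear6D: "linear6 f \<Longrightarrow> f (u + v) = f u + f v" "linear6 f \<Longrightarrow> f (c *s u) = c * f u"
 "linear6 f \<Longrightarrow> f (u - v) = f u - f v"
proof -
 assume f: "linear6 f"
 show "f (u + v) = f u + f v" "f (c *s u) = c * f u" for u v c using f by (simp_all add: linear6_def)
 then show "f (u - v) = f u - f v" using f unfolding linear6_def by (metis add_diff_cancel_right' diff_add_cancel)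
qed

lemma linear6_sum: "linear6 f \<Longrightarrow> f (\<Sum>i\<in>S. g i) = (\<Sum>i\<in>S. f (g i))"
proof -
 assume f: "linear6 f"
 have "f 0 = 0" using linear6D(2)[OF f, of 0 0] by simp
 then show ?thesis
  by (induction S rule: infinite_finite_induct) (simp_all add: linear6D[OF f])
qed

text \<open>Normal form of a trivector with a linear factor \<open>v\<close>: modulo \<open>v\<close> it is a bivector in a
 five-dimensional space, hence of rank at most four.\<close>

lemma partially_decomposable_cases:
 assumes k: "alt k" "kills v k" and v: "v \<noteq> 0"
 obtains y z where "k = T3 v y z"
 | y z y' z' where "indep [v, y, z, y', z']" "k = T3 v y z + T3 v y' z'"
proof -
 obtain u where u: "v \<cdot> u = 1" using pair_nonzero[OF v] by blast
 define f where "f = tri k u"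
 have kf: "tri k p q r = v \<cdot> p * f q r - v \<cdot> q * f p r + v \<cdot> r * f p q" for p q r
  unfolding f_def by (rule kills_expand[OF k(2) u])
 have f: "linear6 (f p)" "f q p = - f p q" "f u q = 0" for p q
  using tri_swap(2)[OF k(1), of u q p] tri_same(1)[OF k(1)] by (auto simp: f_def linear6_def)
 show thesis
 proof (cases "\<forall>p q. f p q = 0")
  case True
  then have "k = T3 v 0 0" by (intro tri_eqI) (simp add: kf T3_lin)
  then show ?thesis by (rule that(1))
 next
  case False
  then obtain p0' q0' where "f p0' q0' \<noteq> 0" by blast
  define p0 where "p0 = p0' - (v \<cdot> p0') *s u"
  define q0 where "q0 = q0' - (v \<cdot> q0') *s u"
  have fu: "f p u = 0" for p using f(2)[of p u] f(3)[of p] by simp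
  have fl: "f (p - a *s u) q = f p q" "f q (p - a *s u) = f q p" for a p q
   using f(2)[of q "p - a *s u"] f(2)[of q p] by (simp_all add: linear6D[OF f(1)] fu)
  have nz: "f p0 q0 \<noteq> 0" using \<open>f p0' q0' \<noteq> 0\<close> by (simp add: p0_def q0_def fl)
  obtain y z g where yz: "\<And>p q. f p q = y \<cdot> p * z \<cdot> q - y \<cdot> q * z \<cdot> p + g p q"
   and g: "\<And>p. linear6 (g p)" "\<And>p q. g q p = - g p q" "\<And>q. g p0 q = 0" "\<And>q. g q0 q = 0"
   and v0: "y \<cdot> p0 = 0" "y \<cdot> q0 = 1" "z \<cdot> p0 \<noteq> 0" "z \<cdot> q0 = 0"
   and u0: "y \<cdot> u = 0" "z \<cdot> u = 0" "\<And>q. g u q = 0"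
   using bilinear_skew_split[of f, OF f(1,2) nz] f(3) by blast
  show thesis
  proof (cases "\<forall>p q. g p q = 0")
   case True
   then have "k = T3 v y z" by (intro tri_eqI) (simp add: kf yz tri_T3 algebra_simps)
   then show ?thesis by (rule that(1))
  next
   case False
   then obtain p1' q1' where "g p1' q1' \<noteq> 0" by blast
   define adj where "adj = (\<lambda>p. p - (v \<cdot> p) *s u - (y \<cdot> p) *s q0 - (z \<cdot> p / z \<cdot> p0) *s p0)"
   have vp: "v \<cdot> p0 = 0" "v \<cdot> q0 = 0" by (simp_all add: p0_def q0_def u)
   have adj: "v \<cdot> adj p = 0" "y \<cdot> adj p = 0" "z \<cdot> adj p = 0" for p
    using v0 u0 vp by (simp_all add: adj_def u)
   have g0: "g p u = 0" "g p p0 = 0" "g p q0 = 0" for p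
    using g(2)[of p u] g(2)[of p p0] g(2)[of p q0] g(3,4)[of p] u0(3)[of p] by simp_all
   have gr: "g q (adj p) = g q p" for p q
    using g0 by (simp add: adj_def linear6D[OF g(1)])
   have gl: "g (adj p) q = g p q" for p q
    using gr[of q p] g(2)[of "adj p" q] g(2)[of p q] by simp
   define p1 where "p1 = adj p1'"
   define q1 where "q1 = adj q1'"
   have nz1: "g p1 q1 \<noteq> 0" using \<open>g p1' q1' \<noteq> 0\<close> by (simp add: p1_def q1_def gl gr)
   obtain y' z' h where yz': "\<And>p q. g p q = y' \<cdot> p * z' \<cdot> q - y' \<cdot> q * z' \<cdot> p + h p q"
    and h: "\<And>p. linear6 (h p)" "\<And>p q. h q p = - h p q" "\<And>q. h p1 q = 0" "\<And>q. h q1 q = 0"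
    and v1: "y' \<cdot> p1 = 0" "y' \<cdot> q1 = 1" "z' \<cdot> p1 \<noteq> 0" "z' \<cdot> q1 = 0"
    and u1: "\<And>w. (\<forall>q. g w q = 0) \<Longrightarrow> y' \<cdot> w = 0 \<and> z' \<cdot> w = 0 \<and> (\<forall>q. h w q = 0)"
    using bilinear_skew_split[of g, OF g(1,2) nz1] by blast
   note w = u1[of u] u1[of p0] u1[of q0]
   define E where "E = nth [u, q0, (1 / z \<cdot> p0) *s p0, q1, (1 / z' \<cdot> p1) *s p1]"
   have E: "dual [v, y, z, y', z'] E"
    using u0 v0 v1 vp w g(3,4) adj[of p1'] adj[of q1'] u
    by (simp add: dual_5 E_def p1_def[symmetric] q1_def[symmetric])
   then have ind: "indep [v, y, z, y', z']" by (auto simp: indep_def)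
   obtain \<theta> where \<theta>: "\<And>p. (\<forall>x\<in>set [v, y, z, y', z']. x \<cdot> p = 0) \<Longrightarrow> \<exists>\<alpha>. p = \<alpha> *s \<theta>"
    using annihilator_line[OF ind] by auto
   have hE: "h (E i) q = 0" if "i < 5" for i q
   proof -
    have hs: "h (a *s p) q = a * h p q" for a p
     using h(2)[of "a *s p" q] h(2)[of p q] by (simp add: linear6D[OF h(1)])
    have "i = 0 \<or> i = 1 \<or> i = 2 \<or> i = 3 \<or> i = 4" using that by auto
    then show ?thesis using w h(3,4) u0(3) g(3,4) by (auto simp: E_def hs)
   qed
   have hE': "h q (E i) = 0" if "i < 5" for i q using hE[OF that, of q] h(2)[of q "E i"] by simp
   have hz: "h p q = 0" for p q
   proof -
    define R where "R = (\<lambda>p. p - (\<Sum>i<5. ([v, y, z, y', z'] ! i \<cdot> p) *s E i))"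
    have "\<forall>x\<in>set [v, y, z, y', z']. x \<cdot> R p = 0" for p
     using E by (simp add: R_def dual_5 sum_less_numeral)
    then obtain \<alpha> \<beta> where ab: "R p = \<alpha> *s \<theta>" "R q = \<beta> *s \<theta>" using \<theta> by metis
    have hR: "h q' (R p') = h q' p'" for p' q'
     using hE' by (simp add: R_def linear6D[OF h(1)] linear6_sum[OF h(1)])
    have hR': "h (R p') q' = h p' q'" for p' q'
     using hR[of q' p'] h(2)[of "R p'" q'] h(2)[of p' q'] by simp
    have "h p q = h (\<alpha> *s \<theta>) (\<beta> *s \<theta>)" using hR hR' ab by metis
    also have "\<dots> = \<beta> * (\<alpha> * h \<theta> \<theta>)"
     using h(2)[of "\<alpha> *s \<theta>" \<theta>] h(2)[of \<theta> \<theta>] by (simp add: linear6D[OF h(1)])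
    also have "h \<theta> \<theta> = 0" using h(2)[of \<theta> \<theta>] by simp
    finally show ?thesis by simp
   qed
   have "k = T3 v y z + T3 v y' z'"
    by (intro tri_eqI) (simp add: kf yz yz' hz tri_T3 algebra_simps)
   then show ?thesis using ind that(2) by blast
  qed
 qed
qed

definition contracts :: "vec6 \<Rightarrow> trivec \<Rightarrow> bool" where
 "contracts \<theta> k \<longleftrightarrow> (\<forall>q r. tri k \<theta> q r = 0)"

text \<open>The five vectors span a hyperplane, so that \<open>\<theta>\<close> is determined up to a factor.\<close>

lemma contracts_rank5_iff:
 assumes "indep [v, y, z, y', z']"
 shows "contracts \<theta> (T3 v y z + T3 v y' z') \<longleftrightarrow> (\<forall>x\<in>set [v, y, z, y', z']. x \<cdot> \<theta> = 0)"
proof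
 obtain E where E: "dual [v, y, z, y', z'] E" using assms by (auto simp: indep_def)
 assume "contracts \<theta> (T3 v y z + T3 v y' z')"
 then have c: "tri (T3 v y z + T3 v y' z') \<theta> q r = 0" for q r by (simp add: contracts_def)
 show "\<forall>x\<in>set [v, y, z, y', z']. x \<cdot> \<theta> = 0"
  using c[of "E 1" "E 2"] c[of "E 0" "E 1"] c[of "E 0" "E 2"] c[of "E 0" "E 3"] c[of "E 0" "E 4"] E
  by (simp add: tri_T3 dual_5)
next
 assume "\<forall>x\<in>set [v, y, z, y', z']. x \<cdot> \<theta> = 0"
 then show "contracts \<theta> (T3 v y z + T3 v y' z')" by (simp add: contracts_def tri_T3)
qed

lemma not_indep_factor:
 assumes "\<not> indep [v, v']" "v \<noteq> 0" "v' \<noteq> 0" shows "\<exists>d. v = d *s v'"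
proof -
 obtain c :: "nat \<Rightarrow> complex" where c: "c 0 \<noteq> 0 \<or> c 1 \<noteq> 0" "c 0 *s v + c 1 *s v' = 0"
  using relation_2 assms(1) by blast
 have "c 0 \<noteq> 0" using c assms(3) by (auto simp: vec.scale_eq_0_iff)
 have "(1 / c 0) *s (c 0 *s v) = (1 / c 0) *s ((- c 1) *s v')" using c(2) by (simp add: add_eq_0_iff)
 then have "v = ((1 / c 0) * (- c 1)) *s v'" using \<open>c 0 \<noteq> 0\<close> unfolding vec.scale_scale by simp
 then show ?thesis by blast
qed

lemma factor_proportional:
 assumes k: "alt k" "\<And>a b c. k \<noteq> T3 a b c" and v: "kills v k" "kills w k" "w \<noteq> 0"
 shows "\<exists>c. v = c *s w"
proof (cases "v = 0")
 case True
 then have "v = 0 *s w" by simp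
 then show ?thesis by blast
next
 case False
 moreover have "\<not> indep [v, w]" using kills_two[OF k(1) v(1,2)] k(2) by blast
 ultimately show ?thesis using not_indep_factor v(3) by blast
qed

lemma cofactor_proportional:
 assumes k: "alt k" "\<And>a b c. k \<noteq> T3 a b c" and v: "kills v k" "v \<noteq> 0" and \<theta>: "contracts \<theta> k" "contracts \<theta>' k" "\<theta>' \<noteq> 0"
 shows "\<exists>c. \<theta> = c *s \<theta>'"
 using k(1) v
proof (cases rule: partially_decomposable_cases)
 case (1 y z)
 then show ?thesis using k(2) by blast
next
 case (2 y z y' z')
 obtain \<alpha> where \<alpha>: "\<And>p. (\<forall>x\<in>set [v, y, z, y', z']. x \<cdot> p = 0) \<Longrightarrow> \<exists>c. p = c *s \<alpha>"
  using annihilator_line[OF 2(1)] by auto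
 have "\<exists>c. \<theta> = c *s \<alpha>" "\<exists>c. \<theta>' = c *s \<alpha>"
  using \<alpha> \<theta>(1,2) contracts_rank5_iff[OF 2(1)] 2(2) by blast+
 then obtain c c' where c: "\<theta> = c *s \<alpha>" "\<theta>' = c' *s \<alpha>" by blast
 then have "c' \<noteq> 0" using \<theta>(3) by auto
 then have "\<theta> = (c / c') *s \<theta>'" using c by (simp add: vec.scale_scale)
 then show ?thesis by blast
qed

section \<open>Linear spaces of partially decomposable trivectors\<close>

definition w5 :: "vec6 \<Rightarrow> (vec6 \<Rightarrow> vec6 \<Rightarrow> vec6 \<Rightarrow> vec6 \<Rightarrow> complex) \<Rightarrow>
  vec6 \<Rightarrow> vec6 \<Rightarrow> vec6 \<Rightarrow> vec6 \<Rightarrow> vec6 \<Rightarrow> complex" where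
 "w5 x F p q r s t = x \<cdot> p * F q r s t - x \<cdot> q * F p r s t + x \<cdot> r * F p q s t
   - x \<cdot> s * F p q r t + x \<cdot> t * F p q r s"

lemma w5_swap: "w5 x (w4 y k) p q r s t = - w5 y (w4 x k) p q r s t"
 by (simp add: w5_def w4_def algebra_simps)

lemma w4_axes_zero:
 assumes "\<And>a b c d. w4 v k (axis a 1) (axis b 1) (axis c 1) (axis d 1) = w4 v' k' (axis a 1) (axis b 1) (axis c 1) (axis d 1)"
 shows "w4 v k p q r s = w4 v' k' p q r s"
proof -
 define F where "F = (\<lambda>p q r s. w4 v k p q r s - w4 v' k' p q r s)"
 have vanish: "f u = 0" if "linear6 f" "\<And>i. f (axis i 1) = 0" for f u
  using linear6_expand[OF that(1), of u] that(2) by simp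
 have l: "linear6 (\<lambda>p. F p q r s)" "linear6 (\<lambda>q. F p q r s)" "linear6 (\<lambda>r. F p q r s)" "linear6 (\<lambda>s. F p q r s)" for p q r s
  by (simp_all add: linear6_def F_def w4_def algebra_simps)
 have "F (axis a 1) (axis b 1) (axis c 1) (axis d 1) = 0" for a b c d using assms by (simp add: F_def)
 then have "F (axis a 1) (axis b 1) (axis c 1) s = 0" for a b c s by (rule vanish[OF l(4)])
 then have "F (axis a 1) (axis b 1) r s = 0" for a b r s by (rule vanish[OF l(3)])
 then have "F (axis a 1) q r s = 0" for a q r s by (rule vanish[OF l(2)])
 then have "F p q r s = 0" by (rule vanish[OF l(1)])
 then show ?thesis by (simp add: F_def)
qed

text \<open>The exterior product as a vector of coordinates, which makes limits and linear combinations available.\<close>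

definition W4 :: "vec6 \<Rightarrow> trivec \<Rightarrow> complex ^ (6 \<times> 6 \<times> 6 \<times> 6)" where
 "W4 v k = (\<chi> p. w4 v k (axis (fst p) 1) (axis (fst (snd p)) 1) (axis (fst (snd (snd p))) 1) (axis (snd (snd (snd p))) 1))"

lemma W4_eq_iff: "W4 v k = W4 v' k' \<longleftrightarrow> (\<forall>p q r s. w4 v k p q r s = w4 v' k' p q r s)"
proof
 assume eq: "W4 v k = W4 v' k'"
 have "w4 v k (axis a 1) (axis b 1) (axis c 1) (axis d 1) = w4 v' k' (axis a 1) (axis b 1) (axis c 1) (axis d 1)" for a b c d
  using arg_cong[OF eq, of "\<lambda>A. A $ (a, b, c, d)"] by (simp add: W4_def)
 then show "\<forall>p q r s. w4 v k p q r s = w4 v' k' p q r s" using w4_axes_zero by blast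
qed (simp add: W4_def)

lemma W4_lin:
 "W4 (v + v') k = W4 v k + W4 v' k" "W4 (c *s v) k = c *s W4 v k"
 "W4 v (k + k') = W4 v k + W4 v k'" "W4 v (c *s k) = c *s W4 v k"
 by (simp_all add: W4_def vec_eq_iff)

lemma W4_zero_iff: "W4 v k = 0 \<longleftrightarrow> kills v k"
proof -
 have "W4 0 k = 0" by (simp add: W4_def vec_eq_iff)
 then show ?thesis using W4_eq_iff[of v k 0 k] by (simp add: kills_def)
qed

lemma W4_0 [simp]: "W4 0 k = 0"
 by (simp add: W4_zero_iff kills_def)

lemma scaleR_eq_scale: "r *\<^sub>R (x :: complex ^ 'n) = complex_of_real r *s x"
 unfolding vec_eq_iff vector_scaleR_component vector_smult_component
 by (simp add: scaleR_conv_of_real)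

lemma linear_W4: "linear (\<lambda>v. W4 v k)"
 by (rule linearI) (simp_all add: W4_lin scaleR_eq_scale)

lemma continuous_W4: "isCont (\<lambda>v. W4 v k) v"
 using linear_W4 linear_continuous_at linear_conv_bounded_linear by blast

lemma kills_lin:
 "kills v k \<Longrightarrow> kills v' k \<Longrightarrow> kills (v + v') k" "kills v k \<Longrightarrow> kills (c *s v) k"
 "kills v k \<Longrightarrow> kills v k' \<Longrightarrow> kills v (k + k')" "kills v k \<Longrightarrow> kills v k' \<Longrightarrow> kills v (k - k')"
 "kills v k \<Longrightarrow> kills v (c *s k)" "kills v 0"
 by (simp_all add: kills_def)

lemma contracts_lin:
 "contracts \<theta> k \<Longrightarrow> contracts \<theta> k' \<Longrightarrow> contracts \<theta> (k + k')" "contracts \<theta> k \<Longrightarrow> contracts \<theta> k' \<Longrightarrow> contracts \<theta> (k - k')"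
 "contracts \<theta> k \<Longrightarrow> contracts \<theta> (c *s k)" "contracts \<theta> k \<Longrightarrow> contracts (c *s \<theta>) k"
 by (simp_all add: contracts_def)

text \<open>The configuration that no parameter count excludes: the closed relation of having a linear factor holds
 on a whole linear space without decomposable elements.\<close>

locale sigma_space =
 fixes K :: "trivec set"
 assumes subspace: "vec.subspace K" and altK: "k \<in> K \<Longrightarrow> alt k"
  and no_decomposable: "T3 x y z \<in> K \<Longrightarrow> T3 x y z = 0"
  and has_factor: "k \<in> K \<Longrightarrow> \<exists>v. v \<noteq> 0 \<and> kills v k"
begin

lemma factor_unique:
 assumes "k \<in> K" "k \<noteq> 0" "kills v k" "v \<noteq> 0" "kills v' k"
 shows "\<exists>c. v' = c *s v"
 by (rule factor_proportional[OF altK[OF assms(1)] _ assms(5,3,4)]) (use no_decomposable assms(1,2) in blast)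

text \<open>Every nearby element \<open>k + s k'\<close> of the pencil has a factor as well; letting \<open>s\<close> tend to zero
 shows that the product of the factor of \<open>k\<close> with \<open>k'\<close> lies in the image of multiplication by \<open>k\<close>.\<close>

lemma tangent_condition:
 assumes k: "k \<in> K" "k \<noteq> 0" "k' \<in> K" and v: "kills v k"
 shows "\<exists>x. W4 v k' = W4 x k"
proof -
 define s where "s = (\<lambda>n. complex_of_real (1 / real (Suc n)))"
 have s0: "s n \<noteq> 0" for n by (simp add: s_def del: of_nat_Suc)
 have "\<exists>u. norm u = 1 \<and> kills u (k + s n *s k')" for n
 proof -
  have "k + s n *s k' \<in> K" using subspace k by (simp add: vec.subspace_add vec.subspace_scale)
  then obtain u where u: "u \<noteq> 0" "kills u (k + s n *s k')" using has_factor by blast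
  have "kills (complex_of_real (1 / norm u) *s u) (k + s n *s k')" by (rule kills_lin(2)[OF u(2)])
  moreover have "norm (complex_of_real (1 / norm u) *s u) = 1"
   unfolding scaleR_eq_scale[symmetric] using u(1) by simp
  ultimately show ?thesis by blast
 qed
 then obtain u where u: "\<And>n. norm (u n) = 1" "\<And>n. kills (u n) (k + s n *s k')" by metis
 have "compact (sphere (0 :: vec6) 1)" by simp
 moreover have "\<forall>n. u n \<in> sphere 0 1" using u by simp
 ultimately obtain l \<rho> where l: "l \<in> sphere 0 1" "strict_mono \<rho>" "(u \<circ> \<rho>) \<longlonglongrightarrow> l"
  unfolding compact_def by meson
 have lim: "(\<lambda>n. W4 (u (\<rho> n)) m) \<longlonglongrightarrow> W4 l m" for m
  using isCont_tendsto_compose[OF continuous_W4 l(3)] by (simp add: o_def)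
 have rel: "W4 (u n) k' = W4 ((- 1 / s n) *s u n) k" for n
 proof -
  have "W4 (u n) k + s n *s W4 (u n) k' = 0"
   using u(2)[of n] by (simp add: W4_zero_iff[symmetric] W4_lin)
  then have e: "W4 (u n) k = - (s n *s W4 (u n) k')" by (simp add: eq_neg_iff_add_eq_0)
  show ?thesis unfolding W4_lin e using s0[of n] by (simp add: vec_eq_iff)
 qed
 have "closed (range (\<lambda>x. W4 x k))"
  by (intro closed_subspace linear_subspace_image linear_W4 subspace_UNIV)
 then have "W4 l k' \<in> range (\<lambda>x. W4 x k)"
  by (rule closed_sequentially[OF _ _ lim[of k']]) (simp only: rel, blast)
 then obtain x where x: "W4 l k' = W4 x k" by blast
 obtain B where B: "\<And>v. norm (W4 v k') \<le> B * norm v"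
   using linear_bounded[OF linear_W4, of k'] by blast
 have "(\<lambda>n. - s (\<rho> n) *s W4 (u (\<rho> n)) k') \<longlonglongrightarrow> 0"
 proof (rule tendsto_norm_zero_cancel, rule Lim_null_comparison)
  show "\<forall>\<^sub>F n in sequentially. norm (norm (- s (\<rho> n) *s W4 (u (\<rho> n)) k')) \<le> \<bar>B\<bar> * (1 / real (Suc (\<rho> n)))"
  proof (intro always_eventually allI)
   fix n
   have "norm (- s (\<rho> n) *s W4 (u (\<rho> n)) k') = (1 / real (Suc (\<rho> n))) * norm (W4 (u (\<rho> n)) k')"
    unfolding s_def of_real_minus[symmetric] scaleR_eq_scale[symmetric] by simp
   also have "\<dots> \<le> (1 / real (Suc (\<rho> n))) * \<bar>B\<bar>"
    using B[of "u (\<rho> n)"] u(1) by (intro mult_left_mono) (auto simp del: of_nat_Suc)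
   finally show "norm (norm (- s (\<rho> n) *s W4 (u (\<rho> n)) k')) \<le> \<bar>B\<bar> * (1 / real (Suc (\<rho> n)))"
    by (simp add: mult.commute)
  qed
  have "(\<lambda>n. 1 / real (Suc n)) \<longlonglongrightarrow> 0" by (rule LIMSEQ_inverse_real_of_nat[unfolded inverse_eq_divide])
  then have "(\<lambda>n. 1 / real (Suc (\<rho> n))) \<longlonglongrightarrow> 0"
   using LIMSEQ_subseq_LIMSEQ[OF _ l(2)] by (auto simp: o_def)
  from tendsto_mult_left[OF this, of "\<bar>B\<bar>"] show "(\<lambda>n. \<bar>B\<bar> * (1 / real (Suc (\<rho> n)))) \<longlonglongrightarrow> 0" by simp
 qed
 moreover have "- s n *s W4 (u n) k' = W4 (u n) k" for n
  unfolding rel W4_lin using s0[of n] by (simp add: vec_eq_iff)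
 ultimately have "W4 l k = 0" using lim[of k] LIMSEQ_unique by auto
 then have "kills l k" by (simp add: W4_zero_iff)
 moreover have "l \<noteq> 0" using l(1) by auto
 ultimately obtain c where "v = c *s l" using factor_unique[OF k(1,2) _ _ v] by blast
 then have "W4 v k' = W4 (c *s x) k" by (simp add: W4_lin x)
 then show ?thesis by blast
qed

text \<open>The configuration of two elements with independent factors that tangency alone would allow, ruled out because
 their sum has no linear factor.\<close>

lemma rank_drop_impossible:
 assumes "dual [v, v', x, b, c, c'] E"
  "T3 v v' b + T3 v x c + (T3 v' x b + T3 v v' c') \<in> K" (is "?k \<in> K")
 shows False
proof -
 obtain u where u: "u \<noteq> 0" "kills u ?k" using has_factor[OF assms(2)] by blast
 note E = assms(1)[unfolded dual_6]
 have w: "w4 u ?k p q r s = 0" for p q r s using u(2) by (simp add: kills_def)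
 \<comment> \<open>The coordinates of a factor \<open>u\<close> vanish one after the other: each evaluation of \<open>u \<and> k\<close> on dual
  vectors contains one coordinate besides those already known to be zero.\<close>
 have 2: "u \<cdot> E 2 = 0" using w[of "E 0" "E 1" "E 2" "E 5"] E by (simp add: w4_def tri_T3)
 have 4: "u \<cdot> E 4 = 0" using w[of "E 0" "E 1" "E 4" "E 5"] E by (simp add: w4_def tri_T3)
 have 3: "u \<cdot> E 3 = 0" using w[of "E 0" "E 2" "E 3" "E 4"] E by (simp add: w4_def tri_T3)
 have 5: "u \<cdot> E 5 = 0" using w[of "E 0" "E 1" "E 3" "E 5"] E 3 by (simp add: w4_def tri_T3)
 have 1: "u \<cdot> E 1 = 0" using w[of "E 0" "E 1" "E 2" "E 4"] E 2 4 by (simp add: w4_def tri_T3)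
 have 0: "u \<cdot> E 0 = 0" using w[of "E 0" "E 1" "E 2" "E 3"] E 1 2 3 by (simp add: w4_def tri_T3)
 have "u = 0"
  using dual_expansion(1)[OF assms(1), of u] 0 1 2 3 4 5 by (simp add: sum_less_numeral)
 then show False using u(1) by simp
qed

text \<open>Two elements with independent factors either have a common bivector cofactor modulo the other
 factor, or are contracted to zero by a common covector.\<close>

lemma pair_dichotomy:
 assumes k: "k \<in> K" "k \<noteq> 0" "kills v k" and k': "k' \<in> K" "k' \<noteq> 0" "kills v' k'" and ind: "indep [v, v']"
 shows "(\<exists>\<beta>. \<beta> \<noteq> 0 \<and> W4 v k' = W4 (\<beta> *s v') k) \<or> (\<exists>\<theta>. \<theta> \<noteq> 0 \<and> contracts \<theta> k \<and> contracts \<theta> k')"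
proof -
 obtain x where x: "W4 v k' = W4 x k" using tangent_condition[OF k(1,2) k'(1) k(3)] by blast
 obtain E0 where E0: "dual [v, v'] E0" using ind by (auto simp: indep_def)
 then have nz: "v \<noteq> 0" "v' \<noteq> 0" by (auto simp: dual_2)
 show ?thesis
 proof (cases "indep [v, v', x]")
  case False
  then obtain c :: "nat \<Rightarrow> complex" where c: "c 0 \<noteq> 0 \<or> c 1 \<noteq> 0 \<or> c 2 \<noteq> 0" "c 0 *s v + c 1 *s v' + c 2 *s x = 0"
   using relation_3 by blast
  have "c 2 \<noteq> 0"
  proof
   assume "c 2 = 0"
   then have "c 0 *s v + c 1 *s v' = 0" using c(2) by simp
   then have "(c 0 *s v + c 1 *s v') \<cdot> E0 0 = 0" "(c 0 *s v + c 1 *s v') \<cdot> E0 1 = 0" by simp_all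
   then show False using E0 c(1) \<open>c 2 = 0\<close> by (simp add: dual_2)
  qed
  define \<beta> where "\<beta> = - c 1 / c 2"
  have xe: "x = (- c 0 / c 2) *s v + \<beta> *s v'"
  proof -
   have "c 2 *s x = (- c 0) *s v + (- c 1) *s v'" using c(2) by (simp add: add_eq_0_iff algebra_simps)
   then have "(1 / c 2) *s (c 2 *s x) = (1 / c 2) *s ((- c 0) *s v + (- c 1) *s v')" by (rule arg_cong)
   then show ?thesis using \<open>c 2 \<noteq> 0\<close> by (simp add: \<beta>_def vec.scale_scale vec.scale_right_distrib)
  qed
  have "W4 v k = 0" using k(3) by (simp add: W4_zero_iff)
  then have G: "W4 v k' = W4 (\<beta> *s v') k" unfolding x xe W4_lin by simp
  have "\<beta> \<noteq> 0"
  proof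
   assume "\<beta> = 0"
   then have "kills v k'" using G by (simp add: W4_lin W4_zero_iff[symmetric])
   then obtain d where "v = d *s v'" using factor_unique[OF k'(1,2,3) nz(2)] by blast
   then show False using E0 by (auto simp: dual_2)
  qed
  then show ?thesis using G by blast
 next
  case True
  then obtain E where E: "dual [v, v', x] E" by (auto simp: indep_def)
  note E = E[unfolded dual_3]
  note ak = altK[OF k(1)]
  define f where "f = tri k (E 0)"
  have kf: "tri k p q r = v \<cdot> p * f q r - v \<cdot> q * f p r + v \<cdot> r * f p q" for p q r
   unfolding f_def using kills_expand[OF k(3)] E by blast
  have flin: "linear6 (f p)" for p by (simp add: linear6_def f_def)
  define e where "e = f (E 1) (E 2)"
  define b where "b = vec_of (f (E 1))"
  define c where "c = vec_of (f (E 2)) + e *s v'"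
  have b: "b \<cdot> q = f (E 1) q" for q unfolding b_def by (rule pair_vec_of[OF flin])
  have c: "c \<cdot> q = f (E 2) q + e * v' \<cdot> q" for q unfolding c_def by (simp add: pair_vec_of[OF flin])
  have x': "w4 v k' p q r s = w4 x k p q r s" for p q r s using x by (simp add: W4_eq_iff)
  have w40: "w4 v' k' = (\<lambda>p q r s. 0)" using k'(3) by (simp add: kills_def fun_eq_iff)
  have "w5 v' (w4 x k) p q r s t = 0" for p q r s t
  proof -
   have "w5 v' (w4 x k) p q r s t = w5 v' (w4 v k') p q r s t" by (simp add: w5_def x')
   also have "\<dots> = - w5 v (w4 v' k') p q r s t" by (rule w5_swap)
   also have "\<dots> = 0" by (simp add: w5_def w40)
   finally show ?thesis .
  qed
  from this[of "E 1" "E 2" "E 0"]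
  have f: "f q r = v' \<cdot> q * b \<cdot> r - v' \<cdot> r * b \<cdot> q + (x \<cdot> q * c \<cdot> r - x \<cdot> r * c \<cdot> q)" for q r
  proof -
   have sw: "tri k (E 2) (E 0) p = - f (E 2) p" "tri k (E 1) (E 0) p = - f (E 1) p" for p
    unfolding f_def by (rule tri_swap(1)[OF ak])+
   have rot: "tri k (E 1) (E 2) (E 0) = e" unfolding e_def f_def by (rule tri_rotate[OF ak])
   have "w5 v' (w4 x k) (E 1) (E 2) (E 0) q r = 0" by fact
   then have "f q r - x \<cdot> q * f (E 2) r + x \<cdot> r * f (E 2) q - v' \<cdot> q * f (E 1) r + v' \<cdot> r * f (E 1) q
     + e * (v' \<cdot> q * x \<cdot> r - v' \<cdot> r * x \<cdot> q) = 0"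
    using E by (simp add: w5_def w4_def sw rot f_def[symmetric] algebra_simps)
   then show ?thesis unfolding b c by (subst eq_iff_diff_eq_0) (simp add: algebra_simps)
  qed
  have kbc: "k = T3 v v' b + T3 v x c"
   by (rule tri_eqI) (simp add: kf f tri_T3 algebra_simps)
  define k2 where "k2 = k' - T3 v' x b"
  have "w4 v k2 p q r s = 0" for p q r s
   unfolding k2_def w4_lin x' kbc by (simp add: w4_def tri_T3 algebra_simps)
  then have "kills v k2" by (simp add: kills_def)
  moreover have "kills v' k2" unfolding k2_def by (rule kills_lin(4)[OF k'(3) kills_T3(1)])
  moreover have "alt k2" using altK[OF k'(1)] by (simp add: k2_def)
  ultimately obtain c' where "k2 = T3 v v' c'" using kills_two ind by blast
  then have k'c: "k' = T3 v' x b + T3 v v' c'" by (simp add: k2_def algebra_simps)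
  have sum: "T3 v v' b + T3 v x c + (T3 v' x b + T3 v v' c') \<in> K"
   using vec.subspace_add[OF subspace k(1) k'(1)] kbc k'c by metis
  have "\<not> indep [v, v', x, b, c, c']" using rank_drop_impossible[OF _ sum] by (auto simp: indep_def)
  then obtain \<theta> where \<theta>: "\<theta> \<noteq> 0" "\<And>y. y \<in> set [v, v', x, b, c, c'] \<Longrightarrow> y \<cdot> \<theta> = 0"
   using six_vectors[of "[v, v', x, b, c, c']"] by auto
  have "contracts \<theta> k" "contracts \<theta> k'" unfolding kbc k'c using \<theta>(2) by (simp_all add: contracts_def tri_T3)
  then show ?thesis using \<theta>(1) by blast
 qed
qed

end

lemma W4_sum: "W4 (\<Sum>i\<in>S. f i) k = (\<Sum>i\<in>S. W4 (f i) k)" "W4 v (\<Sum>i\<in>S. g i) = (\<Sum>i\<in>S. W4 v (g i))"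
 by (induction S rule: infinite_finite_induct)
  (simp_all add: W4_lin, simp_all add: W4_zero_iff kills_def)

lemma W4_diff: "W4 (v - v') k = W4 v k - W4 v' k" "W4 v (k - k') = W4 v k - W4 v k'" "W4 v (- k) = - W4 v k"
 "W4 (- v) k = - W4 v k"
 by (simp_all add: W4_def vec_eq_iff w4_def ring_distribs)

lemma W4_right_0 [simp]: "W4 v 0 = 0"
 by (simp add: W4_zero_iff kills_def)

lemma W4_eqD: "W4 v k = W4 v' k' \<Longrightarrow> w4 v k p q r s = w4 v' k' p q r s"
 by (simp add: W4_eq_iff)

text \<open>A linear family of trivectors with \<open>p \<and> \<kappa> p = 0\<close> is multiplication by a fixed bivector \<open>\<omega>\<close>: polarise and
 contract with a basis. Contracting \<open>p \<and> \<omega>\<close> in this way gives \<open>(6 - 2) \<omega>\<close>, whence the \<open>4\<close>.\<close>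

lemma koszul_bivector:
 fixes \<kappa> :: "vec6 \<Rightarrow> trivec"
 assumes lin: "\<And>p q. \<kappa> (p + q) = \<kappa> p + \<kappa> q" "\<And>c p. \<kappa> (c *s p) = c *s \<kappa> p"
  and altk: "\<And>p. alt (\<kappa> p)" and skew: "\<And>p q. W4 p (\<kappa> q) + W4 q (\<kappa> p) = 0"
 defines "\<omega> \<equiv> \<lambda>q r. (\<Sum>i\<in>UNIV. tri (\<kappa> (axis i 1)) (axis i 1) q r) / 4"
 shows "tri (\<kappa> p) q r s = p \<cdot> q * \<omega> r s - p \<cdot> r * \<omega> q s + p \<cdot> s * \<omega> q r"
proof -
 define e :: "6 \<Rightarrow> vec6" where "e = (\<lambda>i. axis i 1)"
 have k0: "\<kappa> 0 = 0" using lin(2)[of 0 0] by simp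
 have ksum: "(\<Sum>i\<in>UNIV. u $ i * tri (\<kappa> (e i)) q r s) = tri (\<kappa> u) q r s" for u q r s
 proof -
  have "\<kappa> (\<Sum>i\<in>S. u $ i *s e i) = (\<Sum>i\<in>S. u $ i *s \<kappa> (e i))" for S
   by (induction S rule: infinite_finite_induct) (simp_all add: lin k0)
  from this[of UNIV] have "\<kappa> u = (\<Sum>i\<in>UNIV. u $ i *s \<kappa> (e i))"
   unfolding e_def basis_expansion .
  then show ?thesis by (simp add: tri_sum)
 qed
 have tsum: "(\<Sum>i\<in>UNIV. u $ i * tri k (e i) q r) = tri k u q r" for u k q r
 proof -
  have "tri k (\<Sum>i\<in>UNIV. u $ i *s e i) q r = (\<Sum>i\<in>UNIV. u $ i * tri k (e i) q r)"
   unfolding tri_sum by simp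
  then show ?thesis unfolding e_def basis_expansion by simp
 qed
 have *: "p $ i * tri (\<kappa> (e i)) q r s - p \<cdot> q * tri (\<kappa> (e i)) (e i) r s + p \<cdot> r * tri (\<kappa> (e i)) (e i) q s
   - p \<cdot> s * tri (\<kappa> (e i)) (e i) q r + (tri (\<kappa> p) q r s - q $ i * tri (\<kappa> p) (e i) r s
   + r $ i * tri (\<kappa> p) (e i) q s - s $ i * tri (\<kappa> p) (e i) q r) = 0" for i
 proof -
  have "W4 p (\<kappa> (e i)) = W4 (- 1 *s e i) (\<kappa> p)"
   using skew[of p "e i"] unfolding W4_lin by (simp add: eq_neg_iff_add_eq_0)
  from W4_eqD[OF this, of "e i" q r s] show ?thesis
   unfolding w4_lin by (simp add: w4_def e_def)
 qed
 have "(\<Sum>i\<in>UNIV. p $ i * tri (\<kappa> (e i)) q r s - p \<cdot> q * tri (\<kappa> (e i)) (e i) r s + p \<cdot> r * tri (\<kappa> (e i)) (e i) q s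
   - p \<cdot> s * tri (\<kappa> (e i)) (e i) q r + (tri (\<kappa> p) q r s - q $ i * tri (\<kappa> p) (e i) r s
   + r $ i * tri (\<kappa> p) (e i) q s - s $ i * tri (\<kappa> p) (e i) q r)) = 0"
  unfolding * by simp
 then have "tri (\<kappa> p) q r s - p \<cdot> q * (4 * \<omega> r s) + p \<cdot> r * (4 * \<omega> q s) - p \<cdot> s * (4 * \<omega> q r)
   + (6 * tri (\<kappa> p) q r s - tri (\<kappa> p) q r s + tri (\<kappa> p) r q s - tri (\<kappa> p) s q r) = 0"
  by (simp only: sum.distrib sum_subtractf sum_distrib_left[symmetric] ksum tsum)
   (simp add: \<omega>_def e_def)
 moreover have "tri (\<kappa> p) r q s = - tri (\<kappa> p) q r s" "tri (\<kappa> p) s q r = tri (\<kappa> p) q r s"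
  using tri_swap(1)[OF altk, of p r q s] tri_rotate[OF altk, of p q r s] by simp_all
 ultimately have "4 * tri (\<kappa> p) q r s = 4 * (p \<cdot> q * \<omega> r s - p \<cdot> r * \<omega> q s + p \<cdot> s * \<omega> q r)"
  by (simp add: algebra_simps)
 then show ?thesis unfolding mult_cancel_left by simp
qed

text \<open>Six independent elements, with no factor and no annihilating covector common to all of them.\<close>

locale sigma_space6 = sigma_space +
 fixes b :: "nat \<Rightarrow> trivec"
 assumes span_b: "K = range (\<lambda>z. \<Sum>i<6. z i *s b i)"
  and indep_b: "(\<Sum>i<6. z i *s b i) = 0 \<Longrightarrow> i < 6 \<Longrightarrow> z i = 0"
  and no_common_vector: "v \<noteq> 0 \<Longrightarrow> \<exists>k\<in>K. \<not> kills v k"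
  and no_common_covector: "\<theta> \<noteq> 0 \<Longrightarrow> \<exists>k\<in>K. \<not> contracts \<theta> k"
begin

lemma covector_unique:
 assumes k: "k \<in> K" "k \<noteq> 0" and "contracts \<theta> k" "\<theta> \<noteq> 0" "contracts \<theta>' k"
 shows "\<exists>c. \<theta>' = c *s \<theta>"
proof -
 obtain v where v: "v \<noteq> 0" "kills v k" using has_factor k(1) by blast
 show ?thesis
  by (rule cofactor_proportional[OF altK[OF k(1)] _ v(2,1) assms(5,3,4)]) (use no_decomposable k in blast)
qed

lemma subspace_K [intro]: "k \<in> K \<Longrightarrow> k' \<in> K \<Longrightarrow> k + k' \<in> K" "k \<in> K \<Longrightarrow> c *s k \<in> K" "k \<in> K \<Longrightarrow> k' \<in> K \<Longrightarrow> k - k' \<in> K"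
 using subspace by (auto simp: vec.subspace_add vec.subspace_scale vec.subspace_diff)

text \<open>At most one member of the pencil \<open>k + s k1\<close> is in the first alternative of \<open>pair_dichotomy\<close> with \<open>k'\<close>. Hence
 two members share a covector with \<open>k'\<close>, the same one since \<open>k'\<close> determines it, and it then serves the whole
 pencil.\<close>

lemma third_element:
 assumes k: "k \<in> K" "k1 \<in> K" and ni: "\<And>a b. a *s k + b *s k1 = 0 \<Longrightarrow> a = 0 \<and> b = 0"
  and v: "v \<noteq> 0" "kills v k" "kills v k1" and k': "k' \<in> K" "\<not> kills v k'"
 shows "\<exists>\<theta>. \<theta> \<noteq> 0 \<and> contracts \<theta> k \<and> contracts \<theta> k1 \<and> contracts \<theta> k'"
proof -
 have k'0: "k' \<noteq> 0" using k'(2) kills_lin(6) by blast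
 obtain v' where v': "v' \<noteq> 0" "kills v' k'" using has_factor k'(1) by blast
 have ind: "indep [v, v']"
 proof (rule ccontr)
  assume "\<not> indep [v, v']"
  then obtain d where "v = d *s v'" using not_indep_factor v(1) v'(1) by blast
  then show False using kills_lin(2)[OF v'(2)] k'(2) by blast
 qed
 define l where "l = (\<lambda>s. k + s *s k1)"
 have l: "l s \<in> K" "kills v (l s)" "l s \<noteq> 0" for s
  using k v kills_lin(3)[OF v(2) kills_lin(5)[OF v(3)]] ni[of 1 s] by (auto simp: l_def)
 define G where "G = (\<lambda>s. \<exists>\<beta>. \<beta> \<noteq> 0 \<and> W4 v k' = W4 (\<beta> *s v') (l s))"
 define Q where "Q = (\<lambda>s. \<exists>\<theta>. \<theta> \<noteq> 0 \<and> contracts \<theta> (l s) \<and> contracts \<theta> k')"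
 have GQ: "G s \<or> Q s" for s
  unfolding G_def Q_def using pair_dichotomy[OF l(1,3,2) k'(1) k'0 v'(2) ind] .
 have GG: "\<not> (G s \<and> G s')" if "s \<noteq> s'" for s s'
 proof
  assume "G s \<and> G s'"
  then obtain \<beta> \<beta>' where b: "\<beta> \<noteq> 0" "\<beta>' \<noteq> 0" "W4 v k' = W4 (\<beta> *s v') (l s)" "W4 v k' = W4 (\<beta>' *s v') (l s')"
   unfolding G_def by blast
  define m where "m = \<beta> *s l s - \<beta>' *s l s'"
  have "m \<in> K" unfolding m_def using l by blast
  moreover have "W4 v' m = 0" unfolding m_def W4_diff W4_lin using b(3,4) by (simp add: W4_lin)
  moreover have "kills v m" unfolding m_def using l by (intro kills_lin(4) kills_lin(5))
  ultimately have "m = 0" using kills_two[OF altK _ _ ind] no_decomposable W4_zero_iff by metis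
  moreover have "m = (\<beta> - \<beta>') *s k + (\<beta> * s - \<beta>' * s') *s k1"
   by (simp add: m_def l_def vec_eq_iff algebra_simps)
  ultimately have "(\<beta> - \<beta>') *s k + (\<beta> * s - \<beta>' * s') *s k1 = 0" by metis
  from ni[OF this] show False using b(1) that by auto
 qed
 \<comment> \<open>Three members of the pencil suffice to find two in the second alternative.\<close>
 have "Q 0 \<or> Q 1" "Q 0 \<or> Q 2" "Q 1 \<or> Q 2"
  using GQ[of 0] GQ[of 1] GQ[of 2] GG[of 0 1] GG[of 0 2] GG[of 1 2] by auto
 moreover have "(0::complex) \<noteq> 1" "(0::complex) \<noteq> 2" "(1::complex) \<noteq> 2" by simp_all
 ultimately have "\<exists>s s'. s \<noteq> s' \<and> Q s \<and> Q s'" by metis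
 then obtain s s' where s: "s \<noteq> s'" "Q s" "Q s'" by blast
 obtain \<theta> \<theta>' where \<theta>: "\<theta> \<noteq> 0" "contracts \<theta> (l s)" "contracts \<theta> k'" "\<theta>' \<noteq> 0" "contracts \<theta>' (l s')" "contracts \<theta>' k'"
  using s(2,3) unfolding Q_def by blast
 obtain c where "\<theta> = c *s \<theta>'" using covector_unique[OF k'(1) k'0 \<theta>(6,4,3)] by blast
 then have c2: "contracts \<theta> (l s')" using contracts_lin(4)[OF \<theta>(5)] by simp
 have "l s - l s' = (s - s') *s k1" by (simp add: l_def vec.scale_left_diff_distrib)
 then have "k1 = (1 / (s - s')) *s (l s - l s')" using s(1) by (simp only: vec.scale_scale) simp
 then have k1: "contracts \<theta> k1" using contracts_lin(3)[OF contracts_lin(2)[OF \<theta>(2) c2]] by metis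
 have "k = l s - s *s k1" by (simp add: l_def)
 then have "contracts \<theta> k" using contracts_lin(2)[OF \<theta>(2) contracts_lin(3)[OF k1]] by metis
 then show ?thesis using k1 \<theta>(1,3) by blast
qed

text \<open>If two independent elements shared a factor \<open>v\<close>, every element not divisible by \<open>v\<close>, and hence
 every element, would be contracted to zero by the covector of the first one.\<close>

lemma factor_determines_line:
 assumes k: "k \<in> K" "k \<noteq> 0" "k1 \<in> K" and v: "v \<noteq> 0" "kills v k" "kills v k1"
 shows "\<exists>c. k1 = c *s k"
proof (rule ccontr)
 assume no: "\<nexists>c. k1 = c *s k"
 have ni: "a = 0 \<and> b = 0" if "a *s k + b *s k1 = 0" for a b
 proof -
  have "b = 0"
  proof (rule ccontr)
   assume "b \<noteq> 0"
   have "(1 / b) *s (b *s k1) = (1 / b) *s ((- a) *s k)" using that by (simp add: add_eq_0_iff)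
   then have "k1 = ((1 / b) * (- a)) *s k" using \<open>b \<noteq> 0\<close> unfolding vec.scale_scale by simp
   then show False using no by blast
  qed
  then show ?thesis using that k(2) by (simp add: vec.scale_eq_0_iff)
 qed
 obtain k0 where k0: "k0 \<in> K" "\<not> kills v k0" using no_common_vector v(1) by blast
 obtain \<theta> where \<theta>: "\<theta> \<noteq> 0" "contracts \<theta> k" "contracts \<theta> k0"
  using third_element[OF k(1,3) ni v k0] by blast
 have off: "contracts \<theta> k'" if k': "k' \<in> K" "\<not> kills v k'" for k'
 proof -
  obtain \<theta>' where \<theta>': "\<theta>' \<noteq> 0" "contracts \<theta>' k" "contracts \<theta>' k'"
   using third_element[OF k(1,3) ni v k'] by blast
  obtain c where "\<theta> = c *s \<theta>'" using covector_unique[OF k(1,2) \<theta>'(2,1) \<theta>(2)] by blast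
  then show ?thesis using contracts_lin(4)[OF \<theta>'(3)] by simp
 qed
 have "contracts \<theta> k'" if k': "k' \<in> K" for k'
 proof (cases "kills v k'")
  case True
  have "\<not> kills v (k0 + k')"
   using kills_lin(4)[of v "k0 + k'" k'] True k0(2) by auto
  then have "contracts \<theta> (k0 + k')" using off k0(1) k' by blast
  then show ?thesis using contracts_lin(2)[OF _ \<theta>(3), of "k0 + k'"] by simp
 qed (use off k' in blast)
 then show False using no_common_covector[OF \<theta>(1)] by blast
qed

end

context sigma_space6
begin

lemma b_in_K: "i < 6 \<Longrightarrow> b i \<in> K"
proof -
 assume i: "i < 6"
 have "(\<Sum>j<6. (if j = i then 1 else 0) *s b j) = (\<Sum>j<6. if j = i then b i else 0)"
  by (rule sum.cong) auto
 also have "\<dots> = b i" using i by simp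
 finally show ?thesis
  unfolding span_b by (intro range_eqI[where x = "\<lambda>j. if j = i then 1 else 0"]) simp
qed

lemma b_nonzero: "i < 6 \<Longrightarrow> b i \<noteq> 0"
proof
 assume i: "i < 6" and "b i = 0"
 then have "(\<Sum>j<6. (if j = i then 1 else 0) *s b j) = 0"
  by (intro sum.neutral) auto
 from indep_b[OF this i] show False by simp
qed

lemma sum_in_K: "(\<And>i. i \<in> S \<Longrightarrow> f i \<in> K) \<Longrightarrow> (\<Sum>i\<in>S. f i) \<in> K"
 using subspace by (rule vec.subspace_sum)

text \<open>Multiplication by the factor \<open>v0\<close> and multiplication by \<open>k0\<close> have the same image: the
 tangent condition gives one inclusion, and both images are five-dimensional.\<close>

lemma factor_image_onto:
 assumes v0: "v0 \<noteq> 0" "kills v0 (b 0)"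
 shows "\<exists>k\<in>K. W4 v0 k = W4 w (b 0)"
proof -
 have "\<exists>x. W4 v0 (b i) = W4 x (b 0)" if "i < 6" for i
  using tangent_condition[OF b_in_K b_nonzero b_in_K[OF that] v0(2)] by simp
 then obtain x where x: "\<And>i. i < 6 \<Longrightarrow> W4 v0 (b i) = W4 (x i) (b 0)" by metis
 define X where "X = (\<lambda>i::nat. if i = 0 then v0 else x i)"
 define b' where "b' = (\<lambda>i::nat. if i = 0 then 0 else b i)"
 have X: "W4 (X i) (b 0) = W4 v0 (b' i)" if "i < 6" for i
  using x[OF that] v0(2) by (simp add: X_def b'_def W4_zero_iff)
 let ?xs = "map X [0..<6]"
 have nth: "?xs ! i = X i" if "i < 6" for i using that by simp
 have "indep ?xs"
 proof (rule ccontr)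
  assume "\<not> indep ?xs"
  then obtain c :: "nat \<Rightarrow> complex" where c: "\<exists>i<6. c i \<noteq> 0" "(\<Sum>i<6. c i *s X i) = 0"
   using indep_or_relation[of ?xs] by auto
  have "0 = W4 (\<Sum>i<6. c i *s X i) (b 0)" using c(2) by simp
  also have "\<dots> = W4 v0 (\<Sum>i<6. c i *s b' i)"
   unfolding W4_sum W4_lin by (intro sum.cong refl) (simp add: X)
  finally have "kills v0 (\<Sum>i<6. c i *s b' i)" by (simp add: W4_zero_iff)
  moreover have "(\<Sum>i<6. c i *s b' i) \<in> K"
   using b_in_K subspace by (intro sum_in_K) (auto simp: b'_def vec.subspace_0)
  ultimately obtain d where d: "(\<Sum>i<6. c i *s b' i) = d *s b 0"
   using factor_determines_line[OF b_in_K b_nonzero _ v0] by auto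
  define c' where "c' = (\<lambda>i::nat. if i = 0 then - d else c i)"
  have "(\<Sum>i<6. c' i *s b i) = (\<Sum>i<6. c i *s b' i) - d *s b 0"
   by (simp add: sum_less_numeral c'_def b'_def)
  then have c': "c' i = 0" if "i < 6" for i using indep_b[OF _ that] d by simp
  have ci: "c i = 0" if "i < 6" "i \<noteq> 0" for i using c'[OF that(1)] that(2) by (simp add: c'_def)
  have "(\<Sum>i<6. c i *s X i) = c 0 *s v0" using ci by (simp add: sum_less_numeral X_def)
  then have "c 0 = 0" using c(2) v0(1) by (simp add: vec.scale_eq_0_iff)
  then show False using c(1) ci by metis
 qed
 then obtain E where E: "dual ?xs E" by (auto simp: indep_def)
 have "w = (\<Sum>i<6. (w \<cdot> E i) *s X i)" using dual_expansion(1)[OF E, of w] by simp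
 then have "W4 w (b 0) = W4 (\<Sum>i<6. (w \<cdot> E i) *s X i) (b 0)" by (rule arg_cong)
 also have "\<dots> = (\<Sum>i<6. (w \<cdot> E i) *s W4 (X i) (b 0))" unfolding W4_sum W4_lin ..
 also have "\<dots> = W4 v0 (\<Sum>i<6. (w \<cdot> E i) *s b' i)"
  unfolding W4_sum W4_lin by (intro sum.cong refl) (simp add: X)
 finally have "W4 v0 (\<Sum>i<6. (w \<cdot> E i) *s b' i) = W4 w (b 0)" by simp
 moreover have "(\<Sum>i<6. (w \<cdot> E i) *s b' i) \<in> K"
  using b_in_K subspace by (intro sum_in_K) (auto simp: b'_def vec.subspace_0)
 ultimately show ?thesis by blast
qed

text \<open>Multiplication by \<open>v0\<close> takes a suitable \<open>k\<close> to \<open>X \<and> b 0\<close>. The dichotomy for \<open>b 0\<close> and \<open>k\<close> shows that \<open>X\<close> is then a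
 factor of \<open>k\<close> after correction by a multiple of \<open>v0\<close>.\<close>

lemma matched_element:
 assumes v0: "v0 \<noteq> 0" "kills v0 (b 0)" and \<theta>0: "\<theta>0 \<noteq> 0" "contracts \<theta>0 (b 0)" "v0 \<cdot> \<theta>0 = 0"
  and X: "X \<cdot> \<theta>0 = 1"
 shows "\<exists>k v \<alpha>. k \<in> K \<and> k \<noteq> 0 \<and> kills v k \<and> W4 v0 k = W4 v (b 0) \<and> v = X + \<alpha> *s v0"
proof -
 note b0 = b_in_K[of 0, simplified] b_nonzero[of 0, simplified]
 obtain k where k: "k \<in> K" "W4 v0 k = W4 X (b 0)" using factor_image_onto[OF v0] by blast
 have WX: "\<not> kills X (b 0)"
 proof
  assume "kills X (b 0)"
  then obtain c where "X = c *s v0" using factor_unique[OF b0 v0(2,1)] by blast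
  then show False using X \<theta>0(3) by simp
 qed
 have nk: "\<not> kills v0 k" using WX k(2) by (simp add: W4_zero_iff[symmetric])
 then have k0: "k \<noteq> 0" using kills_lin(6) by blast
 obtain v' where v': "v' \<noteq> 0" "kills v' k" using has_factor k(1) by blast
 have ind: "indep [v0, v']"
 proof (rule ccontr)
  assume "\<not> indep [v0, v']"
  then obtain d where "v0 = d *s v'" using not_indep_factor v0(1) v'(1) by blast
  then show False using kills_lin(2)[OF v'(2)] nk by blast
 qed
 from pair_dichotomy[OF b0 v0(2) k(1) k0 v'(2) ind] show ?thesis
 proof
  assume "\<exists>\<beta>. \<beta> \<noteq> 0 \<and> W4 v0 k = W4 (\<beta> *s v') (b 0)"
  then obtain \<beta> where \<beta>: "W4 v0 k = W4 (\<beta> *s v') (b 0)" by blast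
  then have "W4 (\<beta> *s v' - X) (b 0) = 0" using k(2) by (simp add: W4_diff)
  then have "kills (\<beta> *s v' - X) (b 0)" by (simp add: W4_zero_iff)
  then obtain \<alpha> where "\<beta> *s v' - X = \<alpha> *s v0" using factor_unique[OF b0 v0(2,1)] by blast
  then have "\<beta> *s v' = X + \<alpha> *s v0" by (simp add: algebra_simps)
  then show ?thesis using k(1) k0 \<beta> kills_lin(2)[OF v'(2), of \<beta>] by blast
 next
  assume "\<exists>\<theta>. \<theta> \<noteq> 0 \<and> contracts \<theta> (b 0) \<and> contracts \<theta> k"
  then obtain \<theta> where \<theta>: "\<theta> \<noteq> 0" "contracts \<theta> (b 0)" "contracts \<theta> k" by blast
  then obtain c where c: "\<theta> = c *s \<theta>0" using covector_unique[OF b0 \<theta>0(2,1)] by blast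
  then have "c \<noteq> 0" using \<theta>(1) by auto
  have "tri (b 0) q r s = 0" for q r s
   using W4_eqD[OF k(2), of \<theta> q r s] \<theta>(2,3) c X \<theta>0(3) \<open>c \<noteq> 0\<close> by (simp add: w4_def contracts_def)
  then have "b 0 = 0" by (intro tri_eqI) simp
  then show ?thesis using b0 by simp
 qed
qed

text \<open>The relations of two elements with \<open>b 0\<close> fix the scalar in the relation between them. This is what
 turns a collection of elements and factors into a linear family.\<close>

lemma matched_pair:
 assumes v0: "v0 \<noteq> 0" "kills v0 (b 0)" and \<theta>0: "\<theta>0 \<noteq> 0" "contracts \<theta>0 (b 0)"
  and k: "k \<in> K" "k \<noteq> 0" "kills v k" "W4 v0 k = W4 v (b 0)" "v \<cdot> \<theta>0 = 1"
  and k': "k' \<in> K" "k' \<noteq> 0" "kills v' k'" "W4 v0 k' = W4 v' (b 0)" "v' \<cdot> \<theta>0 = 1"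
  and ind: "indep [v0, v, v']"
 shows "W4 v k' + W4 v' k = 0"
proof -
 note b0 = b_in_K[of 0, simplified] b_nonzero[of 0, simplified]
 obtain E where E: "dual [v0, v, v'] E" using ind by (auto simp: indep_def)
 have "dual [v, v'] (\<lambda>i. E (Suc i))" using E by (simp add: dual_2 dual_3 numeral_2_eq_2 One_nat_def)
 then have ind2: "indep [v, v']" by (auto simp: indep_def)
 note e = W4_eqD[OF k(4)] W4_eqD[OF k'(4)]
 from pair_dichotomy[OF k(1,2,3) k'(1,2,3) ind2] show ?thesis
 proof
  assume "\<exists>\<beta>. \<beta> \<noteq> 0 \<and> W4 v k' = W4 (\<beta> *s v') k"
  then obtain d where d: "W4 v k' = W4 (d *s v') k" by blast
  \<comment> \<open>If \<open>v \<and> k' = d v' \<and> k\<close>, multiplication by \<open>v0\<close> gives \<open>- T = d T\<close> for \<open>T = v \<and> v' \<and> b 0\<close>. So \<open>d = - 1\<close>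
   unless \<open>T = 0\<close>, and then contraction with \<open>\<theta>0\<close> makes \<open>v' - v\<close> a multiple of \<open>v0\<close>.\<close>
  define T where "T = w5 v (w4 v' (b 0))"
  have T1: "w5 v0 (w4 v k') p q r s t = - T p q r s t" for p q r s t
   unfolding T_def w5_swap[of v0 v] by (simp add: w5_def e)
  have "w5 v0 (w4 v' k) p q r s t = - w5 v' (w4 v (b 0)) p q r s t" for p q r s t
   unfolding w5_swap[of v0 v'] by (simp add: w5_def e)
  then have T2: "w5 v0 (w4 v' k) p q r s t = T p q r s t" for p q r s t
   by (simp add: T_def w5_swap[of v' v])
  have dT: "- T p q r s t = d * T p q r s t" for p q r s t
  proof -
   have "w5 v0 (w4 v k') p q r s t = d * w5 v0 (w4 v' k) p q r s t"
    using W4_eqD[OF d] by (simp add: w5_def algebra_simps)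
   then show ?thesis by (simp add: T1 T2)
  qed
  have "d = - 1"
  proof (rule ccontr)
   assume "d \<noteq> - 1"
   have T0: "T p q r s t = 0" for p q r s t
   proof -
    have "(1 + d) * T p q r s t = 0" using dT[of p q r s t, symmetric] by (simp add: distrib_right)
    moreover have "1 + d \<noteq> 0" using \<open>d \<noteq> - 1\<close> by (metis add_eq_0_iff)
    ultimately show ?thesis by simp
   qed
   have "w4 (v' - v) (b 0) q r s t = T \<theta>0 q r s t" for q r s t
    using \<theta>0(2) k(5) k'(5) by (simp add: T_def w5_def w4_def contracts_def algebra_simps)
   then have "kills (v' - v) (b 0)" by (simp add: kills_def T0)
   then obtain c where "v' - v = c *s v0" using factor_unique[OF b0 v0(2,1)] by blast
   from arg_cong[OF this, of "\<lambda>x. x \<cdot> E 2"] show False using E by (simp add: dual_3)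
  qed
  then show ?thesis using d by (simp add: W4_diff)
 next
  assume "\<exists>\<theta>. \<theta> \<noteq> 0 \<and> contracts \<theta> k \<and> contracts \<theta> k'"
  then obtain \<theta> where \<theta>: "\<theta> \<noteq> 0" "contracts \<theta> k" "contracts \<theta> k'" by blast
  have pz: "x \<cdot> \<theta> = 0" if "kills x m" "contracts \<theta> m" "m \<noteq> 0" for x m
  proof (rule ccontr)
   assume "x \<cdot> \<theta> \<noteq> 0"
   have "x \<cdot> \<theta> * tri m q r s = 0" for q r s
    using that(1,2) unfolding kills_def contracts_def w4_def by (metis diff_0_right diff_zero add_0_right mult_zero_right)
   then have "m = 0" using \<open>x \<cdot> \<theta> \<noteq> 0\<close> by (intro tri_eqI) simp
   then show False using that(3) by simp
  qed
  have v\<theta>: "v \<cdot> \<theta> = 0" "v' \<cdot> \<theta> = 0" using pz k k' \<theta> by blast+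
  define \<tau> where "\<tau> = tri (b 0) \<theta>"
  define t where "t = v0 \<cdot> \<theta>"
  have tk: "t * tri k q r s = - (v \<cdot> q * \<tau> r s - v \<cdot> r * \<tau> q s + v \<cdot> s * \<tau> q r)" for q r s
   using e(1)[of \<theta> q r s] \<theta>(2) v\<theta> by (simp add: w4_def contracts_def t_def \<tau>_def)
  have tk': "t * tri k' q r s = - (v' \<cdot> q * \<tau> r s - v' \<cdot> r * \<tau> q s + v' \<cdot> s * \<tau> q r)" for q r s
   using e(2)[of \<theta> q r s] \<theta>(3) v\<theta> by (simp add: w4_def contracts_def t_def \<tau>_def)
  show ?thesis
  proof (cases "t = 0")
   case True
   have \<tau>0: "\<tau> \<theta>0 s = 0" for s
    using \<theta>0(2) tri_swap(1)[OF altK[OF b0(1)], of \<theta> \<theta>0 s] by (simp add: \<tau>_def contracts_def)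
   have "\<tau> r s = 0" for r s
    using tk[of \<theta>0 r s] True k(5) \<tau>0 by simp
   then have "contracts \<theta> (b 0)" by (simp add: contracts_def \<tau>_def)
   then obtain c where "\<theta> = c *s \<theta>0" using covector_unique[OF b0 \<theta>0(2,1)] by blast
   then show ?thesis using v\<theta>(1) k(5) \<theta>(1) by auto
  next
   case False
   have "t * (w4 v k' p q r s + w4 v' k p q r s) = 0" for p q r s
   proof -
    have "t * (w4 v k' p q r s + w4 v' k p q r s) =
     v \<cdot> p * (t * tri k' q r s) - v \<cdot> q * (t * tri k' p r s) + v \<cdot> r * (t * tri k' p q s) - v \<cdot> s * (t * tri k' p q r)
     + (v' \<cdot> p * (t * tri k q r s) - v' \<cdot> q * (t * tri k p r s) + v' \<cdot> r * (t * tri k p q s) - v' \<cdot> s * (t * tri k p q r))"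
     by (simp add: w4_def algebra_simps)
    also have "\<dots> = 0" unfolding tk tk' by (simp add: algebra_simps)
    finally show ?thesis .
   qed
   then have "w4 v k' p q r s = w4 (- 1 *s v') k p q r s" for p q r s
    using False unfolding w4_lin(3) by (simp add: eq_neg_iff_add_eq_0)
   then have "W4 v k' = W4 (- 1 *s v') k" unfolding W4_eq_iff by blast
   then show ?thesis by (simp add: W4_diff)
  qed
 qed
qed

text \<open>Six elements with factors in general position match pairwise, so that a linear map with
 \<open>p \<and> \<kappa> p = 0\<close> can be assembled from them.\<close>

theorem bivector_exists:
 shows "\<exists>\<omega>. (\<forall>p. linear6 (\<omega> p)) \<and> (\<forall>p q. \<omega> q p = - \<omega> p q) \<and> (\<exists>p q. \<omega> p q \<noteq> 0) \<and>
  (\<forall>p. \<exists>k\<in>K. \<forall>q r s. tri k q r s = p \<cdot> q * \<omega> r s - p \<cdot> r * \<omega> q s + p \<cdot> s * \<omega> q r)"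
proof -
 note b0 = b_in_K[of 0, simplified] b_nonzero[of 0, simplified]
 obtain v0 where v0: "v0 \<noteq> 0" "kills v0 (b 0)" using has_factor b0(1) by blast
 from altK[OF b0(1)] v0(2,1) have "\<exists>y z y' z'. indep [v0, y, z, y', z'] \<and> b 0 = T3 v0 y z + T3 v0 y' z'"
 proof (cases rule: partially_decomposable_cases)
  case (1 y z)
  then show ?thesis using no_decomposable b0 by metis
 next
  case (2 y z y' z')
  then show ?thesis by blast
 qed
 then obtain y z y' z' where five: "indep [v0, y, z, y', z']" "b 0 = T3 v0 y z + T3 v0 y' z'" by blast
 obtain w where "indep [v0, y, z, y', z', w]" using indep_extend[OF five(1)] by auto
 then obtain E where E: "dual [v0, y, z, y', z', w] E" by (auto simp: indep_def)
 note E' = E[unfolded dual_6]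
 define \<theta>0 where "\<theta>0 = E 5"
 have \<theta>0: "\<theta>0 \<noteq> 0" "contracts \<theta>0 (b 0)" "v0 \<cdot> \<theta>0 = 0"
 proof -
  show "\<theta>0 \<noteq> 0"
  proof
   assume "\<theta>0 = 0"
   then have "w \<cdot> E 5 = 0" by (simp add: \<theta>0_def)
   then show False using E' by simp
  qed
  show "contracts \<theta>0 (b 0)" unfolding five(2) contracts_rank5_iff[OF five(1)] \<theta>0_def using E' by simp
  show "v0 \<cdot> \<theta>0 = 0" unfolding \<theta>0_def using E' by simp
 qed
 \<comment> \<open>All entries but \<open>v0\<close> have value \<open>1\<close> on \<open>\<theta>0\<close>, and the list remains a basis when multiples of \<open>v0\<close> are
  added to the other entries.\<close>
 define X where "X = nth [v0, w, w + y, w + z, w + y', w + z']"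
 have X1: "X i \<cdot> \<theta>0 = 1" if "i \<in> {1..<6}" for i
 proof -
  have "i = 1 \<or> i = 2 \<or> i = 3 \<or> i = 4 \<or> i = 5" using that by auto
  then show ?thesis by (elim disjE) (simp_all add: X_def \<theta>0_def E')
 qed
 have "\<exists>k v \<alpha>. k \<in> K \<and> k \<noteq> 0 \<and> kills v k \<and> W4 v0 k = W4 v (b 0) \<and> v = X i + \<alpha> *s v0"
  if "i \<in> {1..<6}" for i
  by (rule matched_element[OF v0 \<theta>0 X1[OF that]])
 then obtain kf vf \<alpha>f where kf: "\<And>i. i \<in> {1..<6} \<Longrightarrow> kf i \<in> K \<and> kf i \<noteq> 0 \<and> kills (vf i) (kf i) \<and>
   W4 v0 (kf i) = W4 (vf i) (b 0) \<and> vf i = X i + \<alpha>f i *s v0" by metis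
 \<comment> \<open>The sign makes the relations \<open>v i \<and> k j + v j \<and> k i = 0\<close> hold for \<open>i = 0\<close> as well.\<close>
 define k where "k = (\<lambda>i::nat. if i = 0 then - 1 *s b 0 else kf i)"
 define v where "v = (\<lambda>i::nat. if i = 0 then v0 else vf i)"
 have v\<theta>: "v i \<cdot> \<theta>0 = 1" if "i \<in> {1..<6}" for i using kf[OF that] X1[OF that] \<theta>0(3) that by (simp add: v_def)
 define vs where "vs = map v [0..<6]"
 have nth: "vs ! i = v i" "length vs = 6" if "i < 6" for i using that by (simp_all add: vs_def)
 have ind: "indep vs"
 proof (rule ccontr)
  assume "\<not> indep vs"
  then obtain c :: "nat \<Rightarrow> complex" where c: "\<exists>i<6. c i \<noteq> 0" "(\<Sum>i<6. c i *s v i) = 0"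
   using indep_or_relation[of vs] by (auto simp: vs_def)
  define d where "d = c 0 + (\<Sum>i\<in>{1,2,3,4,5}. c i * \<alpha>f i)"
  have "(\<Sum>i<6. c i *s v i) = d *s v0 + (c 1 *s w + c 2 *s (w + y) + c 3 *s (w + z) + c 4 *s (w + y') + c 5 *s (w + z'))"
   using kf[of 1] kf[of 2] kf[of 3] kf[of 4] kf[of 5]
   by (simp add: sum_less_numeral v_def X_def d_def vec_eq_iff algebra_simps)
  then have R: "d *s v0 + (c 1 *s w + c 2 *s (w + y) + c 3 *s (w + z) + c 4 *s (w + y') + c 5 *s (w + z')) = 0"
   using c(2) by simp
  have c2: "c 2 = 0" using arg_cong[OF R, of "\<lambda>p. p \<cdot> E 1"] E' by simp
  have c3: "c 3 = 0" using arg_cong[OF R, of "\<lambda>p. p \<cdot> E 2"] E' by simp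
  have c4: "c 4 = 0" using arg_cong[OF R, of "\<lambda>p. p \<cdot> E 3"] E' by simp
  have c5: "c 5 = 0" using arg_cong[OF R, of "\<lambda>p. p \<cdot> E 4"] E' by simp
  have c1: "c 1 = 0" using arg_cong[OF R, of "\<lambda>p. p \<cdot> E 5"] E' c2 c3 c4 c5 by simp
  have "d = 0" using arg_cong[OF R, of "\<lambda>p. p \<cdot> E 0"] E' c1 c2 c3 c4 c5 by simp
  then have c0: "c 0 = 0" using c1 c2 c3 c4 c5 by (simp add: d_def)
  obtain i where "i < 6" "c i \<noteq> 0" using c(1) by blast
  then have "i = 0 \<or> i = 1 \<or> i = 2 \<or> i = 3 \<or> i = 4 \<or> i = 5" by auto
  then show False using \<open>c i \<noteq> 0\<close> c0 c1 c2 c3 c4 c5 by auto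
 qed
 then obtain F where F: "dual vs F" by (auto simp: indep_def)
 have ind3: "indep [v0, v i, v j]" if "i \<in> {1..<6}" "j \<in> {1..<6}" "i \<noteq> j" for i j
 proof -
  have "dual (map ((!) vs) [0, i, j]) (\<lambda>n. F ([0, i, j] ! n))"
   by (rule indep_select[OF F]) (use that in \<open>auto simp: vs_def\<close>)
  then show ?thesis using that nth(1) by (auto simp: indep_def v_def)
 qed
 have pairs: "W4 (v i) (k j) + W4 (v j) (k i) = 0" if ij: "i < 6" "j < 6" for i j
 proof -
  have zero: "W4 v0 (k j) + W4 (v j) (k 0) = 0" if "j < 6" for j
  proof (cases "j = 0")
   case True
   have "W4 v0 (b 0) = 0" using v0(2) by (simp add: W4_zero_iff)
   then show ?thesis using True by (simp add: k_def v_def W4_diff)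
  next
   case False
   then show ?thesis using kf[of j] that by (simp add: k_def v_def W4_lin W4_diff)
  qed
  consider "i = 0" | "j = 0" | "i \<in> {1..<6}" "i = j" | "i \<in> {1..<6}" "j \<in> {1..<6}" "i \<noteq> j"
  proof -
   have "i = 0 \<or> i \<in> {1..<6}" "j = 0 \<or> j \<in> {1..<6}" using ij by auto
   then show ?thesis using that by blast
  qed
  then show ?thesis
  proof cases
   case 1
   then show ?thesis using zero[OF ij(2)] by (simp add: v_def)
  next
   case 2
   then show ?thesis using zero[OF ij(1)] by (simp add: v_def add.commute)
  next
   case 3
   have "W4 (vf i) (kf i) = 0" using kf[OF 3(1)] W4_zero_iff by blast
   then show ?thesis using 3 by (simp add: k_def v_def)
  next
   case 4
   then show ?thesis
    using matched_pair[OF v0 \<theta>0(1,2), of "k i" "v i" "k j" "v j"] kf[of i] kf[of j] v\<theta>[of i] v\<theta>[of j] ind3[of i j]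
    by (auto simp: k_def v_def)
  qed
 qed
 define \<kappa> where "\<kappa> = (\<lambda>p. \<Sum>i<6. (p \<cdot> F i) *s k i)"
 have lin: "\<kappa> (p + q) = \<kappa> p + \<kappa> q" "\<kappa> (c *s p) = c *s \<kappa> p" for p q c
  by (simp_all add: \<kappa>_def vec.scale_left_distrib sum.distrib vec.scale_sum_right vec.scale_scale)
 have kK: "k i \<in> K" if "i < 6" for i
  using kf[of i] that subspace_K(2)[OF b0(1), of "- 1"] by (cases "i = 0") (auto simp: k_def)
 have \<kappa>K: "\<kappa> p \<in> K" for p unfolding \<kappa>_def by (intro sum_in_K subspace_K kK) auto
 have expand: "p = (\<Sum>i<6. (p \<cdot> F i) *s v i)" for p
  using dual_expansion(1)[OF F, of p] by (simp add: vs_def)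
 have skew: "W4 p (\<kappa> q) + W4 q (\<kappa> p) = 0" for p q
 proof -
  have W: "W4 p (\<kappa> q) = (\<Sum>i<6. \<Sum>j<6. (p \<cdot> F i * q \<cdot> F j) *s W4 (v i) (k j))" for p q
  proof -
   have "W4 p (\<kappa> q) = W4 (\<Sum>i<6. (p \<cdot> F i) *s v i) (\<kappa> q)" using expand[of p] by simp
   also have "\<dots> = (\<Sum>i<6. \<Sum>j<6. (p \<cdot> F i * q \<cdot> F j) *s W4 (v i) (k j))"
    unfolding \<kappa>_def W4_sum W4_lin vec.scale_sum_right vec.scale_scale
    by (rule trans[OF sum.swap]) (simp add: mult.commute)
   finally show ?thesis .
  qed
  have "W4 q (\<kappa> p) = (\<Sum>i<6. \<Sum>j<6. (p \<cdot> F i * q \<cdot> F j) *s W4 (v j) (k i))"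
   unfolding W[of q p] by (rule trans[OF sum.swap]) (simp add: mult.commute)
  then have "W4 p (\<kappa> q) + W4 q (\<kappa> p) =
    (\<Sum>i<6. \<Sum>j<6. (p \<cdot> F i * q \<cdot> F j) *s (W4 (v i) (k j) + W4 (v j) (k i)))"
   unfolding W by (simp only: sum.distrib vec.scale_right_distrib)
  also have "\<dots> = 0" using pairs by (simp add: sum.neutral)
  finally show ?thesis .
 qed
 define \<omega> where "\<omega> = (\<lambda>q r. (\<Sum>i\<in>UNIV. tri (\<kappa> (axis i 1)) (axis i 1) q r) / 4)"
 have \<omega>: "tri (\<kappa> p) q r s = p \<cdot> q * \<omega> r s - p \<cdot> r * \<omega> q s + p \<cdot> s * \<omega> q r" for p q r s
  unfolding \<omega>_def by (rule koszul_bivector[OF lin altK[OF \<kappa>K] skew])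
 have "linear6 (\<omega> p)" for p
  by (simp add: linear6_def \<omega>_def sum.distrib add_divide_distrib sum_distrib_left[symmetric])
 moreover have "\<omega> q p = - \<omega> p q" for p q
 proof -
  have "tri (\<kappa> (axis i 1)) (axis i 1) q p = - tri (\<kappa> (axis i 1)) (axis i 1) p q" for i
   by (rule tri_swap(2)[OF altK[OF \<kappa>K]])
  then show ?thesis by (simp add: \<omega>_def sum_negf)
 qed
 moreover have "\<exists>p q. \<omega> p q \<noteq> 0"
 proof (rule ccontr)
  assume "\<nexists>p q. \<omega> p q \<noteq> 0"
  then have "\<kappa> p = 0" for p by (intro tri_eqI) (simp add: \<omega>)
  moreover have "\<kappa> v0 = k 0"
  proof -
   have "v0 \<cdot> F i = (if i = 0 then 1 else 0)" if "i < 6" for i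
    using F[unfolded dual_def, rule_format, of 0 i] that by (auto simp: vs_def v_def)
   then have "\<kappa> v0 = (\<Sum>i<6. if i = 0 then k i else 0)"
    unfolding \<kappa>_def by (intro sum.cong) auto
   then show ?thesis by simp
  qed
  ultimately show False using b0(2) by (simp add: k_def)
 qed
 ultimately show ?thesis using \<kappa>K \<omega> by blast
qed

end

section \<open>A quadratic covariant of trivectors\<close>

definition Dl :: "vec6 list \<Rightarrow> complex" where
 "Dl xs = Determinants.det (\<chi> i. xs ! rk i)"

lemma Dl_row: "n < 6 \<Longrightarrow> length xs = 6 \<Longrightarrow> Dl (xs[n := x]) = Determinants.det (\<chi> i. if i = ix n then x else xs ! rk i)"
proof -
 assume n: "n < 6" "length xs = 6"
 have "n = rk i \<longleftrightarrow> i = ix n" for i using n(1) rk_ix ix_rk by metis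
 then have "(\<chi> i. xs[n := x] ! rk i) = (\<chi> i. if i = ix n then x else xs ! rk i)"
  using n by (simp add: vec_eq_iff nth_list_update)
 then show ?thesis by (simp add: Dl_def)
qed

lemma Dl_add: "n < 6 \<Longrightarrow> length xs = 6 \<Longrightarrow> Dl (xs[n := x + y]) = Dl (xs[n := x]) + Dl (xs[n := y])"
 using Determinants.det_row_add[of "ix n" "\<lambda>_. x" "\<lambda>_. y" "\<lambda>i. xs ! rk i"] by (simp add: Dl_row)

lemma Dl_scale: "n < 6 \<Longrightarrow> length xs = 6 \<Longrightarrow> Dl (xs[n := c *s x]) = c * Dl (xs[n := x])"
 using Determinants.det_row_mul[of "ix n" c "\<lambda>_. x" "\<lambda>i. xs ! rk i"] by (simp add: Dl_row)

lemma Dl_repeat: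
 assumes "length xs = 6" "i < 6" "j < 6" "i \<noteq> j" "xs ! i = xs ! j"
 shows "Dl xs = 0"
 unfolding Dl_def by (rule Determinants.det_identical_rows[of "ix i" "ix j"]) (use assms ix_eq_iff in \<open>auto simp: Finite_Cartesian_Product.row_def vec_eq_iff\<close>)

lemma Dl_swap:
 assumes "length xs = 6" "i < 6" "j < 6" "i \<noteq> j"
 shows "Dl (xs[i := y, j := x]) = - Dl (xs[i := x, j := y])"
proof -
 have rep: "Dl (xs[i := z, j := z]) = 0" for z
  by (rule Dl_repeat[of _ i j]) (use assms in auto)
 have "0 = Dl (xs[i := x + y, j := x + y])" using rep by simp
 also have "\<dots> = Dl (xs[i := x + y, j := x]) + Dl (xs[i := x + y, j := y])"
  using assms by (simp add: Dl_add)
 also have "\<dots> = Dl (xs[j := x, i := x + y]) + Dl (xs[j := y, i := x + y])"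
  using assms by (simp add: list_update_swap)
 also have "\<dots> = Dl (xs[j := x, i := x]) + Dl (xs[j := x, i := y]) + (Dl (xs[j := y, i := x]) + Dl (xs[j := y, i := y]))"
  using assms by (simp add: Dl_add)
 also have "\<dots> = Dl (xs[i := y, j := x]) + Dl (xs[i := x, j := y])"
  using rep assms by (simp add: list_update_swap[of i j])
 finally show ?thesis by (simp add: eq_neg_iff_add_eq_0)
qed

lemma Dl_dependent:
 assumes "length xs = 6" "\<not> indep xs" shows "Dl xs = 0"
proof -
 define X :: "complex ^ 6 ^ 6" where "X = (\<chi> i. xs ! rk i)"
 obtain \<theta> where \<theta>: "\<theta> \<noteq> 0" "\<And>x. x \<in> set xs \<Longrightarrow> x \<cdot> \<theta> = 0" using six_vectors assms by blast
 have "(X *v \<theta>) $ i = xs ! rk i \<cdot> \<theta>" for i by (simp add: X_def matrix_vector_mult_def pair_def)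
 then have "X *v \<theta> = 0" using \<theta>(2) assms(1) by (simp add: vec_eq_iff)
 then have "\<not> invertible X" using \<theta>(1) unfolding invertible_left_inverse matrix_left_invertible_ker by blast
 then show ?thesis unfolding Dl_def X_def[symmetric] invertible_det_nz by simp
qed

lemma Dl_indep:
 assumes "length xs = 6" "indep xs" shows "Dl xs \<noteq> 0"
proof -
 obtain E where E: "dual xs E" using assms(2) by (auto simp: indep_def)
 define X :: "complex ^ 6 ^ 6" where "X = (\<chi> i. xs ! rk i)"
 have "x = 0" if "X *v x = 0" for x
 proof -
  have "(X *v x) $ i = xs ! rk i \<cdot> x" for i by (simp add: X_def matrix_vector_mult_def pair_def)
  then have z: "xs ! rk i \<cdot> x = 0" for i using that by (metis zero_index)
  have "xs ! i \<cdot> x = 0" if "i < 6" for i using z[of "ix i"] that by simp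
  then show "x = 0" using dual_expansion(2)[OF E assms(1), of x] by simp
 qed
 then have "invertible X" unfolding invertible_left_inverse matrix_left_invertible_ker by blast
 then show ?thesis unfolding Dl_def X_def[symmetric] invertible_det_nz .
qed

definition D6 :: "vec6 \<Rightarrow> vec6 \<Rightarrow> vec6 \<Rightarrow> vec6 \<Rightarrow> vec6 \<Rightarrow> vec6 \<Rightarrow> complex" where
 "D6 p a b c d e = Dl [p, a, b, c, d, e]"

lemma D6_lin:
 "linear6 (\<lambda>x. D6 x a b c d e)" "linear6 (\<lambda>x. D6 p x b c d e)" "linear6 (\<lambda>x. D6 p a x c d e)"
 "linear6 (\<lambda>x. D6 p a b x d e)" "linear6 (\<lambda>x. D6 p a b c x e)" "linear6 (\<lambda>x. D6 p a b c d x)"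
 using Dl_add[of 0 "[0, a, b, c, d, e]"] Dl_scale[of 0 "[0, a, b, c, d, e]"]
  Dl_add[of 1 "[p, 0, b, c, d, e]"] Dl_scale[of 1 "[p, 0, b, c, d, e]"]
  Dl_add[of 2 "[p, a, 0, c, d, e]"] Dl_scale[of 2 "[p, a, 0, c, d, e]"]
  Dl_add[of 3 "[p, a, b, 0, d, e]"] Dl_scale[of 3 "[p, a, b, 0, d, e]"]
  Dl_add[of 4 "[p, a, b, c, 0, e]"] Dl_scale[of 4 "[p, a, b, c, 0, e]"]
  Dl_add[of 5 "[p, a, b, c, d, 0]"] Dl_scale[of 5 "[p, a, b, c, d, 0]"]
 by (simp_all add: linear6_def D6_def numeral_eq_Suc One_nat_def)

lemma D6_repeat [simp]:
 "D6 x x b c d e = 0" "D6 x b x c d e = 0" "D6 x b c x d e = 0" "D6 x b c d x e = 0" "D6 x b c d e x = 0"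
 "D6 p x x c d e = 0" "D6 p x c x d e = 0" "D6 p x c d x e = 0" "D6 p x c d e x = 0"
 "D6 p a x x d e = 0" "D6 p a x d x e = 0" "D6 p a x d e x = 0"
 "D6 p a b x x e = 0" "D6 p a b x e x = 0" "D6 p a b c x x = 0"
 unfolding D6_def
 by (rule Dl_repeat[of _ 0 1] Dl_repeat[of _ 0 2] Dl_repeat[of _ 0 3] Dl_repeat[of _ 0 4] Dl_repeat[of _ 0 5]
   Dl_repeat[of _ 1 2] Dl_repeat[of _ 1 3] Dl_repeat[of _ 1 4] Dl_repeat[of _ 1 5]
   Dl_repeat[of _ 2 3] Dl_repeat[of _ 2 4] Dl_repeat[of _ 2 5]
   Dl_repeat[of _ 3 4] Dl_repeat[of _ 3 5] Dl_repeat[of _ 4 5]; simp; fail)+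

lemma D6_swap:
 "D6 b a c d e f = - D6 a b c d e f" "D6 a c b d e f = - D6 a b c d e f" "D6 a b d c e f = - D6 a b c d e f"
 "D6 a b c e d f = - D6 a b c d e f" "D6 a b c d f e = - D6 a b c d e f"
 "D6 a e c d b f = - D6 a b c d e f" "D6 a b f d e c = - D6 a b c d e f"
 "D6 d b c a e f = - D6 a b c d e f"
 using Dl_swap[of "[a, b, c, d, e, f]" 0 1 b a] Dl_swap[of "[a, b, c, d, e, f]" 1 2 c b] Dl_swap[of "[a, b, c, d, e, f]" 2 3 d c]
  Dl_swap[of "[a, b, c, d, e, f]" 3 4 e d] Dl_swap[of "[a, b, c, d, e, f]" 4 5 f e]
  Dl_swap[of "[a, b, c, d, e, f]" 1 4 e b] Dl_swap[of "[a, b, c, d, e, f]" 2 5 f c]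
  Dl_swap[of "[a, b, c, d, e, f]" 0 3 d a]
 by (simp_all add: D6_def numeral_eq_Suc One_nat_def)

lemma D6_rotate: "D6 a b c d e f = - D6 b c d e f a"
proof -
 have "D6 a b c d e f = - D6 b a c d e f" by (rule D6_swap(1))
 also have "D6 b a c d e f = - D6 b c a d e f" by (rule D6_swap(2))
 also have "D6 b c a d e f = - D6 b c d a e f" by (rule D6_swap(3))
 also have "D6 b c d a e f = - D6 b c d e a f" by (rule D6_swap(4))
 also have "D6 b c d e a f = - D6 b c d e f a" by (rule D6_swap(5))
 finally show ?thesis by simp
qed

lemma T3_nth: "T3 x y z $ (i, j, l) = x $ i * (y $ j * z $ l - y $ l * z $ j)
   - x $ j * (y $ i * z $ l - y $ l * z $ i) + x $ l * (y $ i * z $ j - y $ j * z $ i)"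
 using tri_axis[of "T3 x y z" i j l] by (simp add: tri_T3)

lemma trilinear_T3:
 assumes F: "\<And>v w. linear6 (\<lambda>u. F u v w)" "\<And>u w. linear6 (\<lambda>v. F u v w)" "\<And>u v. linear6 (\<lambda>w. F u v w)"
  and skew: "\<And>u v w. F v u w = - F u v w" "\<And>u v w. F u w v = - F u v w"
 shows "(\<Sum>q\<in>UNIV. T3 x y z $ q * F (axis (fst q) 1) (axis (fst (snd q)) 1) (axis (snd (snd q)) 1)) = 6 * F x y z"
proof -
 define e where "e = (\<lambda>q::6 \<times> 6 \<times> 6. F (axis (fst q) 1) (axis (fst (snd q)) 1) (axis (snd (snd q)) 1))"
 have *: "(\<Sum>q\<in>UNIV. e q * (a $ fst q * b $ fst (snd q) * c $ snd (snd q))) = F a b c" for a b c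
  using tri_tri_of[of F a b c, OF F] by (simp add: tri_def tri_of_def e_def)
 have T: "T3 x y z $ q = x $ fst q * y $ fst (snd q) * z $ snd (snd q) - x $ fst q * z $ fst (snd q) * y $ snd (snd q)
   - y $ fst q * x $ fst (snd q) * z $ snd (snd q) + z $ fst q * x $ fst (snd q) * y $ snd (snd q)
   + y $ fst q * z $ fst (snd q) * x $ snd (snd q) - z $ fst q * y $ fst (snd q) * x $ snd (snd q)" for q
  by (cases q) (simp add: T3_nth algebra_simps)
 have "(\<Sum>q\<in>UNIV. T3 x y z $ q * e q) = F x y z - F x z y - F y x z + F z x y + F y z x - F z y x"
  unfolding T by (simp only: mult.commute[of _ "e _"] right_diff_distrib distrib_left sum.distrib sum_subtractf *)
 also have "\<dots> = 6 * F x y z"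
  using skew(2)[of x y z] skew(1)[of x y z] skew(1)[of x z y] skew(2)[of y x z] skew(1)[of y z x] by simp
 finally show ?thesis by (simp add: e_def)
qed

lemma bilinear_sum:
 assumes F: "\<And>v. linear6 (\<lambda>u. F u v)" "\<And>u. linear6 (\<lambda>v. F u v)"
 shows "(\<Sum>i\<in>UNIV. \<Sum>j\<in>UNIV. a $ i * b $ j * F (axis i 1) (axis j 1)) = F a b"
proof -
 have "F a b = (\<Sum>i\<in>UNIV. a $ i * F (axis i 1) b)" by (rule linear6_expand[OF F(1)])
 also have "\<dots> = (\<Sum>i\<in>UNIV. a $ i * (\<Sum>j\<in>UNIV. b $ j * F (axis i 1) (axis j 1)))"
  by (intro sum.cong refl arg_cong2[where f = "(*)"] linear6_expand[OF F(2)])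
 finally show ?thesis by (simp add: sum_distrib_left mult.assoc)
qed

lemma T3_contract:
 assumes F: "\<And>v. linear6 (\<lambda>u. F u v)" "\<And>u. linear6 (\<lambda>v. F u v)"
 shows "(\<Sum>i\<in>UNIV. \<Sum>j\<in>UNIV. T3 x y z $ (d, i, j) * F (axis i 1) (axis j 1)) =
  x $ d * F y z - x $ d * F z y - y $ d * F x z + y $ d * F z x + z $ d * F x y - z $ d * F y x"
proof -
 have T: "T3 x y z $ (d, i, j) = x $ d * (y $ i * z $ j) - x $ d * (z $ i * y $ j) - y $ d * (x $ i * z $ j)
   + y $ d * (z $ i * x $ j) + z $ d * (x $ i * y $ j) - z $ d * (y $ i * x $ j)" for i j
  unfolding T3_nth by (simp add: algebra_simps)
 show ?thesis
  unfolding T left_diff_distrib distrib_right sum.distrib sum_subtractf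
  by (simp only: mult.assoc[of "_ $ d"] sum_distrib_left[symmetric] bilinear_sum[of F, OF F])
qed

text \<open>Contracting two copies of a trivector with the volume form gives an endomorphism: up to the
 factor \<open>12\<close>, the functional \<open>u\<close> goes to the coefficient of \<open>p \<and> (\<iota>\<^sub>u k) \<and> k'\<close>.\<close>

definition cof :: "trivec \<Rightarrow> vec6 \<Rightarrow> vec6 \<Rightarrow> vec6 \<Rightarrow> complex" where
 "cof k p a b = (\<Sum>q\<in>UNIV. k $ q * D6 p a b (axis (fst q) 1) (axis (fst (snd q)) 1) (axis (snd (snd q)) 1))"

definition Bb :: "trivec \<Rightarrow> trivec \<Rightarrow> vec6 \<Rightarrow> vec6" where
 "Bb k k' p = (\<chi> d. \<Sum>i\<in>UNIV. \<Sum>j\<in>UNIV. k $ (d, i, j) * cof k' p (axis i 1) (axis j 1))"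

lemma cof_T3: "cof (T3 x y z) p a b = 6 * D6 p a b x y z"
 unfolding cof_def by (rule trilinear_T3) (auto intro: D6_lin D6_swap)

lemma cof_lin: "cof (k + l) p a b = cof k p a b + cof l p a b" "cof (c *s k) p a b = c * cof k p a b"
 "cof k (p + p') a b = cof k p a b + cof k p' a b" "cof k (c *s p) a b = c * cof k p a b"
 by (simp_all add: cof_def sum.distrib sum_distrib_left distrib_right distrib_left mult_ac linear6D[OF D6_lin(1)])

lemma Bb_lin: "Bb (k + l) k' p = Bb k k' p + Bb l k' p" "Bb k (k' + l') p = Bb k k' p + Bb k l' p"
 "Bb (c *s k) k' p = c *s Bb k k' p" "Bb k (c *s k') p = c *s Bb k k' p"
 "Bb k k' (p + q) = Bb k k' p + Bb k k' q" "Bb k k' (c *s p) = c *s Bb k k' p"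
 by (simp_all add: Bb_def vec_eq_iff cof_lin sum.distrib sum_distrib_left distrib_right distrib_left mult_ac)

lemma Bb_T3:
 "Bb (T3 x y z) (T3 x' y' z') p =
  12 *s (D6 p y z x' y' z' *s x - D6 p x z x' y' z' *s y + D6 p x y x' y' z' *s z)"
proof -
 define F where "F = (\<lambda>a b. 6 * D6 p a b x' y' z')"
 have F: "linear6 (\<lambda>u. F u v)" "linear6 (\<lambda>v. F u v)" for u v
  using D6_lin(2)[of p v x' y' z'] D6_lin(3)[of p u x' y' z'] by (auto simp: F_def linear6_def distrib_left)
 have sk: "F b a = - F a b" for a b using D6_swap(2)[of p b a x' y' z'] by (simp add: F_def)
 note S = T3_contract[of F x y z, OF F]
 have "Bb (T3 x y z) (T3 x' y' z') p = (\<chi> d. \<Sum>i\<in>UNIV. \<Sum>j\<in>UNIV. T3 x y z $ (d, i, j) * F (axis i 1) (axis j 1))"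
  by (simp add: Bb_def cof_T3 F_def)
 then show ?thesis
  using sk[of y z] sk[of x z] sk[of x y] unfolding S by (simp add: F_def vec_eq_iff algebra_simps)
qed

text \<open>On a sum of two complementary decomposables the covariant has two opposite eigenvalues, and the eigenspaces
 are the two three-dimensional spaces.\<close>

lemma Bb_secant:
 assumes "k = T3 x y z + T3 x' y' z'"
 shows "Bb k k x = (12 * D6 x y z x' y' z') *s x" "Bb k k y = (12 * D6 x y z x' y' z') *s y"
  "Bb k k z = (12 * D6 x y z x' y' z') *s z"
  "Bb k k x' = (- 12 * D6 x y z x' y' z') *s x'" "Bb k k y' = (- 12 * D6 x y z x' y' z') *s y'"
  "Bb k k z' = (- 12 * D6 x y z x' y' z') *s z'"
proof -
 have r: "D6 x' y' z' x y z = - D6 x y z x' y' z'"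
  using D6_rotate[of x' y' z' x y z] D6_rotate[of y' z' x y z x'] D6_rotate[of z' x y z x' y'] by simp
 have s: "D6 y x z x' y' z' = - D6 x y z x' y' z'" "D6 z x y x' y' z' = D6 x y z x' y' z'"
  "D6 y' x' z' x y z = D6 x y z x' y' z'" "D6 z' x' y' x y z = - D6 x y z x' y' z'"
  using D6_swap(1)[of y x z x' y' z'] D6_swap(1)[of z x y x' y' z'] D6_swap(2)[of x z y x' y' z']
   D6_swap(1)[of y' x' z' x y z] D6_swap(1)[of z' x' y' x y z] D6_swap(2)[of x' z' y' x y z] r by simp_all
 show "Bb k k x = (12 * D6 x y z x' y' z') *s x" "Bb k k y = (12 * D6 x y z x' y' z') *s y"
  "Bb k k z = (12 * D6 x y z x' y' z') *s z"
  "Bb k k x' = (- 12 * D6 x y z x' y' z') *s x'" "Bb k k y' = (- 12 * D6 x y z x' y' z') *s y'"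
  "Bb k k z' = (- 12 * D6 x y z x' y' z') *s z'"
  unfolding assms Bb_lin Bb_T3 by (simp_all add: r s vec_eq_iff)
qed

text \<open>The limiting case: the covariant is nilpotent and its image is the three-dimensional space.\<close>

lemma Bb_tangent:
 assumes "k = T3 a y z + T3 x b z + T3 x y c"
 shows "Bb k k x = 0" "Bb k k y = 0" "Bb k k z = 0"
  "Bb k k a = (24 * D6 a y c x b z) *s x" "Bb k k b = (24 * D6 a y c x b z) *s y" "Bb k k c = (24 * D6 a y c x b z) *s z"
proof -
 have e: "D6 a b z x y c = D6 a y c x b z" "D6 b a z x y c = - D6 a y c x b z" "D6 b x c a y z = - D6 a y c x b z"
  "D6 c a y x b z = D6 a y c x b z" "D6 c x b a y z = D6 a y c x b z"
  using D6_swap(6)[of a b z x y c] D6_swap(7)[of a y z x b c] D6_swap(1)[of b a z x y c]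
   D6_swap(8)[of b x c a y z] D6_swap(6)[of a x c b y z] D6_swap(4)[of a y c b x z]
   D6_swap(1)[of c a y x b z] D6_swap(2)[of a c y x b z]
   D6_swap(8)[of c x b a y z] D6_swap(6)[of a x b c y z] D6_swap(3)[of a y b c x z] by simp_all
 show "Bb k k x = 0" "Bb k k y = 0" "Bb k k z = 0"
  unfolding assms Bb_lin Bb_T3 by (simp_all add: vec_eq_iff)
 show "Bb k k a = (24 * D6 a y c x b z) *s x" "Bb k k b = (24 * D6 a y c x b z) *s y" "Bb k k c = (24 * D6 a y c x b z) *s z"
  unfolding assms Bb_lin Bb_T3 by (simp_all add: e vec_eq_iff)
qed

text \<open>In the presence of a linear factor the covariant has rank one; it knows only the factor and the hyperplane.\<close>

lemma Bb_rank5: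
 assumes "k = T3 v y z + T3 v y' z'"
 shows "Bb k k p = (24 * D6 p y z v y' z') *s v"
proof -
 have "D6 p y' z' v y z = D6 p y z v y' z'"
  using D6_swap(6)[of p y z v y' z'] D6_swap(7)[of p y' z v y z'] by simp
 then show ?thesis unfolding assms Bb_lin Bb_T3 by (simp add: vec_eq_iff)
qed

section \<open>Classification of the ambiguous decomposable trivectors\<close>

text \<open>The first alternative of the classification: the span of \<open>x, y, z\<close> is contained in that of three columns of
 \<open>Bb k k + s\<close>. Naming the columns makes the triples the image of a smooth map.\<close>

definition eigen_row :: "trivec \<Rightarrow> complex \<Rightarrow> 6 \<Rightarrow> vec6" where
 "eigen_row k s j = Bb k k (axis j 1) + s *s axis j 1"

definition comb3 :: "complex ^ 3 \<Rightarrow> vec6 \<Rightarrow> vec6 \<Rightarrow> vec6 \<Rightarrow> vec6" where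
 "comb3 g a b c = g $ 1 *s a + g $ 2 *s b + g $ 3 *s c"

definition eigen_type :: "trivec \<Rightarrow> vec6 \<Rightarrow> vec6 \<Rightarrow> vec6 \<Rightarrow> bool" where
 "eigen_type k x y z \<longleftrightarrow> (\<exists>s j1 j2 j3. \<forall>w\<in>{x, y, z}. \<exists>g. w = comb3 g (eigen_row k s j1) (eigen_row k s j2) (eigen_row k s j3))"

text \<open>The second alternative: the space lies between the line of the factor \<open>v\<close> and the hyperplane of \<open>\<theta>\<close>.\<close>

definition rank_one_type :: "trivec \<Rightarrow> vec6 \<Rightarrow> vec6 \<Rightarrow> vec6 \<Rightarrow> bool" where
 "rank_one_type k x y z \<longleftrightarrow> (\<exists>v \<theta>. v \<noteq> 0 \<and> \<theta> \<noteq> 0 \<and> kills v k \<and> contracts \<theta> k \<and> (\<forall>p. Bb k k p = (p \<cdot> \<theta>) *s v) \<and>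
   x \<cdot> \<theta> = 0 \<and> y \<cdot> \<theta> = 0 \<and> z \<cdot> \<theta> = 0 \<and> (\<exists>c1 c2 c3. v = c1 *s x + c2 *s y + c3 *s z))"

text \<open>A minor of \<open>\<alpha>, \<beta>, \<gamma>\<close> that does not vanish selects three columns which span \<open>x, y, z\<close>.\<close>

lemma eigen_typeI:
 assumes M: "\<And>p. Bb k k p + s *s p = (\<alpha> \<cdot> p) *s x + (\<beta> \<cdot> p) *s y + (\<gamma> \<cdot> p) *s z"
  and nz: "T3 \<alpha> \<beta> \<gamma> \<noteq> 0"
 shows "eigen_type k x y z"
proof -
 obtain j1 j2 j3 where J: "T3 \<alpha> \<beta> \<gamma> $ (j1, j2, j3) \<noteq> 0"
  using nz by (auto simp: vec_eq_iff)
 define \<Delta> where "\<Delta> = T3 \<alpha> \<beta> \<gamma> $ (j1, j2, j3)"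
 have D: "\<Delta> = \<alpha> $ j1 * (\<beta> $ j2 * \<gamma> $ j3 - \<beta> $ j3 * \<gamma> $ j2)
   - \<alpha> $ j2 * (\<beta> $ j1 * \<gamma> $ j3 - \<beta> $ j3 * \<gamma> $ j1) + \<alpha> $ j3 * (\<beta> $ j1 * \<gamma> $ j2 - \<beta> $ j2 * \<gamma> $ j1)"
  using tri_axis[of "T3 \<alpha> \<beta> \<gamma>" j1 j2 j3] by (simp add: tri_T3 \<Delta>_def)
 have r: "eigen_row k s j = \<alpha> $ j *s x + \<beta> $ j *s y + \<gamma> $ j *s z" for j
  by (simp add: eigen_row_def M)
 define cx where "cx = (\<chi> i::3. (if i = 1 then \<beta> $ j2 * \<gamma> $ j3 - \<beta> $ j3 * \<gamma> $ j2 else if i = 2 then \<beta> $ j3 * \<gamma> $ j1 - \<beta> $ j1 * \<gamma> $ j3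
   else \<beta> $ j1 * \<gamma> $ j2 - \<beta> $ j2 * \<gamma> $ j1) / \<Delta>)"
 define cy where "cy = (\<chi> i::3. (if i = 1 then \<gamma> $ j2 * \<alpha> $ j3 - \<gamma> $ j3 * \<alpha> $ j2 else if i = 2 then \<gamma> $ j3 * \<alpha> $ j1 - \<gamma> $ j1 * \<alpha> $ j3
   else \<gamma> $ j1 * \<alpha> $ j2 - \<gamma> $ j2 * \<alpha> $ j1) / \<Delta>)"
 define cz where "cz = (\<chi> i::3. (if i = 1 then \<alpha> $ j2 * \<beta> $ j3 - \<alpha> $ j3 * \<beta> $ j2 else if i = 2 then \<alpha> $ j3 * \<beta> $ j1 - \<alpha> $ j1 * \<beta> $ j3
   else \<alpha> $ j1 * \<beta> $ j2 - \<alpha> $ j2 * \<beta> $ j1) / \<Delta>)"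
 have n0: "\<Delta> \<noteq> 0" using J by (simp add: \<Delta>_def)
 have i3: "(2::3) \<noteq> 1" "(3::3) \<noteq> 1" "(3::3) \<noteq> 2" by simp_all
 have gen: "comb3 g (eigen_row k s j1) (eigen_row k s j2) (eigen_row k s j3) =
   (g $ 1 * \<alpha> $ j1 + g $ 2 * \<alpha> $ j2 + g $ 3 * \<alpha> $ j3) *s x +
   (g $ 1 * \<beta> $ j1 + g $ 2 * \<beta> $ j2 + g $ 3 * \<beta> $ j3) *s y +
   (g $ 1 * \<gamma> $ j1 + g $ 2 * \<gamma> $ j2 + g $ 3 * \<gamma> $ j3) *s z" for g
  by (simp add: comb3_def r vec_eq_iff algebra_simps)
 have ev: "a / \<Delta> * p + b / \<Delta> * q + c / \<Delta> * t = (a * p + b * q + c * t) / \<Delta>" for a b c p q t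
  by (simp add: add_divide_distrib)
 have one: "X = \<Delta> \<Longrightarrow> X / \<Delta> = 1" "X = 0 \<Longrightarrow> X / \<Delta> = 0" for X using n0 by simp_all
 have "x = comb3 cx (eigen_row k s j1) (eigen_row k s j2) (eigen_row k s j3)"
  unfolding gen cx_def vec_lambda_beta ev
  by (simp only: i3 if_True if_False simp_thms, subst one(1), simp add: D algebra_simps, subst one(2), simp add: algebra_simps,
    subst one(2), simp add: algebra_simps, simp)
 moreover have "y = comb3 cy (eigen_row k s j1) (eigen_row k s j2) (eigen_row k s j3)"
  unfolding gen cy_def vec_lambda_beta ev
  by (simp only: i3 if_True if_False simp_thms, subst one(2), simp add: algebra_simps, subst one(1), simp add: D algebra_simps,
    subst one(2), simp add: algebra_simps, simp)
 moreover have "z = comb3 cz (eigen_row k s j1) (eigen_row k s j2) (eigen_row k s j3)"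
  unfolding gen cz_def vec_lambda_beta ev
  by (simp only: i3 if_True if_False simp_thms, subst one(2), simp add: algebra_simps, subst one(2), simp add: algebra_simps,
    subst one(1), simp add: D algebra_simps, simp)
 ultimately show ?thesis unfolding eigen_type_def by blast
qed

lemma T3_dual_nonzero:
 assumes E: "dual xs E" "length xs = 6" and ijl: "i < 6" "j < 6" "l < 6" "i \<noteq> j" "j \<noteq> l" "i \<noteq> l" and c: "c1 \<noteq> 0" "c2 \<noteq> 0" "c3 \<noteq> 0"
 shows "T3 (c1 *s E i) (c2 *s E j) (c3 *s E l) \<noteq> 0"
proof
 assume "T3 (c1 *s E i) (c2 *s E j) (c3 *s E l) = 0"
 moreover have p: "E a \<cdot> xs ! b = (if a = b then 1 else 0)" if "a < 6" "b < 6" for a b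
  using E that unfolding dual_def by (auto simp: pair_commute[of "E a"])
 have "tri (T3 (c1 *s E i) (c2 *s E j) (c3 *s E l)) (xs ! i) (xs ! j) (xs ! l) = c1 * c2 * c3"
  unfolding tri_T3 using ijl by (simp add: p)
 ultimately show False using c by simp
qed

lemma kills_combination:
 "kills (c1 *s x + c2 *s y + c3 *s z) (T3 x y z)"
 by (intro kills_lin(1) kills_lin(2) kills_T3)

lemma relation_6:
 assumes "\<not> indep [x, y, z, x', y', z']"
 shows "\<exists>c :: nat \<Rightarrow> complex. (\<exists>i<6. c i \<noteq> 0) \<and>
  c 0 *s x + c 1 *s y + c 2 *s z + c 3 *s x' + c 4 *s y' + c 5 *s z' = 0"
 using indep_or_relation[of "[x, y, z, x', y', z']"] assms
 unfolding length_lists sum_less_numeral by simp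

lemma indep3_relation:
 assumes "T3 x y z \<noteq> 0" "a *s x + b *s y + c *s z = 0"
 shows "a = 0 \<and> b = 0 \<and> c = 0"
proof -
 obtain E where "dual [x, y, z] E" using assms(1) unfolding T3_nonzero_iff indep_def by blast
 then show ?thesis
  using arg_cong[OF assms(2), of "\<lambda>w. w \<cdot> E 0"] arg_cong[OF assms(2), of "\<lambda>w. w \<cdot> E 1"]
   arg_cong[OF assms(2), of "\<lambda>w. w \<cdot> E 2"] by (simp add: dual_3)
qed

lemma common_factor:
 assumes T: "T3 x y z \<noteq> 0" "T3 x' y' z' \<noteq> 0" and dep: "\<not> indep [x, y, z, x', y', z']"
 shows "\<exists>u c1 c2 c3. u \<noteq> 0 \<and> u = c1 *s x + c2 *s y + c3 *s z \<and> kills u (T3 x y z) \<and> kills u (T3 x' y' z')"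
proof -
 obtain c :: "nat \<Rightarrow> complex" where c: "\<exists>i<6. c i \<noteq> 0"
  "c 0 *s x + c 1 *s y + c 2 *s z + c 3 *s x' + c 4 *s y' + c 5 *s z' = 0" using relation_6[OF dep] by blast
 define u where "u = c 0 *s x + c 1 *s y + c 2 *s z"
 have u': "u = (- c 3) *s x' + (- c 4) *s y' + (- c 5) *s z'"
  using c(2) by (simp add: u_def vec_eq_iff eq_neg_iff_add_eq_0 algebra_simps)
 have "u \<noteq> 0"
 proof
  assume "u = 0"
  then have "c 0 = 0 \<and> c 1 = 0 \<and> c 2 = 0" "- c 3 = 0 \<and> - c 4 = 0 \<and> - c 5 = 0"
   using indep3_relation[OF T(1), of "c 0" "c 1" "c 2"] indep3_relation[OF T(2) u'[symmetric, unfolded \<open>u = 0\<close>]] \<open>u = 0\<close> unfolding u_def by blast+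
  then have "\<forall>i<6. c i = 0" unfolding all_less_numeral by simp
  then show False using c(1) by blast
 qed
 moreover have "kills u (T3 x y z)" "kills u (T3 x' y' z')"
  unfolding u_def by (rule kills_combination) (unfold u_def[symmetric] u', rule kills_combination)
 ultimately show ?thesis using u_def by blast
qed

text \<open>Here \<open>k\<close> has rank five and \<open>Bb k k\<close> is a nonzero multiple of \<open>v \<otimes> \<theta>\<close>, so the vanishing of \<open>Bb k k\<close> on the space
 puts it into the hyperplane of \<open>\<theta>\<close>.\<close>

lemma partially_decomposable_rank_one:
 assumes k: "alt k" "k \<noteq> 0" "kills u k" and u: "u \<noteq> 0" and nd: "\<And>a b c. k \<noteq> T3 a b c"
  and B0: "Bb k k x = 0" "Bb k k y = 0" "Bb k k z = 0" and uc: "u = c1 *s x + c2 *s y + c3 *s z"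
 shows "rank_one_type k x y z"
 using k(1,3) u
proof (cases rule: partially_decomposable_cases)
 case (1 a b)
 then show ?thesis using nd by blast
next
 case (2 a b a' b')
 define \<theta> where "\<theta> = vec_of (\<lambda>p. 24 * D6 p a b u a' b')"
 have \<theta>: "p \<cdot> \<theta> = 24 * D6 p a b u a' b'" for p
  using pair_vec_of[of "\<lambda>p. 24 * D6 p a b u a' b'" p] D6_lin(1)[of a b u a' b']
  by (simp add: \<theta>_def linear6_def pair_commute distrib_left)
 have B: "Bb k k p = (p \<cdot> \<theta>) *s u" for p using Bb_rank5[OF 2(2)] \<theta> by simp
 have "\<theta> \<noteq> 0"
 proof -
  obtain w where w: "indep [u, a, b, a', b', w]" using indep_extend[OF 2(1)] by auto
  then obtain E where E: "dual [u, a, b, a', b', w] E" by (auto simp: indep_def)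
  have "dual (map ((!) [u, a, b, a', b', w]) [5, 1, 2, 0, 3, 4]) (\<lambda>n. E ([5, 1, 2, 0, 3, 4] ! n))"
   by (rule indep_select[OF E]) auto
  then have "indep [w, a, b, u, a', b']" by (auto simp: indep_def)
  then have "D6 w a b u a' b' \<noteq> 0" unfolding D6_def by (intro Dl_indep) auto
  then show ?thesis using \<theta>[of w] by auto
 qed
 moreover have "contracts \<theta> k" unfolding 2(2) contracts_rank5_iff[OF 2(1)] using \<theta> by simp
 moreover have "x \<cdot> \<theta> = 0" "y \<cdot> \<theta> = 0" "z \<cdot> \<theta> = 0" using B0 u unfolding B vec.scale_eq_0_iff by blast+
 ultimately show ?thesis unfolding rank_one_type_def using B u uc k(3) by blast
qed

text \<open>If \<open>k\<close> is a difference of \<open>x \<and> y \<and> z\<close> and another decomposable trivector, the two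
 three-dimensional spaces are complementary, or \<open>k\<close> has a factor in the first one.\<close>

lemma classify_secant:
 assumes nz: "T3 x y z \<noteq> 0" and k: "k = T3 x y z - T3 x' y' z'" and nd: "\<And>a b c. k \<noteq> T3 a b c"
 shows "eigen_type k x y z \<or> rank_one_type k x y z"
proof -
 have k': "k = T3 x y z + T3 (- 1 *s x') y' z'" unfolding k by (rule tri_eqI) (simp add: tri_T3 algebra_simps)
 define w where "w = - 1 *s x'"
 note B = Bb_secant[OF k'[folded w_def]]
 show ?thesis
 proof (cases "indep [x, y, z, w, y', z']")
  case True
  then obtain E where E: "dual [x, y, z, w, y', z'] E" by (auto simp: indep_def)
  define \<Delta> where "\<Delta> = D6 x y z w y' z'"
  have \<Delta>: "\<Delta> \<noteq> 0" unfolding \<Delta>_def D6_def by (rule Dl_indep[OF _ True]) simp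
  have M: "Bb k k p + (12 * \<Delta>) *s p = (((24 * \<Delta>) *s E 0) \<cdot> p) *s x + (((24 * \<Delta>) *s E 1) \<cdot> p) *s y + (((24 * \<Delta>) *s E 2) \<cdot> p) *s z" for p
  proof -
   have p: "p = (p \<cdot> E 0) *s x + (p \<cdot> E 1) *s y + (p \<cdot> E 2) *s z + (p \<cdot> E 3) *s w + (p \<cdot> E 4) *s y' + (p \<cdot> E 5) *s z'" (is "p = ?q")
    using dual_expansion(1)[OF E, of p] by (simp add: sum_less_numeral)
   have "Bb k k ?q + (12 * \<Delta>) *s ?q = (24 * \<Delta> * (p \<cdot> E 0)) *s x + (24 * \<Delta> * (p \<cdot> E 1)) *s y + (24 * \<Delta> * (p \<cdot> E 2)) *s z"
    unfolding Bb_lin B \<Delta>_def[symmetric] by (simp add: vec_eq_iff algebra_simps)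
   then show ?thesis unfolding p[symmetric] by (simp add: pair_commute[of p])
  qed
  have "T3 ((24 * \<Delta>) *s E 0) ((24 * \<Delta>) *s E 1) ((24 * \<Delta>) *s E 2) \<noteq> 0"
   by (rule T3_dual_nonzero[OF E]) (use \<Delta> in auto)
  then show ?thesis using eigen_typeI[OF M] by blast
 next
  case False
  then have D0: "D6 x y z w y' z' = 0" unfolding D6_def by (intro Dl_dependent) auto
  have "T3 w y' z' \<noteq> 0" using nd k' unfolding w_def by (metis add.right_neutral)
  then obtain u c1 c2 c3 where u: "u \<noteq> 0" "u = c1 *s x + c2 *s y + c3 *s z" "kills u (T3 x y z)" "kills u (T3 w y' z')"
   using common_factor[OF nz _ False] by blast
  have "kills u k" unfolding k'[folded w_def] by (rule kills_lin(3)[OF u(3,4)])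
  moreover have "alt k" unfolding k by simp
  moreover have "k \<noteq> 0" using nd[of 0 0 0] by (simp add: T3_lin)
  moreover have "Bb k k x = 0" "Bb k k y = 0" "Bb k k z = 0" unfolding B D0 by simp_all
  ultimately have "rank_one_type k x y z" using partially_decomposable_rank_one[OF _ _ _ u(1) nd _ _ _ u(2)] by blast
  then show ?thesis by blast
 qed
qed

text \<open>If \<open>a, b, c\<close> complete \<open>x, y, z\<close> to a basis, the covariant maps them to multiples of \<open>x, y, z\<close>; otherwise a
 combination of \<open>x, y, z\<close> divides \<open>k\<close>.\<close>

lemma classify_tangent:
 assumes nz: "T3 x y z \<noteq> 0" and k: "k = T3 a y z + T3 x b z + T3 x y c" and nd: "\<And>a b c. k \<noteq> T3 a b c"
 shows "eigen_type k x y z \<or> rank_one_type k x y z"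
proof -
 note B = Bb_tangent[OF k]
 show ?thesis
 proof (cases "indep [a, y, c, x, b, z]")
  case True
  then obtain E where E: "dual [a, y, c, x, b, z] E" by (auto simp: indep_def)
  define \<Delta> where "\<Delta> = D6 a y c x b z"
  have \<Delta>: "\<Delta> \<noteq> 0" unfolding \<Delta>_def D6_def by (rule Dl_indep[OF _ True]) simp
  have M: "Bb k k p + 0 *s p = (((24 * \<Delta>) *s E 0) \<cdot> p) *s x + (((24 * \<Delta>) *s E 4) \<cdot> p) *s y + (((24 * \<Delta>) *s E 2) \<cdot> p) *s z" for p
  proof -
   have p: "p = (p \<cdot> E 0) *s a + (p \<cdot> E 1) *s y + (p \<cdot> E 2) *s c + (p \<cdot> E 3) *s x + (p \<cdot> E 4) *s b + (p \<cdot> E 5) *s z" (is "p = ?q")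
    using dual_expansion(1)[OF E, of p] by (simp add: sum_less_numeral)
   have "Bb k k ?q = (24 * \<Delta> * (p \<cdot> E 0)) *s x + (24 * \<Delta> * (p \<cdot> E 4)) *s y + (24 * \<Delta> * (p \<cdot> E 2)) *s z"
    unfolding Bb_lin B \<Delta>_def[symmetric] by (simp add: vec_eq_iff algebra_simps)
   then show ?thesis unfolding p[symmetric] by (simp add: pair_commute[of p])
  qed
  have "T3 ((24 * \<Delta>) *s E 0) ((24 * \<Delta>) *s E 4) ((24 * \<Delta>) *s E 2) \<noteq> 0"
   by (rule T3_dual_nonzero[OF E]) (use \<Delta> in auto)
  then show ?thesis using eigen_typeI[OF M] by blast
 next
  case False
  obtain d :: "nat \<Rightarrow> complex" where d: "\<exists>i<6. d i \<noteq> 0"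
   "d 0 *s a + d 1 *s y + d 2 *s c + d 3 *s x + d 4 *s b + d 5 *s z = 0" using relation_6[OF False] by blast
  define u where "u = d 0 *s x + d 4 *s y + d 2 *s z"
  have rel: "d 0 *s a + d 4 *s b + d 2 *s c = (- d 3) *s x + (- d 1) *s y + (- d 5) *s z"
   using d(2) by (simp add: vec_eq_iff eq_neg_iff_add_eq_0 algebra_simps)
  have "u \<noteq> 0"
  proof
   assume "u = 0"
   then have 1: "d 0 = 0 \<and> d 4 = 0 \<and> d 2 = 0" using indep3_relation[OF nz] unfolding u_def by blast
   then have "(- d 3) *s x + (- d 1) *s y + (- d 5) *s z = 0" using rel by simp
   then have "- d 3 = 0 \<and> - d 1 = 0 \<and> - d 5 = 0" by (rule indep3_relation[OF nz])
   then have "\<forall>i<6. d i = 0" using 1 unfolding all_less_numeral by simp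
   then show False using d(1) by blast
  qed
  moreover have "kills u k"
  proof -
   have "w4 x (T3 a y z) p q r s = - w4 a (T3 x y z) p q r s" "w4 y (T3 x b z) p q r s = - w4 b (T3 x y z) p q r s"
    "w4 z (T3 x y c) p q r s = - w4 c (T3 x y z) p q r s" for p q r s
    by (simp_all add: w4_def tri_T3 algebra_simps)
   then have "w4 x k p q r s = - w4 a (T3 x y z) p q r s" "w4 y k p q r s = - w4 b (T3 x y z) p q r s"
    "w4 z k p q r s = - w4 c (T3 x y z) p q r s" for p q r s
    using kills_T3 unfolding k kills_def by simp_all
   then have "w4 u k p q r s = - w4 (d 0 *s a + d 4 *s b + d 2 *s c) (T3 x y z) p q r s" for p q r s
    unfolding u_def by simp
   moreover have "kills (d 0 *s a + d 4 *s b + d 2 *s c) (T3 x y z)" unfolding rel by (rule kills_combination)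
   ultimately show ?thesis by (simp add: kills_def del: w4_lin)
  qed
  moreover have "alt k" unfolding k by simp
  moreover have "k \<noteq> 0" using nd[of 0 0 0] by (simp add: T3_lin)
  ultimately have "rank_one_type k x y z" using partially_decomposable_rank_one[OF _ _ _ _ nd B(1-3) u_def] by blast
  then show ?thesis by blast
 qed
qed

section \<open>Parameter counts\<close>

lemma differentiable_vecI:
 fixes f :: "'a::euclidean_space \<Rightarrow> complex ^ 'n"
 assumes "\<And>i. (\<lambda>x. f x $ i) differentiable at x"
 shows "f differentiable at x"
proof -
 obtain f' where "\<And>i. ((\<lambda>x. f x $ i) has_derivative f' i) (at x)"
  using assms unfolding differentiable_def by metis
 then have "((\<lambda>x. \<chi> i. f x $ i) has_derivative (\<lambda>h. \<chi> i. f' i h)) (at x)"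
  by (rule has_derivative_vec_lambda)
 then show ?thesis by (auto simp: differentiable_def)
qed

lemma differentiable_nth:
 assumes "f differentiable F" shows "(\<lambda>x. (f x :: 'b::real_normed_vector ^ 'n) $ i) differentiable F"
 using assms bounded_linear.has_derivative[OF bounded_linear_vec_nth] unfolding differentiable_def by blast

lemma differentiable_Pair:
 "f differentiable at x \<Longrightarrow> g differentiable at x \<Longrightarrow> (\<lambda>x. (f x, g x)) differentiable at x"
 unfolding differentiable_def by (blast intro: has_derivative_Pair)

lemma differentiable_fst: "h differentiable F \<Longrightarrow> (\<lambda>x. fst (h x)) differentiable F"
 unfolding differentiable_def by (blast intro: has_derivative_fst)

lemma differentiable_snd: "h differentiable F \<Longrightarrow> (\<lambda>x. snd (h x)) differentiable F"
 unfolding differentiable_def by (blast intro: has_derivative_snd)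

lemmas differentiable_pair = differentiable_Pair differentiable_fst differentiable_snd

lemma differentiable_scale:
 fixes f :: "'a::euclidean_space \<Rightarrow> complex ^ 'n"
 shows "c differentiable at x \<Longrightarrow> f differentiable at x \<Longrightarrow> (\<lambda>x. c x *s f x) differentiable at x"
 by (rule differentiable_vecI) (simp add: differentiable_nth)

lemma differentiable_Bb:
 fixes k :: "'a::euclidean_space \<Rightarrow> trivec"
 assumes "k differentiable at x"
 shows "(\<lambda>x. Bb (k x) (k x) p) differentiable at x"
 unfolding Bb_def cof_def
 by (rule differentiable_vecI, unfold vec_lambda_beta) (intro differentiable_sum differentiable_mult ballI finite differentiable_const differentiable_nth assms)

lemma differentiable_combination:
 fixes w :: "'a::euclidean_space \<Rightarrow> complex ^ 'm" and b :: "'m::finite \<Rightarrow> complex ^ 'n"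
 shows "w differentiable at x \<Longrightarrow> (\<lambda>x. \<Sum>i\<in>UNIV. w x $ i *s b i) differentiable at x"
 by (intro differentiable_sum ballI finite differentiable_scale differentiable_nth differentiable_const)

lemma differentiable_comb3:
 fixes g :: "'a::euclidean_space \<Rightarrow> complex ^ 3"
 shows "g differentiable at x \<Longrightarrow> a differentiable at x \<Longrightarrow> b differentiable at x \<Longrightarrow> c differentiable at x \<Longrightarrow>
  (\<lambda>x. comb3 (g x) (a x) (b x) (c x)) differentiable at x"
 unfolding comb3_def by (intro differentiable_add differentiable_scale differentiable_nth)

lemma differentiable_everywhere:
 "(\<And>x. f differentiable at x) \<Longrightarrow> f differentiable_on S"
 by (simp add: differentiable_at_imp_differentiable_on)

lemma negligible_Times_UNIV:
 fixes Z :: "'a::euclidean_space set"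
 assumes "negligible Z" shows "negligible (Z \<times> (UNIV :: 'b::euclidean_space set))"
proof -
 obtain N where N: "N \<in> null_sets lborel" "Z \<subseteq> N"
  using assms unfolding negligible_iff_null_sets null_sets_completion_iff2 by blast
 have "N \<times> (UNIV :: 'b set) \<in> null_sets (lborel \<Otimes>\<^sub>M lborel)"
 proof (rule null_setsI)
  show "emeasure (lborel \<Otimes>\<^sub>M lborel) (N \<times> (UNIV :: 'b set)) = 0"
   using N(1) by (subst lborel.emeasure_pair_measure_Times) (auto simp: null_sets_def)
  show "N \<times> (UNIV :: 'b set) \<in> sets (lborel \<Otimes>\<^sub>M lborel)" using N(1) by (intro pair_measureI) auto
 qed
 then have "N \<times> (UNIV :: 'b set) \<in> null_sets lborel" by (simp add: lborel_prod)
 then show ?thesis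
  unfolding negligible_iff_null_sets null_sets_completion_iff2 by (rule bexI[rotated]) (use N(2) in auto)
qed

text \<open>By Fubini, the slices being finite and hence null sets.\<close>

lemma negligible_finite_slices:
 fixes Z :: "('a::euclidean_space \<times> 'b::euclidean_space) set"
 assumes "closed Z" and fin: "\<And>w. finite {c. (w, c) \<in> Z}"
 shows "negligible Z"
proof -
 have Z: "Z \<in> sets (lborel \<Otimes>\<^sub>M lborel)"
  unfolding lborel_prod sets_lborel by (rule borel_closed[OF assms(1)])
 have "emeasure lborel (Pair w -` Z) = 0" for w
  using fin[of w] by (intro emeasure_lborel_countable countable_finite) (simp add: vimage_def)
 then have "emeasure (lborel \<Otimes>\<^sub>M lborel) Z = 0"
  by (simp add: lborel.emeasure_pair_measure_alt[OF Z])
 then have "Z \<in> null_sets (lborel \<Otimes>\<^sub>M lborel)" using Z by (simp add: null_sets_def)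
 then have "Z \<in> null_sets lborel" by (simp add: lborel_prod)
 then show ?thesis unfolding negligible_iff_null_sets null_sets_completion_iff2 by blast
qed

lemma negligible_eigen_type:
 fixes b :: "6 \<Rightarrow> trivec"
 shows "negligible {(x, y, z). \<exists>\<zeta> :: complex ^ 6. eigen_type (\<Sum>i\<in>UNIV. \<zeta> $ i *s b i) x y z}"
proof -
 define F :: "6 \<Rightarrow> 6 \<Rightarrow> 6 \<Rightarrow> ((complex ^ 6) \<times> complex) \<times> (complex ^ 3 ^ 3) \<Rightarrow> vec6 \<times> vec6 \<times> vec6" where
  "F j1 j2 j3 = (\<lambda>p. let k = (\<Sum>i\<in>UNIV. fst (fst p) $ i *s b i); r = (\<lambda>j. Bb k k (axis j 1) + snd (fst p) *s axis j 1) in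
    (comb3 (snd p $ 1) (r j1) (r j2) (r j3), comb3 (snd p $ 2) (r j1) (r j2) (r j3), comb3 (snd p $ 3) (r j1) (r j2) (r j3)))" for j1 j2 j3
 have "negligible (range (F j1 j2 j3))" for j1 j2 j3
 proof (rule negligible_differentiable_image_lowdim)
  \<comment> \<open>Six parameters for \<open>k\<close>, one for the eigenvalue and nine coefficients: \<open>16\<close> complex dimensions against \<open>18\<close>.\<close>
  show "DIM(((complex ^ 6) \<times> complex) \<times> (complex ^ 3 ^ 3)) < DIM(vec6 \<times> vec6 \<times> vec6)" by simp
  show "F j1 j2 j3 differentiable_on UNIV"
   unfolding F_def Let_def
   by (rule differentiable_everywhere)
    (intro differentiable_pair differentiable_comb3 differentiable_nth differentiable_add differentiable_Bb differentiable_combination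
     differentiable_scale differentiable_ident differentiable_const)
 qed
 then have "negligible (\<Union>j1. \<Union>j2. \<Union>j3. range (F j1 j2 j3))" by (auto intro!: negligible_Union)
 moreover have "{(x, y, z). \<exists>\<zeta> :: complex ^ 6. eigen_type (\<Sum>i\<in>UNIV. \<zeta> $ i *s b i) x y z} \<subseteq> (\<Union>j1. \<Union>j2. \<Union>j3. range (F j1 j2 j3))"
 proof clarify
  fix x y z and \<zeta> :: "complex ^ 6"
  assume "eigen_type (\<Sum>i\<in>UNIV. \<zeta> $ i *s b i) x y z"
  then obtain s j1 j2 j3 where H: "\<And>w. w \<in> {x, y, z} \<Longrightarrow> \<exists>g. w = comb3 g (eigen_row (\<Sum>i\<in>UNIV. \<zeta> $ i *s b i) s j1)
    (eigen_row (\<Sum>i\<in>UNIV. \<zeta> $ i *s b i) s j2) (eigen_row (\<Sum>i\<in>UNIV. \<zeta> $ i *s b i) s j3)"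
   unfolding eigen_type_def by blast
  define C where "C g = comb3 g (eigen_row (\<Sum>i\<in>UNIV. \<zeta> $ i *s b i) s j1)
    (eigen_row (\<Sum>i\<in>UNIV. \<zeta> $ i *s b i) s j2) (eigen_row (\<Sum>i\<in>UNIV. \<zeta> $ i *s b i) s j3)" for g
  obtain g1 g2 g3 where g: "x = C g1" "y = C g2" "z = C g3"
   using H[of x] H[of y] H[of z] unfolding C_def by auto
  have "(x, y, z) = F j1 j2 j3 ((\<zeta>, s), \<chi> i. if i = 1 then g1 else if i = 2 then g2 else g3)"
   unfolding F_def Let_def g C_def eigen_row_def by simp
  then show "(x, y, z) \<in> (\<Union>j1. \<Union>j2. \<Union>j3. range (F j1 j2 j3))" by blast
 qed
 ultimately show ?thesis by (rule negligible_subset)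
qed

subsection \<open>Three-dimensional subspaces of a hyperplane through a given line\<close>

lemma tri_restricted:
 assumes "contracts \<theta> k" "\<theta> $ a \<noteq> 0" "alt k" "k \<noteq> 0"
 shows "\<exists>i j l. i \<noteq> a \<and> j \<noteq> a \<and> l \<noteq> a \<and> k $ (i, j, l) \<noteq> 0"
proof (rule ccontr)
 assume n: "\<not> ?thesis"
 define P where "P u = u - (u $ a / \<theta> $ a) *s \<theta>" for u :: vec6
 have Pa: "P u $ a = 0" for u using assms(2) by (simp add: P_def)
 have c1: "tri k \<theta> v w = 0" for v w using assms(1) by (simp add: contracts_def)
 have c2: "tri k v \<theta> w = 0" for v w using c1 tri_swap(1)[OF assms(3), of v \<theta> w] by simp
 have c3: "tri k v w \<theta> = 0" for v w using c2 tri_swap(2)[OF assms(3), of v \<theta> w] by simp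
 have "tri k u v w = 0" for u v w
 proof -
  have "tri k u v w = tri k (P u) (P v) (P w)" by (simp add: P_def c1 c2 c3)
  also have "\<dots> = 0" unfolding tri_def
  proof (rule sum.neutral, rule ballI)
   fix q :: "6 \<times> 6 \<times> 6"
   obtain i j l where q: "q = (i, j, l)" by (cases q)
   have "i = a \<or> j = a \<or> l = a \<or> k $ (i, j, l) = 0" using n by blast
   then show "k $ q * (P u $ fst q * P v $ fst (snd q) * P w $ snd (snd q)) = 0" using Pa q by auto
  qed
  finally show ?thesis .
 qed
 then show False using assms(4) tri_eqI[of k 0] by simp
qed

text \<open>A vector with prescribed coordinates \<open>l, l3, l4\<close>, completed along \<open>axis a 1\<close> to one that \<open>\<theta>\<close> annihilates.\<close>

definition hyper_vec :: "vec6 \<Rightarrow> 6 \<Rightarrow> 6 \<Rightarrow> 6 \<Rightarrow> 6 \<Rightarrow> complex \<Rightarrow> complex \<Rightarrow> vec6" where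
 "hyper_vec \<theta> a l l3 l4 h h' = \<theta> $ a *s (axis l 1 + h *s axis l3 1 + h' *s axis l4 1)
   - (\<theta> $ l + h * \<theta> $ l3 + h' * \<theta> $ l4) *s axis a 1"

lemma hyper_vecI:
 assumes d: "distinct [a, l0, l1, l2, l3, l4]" and X: "X $ l0 = 0" "X $ l1 = 1" "X $ l2 = 0" "X \<cdot> \<theta> = 0" and a: "\<theta> $ a \<noteq> 0"
 shows "X = (1 / \<theta> $ a) *s hyper_vec \<theta> a l1 l3 l4 (X $ l3) (X $ l4)"
proof -
 have n: "a \<noteq> l0" "a \<noteq> l1" "a \<noteq> l2" "a \<noteq> l3" "a \<noteq> l4" "l0 \<noteq> l1" "l0 \<noteq> l2" "l0 \<noteq> l3" "l0 \<noteq> l4"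
  "l1 \<noteq> l2" "l1 \<noteq> l3" "l1 \<noteq> l4" "l2 \<noteq> l3" "l2 \<noteq> l4" "l3 \<noteq> l4" using d by simp_all
 have U: "(UNIV :: 6 set) = set [a, l0, l1, l2, l3, l4]"
  using d by (intro card_subset_eq[symmetric]) (auto simp: distinct_card simp del: set_simps)
 have s: "(\<Sum>i\<in>UNIV. f i) = f a + f l0 + f l1 + f l2 + f l3 + f l4" for f :: "6 \<Rightarrow> complex"
  unfolding U using d by (simp add: add.assoc)
 have "X $ a * \<theta> $ a + \<theta> $ l1 + X $ l3 * \<theta> $ l3 + X $ l4 * \<theta> $ l4 = 0"
  using X(4) unfolding pair_def s X by simp
 then have Xa: "X $ a = - (\<theta> $ l1 + X $ l3 * \<theta> $ l3 + X $ l4 * \<theta> $ l4) / \<theta> $ a"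
  using a by (simp add: field_simps eq_neg_iff_add_eq_0)
 have "X $ i = ((1 / \<theta> $ a) *s hyper_vec \<theta> a l1 l3 l4 (X $ l3) (X $ l4)) $ i" for i
 proof -
  have "i \<in> set [a, l0, l1, l2, l3, l4]" using U by blast
  then consider "i = a" | "i = l0" | "i = l1" | "i = l2" | "i = l3" | "i = l4" by auto
  then show ?thesis
   using n by cases (simp_all add: hyper_vec_def axis_def X(1-3) Xa a add_divide_distrib diff_divide_distrib)
 qed
 then show ?thesis unfolding vec_eq_iff by (rule allI)
qed

text \<open>Echelon form of a three-dimensional space with \<open>v\<close> inside and \<open>\<theta>\<close> vanishing on it: the four parameters are the
 coordinates on the Grassmannian of planes in the four-dimensional quotient.\<close>

lemma hyperplane_pivot:
 assumes T: "T3 v y z \<noteq> 0" and \<theta>: "\<theta> \<noteq> 0" "v \<cdot> \<theta> = 0" "y \<cdot> \<theta> = 0" "z \<cdot> \<theta> = 0"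
 shows "\<exists>a l1 l2 l3 l4 h1 h2 h3 h4. \<theta> $ a \<noteq> 0 \<and> (\<forall>w\<in>{v, y, z}. \<exists>c1 c2 c3.
  w = c1 *s v + c2 *s hyper_vec \<theta> a l1 l3 l4 h1 h2 + c3 *s hyper_vec \<theta> a l2 l3 l4 h3 h4)"
proof -
 obtain a where a: "\<theta> $ a \<noteq> 0" using \<theta>(1) by (auto simp: vec_eq_iff)
 let ?k = "T3 v y z"
 have e: "?k $ (i, j, l) = v $ i * (y $ j * z $ l - y $ l * z $ j) - v $ j * (y $ i * z $ l - y $ l * z $ i)
   + v $ l * (y $ i * z $ j - y $ j * z $ i)" for i j l
  using tri_axis[of ?k i j l] by (simp add: tri_T3 algebra_simps)
 have "contracts \<theta> ?k" using \<theta> by (simp add: contracts_def tri_T3)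
 then obtain i j l where ijl: "i \<noteq> a" "j \<noteq> a" "l \<noteq> a" "?k $ (i, j, l) \<noteq> 0"
  using tri_restricted[OF _ a alt_T3 T] by blast
 have "\<exists>l0 l1 l2. l0 \<noteq> a \<and> l1 \<noteq> a \<and> l2 \<noteq> a \<and> v $ l0 \<noteq> 0 \<and> ?k $ (l0, l1, l2) \<noteq> 0"
 proof -
  have "v $ i \<noteq> 0 \<or> v $ j \<noteq> 0 \<or> v $ l \<noteq> 0" using ijl(4) unfolding e by auto
  moreover have "?k $ (j, i, l) \<noteq> 0" "?k $ (l, j, i) \<noteq> 0"
   using ijl(4) altD[OF alt_T3[of v y z]] by (metis neg_equal_0_iff_equal)+
  ultimately show ?thesis using ijl by blast
 qed
 then obtain l0 l1 l2 where l: "l0 \<noteq> a" "l1 \<noteq> a" "l2 \<noteq> a" "v $ l0 \<noteq> 0" "?k $ (l0, l1, l2) \<noteq> 0" by blast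
 have l': "l0 \<noteq> l1" "l1 \<noteq> l2" "l0 \<noteq> l2" using l(5) unfolding e by (auto simp: algebra_simps)
 have "card (UNIV - {a, l0, l1, l2}) = 2" using l l' by (subst card_Diff_subset) auto
 then obtain l3 l4 where l34: "UNIV - {a, l0, l1, l2} = {l3, l4}" "l3 \<noteq> l4" by (auto simp: card_2_iff)
 have d: "distinct [a, l0, l1, l2, l3, l4]" using l l' l34 by auto
 then have d': "distinct [a, l0, l2, l1, l3, l4]" by auto
 define y' where "y' = y - (y $ l0 / v $ l0) *s v"
 define z' where "z' = z - (z $ l0 / v $ l0) *s v"
 define M where "M = y' $ l1 * z' $ l2 - y' $ l2 * z' $ l1"
 have y0: "y' $ l0 = 0" "z' $ l0 = 0" using l(4) by (simp_all add: y'_def z'_def)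
 have "v $ l0 * M = ?k $ (l0, l1, l2)" unfolding M_def y'_def z'_def e using l(4) by (simp add: field_simps)
 then have M: "M \<noteq> 0" using l(5) by auto
 define Y1 where "Y1 = (z' $ l2 / M) *s y' - (y' $ l2 / M) *s z'"
 define Y2 where "Y2 = (y' $ l1 / M) *s z' - (z' $ l1 / M) *s y'"
 have Y: "Y1 $ l0 = 0" "Y1 $ l1 = 1" "Y1 $ l2 = 0" "Y2 $ l0 = 0" "Y2 $ l2 = 1" "Y2 $ l1 = 0"
 proof -
  have "Y1 $ l1 = (y' $ l1 * z' $ l2 - y' $ l2 * z' $ l1) / M" "Y2 $ l2 = (y' $ l1 * z' $ l2 - y' $ l2 * z' $ l1) / M"
   by (simp_all add: Y1_def Y2_def diff_divide_distrib mult.commute)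
  then show "Y1 $ l1 = 1" "Y2 $ l2 = 1" using M unfolding M_def[symmetric] by simp_all
 qed (simp_all add: Y1_def Y2_def y0 mult.commute)
 have p: "Y1 \<cdot> \<theta> = 0" "Y2 \<cdot> \<theta> = 0" using \<theta> by (simp_all add: Y1_def Y2_def y'_def z'_def pair_simps)
 note H1 = hyper_vecI[OF d Y(1,2,3) p(1) a] and H2 = hyper_vecI[OF d' Y(4,5,6) p(2) a]
 define h where "h = hyper_vec \<theta> a l1 l3 l4 (Y1 $ l3) (Y1 $ l4)"
 define h' where "h' = hyper_vec \<theta> a l2 l3 l4 (Y2 $ l3) (Y2 $ l4)"
 have Hh: "Y1 = (1 / \<theta> $ a) *s h" "Y2 = (1 / \<theta> $ a) *s h'" unfolding h_def h'_def by (fact H1, fact H2)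
 have "y' = (y' $ l1) *s Y1 + (y' $ l2) *s Y2"
 proof -
  have "(y' $ l1) *s Y1 + (y' $ l2) *s Y2 = ((y' $ l1 * z' $ l2 - y' $ l2 * z' $ l1) / M) *s y'"
   by (simp add: Y1_def Y2_def vec_eq_iff algebra_simps diff_divide_distrib)
  then show ?thesis using M unfolding M_def[symmetric] by simp
 qed
 then have "y = (y $ l0 / v $ l0) *s v + ((y' $ l1) *s Y1 + (y' $ l2) *s Y2)"
  unfolding y'_def[symmetric] by (metis y'_def add.commute diff_add_cancel)
 then have y: "y = (y $ l0 / v $ l0) *s v + (y' $ l1 / \<theta> $ a) *s h + (y' $ l2 / \<theta> $ a) *s h'"
  unfolding Hh by (simp add: vec.scale_scale add.assoc)
 have "z' = (z' $ l1) *s Y1 + (z' $ l2) *s Y2"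
 proof -
  have "(z' $ l1) *s Y1 + (z' $ l2) *s Y2 = ((y' $ l1 * z' $ l2 - y' $ l2 * z' $ l1) / M) *s z'"
   by (simp add: Y1_def Y2_def vec_eq_iff algebra_simps diff_divide_distrib)
  then show ?thesis using M unfolding M_def[symmetric] by simp
 qed
 then have "z = (z $ l0 / v $ l0) *s v + ((z' $ l1) *s Y1 + (z' $ l2) *s Y2)"
  unfolding z'_def[symmetric] by (metis z'_def add.commute diff_add_cancel)
 then have z: "z = (z $ l0 / v $ l0) *s v + (z' $ l1 / \<theta> $ a) *s h + (z' $ l2 / \<theta> $ a) *s h'"
  unfolding Hh by (simp add: vec.scale_scale add.assoc)
 have "v = 1 *s v + 0 *s h + 0 *s h'" by simp
 then have "\<forall>w\<in>{v, y, z}. \<exists>c1 c2 c3. w = c1 *s v + c2 *s h + c3 *s h'" using y z by blast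
 then show ?thesis using a unfolding h_def h'_def by blast
qed

text \<open>Since \<open>Bb k k\<close> is a multiple of \<open>v \<otimes> \<theta>\<close>, the covector \<open>\<theta>\<close> can be taken to be one of its rows, which depend
 differentiably on \<open>k\<close>.\<close>

definition cov_row :: "trivec \<Rightarrow> 6 \<Rightarrow> vec6" where
 "cov_row k c = (\<chi> p. Bb k k (axis p 1) $ c)"

lemma rank_one_chart:
 assumes R: "rank_one_type k x y z" and T: "T3 x y z \<noteq> 0"
 shows "\<exists>a c l1 l2 l3 l4. \<exists>h :: complex ^ 4. \<forall>w\<in>{x, y, z}. \<exists>g. w = comb3 g (Bb k k (axis a 1))
  (hyper_vec (cov_row k c) a l1 l3 l4 (h $ 1) (h $ 2)) (hyper_vec (cov_row k c) a l2 l3 l4 (h $ 3) (h $ 4))"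
proof -
 obtain v \<theta> c1 c2 c3 where v: "v \<noteq> 0" and \<theta>: "\<theta> \<noteq> 0" "x \<cdot> \<theta> = 0" "y \<cdot> \<theta> = 0" "z \<cdot> \<theta> = 0" and
  B: "\<And>p. Bb k k p = (p \<cdot> \<theta>) *s v" and vx: "v = c1 *s x + c2 *s y + c3 *s z"
  using R unfolding rank_one_type_def by blast
 obtain c where c: "v $ c \<noteq> 0" using v by (auto simp: vec_eq_iff)
 have row: "cov_row k c = v $ c *s \<theta>" by (simp add: cov_row_def B vec_eq_iff pair_axis mult.commute)
 have v\<theta>: "v \<cdot> cov_row k c = 0" unfolding row vx by (simp add: pair_simps \<theta>)
 have \<theta>': "cov_row k c \<noteq> 0" "x \<cdot> cov_row k c = 0" "y \<cdot> cov_row k c = 0" "z \<cdot> cov_row k c = 0"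
  using \<theta> c by (simp_all add: row pair_simps vec.scale_eq_0_iff)
 have "\<exists>a l1 l2 l3 l4 h1 h2 h3 h4. cov_row k c $ a \<noteq> 0 \<and> (\<forall>w\<in>{x, y, z}. \<exists>c1 c2 c3.
  w = c1 *s v + c2 *s hyper_vec (cov_row k c) a l1 l3 l4 h1 h2 + c3 *s hyper_vec (cov_row k c) a l2 l3 l4 h3 h4)"
 proof -
  have main: "\<exists>a l1 l2 l3 l4 h1 h2 h3 h4. cov_row k c $ a \<noteq> 0 \<and> (\<forall>w\<in>{x, y, z}. \<exists>c1 c2 c3.
   w = c1 *s v + c2 *s hyper_vec (cov_row k c) a l1 l3 l4 h1 h2 + c3 *s hyper_vec (cov_row k c) a l2 l3 l4 h3 h4)"
   if t: "T3 v y z \<noteq> 0" "y \<cdot> cov_row k c = 0" "z \<cdot> cov_row k c = 0" "x = d1 *s v + d2 *s y + d3 *s z" for x y z d1 d2 d3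
  proof -
   obtain a l1 l2 l3 l4 h1 h2 h3 h4 where a: "cov_row k c $ a \<noteq> 0" and
    w: "\<And>w. w \<in> {v, y, z} \<Longrightarrow> \<exists>c1 c2 c3. w = c1 *s v + c2 *s hyper_vec (cov_row k c) a l1 l3 l4 h1 h2
     + c3 *s hyper_vec (cov_row k c) a l2 l3 l4 h3 h4"
    using hyperplane_pivot[OF t(1) \<theta>'(1) v\<theta> t(2,3)] by blast
   define Y Y' where "Y = hyper_vec (cov_row k c) a l1 l3 l4 h1 h2" and "Y' = hyper_vec (cov_row k c) a l2 l3 l4 h3 h4"
   obtain a1 a2 a3 b1 b2 b3 where yz: "y = a1 *s v + a2 *s Y + a3 *s Y'" "z = b1 *s v + b2 *s Y + b3 *s Y'"
    using w[of y] w[of z] unfolding Y_def Y'_def by blast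
   have "x = (d1 + d2 * a1 + d3 * b1) *s v + (d2 * a2 + d3 * b2) *s Y + (d2 * a3 + d3 * b3) *s Y'"
    unfolding t(4) by (subst yz(1), subst yz(2)) (simp add: vec_eq_iff algebra_simps)
   then have "\<forall>w\<in>{x, y, z}. \<exists>c1 c2 c3. w = c1 *s v + c2 *s Y + c3 *s Y'" using yz by blast
   then show ?thesis using a unfolding Y_def Y'_def by blast
  qed
  have "c1 \<noteq> 0 \<or> c2 \<noteq> 0 \<or> c3 \<noteq> 0" using v vx by auto
  then consider "c1 \<noteq> 0" | "c2 \<noteq> 0" | "c3 \<noteq> 0" by blast
  then show ?thesis
  proof cases
   case 1
   have "T3 v y z = c1 *s T3 x y z" unfolding vx T3_lin by simp
   then have "T3 v y z \<noteq> 0" using 1 T by (simp add: vec.scale_eq_0_iff)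
   moreover have "x = (1 / c1) *s v + (- c2 / c1) *s y + (- c3 / c1) *s z"
    using 1 by (simp add: vx vec_eq_iff field_simps)
   ultimately show ?thesis using main[of y z x] \<theta>' by blast
  next
   case 2
   have "T3 v x z = - c2 *s T3 x y z" unfolding vx T3_lin by (simp add: T3_swap(1)[of y x z])
   then have "T3 v x z \<noteq> 0" using 2 T by (simp add: vec.scale_eq_0_iff)
   moreover have "y = (1 / c2) *s v + (- c1 / c2) *s x + (- c3 / c2) *s z"
    using 2 by (simp add: vx vec_eq_iff field_simps)
   ultimately show ?thesis using main[of x z y] \<theta>' unfolding insert_commute[of y x] by blast
  next
   case 3
   have "T3 z x y = T3 x y z" using T3_swap(1)[of z x y] T3_swap(2)[of x z y] by simp
   then have "T3 v x y = c3 *s T3 x y z" unfolding vx T3_lin by simp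
   then have "T3 v x y \<noteq> 0" using 3 T by (simp add: vec.scale_eq_0_iff)
   moreover have "z = (1 / c3) *s v + (- c1 / c3) *s x + (- c2 / c3) *s y"
    using 3 by (simp add: vx vec_eq_iff field_simps)
   moreover have "{z, x, y} = {x, y, z}" by blast
   ultimately show ?thesis using main[of x y z] \<theta>' by metis
  qed
 qed
 then obtain a l1 l2 l3 l4 h1 h2 h3 h4 where a: "cov_row k c $ a \<noteq> 0" and
  w: "\<And>w. w \<in> {x, y, z} \<Longrightarrow> \<exists>c1 c2 c3. w = c1 *s v + c2 *s hyper_vec (cov_row k c) a l1 l3 l4 h1 h2
   + c3 *s hyper_vec (cov_row k c) a l2 l3 l4 h3 h4" by blast
 have \<theta>a: "\<theta> $ a \<noteq> 0" using a by (simp add: row)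
 have Ba: "Bb k k (axis a 1) = \<theta> $ a *s v" by (simp add: B pair_axis)
 define h :: "complex ^ 4" where "h = (\<chi> i. if i = 1 then h1 else if i = 2 then h2 else if i = 3 then h3 else h4)"
 have h: "h $ 1 = h1" "h $ 2 = h2" "h $ 3 = h3" "h $ 4 = h4" by (simp_all add: h_def)
 have "\<exists>g. w = comb3 g (Bb k k (axis a 1))
  (hyper_vec (cov_row k c) a l1 l3 l4 (h $ 1) (h $ 2)) (hyper_vec (cov_row k c) a l2 l3 l4 (h $ 3) (h $ 4))" if w': "w \<in> {x, y, z}" for w
 proof -
  obtain e1 e2 e3 where e: "w = e1 *s v + e2 *s hyper_vec (cov_row k c) a l1 l3 l4 h1 h2
   + e3 *s hyper_vec (cov_row k c) a l2 l3 l4 h3 h4" using w[OF w'] by blast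
  show ?thesis
   by (rule exI[of _ "\<chi> i. if i = 1 then e1 / \<theta> $ a else if i = 2 then e2 else e3"])
    (use \<theta>a in \<open>simp add: comb3_def h Ba e\<close>)
 qed
 then show ?thesis by blast
qed

text \<open>Five parameters for \<open>k\<close>, four for the space and nine for a basis of it: as many as there are coordinates. So
 nothing is gained from dimensions, and the parameters of \<open>k\<close> must themselves run over a null set.\<close>

lemma negligible_rank_one_type:
 fixes Z :: "((complex ^ 4) \<times> complex) set" and C :: "4 \<Rightarrow> trivec"
 assumes Z: "negligible Z"
 shows "negligible {(x, y, z). T3 x y z \<noteq> 0 \<and> (\<exists>(w, c)\<in>Z. rank_one_type (A + c *s B + (\<Sum>i\<in>UNIV. w $ i *s C i)) x y z)}"
proof -
 define \<kappa> :: "(((complex ^ 4) \<times> complex) \<times> (complex ^ 4)) \<times> (complex ^ 3 ^ 3) \<Rightarrow> trivec" where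
  "\<kappa> = (\<lambda>p. A + snd (fst (fst p)) *s B + (\<Sum>i\<in>UNIV. fst (fst (fst p)) $ i *s C i))"
 define F :: "6 \<times> 6 \<times> 6 \<times> 6 \<times> 6 \<times> 6 \<Rightarrow> (((complex ^ 4) \<times> complex) \<times> (complex ^ 4)) \<times> (complex ^ 3 ^ 3) \<Rightarrow> vec6 \<times> vec6 \<times> vec6" where
  "F = (\<lambda>(a, c, l1, l2, l3, l4) p. let v = Bb (\<kappa> p) (\<kappa> p) (axis a 1);
    r = hyper_vec (cov_row (\<kappa> p) c) a l1 l3 l4 (snd (fst p) $ 1) (snd (fst p) $ 2);
    r' = hyper_vec (cov_row (\<kappa> p) c) a l2 l3 l4 (snd (fst p) $ 3) (snd (fst p) $ 4) in
    (comb3 (snd p $ 1) v r r', comb3 (snd p $ 2) v r r', comb3 (snd p $ 3) v r r'))"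
 have k: "\<kappa> differentiable at p" for p
  unfolding \<kappa>_def by (intro differentiable_add differentiable_combination differentiable_pair differentiable_scale
    differentiable_ident differentiable_const)
 have row: "(\<lambda>p. cov_row (\<kappa> p) c $ i) differentiable at p" for c i p
  unfolding cov_row_def vec_lambda_beta by (intro differentiable_nth differentiable_Bb k)
 have hv: "(\<lambda>p. hyper_vec (cov_row (\<kappa> p) c) a l1 l3 l4 (f p) (g p)) differentiable at p"
  if "f differentiable at p" "g differentiable at p" for c a l1 l3 l4 f g p
  unfolding hyper_vec_def
  by (intro differentiable_diff differentiable_scale differentiable_add differentiable_mult row that differentiable_const)
 have "negligible (F q ` ((Z \<times> UNIV) \<times> UNIV))" for q
 proof (rule negligible_differentiable_image_negligible)
  show "DIM((((complex ^ 4) \<times> complex) \<times> (complex ^ 4)) \<times> (complex ^ 3 ^ 3)) \<le> DIM(vec6 \<times> vec6 \<times> vec6)" by simp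
  show "negligible ((Z \<times> (UNIV :: (complex ^ 4) set)) \<times> (UNIV :: (complex ^ 3 ^ 3) set))" by (intro negligible_Times_UNIV Z)
  show "F q differentiable_on (Z \<times> UNIV) \<times> UNIV"
   unfolding F_def Let_def
   by (cases q, simp only: prod.case, rule differentiable_everywhere)
    (intro differentiable_pair differentiable_comb3 hv differentiable_nth differentiable_Bb k differentiable_ident)
 qed
 then have "negligible (\<Union>q. F q ` ((Z \<times> UNIV) \<times> UNIV))" by (auto intro!: negligible_Union)
 moreover have "{(x, y, z). T3 x y z \<noteq> 0 \<and> (\<exists>(w, c)\<in>Z. rank_one_type (A + c *s B + (\<Sum>i\<in>UNIV. w $ i *s C i)) x y z)}
  \<subseteq> (\<Union>q. F q ` ((Z \<times> UNIV) \<times> UNIV))"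
 proof clarify
  fix x y z w c
  assume T: "T3 x y z \<noteq> 0" and wc: "(w, c) \<in> Z" and R: "rank_one_type (A + c *s B + (\<Sum>i\<in>UNIV. w $ i *s C i)) x y z"
  define k where "k = A + c *s B + (\<Sum>i\<in>UNIV. w $ i *s C i)"
  obtain a d l1 l2 l3 l4 and h :: "complex ^ 4" where H: "\<And>w. w \<in> {x, y, z} \<Longrightarrow> \<exists>g. w = comb3 g (Bb k k (axis a 1))
   (hyper_vec (cov_row k d) a l1 l3 l4 (h $ 1) (h $ 2)) (hyper_vec (cov_row k d) a l2 l3 l4 (h $ 3) (h $ 4))"
   using rank_one_chart[OF R[folded k_def] T] by blast
  define C where "C g = comb3 g (Bb k k (axis a 1))
   (hyper_vec (cov_row k d) a l1 l3 l4 (h $ 1) (h $ 2)) (hyper_vec (cov_row k d) a l2 l3 l4 (h $ 3) (h $ 4))" for g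
  obtain g1 g2 g3 where g: "x = C g1" "y = C g2" "z = C g3" using H[of x] H[of y] H[of z] unfolding C_def by blast
  define p where "p = (((w, c), h), \<chi> i :: 3. if i = 1 then g1 else if i = 2 then g2 else g3)"
  have kp: "\<kappa> p = k" by (simp add: \<kappa>_def p_def k_def)
  have "F (a, d, l1, l2, l3, l4) p = (x, y, z)" unfolding F_def prod.case Let_def kp g C_def by (simp add: p_def)
  moreover have "p \<in> (Z \<times> UNIV) \<times> UNIV" using wc by (simp add: p_def)
  ultimately have "(x, y, z) \<in> F (a, d, l1, l2, l3, l4) ` ((Z \<times> UNIV) \<times> UNIV)" by (intro image_eqI[of _ _ p]) simp_all
  then show "(x, y, z) \<in> (\<Union>q. F q ` ((Z \<times> UNIV) \<times> UNIV))" by blast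
 qed
 ultimately show ?thesis by (rule negligible_subset)
qed

subsection \<open>Elements with a factor are rare\<close>

lemma seven_relation:
 fixes v :: "nat \<Rightarrow> vec6"
 shows "\<exists>a. (\<exists>i<7. a i \<noteq> 0) \<and> (\<Sum>i<7. a i *s v i) = 0"
proof (cases "indep (map v [0..<6])")
 case True
 then obtain E where E: "dual (map v [0..<6]) E" by (auto simp: indep_def)
 have "v 6 = (\<Sum>i<6. (v 6 \<cdot> E i) *s (map v [0..<6] ! i))" using dual_expansion(1)[OF E] by simp
 also have "\<dots> = (\<Sum>i<6. (v 6 \<cdot> E i) *s v i)" by (intro sum.cong) auto
 finally have v6: "v 6 = (\<Sum>i<6. (v 6 \<cdot> E i) *s v i)" .
 define a where "a i = (if i = 6 then - 1 else v 6 \<cdot> E i)" for i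
 have "(\<Sum>i<7. a i *s v i) = (\<Sum>i<6. a i *s v i) + a 6 *s v 6"
  using sum.lessThan_Suc[of "\<lambda>i. a i *s v i" 6] by simp
 also have "(\<Sum>i<6. a i *s v i) = v 6" by (subst v6) (intro sum.cong, auto simp: a_def)
 finally have "(\<Sum>i<7. a i *s v i) = 0" by (simp add: a_def vec_eq_iff)
 moreover have "(6::nat) < 7" "a 6 \<noteq> 0" by (simp_all add: a_def)
 ultimately show ?thesis by blast
next
 case False
 then obtain c :: "nat \<Rightarrow> complex" where c: "\<exists>i<6. c i \<noteq> 0" "(\<Sum>i<6. c i *s map v [0..<6] ! i) = 0"
  using indep_or_relation[of "map v [0..<6]"] by auto
 have "(\<Sum>i<6. c i *s map v [0..<6] ! i) = (\<Sum>i<6. c i *s v i)" by (intro sum.cong) auto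
 then have s: "(\<Sum>i<6. c i *s v i) = 0" using c(2) by simp
 define a where "a i = (if i < 6 then c i else 0)" for i
 have "(\<Sum>i<7. a i *s v i) = (\<Sum>i<6. a i *s v i) + a 6 *s v 6"
  using sum.lessThan_Suc[of "\<lambda>i. a i *s v i" 6] by simp
 also have "(\<Sum>i<6. a i *s v i) = (\<Sum>i<6. c i *s v i)" by (intro sum.cong) (auto simp: a_def)
 finally have "(\<Sum>i<7. a i *s v i) = 0" using s by (simp add: a_def)
 moreover obtain i where "i < 6" "c i \<noteq> 0" using c(1) by blast
 then have "i < 7" "a i \<noteq> 0" by (auto simp: a_def)
 ultimately show ?thesis by blast
qed

text \<open>Factors of \<open>m + c k0\<close> for distinct \<open>c\<close> behave like eigenvectors for distinct eigenvalues: because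
 multiplication by \<open>k0\<close> is injective, they are linearly independent, and there are at most six of them.\<close>

lemma finite_pencil_factors:
 assumes k0: "\<And>u. kills u k0 \<Longrightarrow> u = 0"
 shows "finite {c. \<exists>v. v \<noteq> 0 \<and> kills v (m + c *s k0)}" (is "finite ?S")
proof (rule ccontr)
 assume "infinite ?S"
 then obtain c :: "nat \<Rightarrow> complex" where c: "inj c" "range c \<subseteq> ?S" using infinite_countable_subset by blast
 then have "\<forall>i. \<exists>v. v \<noteq> 0 \<and> kills v (m + c i *s k0)" by blast
 then obtain v where v: "\<And>i. v i \<noteq> 0" "\<And>i. kills (v i) (m + c i *s k0)" by metis
 have W: "W4 (v i) m = - (c i *s W4 (v i) k0)" for i
  using v(2)[of i] unfolding W4_zero_iff[symmetric] W4_lin by (simp add: eq_neg_iff_add_eq_0)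
 have "\<forall>a. (\<Sum>i<n. a i *s v i) = 0 \<longrightarrow> (\<forall>i<n. a i = 0)" for n
 proof (induction n)
  case (Suc n)
  show ?case
  proof (intro allI impI)
   fix a i assume s: "(\<Sum>i<Suc n. a i *s v i) = 0" and i: "i < Suc n"
   have "W4 (\<Sum>i<Suc n. a i *s v i) m = - (\<Sum>i<Suc n. (a i * c i) *s W4 (v i) k0)"
    by (simp only: W4_sum W4_lin W vec.scale_minus_right vec.scale_scale sum_negf)
   then have "W4 (\<Sum>i<Suc n. (a i * c i) *s v i) k0 = - W4 (\<Sum>i<Suc n. a i *s v i) m"
    by (simp only: W4_sum W4_lin minus_minus)
   then have s': "(\<Sum>i<Suc n. (a i * c i) *s v i) = 0"
    unfolding s using k0 by (simp add: W4_zero_iff del: sum.lessThan_Suc)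
   have "(\<Sum>i<n. (a i * (c i - c n)) *s v i) = (\<Sum>i<Suc n. (a i * (c i - c n)) *s v i)" by simp
   also have "\<dots> = (\<Sum>i<Suc n. (a i * c i) *s v i) - c n *s (\<Sum>i<Suc n. a i *s v i)"
    by (simp add: vec.scale_sum_right sum_subtractf[symmetric] vec_eq_iff algebra_simps del: sum.lessThan_Suc)
   also have "\<dots> = 0" unfolding s s' by simp
   finally have z: "\<forall>i<n. a i * (c i - c n) = 0"
    using Suc.IH[THEN spec, of "\<lambda>i. a i * (c i - c n)"] by simp
   have an: "a j = 0" if "j < n" for j
    using z that c(1) by (auto dest: injD)
   then have "a n *s v n = 0" using s by simp
   then have "a n = 0" using v(1)[of n] by (simp add: vec.scale_eq_0_iff)
   then show "a i = 0" using an i by (cases "i = n") auto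
  qed
 qed simp
 then show False using seven_relation[of v] by blast
qed

text \<open>The factor can be normalised to the unit sphere, which is compact.\<close>

lemma closed_factors:
 fixes \<kappa> :: "'a::euclidean_space \<Rightarrow> trivec"
 assumes "\<And>x. \<kappa> differentiable at x"
 shows "closed {x. \<exists>v. v \<noteq> 0 \<and> kills v (\<kappa> x)}"
proof -
 define T where "T = {q :: vec6 \<times> 'a. W4 (fst q) (\<kappa> (snd q)) = 0}"
 have "(\<lambda>q. W4 (fst q) (\<kappa> (snd q))) differentiable at q" for q :: "vec6 \<times> 'a"
 proof -
  have s: "(\<lambda>q. \<kappa> (snd q)) differentiable at q" for q :: "vec6 \<times> 'a"
   using differentiable_compose[OF assms differentiable_pair(3)[OF differentiable_ident]] .
  show ?thesis
   unfolding W4_def w4_def pair_def tri_def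
   by (rule differentiable_vecI, unfold vec_lambda_beta)
    (intro differentiable_add differentiable_diff differentiable_sum differentiable_mult ballI finite differentiable_const
     differentiable_nth differentiable_pair differentiable_ident s)
 qed
 then have "continuous_on UNIV (\<lambda>q. W4 (fst q) (\<kappa> (snd q)))"
  by (intro differentiable_imp_continuous_on differentiable_everywhere)
 then have "closed T" unfolding T_def using continuous_closed_preimage_constant[of UNIV _ 0] by simp
 then have "closed {x. \<exists>v. v \<in> sphere 0 1 \<and> (v, x) \<in> T}" by (intro closed_compact_projection compact_sphere)
 moreover have "{x. \<exists>v. v \<in> sphere 0 1 \<and> (v, x) \<in> T} = {x. \<exists>v. v \<noteq> 0 \<and> kills v (\<kappa> x)}"
 proof (intro Collect_cong iffI; elim exE conjE)
  fix x v assume "v \<in> sphere 0 1" "(v, x) \<in> T"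
  then show "\<exists>v. v \<noteq> 0 \<and> kills v (\<kappa> x)" by (intro exI[of _ v]) (auto simp: T_def W4_zero_iff)
 next
  fix x v assume v: "v \<noteq> 0" "kills v (\<kappa> x)"
  have "kills (complex_of_real (1 / norm v) *s v) (\<kappa> x)" using v(2) by (intro kills_lin)
  moreover have "norm (complex_of_real (1 / norm v) *s v) = 1" using v(1) by (simp add: scaleR_eq_scale[symmetric] del: of_real_divide)
  ultimately show "\<exists>v. v \<in> sphere 0 1 \<and> (v, x) \<in> T" by (intro exI[of _ "complex_of_real (1 / norm v) *s v"]) (simp add: T_def W4_zero_iff)
 qed
 ultimately show ?thesis by simp
qed

lemma rank_one_type_scale:
 assumes "rank_one_type k x y z" "c \<noteq> 0" shows "rank_one_type (c *s k) x y z"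
proof -
 obtain v \<theta> where v: "v \<noteq> 0" "\<theta> \<noteq> 0" "kills v k" "contracts \<theta> k" "\<And>p. Bb k k p = (p \<cdot> \<theta>) *s v"
  "x \<cdot> \<theta> = 0" "y \<cdot> \<theta> = 0" "z \<cdot> \<theta> = 0" "\<exists>c1 c2 c3. v = c1 *s x + c2 *s y + c3 *s z"
  using assms(1) unfolding rank_one_type_def by blast
 show ?thesis
  unfolding rank_one_type_def
  by (intro exI[of _ v] exI[of _ "(c * c) *s \<theta>"] conjI allI)
   (use v assms(2) in \<open>auto simp: vec.scale_eq_0_iff kills_lin contracts_lin Bb_lin pair_simps\<close>)
qed

lemma rank_one_type_nonzero: "rank_one_type k x y z \<Longrightarrow> k \<noteq> 0"
proof
 assume "rank_one_type k x y z" "k = 0"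
 then obtain v \<theta> where v: "v \<noteq> 0" "\<theta> \<noteq> 0" "\<And>p. Bb 0 0 p = (p \<cdot> \<theta>) *s v" unfolding rank_one_type_def by blast
 obtain a where "\<theta> $ a \<noteq> 0" using v(2) by (auto simp: vec_eq_iff)
 moreover have "Bb 0 0 p = 0" for p using Bb_lin(3)[of 0 0 0 p] by simp
 ultimately show False using v(1) v(3)[of "axis a 1"] by (simp add: pair_axis vec.scale_eq_0_iff)
qed

text \<open>An element with a factor involves some \<open>b j\<close>, whose coefficient can be scaled to one. Of the remaining
 parameters the coefficient of \<open>k0\<close> takes finitely many values for given others; for \<open>k0 = 0\<close>, which stands for
 dimension at most five, it is set to zero.\<close>

lemma negligible_ambiguous:
 fixes b :: "nat \<Rightarrow> trivec"
 assumes K: "K \<subseteq> range (\<lambda>(z, c). c *s k0 + (\<Sum>i<5. z i *s b i))"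
  and k0: "k0 = 0 \<or> (\<forall>u. kills u k0 \<longrightarrow> u = 0)"
 shows "negligible {(x, y, z). T3 x y z \<noteq> 0 \<and> (\<exists>k\<in>K. eigen_type k x y z \<or> rank_one_type k x y z)}"
proof -
 have "\<exists>h :: 4 \<Rightarrow> nat. bij_betw h UNIV ({..<5} - {j})" if "j < 5" for j
  using that by (intro finite_same_card_bij) auto
 then obtain h :: "nat \<Rightarrow> 4 \<Rightarrow> nat" where h: "\<And>j. j < 5 \<Longrightarrow> bij_betw (h j) UNIV ({..<5} - {j})" by metis
 define \<kappa> where "\<kappa> j q = b j + snd q *s k0 + (\<Sum>i\<in>UNIV. fst q $ i *s b (h j i))" for j and q :: "(complex ^ 4) \<times> complex"
 define Z where "Z j = {q. (if k0 = 0 then snd q = 0 else \<exists>v. v \<noteq> 0 \<and> kills v (\<kappa> j q))}" for j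
 have Z: "negligible (Z j)" for j
 proof (rule negligible_finite_slices)
  have "\<kappa> j differentiable at q" for q
   unfolding \<kappa>_def by (intro differentiable_add differentiable_combination differentiable_pair differentiable_scale
    differentiable_ident differentiable_const)
  then have "closed {q. \<exists>v. v \<noteq> 0 \<and> kills v (\<kappa> j q)}" by (rule closed_factors)
  moreover have "closed {q :: (complex ^ 4) \<times> complex. snd q = 0}"
   by (rule closed_Collect_eq) (auto intro: continuous_intros)
  ultimately show "closed (Z j)" by (cases "k0 = 0") (simp_all add: Z_def)
  fix w
  show "finite {c. (w, c) \<in> Z j}"
  proof (cases "k0 = 0")
   case False
   have "\<kappa> j (w, c) = (b j + (\<Sum>i\<in>UNIV. w $ i *s b (h j i))) + c *s k0" for c by (simp add: \<kappa>_def)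
   then show ?thesis using False finite_pencil_factors[of k0 "b j + (\<Sum>i\<in>UNIV. w $ i *s b (h j i))"] k0
    by (simp add: Z_def)
  qed (simp add: Z_def)
 qed
 define b6 :: "6 \<Rightarrow> trivec" where "b6 i = (if rk i < 5 then b (rk i) else k0)" for i
 have sum6: "(\<Sum>i\<in>UNIV. (\<chi> i. if rk i < 5 then \<zeta> (rk i) else c) $ i *s b6 i) = c *s k0 + (\<Sum>i<5. \<zeta> i *s b i)" for \<zeta> c
 proof -
  have "(\<Sum>i\<in>UNIV. (\<chi> i. if rk i < 5 then \<zeta> (rk i) else c) $ i *s b6 i) =
   (\<Sum>i<6. (if i < 5 then \<zeta> i else c) *s (if i < 5 then b i else k0))"
   by (subst sum_ix) (intro sum.cong, auto simp: b6_def)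
  also have "\<dots> = (\<Sum>i<5. (if i < 5 then \<zeta> i else c) *s (if i < 5 then b i else k0)) + c *s k0"
   using sum.lessThan_Suc[of "\<lambda>i. (if i < 5 then \<zeta> i else c) *s (if i < 5 then b i else k0)" 5] by simp
  also have "(\<Sum>i<5. (if i < 5 then \<zeta> i else c) *s (if i < 5 then b i else k0)) = (\<Sum>i<5. \<zeta> i *s b i)" by (intro sum.cong) auto
  finally show ?thesis by (simp add: add.commute)
 qed
 define N where "N = {(x, y, z). \<exists>\<zeta> :: complex ^ 6. eigen_type (\<Sum>i\<in>UNIV. \<zeta> $ i *s b6 i) x y z} \<union>
  (\<Union>j\<in>{..<5}. {(x, y, z). T3 x y z \<noteq> 0 \<and> (\<exists>(w, c)\<in>Z j. rank_one_type (b j + c *s k0 + (\<Sum>i\<in>UNIV. w $ i *s b (h j i))) x y z)})"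
 have "negligible N" unfolding N_def
  by (intro negligible_Un negligible_eigen_type negligible_Union) (auto intro: negligible_rank_one_type Z)
 moreover have "(x, y, z) \<in> N" if T: "T3 x y z \<noteq> 0" and kK: "k \<in> K" and t: "eigen_type k x y z \<or> rank_one_type k x y z" for x y z k
 proof (rule ccontr)
  assume n: "(x, y, z) \<notin> N"
  obtain \<zeta> c where k: "k = c *s k0 + (\<Sum>i<5. \<zeta> i *s b i)" using K kK by auto
  have "\<not> eigen_type k x y z" unfolding k sum6[of \<zeta> c, symmetric] using n unfolding N_def by blast
  then have R: "rank_one_type k x y z" using t by blast
  then obtain v where v: "v \<noteq> 0" "kills v k" unfolding rank_one_type_def by blast
  have "\<exists>j<5. \<zeta> j \<noteq> 0"
  proof (rule ccontr)
   assume "\<not> ?thesis"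
   then have kk: "k = c *s k0" by (simp add: k)
   then have "c \<noteq> 0" "k0 \<noteq> 0" using rank_one_type_nonzero[OF R] by auto
   then have "kills v k0" using kills_lin(5)[OF v(2), of "1 / c"] kk by simp
   then show False using v(1) k0 \<open>k0 \<noteq> 0\<close> by blast
  qed
  then obtain j where j: "j < 5" "\<zeta> j \<noteq> 0" by blast
  define w :: "complex ^ 4" where "w = (\<chi> i. \<zeta> (h j i) / \<zeta> j)"
  define c' where "c' = (if k0 = 0 then 0 else c / \<zeta> j)"
  have "(\<Sum>i<5. \<zeta> i *s b i) = \<zeta> j *s b j + (\<Sum>i\<in>{..<5} - {j}. \<zeta> i *s b i)"
   using j by (subst sum.remove[of _ j]) auto
  also have "(\<Sum>i\<in>{..<5} - {j}. \<zeta> i *s b i) = (\<Sum>i\<in>UNIV. \<zeta> (h j i) *s b (h j i))"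
   using sum.reindex_bij_betw[OF h[OF j(1)], of "\<lambda>i. \<zeta> i *s b i"] by simp
  finally have "(1 / \<zeta> j) *s k = \<kappa> j (w, c')"
   unfolding k \<kappa>_def using j by (simp add: vec.scale_right_distrib vec.scale_sum_right w_def c'_def add_ac)
  then have R': "rank_one_type (\<kappa> j (w, c')) x y z" using rank_one_type_scale[OF R, of "1 / \<zeta> j"] j by simp
  then have "(w, c') \<in> Z j" unfolding Z_def rank_one_type_def by (auto simp: c'_def)
  moreover have "rank_one_type (b j + c' *s k0 + (\<Sum>i\<in>UNIV. w $ i *s b (h j i))) x y z" using R' by (simp add: \<kappa>_def)
  ultimately show False using n T j(1) unfolding N_def by blast
 qed
 ultimately show ?thesis by (auto elim!: negligible_subset)
qed

section \<open>The cone of decomposable trivectors\<close>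

definition cone3 :: "trivec set" where
 "cone3 = {T3 x y z | x y z. True}"

lemma cone3_T3 [simp]: "T3 x y z \<in> cone3" by (auto simp: cone3_def)

lemma cone3_scale: "g \<in> cone3 \<Longrightarrow> c *s g \<in> cone3"
proof -
 assume "g \<in> cone3"
 then obtain x y z where "g = T3 x y z" by (auto simp: cone3_def)
 then have "c *s g = T3 (c *s x) y z" by (simp only: T3_lin(7))
 then show ?thesis by simp
qed

lemma cone3_alt: "g \<in> cone3 \<Longrightarrow> alt g" by (auto simp: cone3_def)

definition sec1 :: "trivec \<Rightarrow> 6 \<Rightarrow> 6 \<Rightarrow> vec6" where "sec1 k b c = (\<chi> i. k $ (i, b, c))"
definition sec2 :: "trivec \<Rightarrow> 6 \<Rightarrow> 6 \<Rightarrow> vec6" where "sec2 k a c = (\<chi> i. k $ (a, i, c))"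
definition sec3 :: "trivec \<Rightarrow> 6 \<Rightarrow> 6 \<Rightarrow> vec6" where "sec3 k a b = (\<chi> i. k $ (a, b, i))"

lemma T3_combination:
 assumes "x' = a1 *s x + a2 *s y + a3 *s z" "y' = b1 *s x + b2 *s y + b3 *s z" "z' = d1 *s x + d2 *s y + d3 *s z"
 shows "T3 x' y' z' = (a1 * (b2 * d3 - b3 * d2) - a2 * (b1 * d3 - b3 * d1) + a3 * (b1 * d2 - b2 * d1)) *s T3 x y z"
 unfolding assms T3_lin by (simp add: T3_lin T3_permutations[where x = x and y = y and z = z] vec_eq_iff algebra_simps)

text \<open>Fixing two arguments of a decomposable trivector gives a vector of its space. Three such sections recover the
 trivector up to a factor, which gives equations for the cone and local sections of \<open>T3\<close>.\<close>

lemma T3_sections: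
 "T3 (sec1 (T3 x y z) b c) (sec2 (T3 x y z) a c) (sec3 (T3 x y z) a b) = (T3 x y z $ (a, b, c) * T3 x y z $ (a, b, c)) *s T3 x y z"
proof -
 define m where "m = (\<lambda>(u::vec6) (v::vec6) i j. u $ i * v $ j - u $ j * v $ i)"
 have s: "sec1 (T3 x y z) b c = m y z b c *s x + (- m x z b c) *s y + m x y b c *s z"
  "sec2 (T3 x y z) a c = (- m y z a c) *s x + m x z a c *s y + (- m x y a c) *s z"
  "sec3 (T3 x y z) a b = m y z a b *s x + (- m x z a b) *s y + m x y a b *s z"
  by (simp_all add: sec1_def sec2_def sec3_def T3_nth vec_eq_iff m_def algebra_simps)
 have "m y z b c * (m x z a c * m x y a b - m x y a c * m x z a b) - m x z b c * (m y z a c * m x y a b - m x y a c * m y z a b)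
   + m x y b c * (m y z a c * m x z a b - m x z a c * m y z a b) = T3 x y z $ (a, b, c) * T3 x y z $ (a, b, c)"
  unfolding m_def T3_nth by (simp add: algebra_simps)
 then show ?thesis unfolding T3_combination[OF s] by (simp add: algebra_simps)
qed

lemma differentiable_T3:
 assumes "x differentiable at p" "y differentiable at p" "z differentiable at p"
 shows "(\<lambda>p. T3 (x p) (y p) (z p)) differentiable at (p :: 'a::euclidean_space)"
proof (rule differentiable_vecI)
 fix q :: "6 \<times> 6 \<times> 6"
 obtain i j l where q: "q = (i, j, l)" by (cases q)
 show "(\<lambda>p. T3 (x p) (y p) (z p) $ q) differentiable at p"
  unfolding q T3_nth by (intro differentiable_add differentiable_diff differentiable_mult differentiable_nth assms)
qed

lemma tendsto_T3:
 assumes "(x \<longlongrightarrow> x') F" "(y \<longlongrightarrow> y') F" "(z \<longlongrightarrow> z') F"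
 shows "((\<lambda>n. T3 (x n) (y n) (z n)) \<longlongrightarrow> T3 x' y' z') F"
proof (rule vec_tendstoI)
 fix q :: "6 \<times> 6 \<times> 6"
 obtain i j l where q: "q = (i, j, l)" by (cases q)
 show "((\<lambda>n. T3 (x n) (y n) (z n) $ q) \<longlongrightarrow> T3 x' y' z' $ q) F"
  unfolding q T3_nth by (intro tendsto_intros tendsto_vec_nth assms)
qed

lemma tendsto_scale: "(c \<longlongrightarrow> c') F \<Longrightarrow> (x \<longlongrightarrow> x') F \<Longrightarrow> ((\<lambda>n. c n *s (x n :: complex ^ 'n)) \<longlongrightarrow> c' *s x') F"
 by (rule vec_tendstoI) (simp, intro tendsto_intros tendsto_vec_nth)

lemma tendsto_sec:
 assumes "(f \<longlongrightarrow> g) F"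
 shows "((\<lambda>n. sec1 (f n) b c) \<longlongrightarrow> sec1 g b c) F" "((\<lambda>n. sec2 (f n) a c) \<longlongrightarrow> sec2 g a c) F" "((\<lambda>n. sec3 (f n) a b) \<longlongrightarrow> sec3 g a b) F"
 unfolding sec1_def sec2_def sec3_def by (rule vec_tendstoI, unfold vec_lambda_beta, rule tendsto_vec_nth[OF assms])+

lemma cone3_iff:
 "k \<in> cone3 \<longleftrightarrow> (\<forall>a b c. T3 (sec1 k b c) (sec2 k a c) (sec3 k a b) = (k $ (a, b, c) * k $ (a, b, c)) *s k)"
proof
 assume r: "\<forall>a b c. T3 (sec1 k b c) (sec2 k a c) (sec3 k a b) = (k $ (a, b, c) * k $ (a, b, c)) *s k"
 show "k \<in> cone3"
 proof (cases "k = 0")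
  case True then show ?thesis using cone3_T3[of 0 0 0] by (simp add: T3_lin)
 next
  case False
  then obtain a b c where n: "k $ (a, b, c) \<noteq> 0" by (auto simp: vec_eq_iff)
  define d where "d = k $ (a, b, c) * k $ (a, b, c)"
  have "(1 / d) *s T3 (sec1 k b c) (sec2 k a c) (sec3 k a b) = k" using r n by (simp add: d_def)
  then show ?thesis using cone3_scale[OF cone3_T3] by metis
 qed
qed (use T3_sections in \<open>auto simp: cone3_def\<close>)

lemma closed_cone3: "closed cone3"
proof -
 have "closed {k. T3 (sec1 k b c) (sec2 k a c) (sec3 k a b) = (k $ (a, b, c) * k $ (a, b, c)) *s k}" for a b c
 proof (rule closed_Collect_eq)
  have s: "(\<lambda>k. sec1 k b c) differentiable at k" "(\<lambda>k. sec2 k a c) differentiable at k" "(\<lambda>k. sec3 k a b) differentiable at k" for k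
   unfolding sec1_def sec2_def sec3_def
   by (rule differentiable_vecI, unfold vec_lambda_beta, intro differentiable_nth differentiable_ident)+
  show "continuous_on UNIV (\<lambda>k. T3 (sec1 k b c) (sec2 k a c) (sec3 k a b))"
   by (intro differentiable_imp_continuous_on differentiable_everywhere differentiable_T3 s)
  show "continuous_on UNIV (\<lambda>k :: trivec. (k $ (a, b, c) * k $ (a, b, c)) *s k)"
   by (intro differentiable_imp_continuous_on differentiable_everywhere differentiable_scale differentiable_mult differentiable_nth differentiable_ident)
 qed
 then have "closed {k. \<forall>a b c. T3 (sec1 k b c) (sec2 k a c) (sec3 k a b) = (k $ (a, b, c) * k $ (a, b, c)) *s k}"
  by (intro closed_Collect_all)
 moreover have "{k. \<forall>a b c. T3 (sec1 k b c) (sec2 k a c) (sec3 k a b) = (k $ (a, b, c) * k $ (a, b, c)) *s k} = cone3"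
  using cone3_iff by blast
 ultimately show ?thesis by simp
qed

text \<open>The continuous section \<open>g \<mapsto> (x, y, z)\<close> of \<open>T3\<close> on the set where a given coordinate does not vanish.\<close>

lemma T3_echelon:
 assumes "g \<in> cone3" "g $ (a, b, c) \<noteq> 0"
 shows "g = T3 (sec1 g b c) ((1 / g $ (a, b, c)) *s sec2 g a c) ((1 / g $ (a, b, c)) *s sec3 g a b)"
 using assms cone3_iff[of g] by (simp add: T3_lin)

lemma T3_span:
 assumes T: "T3 x y z \<noteq> 0" and w: "kills w (T3 x y z)"
 shows "\<exists>c1 c2 c3. w = c1 *s x + c2 *s y + c3 *s z"
proof -
 obtain E where E: "dual [x, y, z] E" using T unfolding T3_nonzero_iff indep_def by blast
 have "w \<cdot> u = ((w \<cdot> E 0) *s x + (w \<cdot> E 1) *s y + (w \<cdot> E 2) *s z) \<cdot> u" for u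
 proof -
  have "w4 w (T3 x y z) (E 0) (E 1) (E 2) u = 0" using w by (simp add: kills_def)
  then show ?thesis unfolding w4_def tri_T3 using E by (simp add: dual_3 pair_simps algebra_simps eq_neg_iff_add_eq_0)
 qed
 then have "w = (w \<cdot> E 0) *s x + (w \<cdot> E 1) *s y + (w \<cdot> E 2) *s z" by (rule pair_eqI)
 then show ?thesis by blast
qed

text \<open>Both types depend only on the span of the three vectors.\<close>

lemma type_change:
 assumes T: "T3 x y z \<noteq> 0" "T3 x y z = T3 x' y' z'" and t: "eigen_type k x y z \<or> rank_one_type k x y z"
 shows "eigen_type k x' y' z' \<or> rank_one_type k x' y' z'"
proof -
 have c: "\<exists>c1 c2 c3. w = c1 *s x + c2 *s y + c3 *s z" if "w \<in> {x', y', z'}" for w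
 proof -
  have "kills w (T3 x' y' z')" using that kills_T3 by auto
  then show ?thesis using T3_span[OF T(1), of w] T(2) by simp
 qed
 have c': "\<exists>c1 c2 c3. w = c1 *s x' + c2 *s y' + c3 *s z'" if "w \<in> {x, y, z}" for w
 proof -
  have "kills w (T3 x y z)" using that kills_T3 by auto
  then show ?thesis using T3_span[of x' y' z' w] T by simp
 qed
 have cc: "comb3 (c1 *s g1 + c2 *s g2 + c3 *s g3) p q r = c1 *s comb3 g1 p q r + c2 *s comb3 g2 p q r + c3 *s comb3 g3 p q r" for c1 c2 c3 g1 g2 g3 p q r
  by (simp add: comb3_def vec_eq_iff algebra_simps)
 from t show ?thesis
 proof
  assume "eigen_type k x y z"
  then obtain s j1 j2 j3 where H: "\<And>w. w \<in> {x, y, z} \<Longrightarrow> \<exists>g. w = comb3 g (eigen_row k s j1) (eigen_row k s j2) (eigen_row k s j3)"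
   unfolding eigen_type_def by blast
  define C where "C g = comb3 g (eigen_row k s j1) (eigen_row k s j2) (eigen_row k s j3)" for g
  obtain g1 g2 g3 where g: "x = C g1" "y = C g2" "z = C g3" using H[of x] H[of y] H[of z] unfolding C_def by auto
  have "\<exists>g. w = comb3 g (eigen_row k s j1) (eigen_row k s j2) (eigen_row k s j3)" if "w \<in> {x', y', z'}" for w
   using c[OF that] unfolding g C_def cc[symmetric] by blast
  then show ?thesis unfolding eigen_type_def by blast
 next
  assume "rank_one_type k x y z"
  then obtain v \<theta> c1 c2 c3 where v: "v \<noteq> 0" "\<theta> \<noteq> 0" "kills v k" "contracts \<theta> k" "\<And>p. Bb k k p = (p \<cdot> \<theta>) *s v" and
   \<theta>: "x \<cdot> \<theta> = 0" "y \<cdot> \<theta> = 0" "z \<cdot> \<theta> = 0" and vx: "v = c1 *s x + c2 *s y + c3 *s z"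
   unfolding rank_one_type_def by blast
  have "w \<cdot> \<theta> = 0" if "w \<in> {x', y', z'}" for w using c[OF that] \<theta> by (auto simp: pair_simps)
  moreover have "\<exists>c1 c2 c3. v = c1 *s x' + c2 *s y' + c3 *s z'"
  proof -
   have "kills v (T3 x' y' z')" unfolding vx T(2)[symmetric] by (rule kills_combination)
   then show ?thesis using T3_span[of x' y' z'] T by auto
  qed
  ultimately show ?thesis using v unfolding rank_one_type_def by blast
 qed
qed

lemma closed_compact_fun:
 fixes S :: "(real \<Rightarrow> complex) set"
 assumes "compact S" shows "closed S"
proof -
 have "Hausdorff_space (euclidean :: (real \<Rightarrow> complex) topology)"
  unfolding euclidean_product_topology[symmetric] Hausdorff_space_product_topology by simp
 moreover have "compactin euclidean S" unfolding compactin_euclidean_iff by (rule assms)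
 ultimately have "closedin euclidean S" by (rule compactin_imp_closedin)
 then show ?thesis by (simp only: closed_closedin)
qed

section \<open>Wronskians as a projection of the cone\<close>

locale wronski_cone =
 fixes I :: "real set" and c0 c1 c2 :: "real \<Rightarrow> vec6"
 assumes decomposable_nonzero: "T3 x y z \<noteq> 0 \<Longrightarrow> \<exists>t\<in>I. tri (T3 x y z) (c0 t) (c1 t) (c2 t) \<noteq> 0"
begin

definition WR :: "trivec \<Rightarrow> real \<Rightarrow> complex" where
 "WR k = (\<lambda>t. if t \<in> I then tri k (c0 t) (c1 t) (c2 t) else 0)"

definition K :: "trivec set" where
 "K = {k. alt k \<and> WR k = 0}"

lemma WR_lin: "WR (k + l) = WR k + WR l" "WR (k - l) = WR k - WR l" "WR (c *s k) = fscale c (WR k)" "WR 0 = 0"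
 by (auto simp: WR_def fscale_def fun_eq_iff)

lemma subspace_K: "vec.subspace K"
 by (rule vec.subspaceI) (auto simp: K_def WR_lin alt_lin fscale_def fun_eq_iff)

lemma K_cone3: "g \<in> cone3 \<Longrightarrow> WR g = 0 \<Longrightarrow> g = 0"
proof (rule ccontr)
 assume g: "g \<in> cone3" "WR g = 0" "g \<noteq> 0"
 then obtain x y z where T: "g = T3 x y z" by (auto simp: cone3_def)
 then obtain t where "t \<in> I" "tri g (c0 t) (c1 t) (c2 t) \<noteq> 0" using decomposable_nonzero g(3) by blast
 moreover have "WR g t = 0" using g(2) by simp
 ultimately show False by (simp add: WR_def)
qed

lemma continuous_WR_nth: "continuous_on S (\<lambda>k. WR k t)"
 unfolding WR_def tri_def
 by (cases "t \<in> I") (simp_all, intro differentiable_imp_continuous_on differentiable_everywhere differentiable_sum differentiable_mult differentiable_nth ballI finite differentiable_ident differentiable_const)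

lemma continuous_WR: "continuous_on S WR"
 by (rule continuous_on_coordinatewise_then_product) (rule continuous_WR_nth)

lemma closed_K: "closed K"
proof -
 have "K = {k. (\<forall>a b c. k $ (b, a, c) = - k $ (a, b, c) \<and> k $ (a, c, b) = - k $ (a, b, c)) \<and> (\<forall>t. WR k t = 0)}"
  by (simp only: K_def alt_def fun_eq_iff zero_fun_apply)
 moreover have "closed {k :: trivec. k $ p = - k $ q}" for p q
  by (intro closed_Collect_eq differentiable_imp_continuous_on differentiable_everywhere differentiable_minus differentiable_nth differentiable_ident)
 moreover have "closed {k. WR k t = 0}" for t
  by (intro closed_Collect_eq continuous_WR_nth continuous_intros)
 ultimately show ?thesis by (simp only:) (intro closed_Collect_conj closed_Collect_all)
qed

text \<open>Finitely many values of the Wronskian control the size of a decomposable trivector, because the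
 unit vectors in the cone form a compact set.\<close>

lemma WR_coercive:
 "\<exists>F \<delta>. finite F \<and> \<delta> > 0 \<and> (\<forall>g\<in>cone3. \<delta> * norm g \<le> (\<Sum>t\<in>F. norm (WR g t)))"
proof -
 define S where "S = cone3 \<inter> sphere 0 1"
 have S: "compact S" unfolding S_def using closed_cone3 by (intro closed_Int_compact compact_sphere)
 have open_t: "open {k. WR k t \<noteq> 0}" for t
  by (intro open_Collect_neq continuous_WR_nth continuous_intros)
 have cover: "S \<subseteq> (\<Union>t\<in>UNIV. {k. WR k t \<noteq> 0})"
 proof
  fix g assume "g \<in> S"
  then have "g \<in> cone3" "g \<noteq> 0" by (auto simp: S_def)
  then have "WR g \<noteq> 0" using K_cone3 by blast
  then show "g \<in> (\<Union>t\<in>UNIV. {k. WR k t \<noteq> 0})" by (auto simp: fun_eq_iff)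
 qed
 obtain F where F: "finite F" "S \<subseteq> (\<Union>t\<in>F. {k. WR k t \<noteq> 0})"
  by (rule compactE_image[OF S open_t cover]) blast
 define \<nu> where "\<nu> g = (\<Sum>t\<in>F. norm (WR g t))" for g
 have pos: "\<nu> g > 0" if gS: "g \<in> S" for g
 proof -
  obtain t where "t \<in> F" "WR g t \<noteq> 0" using F(2) gS by blast
  then show ?thesis unfolding \<nu>_def using F(1) by (intro sum_pos2[of F t]) auto
 qed
 obtain \<delta> where \<delta>: "\<delta> > 0" "\<And>g. g \<in> S \<Longrightarrow> \<delta> \<le> \<nu> g"
 proof (cases "S = {}")
  case True then show ?thesis using that[of 1] by simp
 next
  case False
  have "continuous_on S \<nu>" unfolding \<nu>_def by (intro continuous_intros continuous_WR_nth)
  then obtain g0 where "g0 \<in> S" "\<And>g. g \<in> S \<Longrightarrow> \<nu> g0 \<le> \<nu> g"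
   using continuous_attains_inf[OF S False] by blast
  then show ?thesis using that pos by blast
 qed
 have "\<delta> * norm g \<le> \<nu> g" if "g \<in> cone3" for g
 proof (cases "g = 0")
  case False
  define r where "r = complex_of_real (1 / norm g)"
  have nr: "norm r = 1 / norm g" by (simp add: r_def norm_divide)
  have "norm (r *s g) = 1" unfolding r_def using False by (simp add: scaleR_eq_scale[symmetric] del: of_real_divide)
  then have "r *s g \<in> S" using that cone3_scale by (simp add: S_def)
  then have "\<delta> \<le> \<nu> (r *s g)" by (rule \<delta>(2))
  also have "\<nu> (r *s g) = \<nu> g / norm g"
   by (simp add: \<nu>_def WR_lin fscale_def norm_mult nr sum_divide_distrib)
  finally show ?thesis using False by (simp add: pos_le_divide_eq)
 qed (simp add: \<nu>_def WR_lin)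
 then show ?thesis using F(1) \<delta>(1) unfolding \<nu>_def by blast
qed

text \<open>By \<open>WR_coercive\<close>, decomposables whose Wronskians converge form a bounded sequence.\<close>

lemma closed_WR_image:
 assumes C: "closed C" "C \<subseteq> cone3"
 shows "closed (WR ` C)"
proof -
 obtain F \<delta> where F: "finite F" "\<delta> > 0" "\<And>g. g \<in> cone3 \<Longrightarrow> \<delta> * norm g \<le> (\<Sum>t\<in>F. norm (WR g t))"
  using WR_coercive by blast
 have "f \<in> WR ` C" if f: "f \<in> closure (WR ` C)" for f
 proof -
  define N where "N h = (\<Sum>t\<in>F. norm (h t))" for h :: "real \<Rightarrow> complex"
  have cN: "continuous_on UNIV N" unfolding N_def
   by (intro continuous_intros continuous_on_product_coordinates)
  define O' where "O' = {h. N h < N f + 1}"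
  have "open O'" unfolding O'_def by (intro open_Collect_less cN continuous_intros)
  have "f \<in> O'" by (simp add: O'_def)
  then have "f \<in> closure (O' \<inter> WR ` C)"
   using open_Int_closure_subset[OF \<open>open O'\<close>, of "WR ` C"] f by blast
  moreover have "O' \<inter> WR ` C \<subseteq> WR ` (C \<inter> cball 0 ((N f + 1) / \<delta>))"
  proof
   fix h assume "h \<in> O' \<inter> WR ` C"
   then obtain g where g: "g \<in> C" "h = WR g" "N (WR g) < N f + 1" by (auto simp: O'_def)
   then have "\<delta> * norm g \<le> N f + 1" using F(3)[of g] C(2) by (force simp: N_def)
   then have "norm g \<le> (N f + 1) / \<delta>" using F(2) by (simp add: field_simps)
   then show "h \<in> WR ` (C \<inter> cball 0 ((N f + 1) / \<delta>))" using g by auto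
  qed
  moreover have "closed (WR ` (C \<inter> cball 0 ((N f + 1) / \<delta>)))"
   by (intro closed_compact_fun compact_continuous_image continuous_WR closed_Int_compact C compact_cball)
  ultimately show ?thesis using closure_minimal[of "O' \<inter> WR ` C"] by blast
 qed
 then show ?thesis by (metis closure_subset_eq subsetI)
qed

definition ambiguous :: "trivec set" where
 "ambiguous = {g \<in> cone3. \<exists>h\<in>cone3. h \<noteq> g \<and> WR h = WR g}"

lemma ambiguous_scale:
 assumes "g \<in> ambiguous" "c \<noteq> 0" shows "c *s g \<in> ambiguous"
proof -
 obtain h where h: "g \<in> cone3" "h \<in> cone3" "h \<noteq> g" "WR h = WR g" using assms(1) by (auto simp: ambiguous_def)
 then have "c *s h \<noteq> c *s g" "WR (c *s h) = WR (c *s g)" using assms(2) by (simp_all add: WR_lin vec.scale_cancel_left)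
 then show ?thesis using h cone3_scale unfolding ambiguous_def by blast
qed

lemma K_not_T3: "k \<in> K \<Longrightarrow> k \<noteq> 0 \<Longrightarrow> k \<noteq> T3 a b c"
 using K_cone3[of "T3 a b c"] by (auto simp: K_def)

lemma ambiguous_type:
 assumes "T3 x y z \<in> ambiguous" "T3 x y z \<noteq> 0"
 shows "\<exists>k\<in>K. eigen_type k x y z \<or> rank_one_type k x y z"
proof -
 obtain x' y' z' where h: "T3 x' y' z' \<noteq> T3 x y z" "WR (T3 x' y' z') = WR (T3 x y z)"
  using assms(1) by (auto simp: ambiguous_def cone3_def)
 define k where "k = T3 x y z - T3 x' y' z'"
 have k: "k \<in> K" "k \<noteq> 0" using h by (auto simp: K_def k_def WR_lin)
 then show ?thesis using classify_secant[OF assms(2) k_def] K_not_T3 by blast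
qed

text \<open>A limit of ambiguous trivectors is ambiguous, or two trivectors with the same Wronskian collide
 there, which puts a tangent vector of the cone into \<open>K\<close>.\<close>

lemma closure_ambiguous_type:
 assumes g: "g \<in> closure ambiguous" "g \<noteq> 0" and gx: "g = T3 x y z"
 shows "\<exists>k\<in>K. eigen_type k x y z \<or> rank_one_type k x y z"
proof -
 obtain gn where gn: "\<And>n :: nat. gn n \<in> ambiguous" "gn \<longlonglongrightarrow> g" using g(1) unfolding closure_sequential by blast
 have "\<forall>n. \<exists>h. h \<in> cone3 \<and> h \<noteq> gn n \<and> WR h = WR (gn n)" using gn(1) by (auto simp: ambiguous_def)
 then obtain hn where hn: "\<And>n. hn n \<in> cone3" "\<And>n. hn n \<noteq> gn n" "\<And>n. WR (hn n) = WR (gn n)" by metis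
 have gc: "gn n \<in> cone3" for n using gn(1) by (auto simp: ambiguous_def)
 obtain F \<delta> where F: "finite F" "\<delta> > 0" "\<And>g. g \<in> cone3 \<Longrightarrow> \<delta> * norm g \<le> (\<Sum>t\<in>F. norm (WR g t))"
  using WR_coercive by blast
 have WRt: "(\<lambda>n. WR (f n) t) \<longlonglongrightarrow> WR l t" if "f \<longlonglongrightarrow> l" for f l t
  using continuous_on_tendsto_compose[OF continuous_WR_nth[of UNIV t] that] by simp
 have "(\<lambda>n. \<Sum>t\<in>F. norm (WR (gn n) t)) \<longlonglongrightarrow> (\<Sum>t\<in>F. norm (WR g t))"
  by (intro tendsto_sum tendsto_norm WRt gn(2))
 then have "Bseq (\<lambda>n. \<Sum>t\<in>F. norm (WR (gn n) t))" by (intro convergent_imp_Bseq convergentI)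
 then obtain M where M: "\<And>n. norm (\<Sum>t\<in>F. norm (WR (gn n) t)) \<le> M"
  unfolding Bseq_def by blast
 have "norm (hn n) \<le> M / \<delta>" for n
 proof -
  have "\<delta> * norm (hn n) \<le> (\<Sum>t\<in>F. norm (WR (gn n) t))" using F(3)[OF hn(1)[of n]] unfolding hn(3) .
  also have "\<dots> \<le> M" using M[of n] by simp
  finally have "\<delta> * norm (hn n) \<le> M" .
  then show ?thesis using F(2) by (simp add: field_simps)
 qed
 then have "bounded (range hn)" by (auto simp: bounded_iff)
 then obtain h r where hr: "strict_mono (r :: nat \<Rightarrow> nat)" "(hn \<circ> r) \<longlonglongrightarrow> h"
  using bounded_imp_convergent_subsequence by blast
 have h: "h \<in> cone3" using closed_cone3 hr(2) hn(1) unfolding closed_sequential_limits by (metis comp_apply)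
 have gr: "(gn \<circ> r) \<longlonglongrightarrow> g" using LIMSEQ_subseq_LIMSEQ[OF gn(2) hr(1)] .
 show ?thesis
 proof (cases "h = g")
  case False
  have "WR h t = WR g t" for t
   using WRt[OF hr(2)] WRt[OF gr] LIMSEQ_unique unfolding comp_def hn(3) by blast
  then have "g \<in> ambiguous" unfolding ambiguous_def gx using h False gx by auto
  then show ?thesis using ambiguous_type g gx by blast
 next
  case True
  obtain a b c where ne: "g $ (a, b, c) \<noteq> 0" using g(2) by (auto simp: vec_eq_iff)
  define X where "X k = sec1 k b c" for k
  define Y where "Y k = (1 / k $ (a, b, c)) *s sec2 k a c" for k
  define Z where "Z k = (1 / k $ (a, b, c)) *s sec3 k a b" for k
  have nth: "(\<lambda>n. f n $ q) \<longlonglongrightarrow> g $ q" if "f \<longlonglongrightarrow> g" for f and q :: "6 \<times> 6 \<times> 6" by (rule tendsto_vec_nth[OF that])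
  have sec: "(\<lambda>n. X (f n)) \<longlonglongrightarrow> X g" "(\<lambda>n. Y (f n)) \<longlonglongrightarrow> Y g" "(\<lambda>n. Z (f n)) \<longlonglongrightarrow> Z g" if f: "f \<longlonglongrightarrow> g" for f
   unfolding X_def Y_def Z_def by (intro tendsto_scale tendsto_divide tendsto_const tendsto_sec nth[OF f] ne f)+
  define P where "P n = X (gn (r n)) - X (hn (r n))" for n
  define Q where "Q n = Y (gn (r n)) - Y (hn (r n))" for n
  define R where "R n = Z (gn (r n)) - Z (hn (r n))" for n
  define e where "e n = norm (P n, Q n, R n)" for n
  have "\<forall>\<^sub>F n in sequentially. gn (r n) $ (a, b, c) \<noteq> 0" "\<forall>\<^sub>F n in sequentially. hn (r n) $ (a, b, c) \<noteq> 0"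
   using tendsto_imp_eventually_ne[OF nth[OF gr] ne] tendsto_imp_eventually_ne[OF nth[OF hr(2)[unfolded True]] ne] by (simp_all add: comp_def)
  then have "\<forall>\<^sub>F n in sequentially. gn (r n) $ (a, b, c) \<noteq> 0 \<and> hn (r n) $ (a, b, c) \<noteq> 0" by (rule eventually_conj)
  then obtain n0 where n0: "\<And>n. n \<ge> n0 \<Longrightarrow> gn (r n) $ (a, b, c) \<noteq> 0 \<and> hn (r n) $ (a, b, c) \<noteq> 0"
   unfolding eventually_sequentially by blast
  have lift: "gn (r n) = T3 (X (gn (r n))) (Y (gn (r n))) (Z (gn (r n)))" "hn (r n) = T3 (X (hn (r n))) (Y (hn (r n))) (Z (hn (r n)))" if "n \<ge> n0" for n
   unfolding X_def Y_def Z_def using T3_echelon[OF gc] T3_echelon[OF hn(1)] n0[OF that] by blast+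
  have e0: "e n > 0" if "n \<ge> n0" for n
  proof (rule ccontr)
   assume "\<not> e n > 0"
   then have "P n = 0" "Q n = 0" "R n = 0" by (simp_all add: e_def zero_prod_def)
   then have "gn (r n) = hn (r n)" using lift[OF that] by (simp add: P_def Q_def R_def)
   then show False using hn(2) by metis
  qed
  define u where "u n = (1 / e (n + n0)) *\<^sub>R (P (n + n0), Q (n + n0), R (n + n0))" for n
  have un: "norm (u n) = 1" for n
  proof -
   have "norm (u n) = (1 / e (n + n0)) * e (n + n0)" unfolding u_def norm_scaleR using e0[of "n + n0"] by (simp add: e_def[symmetric])
   then show ?thesis using e0[of "n + n0"] by simp
  qed
  then have "bounded (range u)" by (auto simp: bounded_iff intro!: exI[of _ 1])
  then obtain pqr s where s: "strict_mono (s :: nat \<Rightarrow> nat)" "(u \<circ> s) \<longlonglongrightarrow> pqr"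
   using bounded_imp_convergent_subsequence by blast
  obtain p q w where pqr: "pqr = (p, q, w)" by (cases pqr)
  have "norm pqr = 1" using tendsto_norm[OF s(2)] un by (simp add: comp_def LIMSEQ_const_iff)
  then have pqr0: "\<not> (p = 0 \<and> q = 0 \<and> w = 0)" using pqr by (auto simp: norm_Pair)
  define k where "k = T3 p (Y g) (Z g) + T3 (X g) q (Z g) + T3 (X g) (Y g) w"
  define m where "m n = s n + n0" for n
  define d where "d n = complex_of_real (1 / e (m n))" for n
  have lim: "(\<lambda>n. d n *s P (m n)) \<longlonglongrightarrow> p" "(\<lambda>n. d n *s Q (m n)) \<longlonglongrightarrow> q" "(\<lambda>n. d n *s R (m n)) \<longlonglongrightarrow> w"
   using tendsto_fst[OF s(2)[unfolded pqr]] tendsto_fst[OF tendsto_snd[OF s(2)[unfolded pqr]]] tendsto_snd[OF tendsto_snd[OF s(2)[unfolded pqr]]]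
   unfolding comp_def u_def d_def m_def scaleR_eq_scale[symmetric] by (simp_all add: scaleR_prod_def)
  have sm: "strict_mono m" using s(1) by (auto simp: m_def strict_mono_def)
  have gm: "(\<lambda>n. gn (r (m n))) \<longlonglongrightarrow> g" using LIMSEQ_subseq_LIMSEQ[OF gr sm] by (simp add: comp_def)
  have hm: "(\<lambda>n. hn (r (m n))) \<longlonglongrightarrow> g" using LIMSEQ_subseq_LIMSEQ[OF hr(2)[unfolded True] sm] by (simp add: comp_def)
  have kn: "d n *s (gn (r (m n)) - hn (r (m n))) = T3 (d n *s P (m n)) (Y (gn (r (m n)))) (Z (gn (r (m n))))
   + T3 (X (hn (r (m n)))) (d n *s Q (m n)) (Z (gn (r (m n)))) + T3 (X (hn (r (m n)))) (Y (hn (r (m n)))) (d n *s R (m n))" for n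
  proof -
   have "m n \<ge> n0" by (simp add: m_def)
   note l = lift[OF this]
   show ?thesis
    by (subst l(1), subst l(2)) (simp add: P_def Q_def R_def T3_lin vec_eq_iff algebra_simps)
  qed
  have lk: "(\<lambda>n. d n *s (gn (r (m n)) - hn (r (m n)))) \<longlonglongrightarrow> k"
   unfolding kn k_def by (intro tendsto_add tendsto_T3 lim sec gm hm)
  have "d n *s (gn (r (m n)) - hn (r (m n))) \<in> K" for n
   using hn(3) cone3_alt[OF gc] cone3_alt[OF hn(1)] by (intro vec.subspace_scale[OF subspace_K]) (simp add: K_def WR_lin)
  then have kK: "k \<in> K" using closed_sequentially[OF closed_K _ lk] by blast
  have zero: "P n $ b = 0" "P n $ c = 0" "Q (n + n0) $ a = 0" "Q (n + n0) $ b = 0" "Q (n + n0) $ c = 0"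
   "R (n + n0) $ a = 0" "R (n + n0) $ b = 0" "R (n + n0) $ c = 0" for n
  proof -
   have z: "k $ (b, b, c) = 0" "k $ (c, b, c) = 0" "k $ (a, a, c) = 0" "k $ (a, c, c) = 0" "k $ (a, b, b) = 0" "k $ (a, b, a) = 0" if "alt k" for k :: trivec
    using altD(1)[OF that, of b b c] altD(1)[OF that, of c b c] altD(2)[OF that, of b c c] altD(1)[OF that, of a a c] altD(2)[OF that, of a c c]
     altD(2)[OF that, of a b b] altD(2)[OF that, of a b a] altD(1)[OF that, of a a b] by simp_all
   note zz = z[OF cone3_alt[OF gc]] z[OF cone3_alt[OF hn(1)]]
   show "P n $ b = 0" "P n $ c = 0" by (simp_all add: P_def X_def sec1_def zz)
   have "gn (r (n + n0)) $ (a, b, c) \<noteq> 0" "hn (r (n + n0)) $ (a, b, c) \<noteq> 0" using n0[of "n + n0"] by simp_all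
   then show "Q (n + n0) $ a = 0" "Q (n + n0) $ b = 0" "Q (n + n0) $ c = 0" "R (n + n0) $ a = 0" "R (n + n0) $ b = 0" "R (n + n0) $ c = 0"
    by (simp_all add: Q_def R_def Y_def Z_def sec2_def sec3_def zz)
  qed
  have l0: "x $ i = 0" if "(\<lambda>n. d n *s f (m n)) \<longlonglongrightarrow> x" "\<And>n. f (n + n0) $ i = 0" for x :: vec6 and f i
   using tendsto_vec_nth[OF that(1), of i] that(2) by (simp add: m_def LIMSEQ_const_iff)
  have pz: "p $ b = 0" "p $ c = 0" "q $ a = 0" "q $ b = 0" "q $ c = 0" "w $ a = 0" "w $ b = 0" "w $ c = 0"
   using l0[OF lim(1)] l0[OF lim(2)] l0[OF lim(3)] zero by blast+
  have ag: "alt g" using gx by simp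
  have gz: "X g $ b = 0" "X g $ c = 0" "X g $ a \<noteq> 0" "Y g $ b = 1" "Y g $ c = 0" "Y g $ a = 0" "Z g $ c = 1" "Z g $ a = 0" "Z g $ b = 0"
   using altD(1)[OF ag, of b b c] altD(1)[OF ag, of c b c] altD(2)[OF ag, of b c c] altD(1)[OF ag, of a a c] altD(2)[OF ag, of a c c]
     altD(2)[OF ag, of a b b] altD(2)[OF ag, of a b a] altD(1)[OF ag, of a a b] ne
   by (simp_all add: X_def Y_def Z_def sec1_def sec2_def sec3_def)
  have "k \<noteq> 0"
  proof
   assume k0: "k = 0"
   have "k $ (i, b, c) = p $ i" "k $ (a, i, c) = p $ a * Y g $ i + X g $ a * q $ i" "k $ (a, b, i) = p $ a * Z g $ i + X g $ a * w $ i" for i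
    by (simp_all add: k_def T3_nth pz gz)
   then have "p $ i = 0" "X g $ a * q $ i = 0" "X g $ a * w $ i = 0" for i using k0 by (metis zero_index add_0 mult_zero_left)+
   then show False using pqr0 gz(3) by (simp add: vec_eq_iff)
  qed
  have gT: "g = T3 (X g) (Y g) (Z g)" using T3_echelon[OF _ ne] gx unfolding X_def Y_def Z_def by simp
  then have "eigen_type k (X g) (Y g) (Z g) \<or> rank_one_type k (X g) (Y g) (Z g)"
   using classify_tangent[OF _ k_def] K_not_T3[OF kK \<open>k \<noteq> 0\<close>] g(2) by metis
  then have "eigen_type k x y z \<or> rank_one_type k x y z" using type_change[of "X g" "Y g" "Z g" x y z] gT gx g(2) by metis
  then show ?thesis using kK by blast
 qed
qed

text \<open>The complement of a null set is dense, and \<open>T3\<close> is continuous.\<close>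

lemma dense_from_negligible:
 assumes N: "negligible N" and D: "\<And>x y z. T3 x y z \<noteq> 0 \<Longrightarrow> (x, y, z) \<notin> N \<Longrightarrow> T3 x y z \<in> D"
 shows "cone3 - {0} \<subseteq> closure D"
proof
 fix g assume "g \<in> cone3 - {0}"
 then obtain x0 y0 z0 where g: "g = T3 x0 y0 z0" "g \<noteq> 0" by (auto simp: cone3_def)
 show "g \<in> closure D"
  unfolding closure_iff_nhds_not_empty
 proof (intro allI impI)
  fix A V assume V: "V \<subseteq> A" "open V" "g \<in> V"
  define P where "P = (\<lambda>p. T3 (fst p) (fst (snd p)) (snd (snd p))) -` (V - {0})"
  have "continuous_on UNIV (\<lambda>p. T3 (fst p) (fst (snd p)) (snd (snd p)))"
   by (intro differentiable_imp_continuous_on differentiable_everywhere differentiable_T3 differentiable_pair differentiable_ident)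
  then have "open P" unfolding P_def using V(2) by (intro open_vimage open_Diff) auto
  moreover have "(x0, y0, z0) \<in> P" using V(3) g by (simp add: P_def)
  ultimately have "\<not> negligible P" using open_not_negligible by blast
  then obtain x y z where "(x, y, z) \<in> P" "(x, y, z) \<notin> N" using N negligible_subset by (metis subsetI prod_cases3)
  then have "T3 x y z \<in> D" "T3 x y z \<in> V" using D by (auto simp: P_def)
  then show "D \<inter> A \<noteq> {}" using V(1) by blast
 qed
qed

end

section \<open>Solutions as vectors\<close>

lemma sum_fun_apply: "(\<Sum>i\<in>S. h i) x = (\<Sum>i\<in>S. h i x)" for h :: "'i \<Rightarrow> 'x \<Rightarrow> complex"
 by (induction S rule: infinite_finite_induct) auto

context odo6
begin

abbreviation V :: "(real \<Rightarrow> complex) set" where "V \<equiv> solutions I L"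

definition t0 :: real where "t0 = (SOME t. t \<in> I)"

lemma t0: "t0 \<in> I"
 unfolding t0_def using interior_nonempty interior_subset by (metis (no_types) all_not_in_conv someI_ex subsetD)

lemma nderiv_on_lin:
 assumes "smooth_on I x" "smooth_on I y" "t \<in> I"
 shows "nderiv_on I k (\<lambda>s. \<alpha> * x s + \<beta> * y s) t = \<alpha> * nderiv_on I k x t + \<beta> * nderiv_on I k y t"
 using assms by (simp add: nderiv_on_add nderiv_on_cmult)

lemma V_lin:
 assumes "x \<in> V" "y \<in> V" shows "(\<lambda>t. \<alpha> * x t + \<beta> * y t) \<in> V"
proof -
 have s: "smooth_on I x" "smooth_on I y" using assms by (auto intro: solutionsD)
 have "odo_apply I L (\<lambda>t. \<alpha> * x t + \<beta> * y t) t = \<alpha> * odo_apply I L x t + \<beta> * odo_apply I L y t" if "t \<in> I" for t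
  unfolding odo_apply_def nderiv_on_lin[OF s that] by (simp add: algebra_simps sum.distrib sum_distrib_left)
 then show ?thesis using assms s by (auto simp: solutions_def smooth_functions_def)
qed

lemma V_eqI:
 assumes "x \<in> V" "y \<in> V" "s \<in> I" "\<And>j. j < 6 \<Longrightarrow> nderiv_on I j x s = nderiv_on I j y s"
 shows "x = y"
proof -
 have sm: "smooth_on I x" "smooth_on I y" using assms by (auto intro: solutionsD)
 have "(\<lambda>t. 1 * x t + (- 1) * y t) = (\<lambda>t. 0)"
  by (rule solution_unique[OF V_lin[OF assms(1,2)] assms(3)]) (simp only: nderiv_on_lin[OF sm assms(3)], simp add: assms(4))
 then show ?thesis by (simp add: fun_eq_iff)
qed

text \<open>Solutions are parametrised by their jets at \<open>t0\<close>.\<close>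

definition sol :: "vec6 \<Rightarrow> real \<Rightarrow> complex" where
 "sol v = (SOME x. x \<in> V \<and> (\<forall>j<6. nderiv_on I j x t0 = v $ ix j))"

lemma sol: "sol v \<in> V" "j < 6 \<Longrightarrow> nderiv_on I j (sol v) t0 = v $ ix j"
proof -
 have "\<exists>x. x \<in> V \<and> (\<forall>j<6. nderiv_on I j x t0 = v $ ix j)" using solution_exists[OF t0] by blast
 from someI_ex[OF this] show "sol v \<in> V" "j < 6 \<Longrightarrow> nderiv_on I j (sol v) t0 = v $ ix j" unfolding sol_def by auto
qed

lemma smooth_sol: "smooth_on I (sol v)" using sol(1) solutionsD(1) by blast

lemma sol_outside: "t \<notin> I \<Longrightarrow> sol v t = 0"
 using sol(1)[of v] by (simp add: solutions_def smooth_functions_def)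

lemma sol_lin: "sol (\<alpha> *s v + \<beta> *s w) = (\<lambda>t. \<alpha> * sol v t + \<beta> * sol w t)"
 by (rule V_eqI[OF sol(1) V_lin[OF sol(1) sol(1)] t0])
  (simp add: nderiv_on_lin[OF smooth_sol smooth_sol t0] sol(2))

lemma sol_surj: "x \<in> V \<Longrightarrow> \<exists>v. x = sol v"
proof
 assume "x \<in> V"
 then show "x = sol (\<chi> i. nderiv_on I (rk i) x t0)" by (rule V_eqI[OF _ sol(1) t0]) (simp add: sol(2))
qed

lemma sol_inj: "sol v = sol w \<Longrightarrow> v = w"
proof -
 assume e: "sol v = sol w"
 have "v $ i = w $ i" for i using sol(2)[of "rk i" v] sol(2)[of "rk i" w] e by simp
 then show ?thesis by (simp add: vec_eq_iff)
qed

lemma sol_add: "sol (v + w) = sol v + sol w" and sol_scale: "sol (c *s v) = fscale c (sol v)" and sol_0: "sol 0 = 0"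
proof -
 show "sol (v + w) = sol v + sol w" using sol_lin[of 1 v 1 w] by (simp add: fun_eq_iff)
 show "sol (c *s v) = fscale c (sol v)" for c v using sol_lin[of c v 0 0] by (simp add: fun_eq_iff fscale_def)
 from this[of 0 0] show "sol 0 = 0" by (simp add: fscale_def fun_eq_iff)
qed

lemma V_eq_sol: "V = range sol"
proof
 show "V \<subseteq> range sol" using sol_surj by blast
 show "range sol \<subseteq> V" using sol(1) by blast
qed

text \<open>The curve of evaluation functionals and its derivatives, in coordinates.\<close>

definition cc :: "nat \<Rightarrow> real \<Rightarrow> vec6" where
 "cc j t = (\<chi> i. nderiv_on I j (sol (axis i 1)) t)"

lemma nderiv_sol:
 assumes "t \<in> I" shows "nderiv_on I j (sol v) t = v \<cdot> cc j t"
proof -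
 have "linear6 (\<lambda>v. nderiv_on I j (sol v) t)"
 proof -
  have "nderiv_on I j (sol (v + w)) t = nderiv_on I j (sol v) t + nderiv_on I j (sol w) t" for v w
   using nderiv_on_lin[OF smooth_sol[of v] smooth_sol[of w] assms, of j 1 1] sol_lin[of 1 v 1 w] by simp
  moreover have "nderiv_on I j (sol (c *s v)) t = c * nderiv_on I j (sol v) t" for c v
   using nderiv_on_lin[OF smooth_sol[of v] smooth_sol[of v] assms, of j c 0] sol_lin[of c v 0 v] by simp
  ultimately show ?thesis by (simp add: linear6_def)
 qed
 from linear6_expand[OF this] show ?thesis unfolding pair_def cc_def vec_lambda_beta .
qed

lemma cc_derivative:
 assumes "t \<in> I" shows "(cc j has_vector_derivative cc (Suc j) t) (at t within I)"
proof -
 have "((\<lambda>t. nderiv_on I j (sol (axis i 1)) t) has_vector_derivative nderiv_on I (Suc j) (sol (axis i 1)) t) (at t within I)" for i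
  by (rule smooth_on_has_derivative[OF smooth_sol assms])
 from has_vector_derivative_vec_lambda[OF this] show ?thesis unfolding cc_def[abs_def] .
qed

lemma pair_cc_derivative:
 assumes "t \<in> I" shows "((\<lambda>t. v \<cdot> cc j t) has_vector_derivative v \<cdot> cc (Suc j) t) (at t within I)"
proof -
 have "((\<lambda>t. \<Sum>i\<in>UNIV. v $ i * cc j t $ i) has_vector_derivative (\<Sum>i\<in>UNIV. v $ i * cc (Suc j) t $ i)) (at t within I)"
  by (intro has_vector_derivative_sum has_vector_derivative_mult_right
    bounded_linear.has_vector_derivative[OF bounded_linear_vec_nth cc_derivative] assms)
 then show ?thesis by (simp only: pair_def)
qed

lemma cc_6: "t \<in> I \<Longrightarrow> cc 6 t = - (\<Sum>j<6. a j t *s cc j t)"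
 using solutionsD(3)[OF sol(1)] by (simp add: cc_def vec_eq_iff)

lemma cc_base: "j < 6 \<Longrightarrow> cc j t0 = axis (ix j) 1"
 by (simp add: cc_def vec_eq_iff sol(2) axis_def)

lemma cc_dual: "t \<in> I \<Longrightarrow> \<exists>E. \<forall>i<6. \<forall>j<6. E i \<cdot> cc j t = (if i = j then 1 else 0)"
proof -
 assume t: "t \<in> I"
 have "\<exists>v. \<forall>j<6. v \<cdot> cc j t = (if i = j then 1 else 0)" if "i < 6" for i
 proof -
  obtain x where x: "x \<in> V" "\<forall>j<6. nderiv_on I j x t = (axis (ix i) 1 :: vec6) $ ix j" using solution_exists[OF t] by blast
  obtain v where v: "x = sol v" using sol_surj x(1) by blast
  have "v \<cdot> cc j t = (if i = j then 1 else 0)" if j: "j < 6" for j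
   using x(2) j \<open>i < 6\<close> nderiv_sol[OF t, of j v] unfolding v by (auto simp: axis_def ix_eq_iff)
  then show ?thesis by blast
 qed
 then show ?thesis by metis
qed

lemma cc_dual_list:
 assumes "t \<in> I" shows "\<exists>E. dual (map (\<lambda>j. cc j t) [0..<6]) E"
proof -
 obtain E where "\<forall>i<6. \<forall>j<6. E i \<cdot> cc j t = (if i = j then 1 else 0)" using cc_dual[OF assms] by blast
 then have "dual (map (\<lambda>j. cc j t) [0..<6]) E" by (auto simp: dual_def pair_commute[of "cc _ t"])
 then show ?thesis by blast
qed

section \<open>The Wronskian of independent solutions\<close>

text \<open>On an open set all derivatives vanish too, and a solution with a vanishing jet is zero.\<close>

lemma solution_zero_open:
 assumes J: "open J" "J \<subseteq> I" "J \<noteq> {}" and z: "\<And>t. t \<in> J \<Longrightarrow> v \<cdot> cc 0 t = 0"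
 shows "v = 0"
proof -
 have at_I: "at t within I = at t" if "t \<in> J" for t
  using J that by (intro at_within_interior) (meson interior_maximal subsetD)
 have "\<forall>t\<in>J. v \<cdot> cc k t = 0" for k
 proof (induction k)
  case (Suc k)
  show ?case
  proof
   fix t assume t: "t \<in> J"
   have "((\<lambda>t. v \<cdot> cc k t) has_vector_derivative v \<cdot> cc (Suc k) t) (at t)"
    using pair_cc_derivative[of t v k] at_I[OF t] t J(2) by auto
   moreover have "((\<lambda>t. v \<cdot> cc k t) has_vector_derivative 0) (at t)"
    by (rule has_vector_derivative_transform_within_open[OF has_vector_derivative_const J(1) t]) (simp add: Suc.IH)
   ultimately show "v \<cdot> cc (Suc k) t = 0" by (rule vector_derivative_unique_at)
  qed
 qed (use z in blast)
 moreover obtain s where s: "s \<in> J" using J(3) by blast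
 ultimately have "\<And>j. v \<cdot> cc j s = 0" by blast
 then have "sol v = (\<lambda>t. 0)"
  using s J(2) nderiv_sol by (intro solution_unique[OF sol(1)]) auto
 then show ?thesis using sol_inj[of v 0] sol_0 by (simp add: zero_fun_def)
qed

lemma quotient_constant:
 fixes f g f' g' :: "real \<Rightarrow> complex"
 assumes J: "J = ball s r" and d: "\<And>t. t \<in> J \<Longrightarrow> (f has_vector_derivative f' t) (at t)" "\<And>t. t \<in> J \<Longrightarrow> (g has_vector_derivative g' t) (at t)"
  and nz: "\<And>t. t \<in> J \<Longrightarrow> f t \<noteq> 0" and W: "\<And>t. t \<in> J \<Longrightarrow> g' t * f t = g t * f' t"
 shows "\<exists>c. \<forall>t\<in>J. g t = c * f t"
proof -
 have dz: "((\<lambda>t. g t / f t) has_vector_derivative 0) (at t within J)" if t: "t \<in> J" for t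
 proof -
  have "((\<lambda>t. g t / f t) has_derivative (\<lambda>h. ((h *\<^sub>R g' t) * f t - g t * (h *\<^sub>R f' t)) / (f t * f t))) (at t within J)"
   using d[OF t] nz[OF t] unfolding has_vector_derivative_def by (intro has_derivative_divide') (auto intro: has_derivative_at_withinI)
  moreover have "(\<lambda>h. ((h *\<^sub>R g' t) * f t - g t * (h *\<^sub>R f' t)) / (f t * f t)) = (\<lambda>h. h *\<^sub>R 0)"
  proof
   fix h :: real
   have "(h *\<^sub>R g' t) * f t - g t * (h *\<^sub>R f' t) = h *\<^sub>R (g' t * f t - g t * f' t)"
    by (simp add: scaleR_conv_of_real algebra_simps)
   then show "((h *\<^sub>R g' t) * f t - g t * (h *\<^sub>R f' t)) / (f t * f t) = h *\<^sub>R 0" using W[OF t] by simp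
  qed
  ultimately show ?thesis by (simp add: has_vector_derivative_def)
 qed
 have "convex J" unfolding J by (rule convex_ball)
 then obtain c where "\<And>t. t \<in> J \<Longrightarrow> g t / f t = c" using has_vector_derivative_zero_constant dz by blast
 then have "\<forall>t\<in>J. g t = c * f t" using nz by (simp add: field_simps)
 then show ?thesis by blast
qed

text \<open>On an interval where \<open>f\<close> and the Wronskian of \<open>f, g\<close> do not vanish, a vanishing Wronskian of
 \<open>f, g, h\<close> forces \<open>(h/f)' = \<beta> (g/f)'\<close> with a constant \<open>\<beta>\<close>, hence a linear relation.\<close>

lemma wronskian_nonzero:
 assumes T: "T3 x y z \<noteq> 0"
 shows "\<exists>t\<in>I. tri (T3 x y z) (cc 0 t) (cc 1 t) (cc 2 t) \<noteq> 0"
proof (rule ccontr)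
 assume n: "\<not> ?thesis"
 define f where "f j t = x \<cdot> cc j t" for j t
 define g where "g j t = y \<cdot> cc j t" for j t
 define h where "h j t = z \<cdot> cc j t" for j t
 have W: "f 0 t * (g 1 t * h 2 t - g 2 t * h 1 t) - f 1 t * (g 0 t * h 2 t - g 2 t * h 0 t)
   + f 2 t * (g 0 t * h 1 t - g 1 t * h 0 t) = 0" if "t \<in> I" for t
  using n that unfolding tri_T3 f_def g_def h_def by blast
 have der: "(f j has_vector_derivative f (Suc j) t) (at t)" "(g j has_vector_derivative g (Suc j) t) (at t)"
  "(h j has_vector_derivative h (Suc j) t) (at t)" if "t \<in> interior I" for t j
  using pair_cc_derivative[of t _ j] that interior_subset at_within_interior[OF that] unfolding f_def g_def h_def by auto
 have d1: "(f 0 has_vector_derivative f 1 t) (at t)" "(g 0 has_vector_derivative g 1 t) (at t)" "(h 0 has_vector_derivative h 1 t) (at t)"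
  "(f 1 has_vector_derivative f 2 t) (at t)" "(g 1 has_vector_derivative g 2 t) (at t)" "(h 1 has_vector_derivative h 2 t) (at t)"
  if "t \<in> interior I" for t
  using der[OF that, of 0] der[OF that, of 1] by (simp_all add: numeral_2_eq_2 One_nat_def)
 have cont: "isCont (f j) t" "isCont (g j) t" "isCont (h j) t" if "t \<in> interior I" for t j
  using der[OF that] has_vector_derivative_continuous by blast+
 have rel: "p = 0 \<and> q = 0 \<and> r = 0" if "p *s x + q *s y + r *s z = 0" for p q r
  using indep3_relation[OF T that] .
 have "\<exists>t\<in>interior I. f 0 t \<noteq> 0"
 proof (rule ccontr)
  assume "\<not> ?thesis"
  then have "x = 0" using interior_nonempty interior_subset
   by (intro solution_zero_open[of "interior I"]) (auto simp: f_def)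
  then show False using T by (simp add: T3_lin)
 qed
 then obtain s1 where s1: "s1 \<in> interior I" "f 0 s1 \<noteq> 0" by blast
 obtain r1 where r1: "r1 > 0" "ball s1 r1 \<subseteq> interior I" "\<And>t. t \<in> ball s1 r1 \<Longrightarrow> f 0 t \<noteq> 0"
 proof -
  obtain e where e: "e > 0" "\<And>t. dist s1 t < e \<Longrightarrow> f 0 t \<noteq> 0"
   using continuous_at_avoid[of s1 "f 0" 0] cont(1)[OF s1(1)] s1(2) by blast
  obtain e' where e': "e' > 0" "ball s1 e' \<subseteq> interior I" using open_contains_ball open_interior s1(1) by blast
  show ?thesis by (rule that[of "min e e'"]) (use e e' in auto)
 qed
 define Q where "Q t = g 1 t * f 0 t - g 0 t * f 1 t" for t
 have "\<exists>t\<in>ball s1 r1. Q t \<noteq> 0"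
 proof (rule ccontr)
  assume q: "\<not> ?thesis"
  obtain c where c: "\<forall>t\<in>ball s1 r1. g 0 t = c * f 0 t"
   using quotient_constant[OF refl, of s1 r1 "f 0" "f 1" "g 0" "g 1"] d1 r1 q by (auto simp: Q_def subset_iff)
  have "y - c *s x = 0"
  proof (rule solution_zero_open[OF open_ball])
   show "ball s1 r1 \<subseteq> I" using r1(2) interior_subset by blast
   show "ball s1 r1 \<noteq> {}" using r1(1) by simp
   fix t assume "t \<in> ball s1 r1"
   then show "(y - c *s x) \<cdot> cc 0 t = 0" using c by (simp add: f_def g_def pair_simps)
  qed
  then have "(- c) *s x + 1 *s y + 0 *s z = 0" by (simp add: vec_eq_iff)
  then show False using rel by fastforce
 qed
 then obtain s2 where s2: "s2 \<in> ball s1 r1" "Q s2 \<noteq> 0" by blast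
 have "isCont Q s2" unfolding Q_def using s2(1) r1(2) cont by (intro continuous_intros) auto
 obtain r2 where r2: "r2 > 0" "ball s2 r2 \<subseteq> ball s1 r1" "\<And>t. t \<in> ball s2 r2 \<Longrightarrow> Q t \<noteq> 0"
 proof -
  obtain e where e: "e > 0" "\<And>t. dist s2 t < e \<Longrightarrow> Q t \<noteq> 0"
   using continuous_at_avoid[of s2 Q 0] \<open>isCont Q s2\<close> s2(2) by blast
  obtain e' where e': "e' > 0" "ball s2 e' \<subseteq> ball s1 r1" using open_contains_ball open_ball s2(1) by blast
  show ?thesis by (rule that[of "min e e'"]) (use e e' in auto)
 qed
 have J: "t \<in> interior I" "t \<in> I" "f 0 t \<noteq> 0" if "t \<in> ball s2 r2" for t
  using that r2(2) r1(2,3) interior_subset by blast+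
 define P where "P t = h 1 t * f 0 t - h 0 t * f 1 t" for t
 have dQ: "(Q has_vector_derivative g 2 t * f 0 t - g 0 t * f 2 t) (at t)" if "t \<in> ball s2 r2" for t
 proof -
  note d = d1[OF J(1)[OF that]]
  show ?thesis unfolding Q_def
   using has_vector_derivative_diff[OF has_vector_derivative_mult[OF d(5) d(1)] has_vector_derivative_mult[OF d(2) d(4)]] by (simp add: algebra_simps)
 qed
 have dP: "(P has_vector_derivative h 2 t * f 0 t - h 0 t * f 2 t) (at t)" if "t \<in> ball s2 r2" for t
 proof -
  note d = d1[OF J(1)[OF that]]
  show ?thesis unfolding P_def
   using has_vector_derivative_diff[OF has_vector_derivative_mult[OF d(6) d(1)] has_vector_derivative_mult[OF d(3) d(4)]] by (simp add: algebra_simps)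
 qed
 have PQ: "(h 2 t * f 0 t - h 0 t * f 2 t) * Q t = P t * (g 2 t * f 0 t - g 0 t * f 2 t)" if "t \<in> ball s2 r2" for t
 proof -
  have "(h 2 t * f 0 t - h 0 t * f 2 t) * Q t - P t * (g 2 t * f 0 t - g 0 t * f 2 t) =
   f 0 t * (f 0 t * (g 1 t * h 2 t - g 2 t * h 1 t) - f 1 t * (g 0 t * h 2 t - g 2 t * h 0 t)
   + f 2 t * (g 0 t * h 1 t - g 1 t * h 0 t))"
   by (simp add: P_def Q_def algebra_simps)
  then show ?thesis using W[OF J(2)[OF that]] by simp
 qed
 obtain \<beta> where \<beta>: "\<forall>t\<in>ball s2 r2. P t = \<beta> * Q t"
  using quotient_constant[OF refl dQ dP r2(3) PQ] by blast
 have hb: "((\<lambda>t. h 0 t - \<beta> * g 0 t) has_vector_derivative h 1 t - \<beta> * g 1 t) (at t)" if "t \<in> ball s2 r2" for t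
  using d1[OF J(1)[OF that]] by (intro has_vector_derivative_diff has_vector_derivative_mult_right)
 have "(h 1 t - \<beta> * g 1 t) * f 0 t = (h 0 t - \<beta> * g 0 t) * f 1 t" if "t \<in> ball s2 r2" for t
  using \<beta> that by (auto simp: P_def Q_def algebra_simps)
 then obtain \<alpha> where \<alpha>: "\<forall>t\<in>ball s2 r2. h 0 t - \<beta> * g 0 t = \<alpha> * f 0 t"
  using quotient_constant[OF refl d1(1)[OF J(1)] hb J(3)] by blast
 have "z - \<beta> *s y - \<alpha> *s x = 0"
 proof (rule solution_zero_open[of "ball s2 r2"])
  fix t assume "t \<in> ball s2 r2"
  then show "(z - \<beta> *s y - \<alpha> *s x) \<cdot> cc 0 t = 0" using \<alpha> by (simp add: pair_simps f_def g_def h_def)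
 qed (use r2(1) J(2) in auto)
 then have "(- \<alpha>) *s x + (- \<beta>) *s y + 1 *s z = 0" by (simp add: vec_eq_iff algebra_simps)
 then show False using rel by fastforce
qed

end

lemma det_mat_3:
 "Determinant.det (Matrix.mat 3 3 f) = f (0, 0) * (f (1, 1) * f (2, 2) - f (1, 2) * f (2, 1))
  - f (0, 1) * (f (1, 0) * f (2, 2) - f (1, 2) * f (2, 0)) + f (0, 2) * (f (1, 0) * f (2, 1) - f (1, 1) * (f (2, 0) :: complex))"
proof -
 have det2: "Determinant.det (Matrix.mat 2 2 h) = h (0, 0) * h (1, 1) - h (0, 1) * h (1, 0)" for h :: "nat \<times> nat \<Rightarrow> complex"
 proof -
  have c: "Matrix.mat 2 2 h \<in> carrier_mat 2 2" by simp
  have m: "mat_delete (Matrix.mat 2 2 h) 0 j = Matrix.mat 1 1 (\<lambda>_. h (1, 1 - j))" if "j < 2" for j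
   by (rule eq_matI) (use that in \<open>auto simp: mat_delete_def less_Suc_eq numeral_2_eq_2 One_nat_def\<close>)
  have d1: "Determinant.det (Matrix.mat 1 1 (\<lambda>_. v)) = v" for v :: complex
   using det_single[of "Matrix.mat 1 1 (\<lambda>_. v)"] by simp
  show ?thesis
   unfolding laplace_expansion_row[OF c, of 0, simplified] sum_less_numeral
   by (simp add: cofactor_def m d1)
 qed
 have c: "Matrix.mat 3 3 f \<in> carrier_mat 3 3" by simp
 have m: "mat_delete (Matrix.mat 3 3 f) 0 j = Matrix.mat 2 2 (\<lambda>(p, q). f (p + 1, if q < j then q else q + 1))" if "j < 3" for j
  by (rule eq_matI) (use that in \<open>auto simp: mat_delete_def Suc_eq_plus1\<close>)
 show ?thesis
  unfolding laplace_expansion_row[OF c, of 0, simplified] sum_less_numeral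
  by (simp add: cofactor_def m det2 algebra_simps)
qed

lemma sum_list_index:
 assumes "distinct fs"
 shows "(\<Sum>i<length fs. G (fs ! i)) = (\<Sum>f\<in>set fs. G f)"
 using sum.reindex_bij_betw[OF bij_betw_nth[OF assms refl refl], of G] by (simp add: lessThan_atLeast0)

lemma basis_list_iff:
 "basis_list fs W \<longleftrightarrow> (\<forall>u. (\<Sum>i<length fs. fscale (u i) (fs ! i)) = 0 \<longrightarrow> (\<forall>i<length fs. u i = 0)) \<and>
  W = range (\<lambda>u. \<Sum>i<length fs. fscale (u i) (fs ! i))" (is "_ \<longleftrightarrow> ?I \<and> ?S")
proof -
 have key: "(\<Sum>i<length fs. fscale (u i) (fs ! i)) = (\<Sum>f\<in>set fs. fscale (u (inv_into {..<length fs} ((!) fs) f)) f)"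
  and bk: "(\<Sum>f\<in>set fs. fscale (w f) f) = (\<Sum>i<length fs. fscale (w (fs ! i)) (fs ! i))" if d: "distinct fs" for u w
 proof -
  have "inv_into {..<length fs} ((!) fs) (fs ! i) = i" if "i < length fs" for i
   using d that by (intro inv_into_f_f) (auto simp: inj_on_def nth_eq_iff_index_eq)
  then have "(\<Sum>i<length fs. fscale (u i) (fs ! i)) = (\<Sum>i<length fs. fscale (u (inv_into {..<length fs} ((!) fs) (fs ! i))) (fs ! i))"
   by (intro sum.cong) auto
  also have "\<dots> = (\<Sum>f\<in>set fs. fscale (u (inv_into {..<length fs} ((!) fs) f)) f)"
   by (rule sum_list_index[OF d, of "\<lambda>f. fscale (u (inv_into {..<length fs} ((!) fs) f)) f"])
  finally show "(\<Sum>i<length fs. fscale (u i) (fs ! i)) = (\<Sum>f\<in>set fs. fscale (u (inv_into {..<length fs} ((!) fs) f)) f)" .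
  show "(\<Sum>f\<in>set fs. fscale (w f) f) = (\<Sum>i<length fs. fscale (w (fs ! i)) (fs ! i))"
   by (rule sum_list_index[OF d, of "\<lambda>f. fscale (w f) f", symmetric])
 qed
 have span: "cfun.span (set fs) = range (\<lambda>u. \<Sum>i<length fs. fscale (u i) (fs ! i))" if d: "distinct fs"
  unfolding cfun.span_finite[OF finite_set]
 proof (intro subset_antisym image_subsetI)
  fix u show "(\<Sum>v\<in>set fs. fscale (u v) v) \<in> range (\<lambda>u. \<Sum>i<length fs. fscale (u i) (fs ! i))"
   unfolding bk[OF d] by (rule range_eqI[of _ _ "\<lambda>i. u (fs ! i)"]) simp
 next
  fix u show "(\<Sum>i<length fs. fscale (u i) (fs ! i)) \<in> range (\<lambda>u. \<Sum>v\<in>set fs. fscale (u v) v)"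
   unfolding key[OF d] by (rule range_eqI[of _ _ "\<lambda>f. u (inv_into {..<length fs} ((!) fs) f)"]) simp
 qed
 show ?thesis
 proof
  assume b: "basis_list fs W"
  then have d: "distinct fs" and ind: "cfun.independent (set fs)" by (auto simp: basis_list_def)
  have ?I
  proof (intro allI impI)
   fix u i assume s: "(\<Sum>i<length fs. fscale (u i) (fs ! i)) = 0" and i: "i < length fs"
   have "u (inv_into {..<length fs} ((!) fs) (fs ! i)) = 0"
    using ind s i unfolding key[OF d] cfun.dependent_finite[OF finite_set] by force
   moreover have "inv_into {..<length fs} ((!) fs) (fs ! i) = i"
    using d i by (intro inv_into_f_f) (auto simp: inj_on_def nth_eq_iff_index_eq)
   ultimately show "u i = 0" by simp
  qed
  then show "?I \<and> ?S" using b span[OF d] by (simp add: basis_list_def)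
 next
  assume IS: "?I \<and> ?S"
  have d: "distinct fs"
   unfolding distinct_conv_nth
  proof (intro allI impI)
   fix i j assume ij: "i < length fs" "j < length fs" "i \<noteq> j"
   show "fs ! i \<noteq> fs ! j"
   proof
    assume e: "fs ! i = fs ! j"
    define u :: "nat \<Rightarrow> complex" where "u k = (if k = i then 1 else 0) + (if k = j then - 1 else 0)" for k
    have sp: "fscale (u k) (fs ! k) = (if k = i then fs ! i else 0) + (if k = j then - (fs ! i) else 0)" for k
     using e ij(3) by (auto simp: u_def fscale_def fun_eq_iff)
    have "(\<Sum>k<length fs. fscale (u k) (fs ! k)) = 0" unfolding sp using ij by (simp add: sum.distrib)
    then have "u i = 0" using IS ij by blast
    then show False using ij by (simp add: u_def)
   qed
  qed
  have "cfun.independent (set fs)"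
   unfolding cfun.dependent_finite[OF finite_set]
  proof clarify
   fix u v assume s: "(\<Sum>v\<in>set fs. fscale (u v) v) = 0" and v: "v \<in> set fs" "u v \<noteq> 0"
   have "\<forall>i<length fs. u (fs ! i) = 0" using IS[THEN conjunct1, THEN spec, of "\<lambda>i. u (fs ! i)"] s unfolding bk[OF d] by simp
   then show False using v by (metis in_set_conv_nth)
  qed
  then show "basis_list fs W" using d span[OF d] IS by (simp add: basis_list_def)
 qed
qed

context odo6
begin

lemma sol_sum: "(\<Sum>i\<in>S. fscale (u i) (sol (w i))) = sol (\<Sum>i\<in>S. u i *s w i)"
 by (induction S rule: infinite_finite_induct) (simp_all add: sol_0 sol_add sol_scale)

lemma basis_list_sol:
 "basis_list (map sol xs) W \<longleftrightarrow> (\<forall>u. (\<Sum>i<length xs. u i *s xs ! i) = 0 \<longrightarrow> (\<forall>i<length xs. u i = 0)) \<and>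
  W = range (\<lambda>u. sol (\<Sum>i<length xs. u i *s xs ! i))"
proof -
 have "(\<Sum>i<length (map sol xs). fscale (u i) (map sol xs ! i)) = sol (\<Sum>i<length xs. u i *s xs ! i)" for u
  unfolding sol_sum[symmetric] by (intro sum.cong) auto
 moreover have "sol v = 0 \<longleftrightarrow> v = 0" for v using sol_inj[of v 0] sol_0 by auto
 ultimately show ?thesis unfolding basis_list_iff by simp
qed

definition fsol :: "(real \<Rightarrow> complex) list" where
 "fsol = map (\<lambda>i. sol (axis (ix i) 1)) [0..<6]"

lemma basis_fsol: "basis_list fsol V"
proof -
 define xs :: "vec6 list" where "xs = map (\<lambda>i. axis (ix i) 1) [0..<6]"
 have s: "(\<Sum>i<6. u i *s xs ! i) = (\<chi> i. u (rk i))" for u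
 proof -
  have "(\<Sum>i<6. u i *s xs ! i) = (\<Sum>i<6. u (rk (ix i)) *s axis (ix i) 1)" by (intro sum.cong) (auto simp: xs_def)
  also have "\<dots> = (\<Sum>i\<in>UNIV. u (rk i) *s axis i 1)" by (rule sum_ix[symmetric])
  also have "\<dots> = (\<chi> i. u (rk i))" by (simp add: vec_eq_iff axis_def if_distrib cong: if_cong)
  finally show ?thesis .
 qed
 have "V = range (\<lambda>u. sol (\<chi> i. u (rk i)))"
 proof -
  have "sol v \<in> range (\<lambda>u. sol (\<chi> i. u (rk i)))" for v
   by (rule range_eqI[of _ _ "\<lambda>j. v $ ix j"]) simp
  then show ?thesis unfolding V_eq_sol by blast
 qed
 moreover have "u i = 0" if "(\<chi> i. u (rk i)) = 0" "i < 6" for u :: "nat \<Rightarrow> complex" and i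
  using that(1)[unfolded vec_eq_iff, THEN spec, of "ix i"] that(2) by simp
 ultimately have "basis_list (map sol xs) V" unfolding basis_list_sol using s by (simp add: xs_def)
 then show ?thesis by (simp add: fsol_def xs_def comp_def)
qed

lemma basis_list_sol_3:
 "basis_list [sol x, sol y, sol z] W \<longleftrightarrow> T3 x y z \<noteq> 0 \<and> W = {sol (\<alpha> *s x + \<beta> *s y + \<gamma> *s z) | \<alpha> \<beta> \<gamma>. True}"
proof -
 have r: "range (\<lambda>u. sol (\<Sum>i<3. u i *s [x, y, z] ! i)) = {sol (\<alpha> *s x + \<beta> *s y + \<gamma> *s z) | \<alpha> \<beta> \<gamma>. True}"
 proof (intro subset_antisym image_subsetI subsetI)
  fix f assume "f \<in> {sol (\<alpha> *s x + \<beta> *s y + \<gamma> *s z) | \<alpha> \<beta> \<gamma>. True}"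
  then obtain \<alpha> \<beta> \<gamma> where f: "f = sol (\<alpha> *s x + \<beta> *s y + \<gamma> *s z)" by blast
  show "f \<in> range (\<lambda>u. sol (\<Sum>i<3. u i *s [x, y, z] ! i))"
   unfolding f by (rule range_eqI[of _ _ "\<lambda>i. [\<alpha>, \<beta>, \<gamma>] ! i"]) (simp add: sum_less_numeral)
 qed (auto simp: sum_less_numeral)
 have "(\<forall>u. (\<Sum>i<3. u i *s [x, y, z] ! i) = 0 \<longrightarrow> (\<forall>i<3. u i = 0)) \<longleftrightarrow> T3 x y z \<noteq> 0"
 proof
  assume l: "\<forall>u. (\<Sum>i<3. u i *s [x, y, z] ! i) = 0 \<longrightarrow> (\<forall>i<3. u i = 0)"
  show "T3 x y z \<noteq> 0"
   unfolding T3_nonzero_iff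
  proof (rule ccontr)
   assume "\<not> indep [x, y, z]"
   then obtain c :: "nat \<Rightarrow> complex" where "c 0 \<noteq> 0 \<or> c 1 \<noteq> 0 \<or> c 2 \<noteq> 0" "c 0 *s x + c 1 *s y + c 2 *s z = 0"
    using relation_3 by blast
   then show False using l[THEN spec, of c] unfolding sum_less_numeral all_less_numeral by simp
  qed
 next
  assume "T3 x y z \<noteq> 0"
  from indep3_relation[OF this] show "\<forall>u. (\<Sum>i<3. u i *s [x, y, z] ! i) = 0 \<longrightarrow> (\<forall>i<3. u i = 0)"
   unfolding sum_less_numeral all_less_numeral by simp
 qed
 then show ?thesis using basis_list_sol[of "[x, y, z]" W] r unfolding length_lists by simp
qed

end

section \<open>The Grassmannian and the degree\<close>

sublocale odo6 \<subseteq> wronski_cone I "cc 0" "cc 1" "cc 2"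
 by unfold_locales (rule wronskian_nonzero)

context odo6
begin

abbreviation Gr :: "(real \<Rightarrow> complex) set set" where "Gr \<equiv> grassmannian 3 V"

lemma wronskian_sol: "wronskian I [sol x, sol y, sol z] = WR (T3 x y z)"
proof
 fix t
 have l: "length [sol x, sol y, sol z] = 3" by simp
 show "wronskian I [sol x, sol y, sol z] t = WR (T3 x y z) t"
 proof (cases "t \<in> I")
  case True
  have n: "nderiv_on I 0 (sol v) t = v \<cdot> cc 0 t" "nderiv_on I 1 (sol v) t = v \<cdot> cc 1 t" "nderiv_on I 2 (sol v) t = v \<cdot> cc 2 t" for v
   by (rule nderiv_sol[OF True])+
  show ?thesis unfolding wronskian_def l det_mat_3 prod.case WR_def tri_T3
   using True by (simp add: n[unfolded funpow_0] numeral_2_eq_2[symmetric] One_nat_def[symmetric] n del: funpow.simps One_nat_def) (simp add: algebra_simps)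
 next
  case False
  then show ?thesis unfolding wronskian_def l det_mat_3 by (simp add: WR_def sol_outside)
 qed
qed

text \<open>The space of a decomposable \<open>g\<close> is recovered without choosing factors, as the set of vectors that divide \<open>g\<close>.\<close>

definition Lam :: "trivec \<Rightarrow> (real \<Rightarrow> complex) set" where
 "Lam g = sol ` {w. kills w g}"

lemma Lam_T3:
 assumes "T3 x y z \<noteq> 0" shows "Lam (T3 x y z) = {sol (\<alpha> *s x + \<beta> *s y + \<gamma> *s z) | \<alpha> \<beta> \<gamma>. True}"
 unfolding Lam_def using T3_span[OF assms] kills_combination[of _ x _ y _ z] by blast

lemma Lam_scale: "c \<noteq> 0 \<Longrightarrow> Lam (c *s g) = Lam g"
proof -
 assume c: "c \<noteq> 0"
 have "kills w (c *s g) \<longleftrightarrow> kills w g" for w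
  using kills_lin(5)[of w g c] kills_lin(5)[of w "c *s g" "1 / c"] c by auto
 then show ?thesis by (simp add: Lam_def)
qed

lemma Lam_eqD:
 assumes g: "g \<in> cone3" "g \<noteq> 0" and h: "h \<in> cone3" and eq: "Lam g = Lam h"
 shows "\<exists>c. h = c *s g"
proof -
 obtain x y z where gx: "g = T3 x y z" using g(1) by (auto simp: cone3_def)
 obtain x' y' z' where hx: "h = T3 x' y' z'" using h by (auto simp: cone3_def)
 have "kills w g" if "kills w h" for w
 proof -
  have "sol w \<in> Lam g" unfolding eq using that by (simp add: Lam_def)
  then obtain w' where w': "kills w' g" "sol w = sol w'" by (auto simp: Lam_def)
  then have "w = w'" by (intro sol_inj)
  then show ?thesis using w'(1) by simp
 qed
 then have "\<exists>c1 c2 c3. w = c1 *s x + c2 *s y + c3 *s z" if "kills w h" for w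
  using T3_span[of x y z w] g(2) gx that by blast
 moreover have "kills x' h" "kills y' h" "kills z' h" unfolding hx by (rule kills_T3)+
 ultimately obtain a1 a2 a3 b1 b2 b3 d1 d2 d3 where "x' = a1 *s x + a2 *s y + a3 *s z" "y' = b1 *s x + b2 *s y + b3 *s z" "z' = d1 *s x + d2 *s y + d3 *s z"
  by meson
 then show ?thesis unfolding gx hx using T3_combination by blast
qed

lemma Gr_basis:
 assumes "basis_list fs \<Lambda>" "\<Lambda> \<subseteq> V" "length fs = 3"
 shows "\<exists>x y z. fs = [sol x, sol y, sol z] \<and> T3 x y z \<noteq> 0 \<and> \<Lambda> = Lam (T3 x y z)"
proof -
 obtain f1 f2 f3 where fs: "fs = [f1, f2, f3]"
  using assms(3) by (auto simp: numeral_3_eq_3 length_Suc_conv)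
 have "set fs \<subseteq> \<Lambda>" using assms(1) cfun.span_superset unfolding basis_list_def by blast
 then have "f1 \<in> V" "f2 \<in> V" "f3 \<in> V" using assms(2) fs by auto
 then obtain x y z where f: "f1 = sol x" "f2 = sol y" "f3 = sol z" by (meson sol_surj)
 then show ?thesis using assms(1) basis_list_sol_3[of x y z \<Lambda>] Lam_T3[of x y z] unfolding fs f by blast
qed

lemma length_basis_list: "basis_list fs W \<Longrightarrow> basis_list gs W \<Longrightarrow> length fs = length gs"
 unfolding basis_list_def by (metis cfun.dim_eq_card_independent cfun.dim_span distinct_card)

lemma wronski_map_Lam:
 assumes "g \<in> cone3" "g \<noteq> 0"
 shows "Lam g \<in> Gr" "wronski_map I (Lam g) = cfun.span {WR g}"
proof -
 obtain x y z where gx: "g = T3 x y z" using assms(1) by (auto simp: cone3_def)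
 have T: "T3 x y z \<noteq> 0" using assms(2) gx by simp
 have b: "basis_list [sol x, sol y, sol z] (Lam g)" unfolding gx basis_list_sol_3 using T Lam_T3[OF T] by blast
 have sub: "Lam g \<subseteq> V" unfolding Lam_def using sol(1) by blast
 show "Lam g \<in> Gr" unfolding grassmannian_def using b sub by (auto intro!: exI[of _ "[sol x, sol y, sol z]"])
 define fs where "fs = (SOME fs. basis_list fs (Lam g))"
 have fs: "basis_list fs (Lam g)" unfolding fs_def by (rule someI[of "\<lambda>fs. basis_list fs (Lam g)", OF b])
 have "length fs = 3" using length_basis_list[OF fs b] by simp
 then obtain x' y' z' where f: "fs = [sol x', sol y', sol z']" "T3 x' y' z' \<noteq> 0" "Lam g = Lam (T3 x' y' z')"
  using Gr_basis[OF fs sub] by blast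
 obtain c where c: "T3 x' y' z' = c *s g" using Lam_eqD[OF assms cone3_T3 f(3)] by blast
 have c0: "c \<noteq> 0" using c f(2) by auto
 have "wronskian I fs = fscale c (WR g)" unfolding f(1) wronskian_sol c WR_lin ..
 then have "wronski_map I (Lam g) = cfun.span {fscale c (WR g)}" unfolding wronski_map_def fs_def[symmetric] by simp
 also have "\<dots> = cfun.span {WR g}"
 proof (rule line_eqI)
  show "fscale c (WR g) \<in> cfun.span {fscale c (WR g)}" by (rule cfun.span_base) simp
  show "fscale c (WR g) \<in> cfun.span {WR g}" by (intro cfun.span_scale cfun.span_base) simp
  show "fscale c (WR g) \<noteq> 0" using c0 K_cone3[OF assms(1)] assms(2) cfun.scale_eq_0_iff by blast
 qed
 finally show "wronski_map I (Lam g) = cfun.span {WR g}" .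
qed

lemma Gr_eq: "Gr = Lam ` (cone3 - {0})"
proof (intro subset_antisym subsetI)
 fix \<Lambda> assume "\<Lambda> \<in> Gr"
 then obtain fs where "basis_list fs \<Lambda>" "\<Lambda> \<subseteq> V" "length fs = 3" by (auto simp: grassmannian_def)
 from Gr_basis[OF this] obtain x y z where "T3 x y z \<noteq> 0" "\<Lambda> = Lam (T3 x y z)" by blast
 then show "\<Lambda> \<in> Lam ` (cone3 - {0})" by (intro image_eqI[of _ _ "T3 x y z"]) auto
qed (use wronski_map_Lam in auto)

lemma WR_line:
 assumes g: "g \<in> cone3" "g \<noteq> 0" and h: "h \<in> cone3" "h \<noteq> 0" and eq: "cfun.span {WR g} = cfun.span {WR h}"
 shows "\<exists>c. c \<noteq> 0 \<and> WR g = WR (c *s h)"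
proof -
 have "WR g \<in> cfun.span {WR h}" using eq cfun.span_base by blast
 then obtain c where c: "WR g = fscale c (WR h)" by (auto simp: cfun.span_singleton)
 have "c \<noteq> 0" using c K_cone3[OF g(1)] g(2) by auto
 then show ?thesis using c by (auto simp: WR_lin)
qed

lemma punctured_lines:
 assumes D: "D \<subseteq> cone3 - {0}" and scale: "\<And>g c. g \<in> D \<Longrightarrow> c \<noteq> 0 \<Longrightarrow> c *s g \<in> D"
 shows "punctured_cone ((\<lambda>g. cfun.span {WR g}) ` D) = WR ` D"
proof (intro subset_antisym subsetI)
 fix f assume "f \<in> punctured_cone ((\<lambda>g. cfun.span {WR g}) ` D)"
 then obtain g where g: "g \<in> D" "f \<in> cfun.span {WR g}" "f \<noteq> 0" by (auto simp: punctured_cone_def)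
 then obtain c where c: "f = fscale c (WR g)" by (auto simp: cfun.span_singleton)
 then have "c \<noteq> 0" using g(3) by auto
 then show "f \<in> WR ` D" using scale[OF g(1)] c by (auto simp: WR_lin[symmetric])
next
 fix f assume "f \<in> WR ` D"
 then obtain g where g: "g \<in> D" "f = WR g" by blast
 then have "f \<noteq> 0" using K_cone3 D by auto
 moreover have "f \<in> cfun.span {WR g}" using g(2) cfun.span_base by blast
 ultimately show "f \<in> punctured_cone ((\<lambda>g. cfun.span {WR g}) ` D)" using g(1) by (auto simp: punctured_cone_def)
qed

text \<open>A point of the image is a line of Wronskians; scaling the Pluecker vectors over it to have one common Wronskian
 identifies the fibre with a set of decomposables. Openness in the image comes from the closedness of \<open>WR\<close> on the cone.\<close>

lemma degree_criterion:
 assumes D: "D \<subseteq> cone3 - {0}" and closed: "closed (cone3 - D)" and dense: "cone3 - {0} \<subseteq> closure D"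
  and scale: "\<And>g c. g \<in> D \<Longrightarrow> c \<noteq> 0 \<Longrightarrow> c *s g \<in> D"
  and saturated: "\<And>g h. g \<in> D \<Longrightarrow> h \<in> cone3 \<Longrightarrow> WR h = WR g \<Longrightarrow> h \<in> D"
  and fibre: "\<And>g. g \<in> D \<Longrightarrow> finite {h \<in> cone3. WR h = WR g} \<and> card {h \<in> cone3. WR h = WR g} = d"
 shows "has_wronski_degree I L 3 d"
proof -
 define U where "U = (\<lambda>g. cfun.span {WR g}) ` D"
 have Y: "wronski_map I ` Gr = (\<lambda>g. cfun.span {WR g}) ` (cone3 - {0})"
  unfolding Gr_eq image_image by (rule image_cong[OF refl]) (use wronski_map_Lam in auto)
 have pY: "punctured_cone (wronski_map I ` Gr) = WR ` (cone3 - {0})"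
  unfolding Y by (rule punctured_lines) (auto simp: cone3_scale vec.scale_eq_0_iff)
 have pU: "punctured_cone U = WR ` D" unfolding U_def by (rule punctured_lines[OF D scale])
 have "open_dense_in (wronski_map I ` Gr) U"
  unfolding open_dense_in_def pY pU
 proof (intro conjI)
  show "U \<subseteq> wronski_map I ` Gr" unfolding Y U_def using D by blast
  have "WR ` D = WR ` (cone3 - {0}) \<inter> - WR ` (cone3 - D)"
  proof (intro subset_antisym subsetI IntI)
   fix f assume "f \<in> WR ` D"
   then obtain g where g: "g \<in> D" "f = WR g" by blast
   show "f \<in> WR ` (cone3 - {0})" using g D by blast
   show "f \<in> - WR ` (cone3 - D)" using saturated[OF g(1)] g(2) by auto
  qed blast
  moreover have "open (- WR ` (cone3 - D))" using closed_WR_image[OF closed] by (simp add: open_Compl)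
  ultimately show "openin (top_of_set (WR ` (cone3 - {0}))) (WR ` D)" by (auto simp: openin_open)
  have "WR ` (cone3 - {0}) \<subseteq> WR ` closure D" using dense by blast
  also have "\<dots> \<subseteq> closure (WR ` D)"
   by (rule image_closure_subset[OF continuous_WR closed_closure closure_subset])
  finally show "WR ` (cone3 - {0}) \<subseteq> closure (WR ` D)" .
 qed
 moreover have "finite {\<Lambda> \<in> Gr. wronski_map I \<Lambda> = y} \<and> card {\<Lambda> \<in> Gr. wronski_map I \<Lambda> = y} = d" if yU: "y \<in> U" for y
 proof -
  obtain g where g: "g \<in> D" "y = cfun.span {WR g}" using yU by (auto simp: U_def)
  have gc: "g \<in> cone3" "g \<noteq> 0" using g(1) D by auto
  define F where "F = {h \<in> cone3. WR h = WR g}"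
  have F0: "h \<noteq> 0" if "h \<in> F" for h using that saturated[OF g(1)] D by (auto simp: F_def)
  have "{\<Lambda> \<in> Gr. wronski_map I \<Lambda> = y} = Lam ` F"
  proof (intro subset_antisym subsetI)
   fix \<Lambda> assume "\<Lambda> \<in> {\<Lambda> \<in> Gr. wronski_map I \<Lambda> = y}"
   then obtain h where h: "h \<in> cone3" "h \<noteq> 0" "\<Lambda> = Lam h" "wronski_map I \<Lambda> = y" unfolding Gr_eq by blast
   then have "cfun.span {WR g} = cfun.span {WR h}" using wronski_map_Lam(2)[OF h(1,2)] g(2) by simp
   then obtain c where c: "c \<noteq> 0" "WR g = WR (c *s h)" using WR_line[OF gc h(1,2)] by blast
   then have "c *s h \<in> F" using h(1) cone3_scale by (simp add: F_def)
   moreover have "\<Lambda> = Lam (c *s h)" using h(3) Lam_scale[OF c(1)] by simp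
   ultimately show "\<Lambda> \<in> Lam ` F" by blast
  next
   fix \<Lambda> assume "\<Lambda> \<in> Lam ` F"
   then obtain h where h: "h \<in> F" "\<Lambda> = Lam h" by blast
   then show "\<Lambda> \<in> {\<Lambda> \<in> Gr. wronski_map I \<Lambda> = y}"
    using wronski_map_Lam[of h] F0[OF h(1)] by (auto simp: F_def g(2))
  qed
  moreover have "inj_on Lam F"
  proof (rule inj_onI)
   fix h h' assume h: "h \<in> F" "h' \<in> F" "Lam h = Lam h'"
   then obtain c where c: "h' = c *s h" using Lam_eqD[of h h'] F0 by (auto simp: F_def)
   then have "WR g = fscale c (WR g)" using h by (simp add: F_def WR_lin)
   then have "fscale (1 - c) (WR g) = 0" by (auto simp: fscale_def fun_eq_iff algebra_simps)
   then have "c = 1" using K_cone3 gc by auto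
   then show "h = h'" using c by simp
  qed
  ultimately show ?thesis using fibre[OF g(1)] by (simp add: F_def card_image)
 qed
 ultimately show ?thesis unfolding has_wronski_degree_def Let_def by blast
qed

lemma punctured_nonempty: "punctured_cone (wronski_map I ` Gr) \<noteq> {}"
proof -
 have "T3 (cc 0 t0) (cc 1 t0) (cc 2 t0) \<noteq> 0"
 proof
  assume 0: "T3 (cc 0 t0) (cc 1 t0) (cc 2 t0) = 0"
  have "T3 (cc 0 t0) (cc 1 t0) (cc 2 t0) $ (ix 0, ix 1, ix 2) = 1"
   unfolding T3_nth by (simp add: cc_base axis_def ix_eq_iff)
  then show False unfolding 0 by simp
 qed
 then obtain g where g: "g \<in> cone3" "g \<noteq> 0" using cone3_T3 by blast
 then have "WR g \<noteq> 0" using K_cone3 by blast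
 moreover have "WR g \<in> wronski_map I (Lam g)" unfolding wronski_map_Lam(2)[OF g] by (rule cfun.span_base) simp
 ultimately show ?thesis using wronski_map_Lam(1)[OF g] by (auto simp: punctured_cone_def)
qed

text \<open>The good set is the complement of the closure of the ambiguous decomposables, which the classification makes dense.\<close>

lemma degree_one:
 assumes N: "negligible N" and bad: "\<And>x y z k. T3 x y z \<noteq> 0 \<Longrightarrow> k \<in> K \<Longrightarrow> eigen_type k x y z \<or> rank_one_type k x y z \<Longrightarrow> (x, y, z) \<in> N"
 shows "has_wronski_degree I L 3 1"
proof -
 define D where "D = cone3 - {0} - closure ambiguous"
 show ?thesis
 proof (rule degree_criterion)
  show "D \<subseteq> cone3 - {0}" by (auto simp: D_def)
  have "cone3 - D = cone3 \<inter> ({0} \<union> closure ambiguous)" by (auto simp: D_def)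
  then show "closed (cone3 - D)" using closed_cone3 by (auto intro!: closed_Int closed_Un)
  show "cone3 - {0} \<subseteq> closure D"
  proof (rule dense_from_negligible[OF N])
   fix x y z assume T: "T3 x y z \<noteq> 0" "(x, y, z) \<notin> N"
   then have "T3 x y z \<notin> closure ambiguous" using closure_ambiguous_type[OF _ T(1) refl] bad by blast
   then show "T3 x y z \<in> D" unfolding D_def using T(1) by simp
  qed
 next
  fix g :: trivec and c :: complex assume "g \<in> D" and c: "c \<noteq> 0"
  then have g: "g \<in> cone3 - {0} - closure ambiguous" by (simp add: D_def)
  have "c *s g \<notin> closure ambiguous"
  proof
   assume "c *s g \<in> closure ambiguous"
   then obtain s where s: "\<And>n :: nat. s n \<in> ambiguous" "s \<longlonglongrightarrow> c *s g" unfolding closure_sequential by blast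
   have "(\<lambda>n. (1 / c) *s s n) \<longlonglongrightarrow> (1 / c) *s (c *s g)" by (intro tendsto_scale tendsto_const s(2))
   moreover have "(1 / c) *s s n \<in> ambiguous" for n using ambiguous_scale[OF s(1)] c by simp
   ultimately have "g \<in> closure ambiguous"
    unfolding closure_sequential using c by (intro exI[of _ "\<lambda>n. (1 / c) *s s n"]) simp
   then show False using g by blast
  qed
  then show "c *s g \<in> D" unfolding D_def using g c cone3_scale by (auto simp: vec.scale_eq_0_iff)
 next
  fix g h assume "g \<in> D" and h: "h \<in> cone3" "WR h = WR g"
  then have g: "g \<in> cone3 - {0} - closure ambiguous" by (simp add: D_def)
  then have "g \<notin> ambiguous" using closure_subset by blast
  then have "h = g" using g h by (auto simp: ambiguous_def)
  then show "h \<in> D" unfolding D_def using g by simp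
 next
  fix g assume "g \<in> D"
  then have g: "g \<in> cone3 - {0} - closure ambiguous" by (simp add: D_def)
  then have "g \<notin> ambiguous" using closure_subset by blast
  then have "{h \<in> cone3. WR h = WR g} = {g}" using g by (auto simp: ambiguous_def)
  then show "finite {h \<in> cone3. WR h = WR g} \<and> card {h \<in> cone3. WR h = WR g} = 1" by simp
 qed
qed

section \<open>The annihilator as a space of trivectors\<close>

lemma wedge_3: "wedge W [f, g, h] \<alpha> = (if \<alpha> \<in> alternating_forms 3 W then \<alpha> [f, g, h] else 0)"
 by (simp only: wedge_def length_lists)

text \<open>The identification of coordinates with the third exterior power; an alternating array lists every triple of
 indices six times, whence the \<open>6\<close>.\<close>

definition Ps :: "trivec \<Rightarrow> ((real \<Rightarrow> complex) list \<Rightarrow> complex) \<Rightarrow> complex" where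
 "Ps k = (\<Sum>q\<in>UNIV. fscale (k $ q / 6) (wedge V [sol (axis (fst q) 1), sol (axis (fst (snd q)) 1), sol (axis (snd (snd q)) 1)]))"

lemma Ps_lin: "Ps (k + l) = Ps k + Ps l" "Ps (c *s k) = fscale c (Ps k)"
 by (simp_all add: Ps_def fun_eq_iff sum_fun_apply fscale_def add_divide_distrib distrib_right sum.distrib sum_distrib_left mult.assoc)

lemma linear_Ps: "Vector_Spaces.linear (*s) fscale Ps"
 by unfold_locales (simp_all add: Ps_lin)

lemma Ps_T3: "Ps (T3 x y z) = wedge V [sol x, sol y, sol z]"
proof
 fix \<alpha>
 show "Ps (T3 x y z) \<alpha> = wedge V [sol x, sol y, sol z] \<alpha>"
 proof (cases "\<alpha> \<in> alternating_forms 3 V")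
  case False
  then show ?thesis by (simp add: Ps_def sum_fun_apply fscale_def wedge_3)
 next
  case True
  define F where "F u v w = \<alpha> [sol u, sol v, sol w]" for u v w
  have sV: "set [sol u, sol v, sol w] \<subseteq> V" for u v w using sol(1) by simp
  have lin: "\<alpha> (vs[i := fscale a x + fscale b y]) = a * \<alpha> (vs[i := x]) + b * \<alpha> (vs[i := y])"
   if "length vs = 3" "set vs \<subseteq> V" "i < 3" "x \<in> V" "y \<in> V" for vs i x y a b
   using True that unfolding alternating_forms_def by blast
  have rep: "\<alpha> vs = 0" if "length vs = 3" "set vs \<subseteq> V" "\<not> distinct vs" for vs
   using True that unfolding alternating_forms_def by blast
  have L: "F (a *s u + b *s u') v w = a * F u v w + b * F u' v w" "F v (a *s u + b *s u') w = a * F v u w + b * F v u' w"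
   "F v w (a *s u + b *s u') = a * F v w u + b * F v w u'" for a b u u' v w
   using lin[of "[sol u, sol v, sol w]" 0 "sol u" "sol u'" a b] lin[of "[sol v, sol u, sol w]" 1 "sol u" "sol u'" a b]
    lin[of "[sol v, sol w, sol u]" 2 "sol u" "sol u'" a b] sol(1)
   by (simp_all add: F_def sol_add sol_scale numeral_2_eq_2 numeral_3_eq_3 One_nat_def)
  have l6: "linear6 (\<lambda>u. F u v w)" "linear6 (\<lambda>v. F u v w)" "linear6 (\<lambda>w. F u v w)" for u v w
   using L(1)[of 1 _ 1] L(1)[of _ _ 0 0] L(2)[of _ 1 _ 1] L(2)[of _ _ _ 0 0] L(3)[of _ _ 1 _ 1] L(3)[of _ _ _ _ 0 0]
   by (simp_all add: linear6_def)
  have z: "F u u w = 0" "F w u u = 0" for u w using rep sV by (simp_all add: F_def)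
  have sk: "F v u w = - F u v w" "F u w v = - F u v w" for u v w
  proof -
   have "0 = F (1 *s u + 1 *s v) (1 *s u + 1 *s v) w" by (simp add: z)
   also have "\<dots> = F u v w + F v u w" unfolding L by (simp add: z)
   finally show "F v u w = - F u v w" by (simp add: eq_neg_iff_add_eq_0 add.commute)
   have "0 = F u (1 *s v + 1 *s w) (1 *s v + 1 *s w)" by (simp add: z)
   also have "\<dots> = F u v w + F u w v" unfolding L by (simp add: z)
   finally show "F u w v = - F u v w" by (simp add: eq_neg_iff_add_eq_0 add.commute)
  qed
  have w: "wedge V [sol u, sol v, sol w] \<alpha> = F u v w" for u v w using True by (simp add: wedge_3 F_def)
  have "Ps (T3 x y z) \<alpha> = (\<Sum>q\<in>UNIV. T3 x y z $ q * F (axis (fst q) 1) (axis (fst (snd q)) 1) (axis (snd (snd q)) 1)) / 6"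
   by (simp add: Ps_def sum_fun_apply fscale_def w sum_divide_distrib)
  also have "\<dots> = F x y z" using trilinear_T3[of F x y z, OF l6 sk] by simp
  finally show ?thesis by (simp add: w)
 qed
qed

lemma jet_sol: "t \<in> I \<Longrightarrow> dual_curve I fsol j t (sol v) = v \<cdot> cc j t"
proof -
 assume t: "t \<in> I"
 have Vs: "V \<subseteq> smooth_functions I" using solutionsD(2) by blast
 show ?thesis
  unfolding dual_curve_eq[OF interval interior_nonempty t basis_fsol Vs] using sol(1) nderiv_sol[OF t] by simp
qed

lemma jet_lin:
 assumes "t \<in> I" "x \<in> V" "y \<in> V"
 shows "dual_curve I fsol j t (fscale p x + fscale q y) = p * dual_curve I fsol j t x + q * dual_curve I fsol j t y"
proof -
 obtain v w where v: "x = sol v" "y = sol w" using sol_surj assms(2,3) by blast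
 have e: "fscale p (sol v) + fscale q (sol w) = sol (p *s v + q *s w)" by (simp add: sol_add sol_scale)
 show ?thesis unfolding v e jet_sol[OF assms(1)] by (simp add: pair_simps)
qed

lemma subspace_V: "cfun.subspace V"
proof (rule cfun.subspaceI)
 show "0 \<in> V" using sol(1)[of 0] sol_0 by simp
 fix x y c assume "x \<in> V"
 then obtain v where v: "x = sol v" using sol_surj by blast
 show "fscale c x \<in> V" unfolding v sol_scale[symmetric] by (rule sol(1))
 assume "y \<in> V"
 then obtain w where w: "y = sol w" using sol_surj by blast
 show "x + y \<in> V" unfolding v w sol_add[symmetric] by (rule sol(1))
qed

lemma subspace_alternating_forms: "cfun.subspace (alternating_forms n W)"
 by (rule cfun.subspaceI) (auto simp: alternating_forms_def fscale_def algebra_simps)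

lemma Ps_form_lin:
 assumes "\<alpha> \<in> alternating_forms 3 V"
 shows "\<beta> \<in> alternating_forms 3 V \<Longrightarrow> Ps k (\<alpha> + \<beta>) = Ps k \<alpha> + Ps k \<beta>" "Ps k (fscale c \<alpha>) = c * Ps k \<alpha>" "Ps k 0 = 0"
proof -
 note A = subspace_alternating_forms[of 3 V]
 show "Ps k (\<alpha> + \<beta>) = Ps k \<alpha> + Ps k \<beta>" if b: "\<beta> \<in> alternating_forms 3 V"
  using assms b cfun.subspace_add[OF A assms b]
  by (simp add: Ps_def sum_fun_apply fscale_def wedge_3 distrib_left add_divide_distrib sum.distrib)
 show "Ps k (fscale c \<alpha>) = c * Ps k \<alpha>"
  using assms cfun.subspace_scale[OF A assms, of c]
  by (simp add: Ps_def sum_fun_apply fscale_def[of "_ / 6"] wedge_3 sum_distrib_left) (simp add: fscale_def mult_ac)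
 show "Ps k 0 = 0" using cfun.subspace_0[OF A] by (simp add: Ps_def sum_fun_apply fscale_def wedge_3)
qed

lemma Ps_jets:
 assumes k: "alt k" and t: "t \<in> I"
 shows "Ps k (wedge_functionals V (map (\<lambda>j. dual_curve I fsol j t) [i, j, l])) = tri k (cc i t) (cc j t) (cc l t)"
proof -
 define \<phi> where "\<phi> j = dual_curve I fsol j t" for j
 have \<phi>: "\<phi> j (sol v) = v \<cdot> cc j t" for j v unfolding \<phi>_def by (rule jet_sol[OF t])
 have lin: "\<psi> (fscale a x + fscale b y) = a * \<psi> x + b * \<psi> y" if "\<psi> \<in> set [\<phi> i, \<phi> j, \<phi> l]" "x \<in> V" "y \<in> V" for \<psi> x y a b
  using jet_lin[OF t] that by (auto simp: \<phi>_def)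
 define G where "G u v w = wedge V [sol u, sol v, sol w] (wedge_functionals V [\<phi> i, \<phi> j, \<phi> l])" for u v w
 have G: "G u v w = tri (T3 u v w) (cc i t) (cc j t) (cc l t)" for u v w
 proof -
  have "G u v w = Determinant.det (Matrix.mat (length [\<phi> i, \<phi> j, \<phi> l]) (length [\<phi> i, \<phi> j, \<phi> l]) (\<lambda>(p, q). ([\<phi> i, \<phi> j, \<phi> l] ! p) ([sol u, sol v, sol w] ! q)))"
   unfolding G_def by (rule wedge_pairing[OF subspace_V lin]) (use sol(1) in auto)
  also have "\<dots> = tri (T3 u v w) (cc i t) (cc j t) (cc l t)"
   unfolding length_lists det_mat_3 tri_T3 prod.case by (simp add: \<phi> algebra_simps)
  finally show ?thesis .
 qed
 have "Ps k (wedge_functionals V [\<phi> i, \<phi> j, \<phi> l]) = (\<Sum>q\<in>UNIV. k $ q * G (axis (fst q) 1) (axis (fst (snd q)) 1) (axis (snd (snd q)) 1)) / 6"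
  by (simp add: Ps_def sum_fun_apply fscale_def G_def sum_divide_distrib)
 also have "(\<Sum>q\<in>UNIV. k $ q * G (axis (fst q) 1) (axis (fst (snd q)) 1) (axis (snd (snd q)) 1)) = 6 * tri k (cc i t) (cc j t) (cc l t)"
 proof -
  let ?c = "\<lambda>p :: 6 \<times> 6 \<times> 6. cc i t $ fst p * cc j t $ fst (snd p) * cc l t $ snd (snd p)"
  have "T3 (axis (fst q) 1) (axis (fst (snd q)) 1) (axis (snd (snd q)) 1) $ p = T3 (axis (fst p) 1) (axis (fst (snd p)) 1) (axis (snd (snd p)) 1) $ q" for p q
  proof -
   obtain a b c where p: "p = (a, b, c)" by (cases p)
   obtain a' b' c' where q: "q = (a', b', c')" by (cases q)
   have s: "(axis i 1 :: vec6) $ j = (axis j 1 :: vec6) $ i" for i j by (simp add: axis_def)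
   show ?thesis unfolding p q fst_conv snd_conv T3_nth s[of a'] s[of b'] s[of c'] by (simp add: algebra_simps)
  qed
  then have "(\<Sum>q\<in>UNIV. k $ q * G (axis (fst q) 1) (axis (fst (snd q)) 1) (axis (snd (snd q)) 1)) =
    (\<Sum>q\<in>UNIV. \<Sum>p\<in>UNIV. (T3 (axis (fst p) 1) (axis (fst (snd p)) 1) (axis (snd (snd p)) 1) $ q * k $ q) * ?c p)"
   unfolding G tri_def sum_distrib_left by (simp add: mult_ac)
  also have "\<dots> = (\<Sum>p\<in>UNIV. (\<Sum>q\<in>UNIV. T3 (axis (fst p) 1) (axis (fst (snd p)) 1) (axis (snd (snd p)) 1) $ q * k $ q) * ?c p)"
   unfolding sum_distrib_right by (rule sum.swap)
  also have "\<dots> = (\<Sum>p\<in>UNIV. (6 * k $ p) * ?c p)"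
  proof (rule sum.cong[OF refl], rule arg_cong2[where f = "(*)", OF _ refl])
   fix p :: "6 \<times> 6 \<times> 6"
   have "linear6 (\<lambda>u. tri k u v w)" "linear6 (\<lambda>u. tri k v u w)" "linear6 (\<lambda>u. tri k v w u)" for v w by (simp_all add: linear6_def)
   from trilinear_T3[of "tri k" "axis (fst p) 1" "axis (fst (snd p)) 1" "axis (snd (snd p)) 1", OF this tri_swap[OF k]]
   have "(\<Sum>q\<in>UNIV. T3 (axis (fst p) 1) (axis (fst (snd p)) 1) (axis (snd (snd p)) 1) $ q * k $ (fst q, fst (snd q), snd (snd q))) = 6 * k $ (fst p, fst (snd p), snd (snd p))"
    unfolding tri_axis .
   then show "(\<Sum>q\<in>UNIV. T3 (axis (fst p) 1) (axis (fst (snd p)) 1) (axis (snd (snd p)) 1) $ q * k $ q) = 6 * k $ p" by simp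
  qed
  also have "\<dots> = 6 * tri k (cc i t) (cc j t) (cc l t)" unfolding tri_def sum_distrib_left by (simp add: mult_ac)
  finally show ?thesis .
 qed
 finally show ?thesis by (simp add: \<phi>_def)
qed

lemma Ps_inj: "inj_on Ps {k. alt k}"
proof (rule inj_onI)
 fix k l assume k: "k \<in> {k. alt k}" "l \<in> {k. alt k}" and e: "Ps k = Ps l"
 have "k $ (a, b, c) = l $ (a, b, c)" for a b c
  using Ps_jets[of k t0 "rk a" "rk b" "rk c"] Ps_jets[of l t0 "rk a" "rk b" "rk c"] k e t0 by (simp add: cc_base tri_axis)
 then show "k = l" unfolding vec_eq_iff by (metis prod_cases3)
qed

lemma subspace_alt: "vec.subspace {k. alt k}"
 by (rule vec.subspaceI) (simp_all add: alt_lin)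

lemma exterior_power_eq: "exterior_power 3 V = Ps ` {k. alt k}"
proof
 interpret P: Vector_Spaces.linear "(*s)" fscale Ps by (rule linear_Ps)
 have "cfun.subspace (Ps ` {k. alt k})" by (rule P.subspace_image[OF subspace_alt])
 moreover have "{wedge V vs | vs. length vs = 3 \<and> set vs \<subseteq> V} \<subseteq> Ps ` {k. alt k}"
 proof
  fix w assume "w \<in> {wedge V vs | vs. length vs = 3 \<and> set vs \<subseteq> V}"
  then obtain f1 f2 f3 where f: "w = wedge V [f1, f2, f3]" "f1 \<in> V" "f2 \<in> V" "f3 \<in> V"
   by (auto simp: numeral_3_eq_3 length_Suc_conv)
  then obtain x y z where "f1 = sol x" "f2 = sol y" "f3 = sol z" by (meson sol_surj)
  then have "w = Ps (T3 x y z)" using f(1) by (simp add: Ps_T3)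
  then show "w \<in> Ps ` {k. alt k}" by simp
 qed
 ultimately show "exterior_power 3 V \<subseteq> Ps ` {k. alt k}"
  unfolding exterior_power_def by (intro cfun.span_minimal)
 have "wedge V [sol u, sol v, sol w] \<in> {wedge V vs | vs. length vs = 3 \<and> set vs \<subseteq> V}" for u v w
  by (intro CollectI exI[of _ "[sol u, sol v, sol w]"]) (simp add: sol(1))
 then show "Ps ` {k. alt k} \<subseteq> exterior_power 3 V"
  unfolding exterior_power_def Ps_def by (intro image_subsetI cfun.span_sum cfun.span_scale cfun.span_base)
qed

lemma dim_X_perp_aux: "K \<subseteq> {k. alt k}" by (auto simp: K_def)

text \<open>Pairing with \<open>c \<and> c' \<and> c''\<close> at \<open>t\<close> is the evaluation of the Wronskian at \<open>t\<close>.\<close>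

lemma X_perp_eq: "X_perp I L 3 = Ps ` K"
proof -
 have gen: "(\<forall>v\<in>X_space I L 3. Ps k v = 0) \<longleftrightarrow> k \<in> K" if k: "alt k" for k
 proof -
  define S where "S = {wedge_functionals V (map (\<lambda>j. dual_curve I fsol j t) [0..<3]) | t. t \<in> I}"
  have X: "X_space I L 3 = cfun.span S" unfolding S_def by (rule X_space_eq[OF interval interior_nonempty basis_fsol])
  have l: "[0..<3] = [0, 1, 2 :: nat]" by (simp add: upt_rec)
  note A = subspace_alternating_forms[of 3 V]
  have SA: "S \<subseteq> alternating_forms 3 V"
  proof
   fix \<alpha> assume "\<alpha> \<in> S"
   then obtain t where t: "t \<in> I" "\<alpha> = wedge_functionals V (map (\<lambda>j. dual_curve I fsol j t) [0..<3])" by (auto simp: S_def)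
   have "\<alpha> \<in> alternating_forms (length (map (\<lambda>j. dual_curve I fsol j t) [0..<3])) V"
    unfolding t(2) by (rule wedge_functionals_alternating[OF subspace_V]) (use jet_lin[OF t(1)] in auto)
   then show "\<alpha> \<in> alternating_forms 3 V" by simp
  qed
  have "cfun.subspace {\<alpha> \<in> alternating_forms 3 V. Ps k \<alpha> = 0}"
   using cfun.subspace_0[OF A] cfun.subspace_add[OF A] cfun.subspace_scale[OF A] Ps_form_lin Ps_form_lin(3)[OF cfun.subspace_0[OF A]]
   by (intro cfun.subspaceI) auto
  then have "cfun.span S \<subseteq> {\<alpha> \<in> alternating_forms 3 V. Ps k \<alpha> = 0}" if "\<And>\<alpha>. \<alpha> \<in> S \<Longrightarrow> Ps k \<alpha> = 0"
   using that SA by (intro cfun.span_minimal) auto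
  then have "(\<forall>v\<in>cfun.span S. Ps k v = 0) \<longleftrightarrow> (\<forall>\<alpha>\<in>S. Ps k \<alpha> = 0)" using cfun.span_superset by blast
  also have "\<dots> \<longleftrightarrow> (\<forall>t\<in>I. tri k (cc 0 t) (cc 1 t) (cc 2 t) = 0)"
   unfolding S_def l using Ps_jets[OF k, of _ 0 1 2] by auto
  also have "\<dots> \<longleftrightarrow> k \<in> K" using k by (auto simp: K_def WR_def fun_eq_iff)
  finally show ?thesis unfolding X .
 qed
 show ?thesis unfolding X_perp_def exterior_power_eq using gen by (auto simp: K_def)
qed

lemma dim_X_perp: "cfun.dim (X_perp I L 3) = vec.dim K"
proof -
 interpret P: finite_dimensional_vector_space_pair_1 "(*s) :: complex \<Rightarrow> trivec \<Rightarrow> trivec" cart_basis fscale ..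
 have "vec.span K \<subseteq> {k. alt k}" by (rule vec.span_minimal[OF dim_X_perp_aux subspace_alt])
 then show ?thesis unfolding X_perp_eq
  by (intro P.dim_image_eq linear_Ps inj_on_subset[OF Ps_inj])
qed

end

section \<open>Annihilators that force degree one\<close>

lemma span_enumeration:
 fixes B :: "trivec set"
 assumes B: "finite B" "card B \<le> n"
 shows "\<exists>b. (\<forall>i<card B. b i \<in> B) \<and> vec.span B \<subseteq> range (\<lambda>z. \<Sum>i<n. z i *s b i)
  \<and> (vec.independent B \<longrightarrow> card B = n \<longrightarrow> (\<forall>z. (\<Sum>i<n. z i *s b i) = 0 \<longrightarrow> (\<forall>i<n. z i = 0)))"
proof -
 obtain f where f: "bij_betw f {0..<card B} B" using ex_bij_betw_nat_finite[OF B(1)] by blast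
 define b where "b i = (if i < card B then f i else 0)" for i
 have bB: "b i \<in> B" if "i < card B" for i using f that by (auto simp: b_def bij_betw_def)
 have f': "bij_betw f {..<card B} B" using f by (simp add: lessThan_atLeast0)
 have inv: "inv_into {..<card B} f (f i) = i" if "i < card B" for i
  using f' that by (auto simp: bij_betw_def intro!: inv_into_f_f)
 have cut: "(\<Sum>i<n. z i *s b i) = (\<Sum>i<card B. z i *s f i)" for z
 proof -
  have "(\<Sum>i<card B. z i *s f i) = (\<Sum>i<card B. z i *s b i)" by (intro sum.cong) (auto simp: b_def)
  also have "\<dots> = (\<Sum>i<n. z i *s b i)" using B(2) by (intro sum.mono_neutral_left) (auto simp: b_def)
  finally show ?thesis by simp
 qed
 have "vec.span B \<subseteq> range (\<lambda>z. \<Sum>i<n. z i *s b i)"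
 proof
  fix k assume "k \<in> vec.span B"
  then obtain u where u: "k = (\<Sum>v\<in>B. u v *s v)" unfolding vec.span_finite[OF B(1)] by blast
  have "k = (\<Sum>i<card B. u (f i) *s f i)" unfolding u using sum.reindex_bij_betw[OF f', of "\<lambda>v. u v *s v"] by simp
  then have "k = (\<Sum>i<n. u (f i) *s b i)" unfolding cut[of "\<lambda>i. u (f i)"] .
  then show "k \<in> range (\<lambda>z. \<Sum>i<n. z i *s b i)"
   using rangeI[of "\<lambda>z. \<Sum>i<n. z i *s b i" "\<lambda>i. u (f i)"] by simp
 qed
 moreover have "\<forall>i<n. z i = 0" if ind: "vec.independent B" "card B = n" and s: "(\<Sum>i<n. z i *s b i) = 0" for z
 proof -
  define u where "u v = z (inv_into {..<card B} f v)" for v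
  have "(\<Sum>v\<in>B. u v *s v) = (\<Sum>i<card B. u (f i) *s f i)"
   using sum.reindex_bij_betw[OF f', of "\<lambda>v. u v *s v"] by simp
  also have "\<dots> = (\<Sum>i<card B. z i *s f i)" by (intro sum.cong) (auto simp: u_def inv)
  also have "\<dots> = 0" using s unfolding cut .
  finally have u0: "(\<Sum>v\<in>B. u v *s v) = 0" .
  show ?thesis
  proof (intro allI impI)
   fix i assume i: "i < n"
   have "f i \<in> B" using f' i ind(2) by (auto simp: bij_betw_def)
   then have "u (f i) = 0" using ind(1) u0 unfolding vec.dependent_finite[OF B(1)] by blast
   moreover have "u (f i) = z i" using inv[of i] i ind(2) by (simp only: u_def)
   ultimately show "z i = 0" by simp
  qed
 qed
 ultimately show ?thesis using bB by blast
qed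

lemma negligible_common_vector:
 fixes v :: vec6
 assumes "v \<noteq> 0"
 shows "negligible {(x, y, z). \<exists>c1 c2 c3. v = c1 *s x + c2 *s y + c3 *s z}"
proof -
 define F :: "(complex ^ 3) \<times> vec6 \<times> vec6 \<Rightarrow> vec6" where
  "F p = (fst p $ 1) *s v + (fst p $ 2) *s fst (snd p) + (fst p $ 3) *s snd (snd p)" for p
 have F: "F differentiable at p" for p
  unfolding F_def by (intro differentiable_add differentiable_scale differentiable_nth differentiable_pair differentiable_ident differentiable_const)
 have dim: "DIM((complex ^ 3) \<times> vec6 \<times> vec6) < DIM(vec6 \<times> vec6 \<times> vec6)" by simp
 have n: "negligible (range (\<lambda>p. (F p, fst (snd p), snd (snd p))))" "negligible (range (\<lambda>p. (fst (snd p), F p, snd (snd p))))"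
  "negligible (range (\<lambda>p. (fst (snd p), snd (snd p), F p)))"
  by (rule negligible_differentiable_image_lowdim[OF dim],
    rule differentiable_everywhere, intro differentiable_pair F differentiable_ident)+
 have "{(x, y, z). \<exists>c1 c2 c3. v = c1 *s x + c2 *s y + c3 *s z} \<subseteq> range (\<lambda>p. (F p, fst (snd p), snd (snd p)))
  \<union> range (\<lambda>p. (fst (snd p), F p, snd (snd p))) \<union> range (\<lambda>p. (fst (snd p), snd (snd p), F p))"
 proof clarify
  fix x y z c1 c2 c3
  assume v: "v = c1 *s x + c2 *s y + c3 *s z"
   and n3: "(x, y, z) \<notin> range (\<lambda>p. (fst (snd p), snd (snd p), F p))"
   and n2: "(x, y, z) \<notin> range (\<lambda>p. (fst (snd p), F p, snd (snd p)))"
  define P where "P b1 b2 b3 p q = ((\<chi> i. if i = 1 then b1 else if i = 2 then b2 else b3) :: complex ^ 3, p :: vec6, q :: vec6)" for b1 b2 b3 p q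
  have FP: "F (P b1 b2 b3 p q) = b1 *s v + b2 *s p + b3 *s q" "fst (snd (P b1 b2 b3 p q)) = p" "snd (snd (P b1 b2 b3 p q)) = q" for b1 b2 b3 p q
   by (simp_all add: F_def P_def)
  have "c3 = 0"
  proof (rule ccontr)
   assume c: "c3 \<noteq> 0"
   have "z = (1 / c3) *s v + (- c1 / c3) *s x + (- c2 / c3) *s y" using c by (simp add: v vec_eq_iff field_simps)
   then have "(x, y, z) \<in> range (\<lambda>p. (fst (snd p), snd (snd p), F p))"
    by (intro range_eqI[of _ _ "P (1 / c3) (- c1 / c3) (- c2 / c3) x y"]) (simp only: FP)
   then show False using n3 by blast
  qed
  moreover have "c2 = 0"
  proof (rule ccontr)
   assume c: "c2 \<noteq> 0"
   have "y = (1 / c2) *s v + (- c1 / c2) *s x + (- c3 / c2) *s z" using c by (simp add: v vec_eq_iff field_simps)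
   then have "(x, y, z) \<in> range (\<lambda>p. (fst (snd p), F p, snd (snd p)))"
    by (intro range_eqI[of _ _ "P (1 / c2) (- c1 / c2) (- c3 / c2) x z"]) (simp only: FP)
   then show False using n2 by blast
  qed
  ultimately have c: "c1 \<noteq> 0" using assms v by auto
  have "x = (1 / c1) *s v + (- c2 / c1) *s y + (- c3 / c1) *s z" using c by (simp add: v vec_eq_iff field_simps)
  then show "(x, y, z) \<in> range (\<lambda>p. (F p, fst (snd p), snd (snd p)))"
   by (intro range_eqI[of _ _ "P (1 / c1) (- c2 / c1) (- c3 / c1) y z"]) (simp only: FP)
 qed
 then show ?thesis by (rule negligible_subset[OF negligible_Un[OF negligible_Un[OF n(1,2)] n(3)]])
qed

lemma negligible_common_covector:
 fixes \<theta> :: vec6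
 assumes "\<theta> \<noteq> 0"
 shows "negligible {(x, y :: vec6, z :: vec6). x \<cdot> \<theta> = 0}"
proof -
 define n :: vec6 where "n = (\<chi> i. cnj (\<theta> $ i))"
 have n: "n \<noteq> 0" using assms by (simp add: n_def vec_eq_iff)
 have i: "inner n x = Re (x \<cdot> \<theta>)" for x by (simp add: n_def pair_def inner_vec_def inner_complex_def mult.commute)
 have "negligible {p :: vec6 \<times> vec6 \<times> vec6. inner (n, 0, 0) p = 0}" using n by (intro negligible_hyperplane) (auto simp: zero_prod_def)
 moreover have "{(x, y :: vec6, z :: vec6). x \<cdot> \<theta> = 0} \<subseteq> {p :: vec6 \<times> vec6 \<times> vec6. inner (n, 0, 0) p = 0}" by (auto simp: i)
 ultimately show ?thesis by (rule negligible_subset)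
qed

context odo6
begin

lemma K_basis: obtains B where "B \<subseteq> K" "vec.independent B" "K \<subseteq> vec.span B" "card B = vec.dim K" "finite B"
 using vec.basis_exists vec.finiteI_independent by metis

lemma degree_one_ambiguous:
 fixes b :: "nat \<Rightarrow> trivec"
 assumes "K \<subseteq> range (\<lambda>(z, c). c *s k0 + (\<Sum>i<5. z i *s b i))" and "k0 = 0 \<or> (\<forall>u. kills u k0 \<longrightarrow> u = 0)"
 shows "has_wronski_degree I L 3 1"
 by (rule degree_one[OF negligible_ambiguous[OF assms]]) blast

lemma degree_one_small:
 assumes "vec.dim K \<le> 5" shows "has_wronski_degree I L 3 1"
proof -
 obtain B where B: "B \<subseteq> K" "vec.independent B" "K \<subseteq> vec.span B" "card B = vec.dim K" "finite B" by (rule K_basis)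
 obtain b :: "nat \<Rightarrow> trivec" where "vec.span B \<subseteq> range (\<lambda>z. \<Sum>i<5. z i *s b i)" using span_enumeration[OF B(5), of 5] B(4) assms by auto
 then have "K \<subseteq> range (\<lambda>(z, c). c *s 0 + (\<Sum>i<5. z i *s b i))" using B(3) by fastforce
 then show ?thesis by (rule degree_one_ambiguous) simp
qed

text \<open>Completing \<open>k0\<close> to a basis of \<open>K\<close> brings the lines parallel to \<open>k0\<close> into play, on which elements with a factor are
 finite in number.\<close>

lemma degree_one_no_factor:
 assumes dim: "vec.dim K = 6" and k0: "k0 \<in> K" "\<And>u. kills u k0 \<Longrightarrow> u = 0"
 shows "has_wronski_degree I L 3 1"
proof -
 have "k0 \<noteq> 0"
 proof
  assume "k0 = 0"
  then have "axis 1 1 = (0 :: vec6)" using k0(2)[of "axis 1 1"] kills_lin(6) by simp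
  then show False by (simp add: axis_eq_0_iff)
 qed
 then have "vec.independent {k0}" by simp
 then obtain B where B: "{k0} \<subseteq> B" "B \<subseteq> K" "vec.independent B" "K \<subseteq> vec.span B"
  using vec.maximal_independent_subset_extend[of "{k0}" K] k0(1) by blast
 have fin: "finite B" using B(3) by (rule vec.finiteI_independent)
 have "card B = 6" using vec.basis_card_eq_dim[OF B(2,4,3)] dim by simp
 then have c5: "card (B - {k0}) = 5" using B(1) fin by simp
 obtain b :: "nat \<Rightarrow> trivec" where b: "vec.span (B - {k0}) \<subseteq> range (\<lambda>z. \<Sum>i<5. z i *s b i)"
  using span_enumeration[of "B - {k0}" 5] fin c5 by auto
 have "K \<subseteq> range (\<lambda>(z, c). c *s k0 + (\<Sum>i<5. z i *s b i))"
 proof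
  fix k assume "k \<in> K"
  then have "k \<in> vec.span (insert k0 (B - {k0}))" using B(1,4) by (auto simp: insert_absorb)
  then obtain c where "k - c *s k0 \<in> vec.span (B - {k0})" unfolding vec.span_insert by blast
  then obtain z where "k - c *s k0 = (\<Sum>i<5. z i *s b i)" using b by blast
  then have "k = c *s k0 + (\<Sum>i<5. z i *s b i)" by (simp add: algebra_simps)
  then show "k \<in> range (\<lambda>(z, c). c *s k0 + (\<Sum>i<5. z i *s b i))" by (auto intro!: range_eqI[of _ _ "(z, c)"])
 qed
 then show ?thesis by (rule degree_one_ambiguous) (use k0(2) in blast)
qed

text \<open>With an independent reason for the second type to be rare, six parameters are harmless for the first one.\<close>

lemma degree_one_rank_one:
 assumes dim: "vec.dim K \<le> 6" and N: "negligible N" and bad: "\<And>x y z k. k \<in> K \<Longrightarrow> rank_one_type k x y z \<Longrightarrow> (x, y, z) \<in> N"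
 shows "has_wronski_degree I L 3 1"
proof -
 obtain B where B: "B \<subseteq> K" "vec.independent B" "K \<subseteq> vec.span B" "card B = vec.dim K" "finite B" by (rule K_basis)
 obtain b :: "nat \<Rightarrow> trivec" where b: "vec.span B \<subseteq> range (\<lambda>z. \<Sum>i<6. z i *s b i)" using span_enumeration[OF B(5), of 6] B(4) dim by auto
 have "\<exists>\<zeta> :: complex ^ 6. k = (\<Sum>i\<in>UNIV. \<zeta> $ i *s b (rk i))" if kK: "k \<in> K" for k
 proof -
  obtain z where z: "k = (\<Sum>i<6. z i *s b i)" using b B(3) kK by blast
  have "(\<Sum>i\<in>UNIV. (\<chi> i. z (rk i)) $ i *s b (rk i)) = (\<Sum>j<6. z (rk (ix j)) *s b (rk (ix j)))"
   by (subst sum_ix) simp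
  also have "\<dots> = (\<Sum>j<6. z j *s b j)" by (intro sum.cong) auto
  finally have "k = (\<Sum>i\<in>UNIV. (\<chi> i. z (rk i)) $ i *s b (rk i))" using z by simp
  then show ?thesis by blast
 qed
 then show ?thesis
  using bad by (intro degree_one[OF negligible_Un[OF negligible_eigen_type[of "\<lambda>i. b (rk i)"] N]]) fastforce
qed

lemma rank_one_K:
 assumes "k \<in> K" "rank_one_type k x y z"
 shows "alt k" "k \<noteq> T3 p q r"
 using assms K_not_T3 rank_one_type_nonzero by (auto simp: K_def)

text \<open>The factor of an element is unique, so all spaces of the second type contain \<open>v\<close>.\<close>

lemma degree_one_common_vector:
 assumes dim: "vec.dim K = 6" and v: "v \<noteq> 0" "\<And>k. k \<in> K \<Longrightarrow> kills v k"
 shows "has_wronski_degree I L 3 1"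
proof (rule degree_one_rank_one[OF _ negligible_common_vector[OF v(1)]])
 fix x y z k assume k: "k \<in> K" and R: "rank_one_type k x y z"
 obtain w c1 c2 c3 where w: "w \<noteq> 0" "kills w k" "w = c1 *s x + c2 *s y + c3 *s z" using R unfolding rank_one_type_def by blast
 obtain c where "v = c *s w" using factor_proportional[OF rank_one_K(1)[OF k R] rank_one_K(2)[OF k R] v(2)[OF k] w(2,1)] by blast
 then have "v = (c * c1) *s x + (c * c2) *s y + (c * c3) *s z" unfolding w(3) by (simp add: vec_eq_iff algebra_simps)
 then show "(x, y, z) \<in> {(x, y, z). \<exists>c1 c2 c3. v = c1 *s x + c2 *s y + c3 *s z}" by blast
qed (simp add: dim)

text \<open>Dually, all spaces of the second type lie in the hyperplane of \<open>\<theta>\<close>.\<close>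

lemma degree_one_common_covector:
 assumes dim: "vec.dim K = 6" and \<theta>: "\<theta> \<noteq> 0" "\<And>k. k \<in> K \<Longrightarrow> contracts \<theta> k"
 shows "has_wronski_degree I L 3 1"
proof (rule degree_one_rank_one[OF _ negligible_common_covector[OF \<theta>(1)]])
 fix x y z k assume k: "k \<in> K" and R: "rank_one_type k x y z"
 obtain w \<theta>' where w: "w \<noteq> 0" "kills w k" "contracts \<theta>' k" "\<theta>' \<noteq> 0" "x \<cdot> \<theta>' = 0" using R unfolding rank_one_type_def by blast
 obtain c where "\<theta> = c *s \<theta>'" using cofactor_proportional[OF rank_one_K(1)[OF k R] rank_one_K(2)[OF k R] w(2,1) \<theta>(2)[OF k] w(3,4)] by blast
 then show "(x, y, z) \<in> {(x, y, z). x \<cdot> \<theta> = 0}" using w(5) by simp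
qed (simp add: dim)

lemma bivector_of_degree:
 assumes dim: "vec.dim K = 6" and d: "\<not> has_wronski_degree I L 3 1"
 shows "\<exists>\<omega>. (\<forall>p. linear6 (\<omega> p)) \<and> (\<forall>p q. \<omega> q p = - \<omega> p q) \<and> (\<exists>p q. \<omega> p q \<noteq> 0) \<and>
  (\<forall>p. \<exists>k\<in>K. \<forall>q r s. tri k q r s = p \<cdot> q * \<omega> r s - p \<cdot> r * \<omega> q s + p \<cdot> s * \<omega> q r)"
proof -
 obtain B where B: "B \<subseteq> K" "vec.independent B" "K \<subseteq> vec.span B" "card B = vec.dim K" "finite B" by (rule K_basis)
 obtain b :: "nat \<Rightarrow> trivec" where b: "\<And>i. i < 6 \<Longrightarrow> b i \<in> B" "vec.span B \<subseteq> range (\<lambda>z. \<Sum>i<6. z i *s b i)"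
  "\<And>z i. (\<Sum>i<6. z i *s b i) = 0 \<Longrightarrow> i < 6 \<Longrightarrow> z i = 0"
  using span_enumeration[OF B(5), of 6] B(2,4) dim by force
 have "range (\<lambda>z. \<Sum>i<6. z i *s b i) \<subseteq> K"
  using b(1) B(1) by (auto intro!: vec.subspace_sum[OF subspace_K] vec.subspace_scale[OF subspace_K])
 then have Kb: "K = range (\<lambda>z. \<Sum>i<6. z i *s b i)" using b(2) B(3) by blast
 interpret S: sigma_space6 K b
 proof unfold_locales
  show "vec.subspace K" by (rule subspace_K)
  show "alt k" if "k \<in> K" for k using that by (simp add: K_def)
  show "T3 x y z = 0" if "T3 x y z \<in> K" for x y z using that K_cone3[OF cone3_T3] by (auto simp: K_def)
  show "\<exists>v. v \<noteq> 0 \<and> kills v k" if "k \<in> K" for k using degree_one_no_factor[OF dim that] d by blast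
  show "K = range (\<lambda>z. \<Sum>i<6. z i *s b i)" by (rule Kb)
  show "(\<Sum>i<6. z i *s b i) = 0 \<Longrightarrow> i < 6 \<Longrightarrow> z i = 0" for z i by (rule b(3))
  show "\<exists>k\<in>K. \<not> kills v k" if "v \<noteq> 0" for v using degree_one_common_vector[OF dim that] d by blast
  show "\<exists>k\<in>K. \<not> contracts \<theta> k" if "\<theta> \<noteq> 0" for \<theta> using degree_one_common_covector[OF dim that] d by blast
 qed
 show ?thesis by (rule S.bivector_exists)
qed

end

section \<open>Symplectic annihilators give degree two\<close>

lemma T3_with_factor:
 assumes p: "p \<noteq> 0" "p = c1 *s x + c2 *s y + c3 *s z"
 shows "\<exists>y' z'. T3 x y z = T3 p y' z'"
proof -
 note s = T3_permutations(1,5)[where x = x and y = y and z = z]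
 have "c1 \<noteq> 0 \<or> c2 \<noteq> 0 \<or> c3 \<noteq> 0" using p by auto
 then consider "c1 \<noteq> 0" | "c2 \<noteq> 0" | "c3 \<noteq> 0" by blast
 then show ?thesis
 proof cases
  case 1
  have "T3 p ((1 / c1) *s y) z = T3 x y z" using 1 unfolding p(2) by (simp add: T3_lin)
  then show ?thesis by metis
 next
  case 2
  have "T3 p ((- 1 / c2) *s x) z = (c2 * (- 1 / c2)) *s T3 y x z"
   unfolding p(2) T3_lin by (simp add: vec_eq_iff)
  also have "\<dots> = T3 x y z" using 2 unfolding s by simp
  finally have "T3 p ((- 1 / c2) *s x) z = T3 x y z" .
  then show ?thesis by metis
 next
  case 3
  have "T3 p ((1 / c3) *s x) y = T3 x y z" using 3 unfolding p(2) by (simp add: T3_lin s)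
  then show ?thesis by metis
 qed
qed

text \<open>A nondegenerate skew form on the dual space, with nondegeneracy expressed by an inverse from vectors to
 covectors.\<close>

locale symplectic =
 fixes \<beta> :: "vec6 \<Rightarrow> vec6 \<Rightarrow> complex" and flat :: "vec6 \<Rightarrow> vec6"
 assumes lin: "linear6 (\<beta> u)" and skew: "\<beta> w u = - \<beta> u w" and flat: "\<beta> (flat p) u = p \<cdot> u"
begin

lemma lin': "linear6 (\<lambda>u. \<beta> u w)"
proof -
 have e: "\<beta> u w = - \<beta> w u" for u by (rule skew)
 show ?thesis
  unfolding linear6_def
 proof (intro conjI allI)
  fix u v c
  show "\<beta> (u + v) w = \<beta> u w + \<beta> v w" unfolding e[of "u + v"] e[of u] e[of v] using lin[of w] by (simp add: linear6_def)
  show "\<beta> (c *s u) w = c * \<beta> u w" unfolding e[of "c *s u"] e[of u] using lin[of w] by (simp add: linear6_def)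
 qed
qed

lemma \<beta>_simps: "\<beta> (u + u') w = \<beta> u w + \<beta> u' w" "\<beta> (c *s u) w = c * \<beta> u w" "\<beta> u (w + w') = \<beta> u w + \<beta> u w'" "\<beta> u (c *s w) = c * \<beta> u w"
 using linear6D[OF lin] linear6D[OF lin'] by blast+

lemma nondegenerate: "(\<And>w. \<beta> u w = 0) \<Longrightarrow> u = 0"
proof -
 assume z: "\<And>w. \<beta> u w = 0"
 have "u \<cdot> p = 0 \<cdot> p" for p using flat[of p u] skew[of u "flat p"] z by (simp add: pair_commute)
 then show ?thesis by (rule pair_eqI)
qed

definition \<sigma> :: "vec6 \<Rightarrow> vec6 \<Rightarrow> complex" where "\<sigma> p q = p \<cdot> flat q"

lemma \<sigma>_skew: "\<sigma> q p = - \<sigma> p q"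
 unfolding \<sigma>_def flat[symmetric] by (rule skew)

lemma \<sigma>_self [simp]: "\<sigma> p p = 0" using \<sigma>_skew[of p p] by simp

lemma \<sigma>_lin: "\<sigma> (p + p') q = \<sigma> p q + \<sigma> p' q" "\<sigma> (c *s p) q = c * \<sigma> p q"
 "\<sigma> q (p + p') = \<sigma> q p + \<sigma> q p'" "\<sigma> q (c *s p) = c * \<sigma> q p"
 using \<sigma>_skew[of q] by (simp_all add: \<sigma>_def)

lemma flat_zero: "flat p = 0 \<Longrightarrow> p = 0"
proof -
 assume "flat p = 0"
 then have "p \<cdot> u = 0 \<cdot> u" for u using flat[of p u] \<beta>_simps(2)[of 0 0 u] by simp
 then show ?thesis by (rule pair_eqI)
qed

lemma flat_lin: "flat (c *s p + d *s q) = c *s flat p + d *s flat q"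
proof -
 have "\<beta> (flat (c *s p + d *s q) + (- 1) *s (c *s flat p + d *s flat q)) w = 0" for w
  unfolding \<beta>_simps flat by simp
 then have "flat (c *s p + d *s q) + (- 1) *s (c *s flat p + d *s flat q) = 0" by (rule nondegenerate)
 then have "flat (c *s p + d *s q) - (c *s flat p + d *s flat q) = 0" by (simp add: algebra_simps)
 then show ?thesis by simp
qed

lemma \<sigma>_nondegenerate: "y \<noteq> 0 \<Longrightarrow> \<exists>w. \<sigma> y w = 1"
proof -
 assume "y \<noteq> 0"
 then have "flat y \<noteq> 0" using flat_zero by blast
 then obtain w where "flat y \<cdot> w = 1" using pair_nonzero by blast
 then have "\<sigma> y ((- 1) *s w) = 1" unfolding \<sigma>_lin using \<sigma>_skew[of y w] by (simp add: \<sigma>_def pair_commute)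
 then show ?thesis by blast
qed

text \<open>The trivector \<open>p \<and> \<beta>\<close>.\<close>

definition pb :: "vec6 \<Rightarrow> trivec" where
 "pb p = tri_of (\<lambda>q r s. p \<cdot> q * \<beta> r s - p \<cdot> r * \<beta> q s + p \<cdot> s * \<beta> q r)"

lemma tri_pb: "tri (pb p) q r s = p \<cdot> q * \<beta> r s - p \<cdot> r * \<beta> q s + p \<cdot> s * \<beta> q r"
 unfolding pb_def by (rule tri_tri_of) (auto simp: linear6_def \<beta>_simps algebra_simps)

lemma alt_pb: "alt (pb p)"
proof (rule altI)
 fix u v w
 show "tri (pb p) v u w = - tri (pb p) u v w" unfolding tri_pb using skew[of v u] by (simp add: algebra_simps)
 show "tri (pb p) u w v = - tri (pb p) u v w" unfolding tri_pb using skew[of w v] by (simp add: algebra_simps)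
qed

lemma pb_lin: "pb (p + q) = pb p + pb q" "pb (c *s p) = c *s pb p"
 by (rule tri_eqI, simp add: tri_pb algebra_simps)+

lemma kills_pb: "kills p (pb p)"
 unfolding kills_def w4_def tri_pb by (simp add: algebra_simps)

lemma tri_pb_flat: "tri (pb p) (flat p') r s = \<sigma> p p' * \<beta> r s - p \<cdot> r * p' \<cdot> s + p \<cdot> s * p' \<cdot> r"
 unfolding tri_pb flat \<sigma>_def ..

lemma contracts_pb: "contracts (flat p) (pb p)"
 unfolding contracts_def tri_pb_flat by simp

lemma pb_zero: "pb p = 0 \<Longrightarrow> p = 0"
proof (rule ccontr)
 assume 0: "pb p = 0" and p: "p \<noteq> 0"
 obtain p' where p': "\<sigma> p p' = 1" using \<sigma>_nondegenerate[OF p] by blast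
 have b: "\<beta> r s = p \<cdot> r * p' \<cdot> s - p \<cdot> s * p' \<cdot> r" for r s
  using tri_pb_flat[of p p' r s] unfolding 0 p' by (simp add: algebra_simps)
 have T6: "\<not> indep [p, p', 0, 0, 0, 0]"
 proof
  assume "indep [p, p', 0, 0, 0, 0]"
  then show False unfolding indep_def by (auto simp: dual_6)
 qed
 obtain r where r: "r \<noteq> 0" "r \<cdot> p = 0" "r \<cdot> p' = 0"
  using six_vectors[of "[p, p', 0, 0, 0, 0]"] T6 by (auto simp: pair_commute[of _ p] pair_commute[of _ p'])
 then have r: "r \<noteq> 0" "p \<cdot> r = 0" "p' \<cdot> r = 0" by (simp_all add: pair_commute)
 have "r = 0" by (rule nondegenerate) (simp add: b r)
 then show False using r(1) by blast
qed

text \<open>The contraction of a trivector with the inverse form; every pair of indices is counted twice.\<close>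

definition vv :: "trivec \<Rightarrow> vec6" where
 "vv k = (\<chi> d. (\<Sum>i\<in>UNIV. \<Sum>j\<in>UNIV. k $ (d, i, j) * \<sigma> (axis i 1) (axis j 1)) / 2)"

lemma vv_T3: "vv (T3 x y z) = \<sigma> y z *s x - \<sigma> x z *s y + \<sigma> x y *s z"
proof -
 have F: "linear6 (\<lambda>u. \<sigma> u w)" "linear6 (\<lambda>w. \<sigma> u w)" for u w by (simp_all add: linear6_def \<sigma>_lin)
 note S = T3_contract[of \<sigma> x y z, OF F]
 have "vv (T3 x y z) $ d = (x $ d * \<sigma> y z - x $ d * \<sigma> z y - y $ d * \<sigma> x z + y $ d * \<sigma> z x + z $ d * \<sigma> x y - z $ d * \<sigma> y x) / 2" for d
  unfolding vv_def vec_lambda_beta S ..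
 moreover have "(x $ d * \<sigma> y z - x $ d * \<sigma> z y - y $ d * \<sigma> x z + y $ d * \<sigma> z x + z $ d * \<sigma> x y - z $ d * \<sigma> y x) / 2 =
   (\<sigma> y z *s x - \<sigma> x z *s y + \<sigma> x y *s z) $ d" for d
  unfolding \<sigma>_skew[of z y] \<sigma>_skew[of z x] \<sigma>_skew[of y x] by (simp add: field_simps)
 ultimately show ?thesis unfolding vec_eq_iff by simp
qed

lemma vv_scale: "vv (c *s k) = c *s vv k"
 by (simp add: vv_def vec_eq_iff sum_distrib_left mult.assoc)

lemma differentiable_vv: "vv differentiable at k"
 unfolding vv_def
 by (rule differentiable_vecI, unfold vec_lambda_beta divide_inverse)
  (intro differentiable_mult differentiable_sum ballI finite differentiable_nth differentiable_ident differentiable_const)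

lemma kills_vv: "g \<in> cone3 \<Longrightarrow> kills (vv g) g"
proof -
 assume "g \<in> cone3"
 then obtain x y z where g: "g = T3 x y z" by (auto simp: cone3_def)
 have "vv g = \<sigma> y z *s x + (- \<sigma> x z) *s y + \<sigma> x y *s z" unfolding g vv_T3 by (simp add: vec_eq_iff)
 then show ?thesis unfolding g by (simp only: kills_combination)
qed

text \<open>If \<open>g\<close> and \<open>g - p \<and> \<beta>\<close> are both decomposable, the vector \<open>p\<close> lies in both three-dimensional
 spaces, which makes it the contraction of \<open>g\<close>.\<close>

lemma companion_unique:
 assumes g: "g \<in> cone3" "g - pb p \<in> cone3" and p: "p \<noteq> 0" and nd: "\<And>a b c. pb p \<noteq> T3 a b c"
 shows "vv g = p"
proof -
 obtain x y z where gx: "g = T3 x y z" using g(1) by (auto simp: cone3_def)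
 obtain x' y' z' where hx: "g - pb p = T3 x' y' z'" using g(2) by (auto simp: cone3_def)
 have k: "pb p = T3 x y z - T3 x' y' z'" using gx hx by (simp add: algebra_simps)
 have T: "T3 x y z \<noteq> 0"
 proof
  assume "T3 x y z = 0"
  then have "pb p = (- 1) *s T3 x' y' z'" unfolding k by simp
  then have "pb p = T3 ((- 1) *s x') y' z'" unfolding T3_lin(7) .
  then show False using nd by blast
 qed
 have T': "T3 x' y' z' \<noteq> 0"
 proof
  assume "T3 x' y' z' = 0"
  then have "pb p = T3 x y z" unfolding k by simp
  then show False using nd by blast
 qed
 have "\<not> indep [x, y, z, x', y', z']"
 proof
  assume "indep [x, y, z, x', y', z']"
  then obtain E where E: "dual [x, y, z, x', y', z'] E" by (auto simp: indep_def)
  have w: "w4 p (T3 x y z - T3 x' y' z') q r s t = 0" for q r s t using kills_pb[of p] unfolding k kills_def by blast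
  have "p \<cdot> E 0 = 0" "p \<cdot> E 1 = 0" "p \<cdot> E 2 = 0" "p \<cdot> E 3 = 0" "p \<cdot> E 4 = 0" "p \<cdot> E 5 = 0"
   using w[of "E 0" "E 3" "E 4" "E 5"] w[of "E 1" "E 3" "E 4" "E 5"] w[of "E 2" "E 3" "E 4" "E 5"]
    w[of "E 3" "E 0" "E 1" "E 2"] w[of "E 4" "E 0" "E 1" "E 2"] w[of "E 5" "E 0" "E 1" "E 2"] E
   unfolding w4_def tri_diff tri_T3 by (simp_all add: dual_6)
  then have "p = 0" using dual_expansion(1)[OF E, of p] by (simp add: sum_less_numeral)
  then show False using p by blast
 qed
 then obtain u where u: "u \<noteq> 0" "kills u (T3 x y z)" "kills u (T3 x' y' z')" using common_factor[OF T T'] by blast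
 then have "kills u (pb p)" unfolding k by (intro kills_lin(4))
 then obtain d where d: "p = d *s u" using factor_proportional[OF alt_pb nd kills_pb _ u(1)] by blast
 have "kills p (T3 x y z)" "kills p (T3 x' y' z')" unfolding d using u(2,3) by (auto intro: kills_lin)
 then obtain y1 z1 y2 z2 where yz: "T3 x y z = T3 p y1 z1" "T3 x' y' z' = T3 p y2 z2"
  using T3_span[OF T] T3_span[OF T'] T3_with_factor[OF p] by metis
 have T1: "T3 p y1 z1 \<noteq> 0" and T2: "T3 p y2 z2 \<noteq> 0" using T T' yz by auto
 define w where "w = - 1 *s y2"
 have kw: "pb p = T3 p y1 z1 + T3 p w z2" unfolding k yz w_def by (rule tri_eqI) (simp add: tri_T3 algebra_simps)
 have T3w: "T3 p w z2 \<noteq> 0" using nd kw by (metis add.right_neutral)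
 have ind: "indep [p, y1, z1, w, z2]"
 proof (rule ccontr)
  assume "\<not> ?thesis"
  then obtain b :: "nat \<Rightarrow> complex" where b: "\<exists>i<5. b i \<noteq> 0" "b 0 *s p + b 1 *s y1 + b 2 *s z1 + b 3 *s w + b 4 *s z2 = 0"
   using indep_or_relation[of "[p, y1, z1, w, z2]"] unfolding length_lists sum_less_numeral by auto
  define e where "e = b 0 *s p + b 1 *s y1 + b 2 *s z1"
  have e': "e = 0 *s p + (- b 3) *s w + (- b 4) *s z2"
   using b(2) by (simp add: e_def vec_eq_iff eq_neg_iff_add_eq_0 algebra_simps)
  have "kills e (T3 p y1 z1)" "kills e (T3 p w z2)"
   unfolding e_def by (rule kills_combination) (unfold e_def[symmetric] e', rule kills_combination)
  then have "kills e (pb p)" unfolding kw by (rule kills_lin(3))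
  then obtain d where d: "e = d *s p" using factor_proportional[OF alt_pb nd _ kills_pb p] by blast
  have "(b 0 - d) *s p + b 1 *s y1 + b 2 *s z1 = 0" using d unfolding e_def by (simp add: vec_eq_iff algebra_simps)
  then have b1: "b 1 = 0" "b 2 = 0" using indep3_relation[OF T1] by blast+
  have "d *s p + b 3 *s w + b 4 *s z2 = d *s p - (0 *s p + (- b 3) *s w + (- b 4) *s z2)" by (simp add: vec_eq_iff)
  also have "\<dots> = 0" unfolding e'[symmetric] d by simp
  finally have "d *s p + b 3 *s w + b 4 *s z2 = 0" .
  then have b2: "b 3 = 0" "b 4 = 0" using indep3_relation[OF T3w] by blast+
  then have "b 0 *s p = 0" using b(2) b1 by simp
  then have "b 0 = 0" using p by (simp add: vec.scale_eq_0_iff)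
  then have "\<forall>i<5. b i = 0" using b1 b2 unfolding all_less_numeral by simp
  then show False using b(1) by blast
 qed
 have c: "\<forall>q\<in>set [p, y1, z1, w, z2]. q \<cdot> flat p = 0"
  using contracts_pb[of p] contracts_rank5_iff[OF ind] unfolding kw by blast
 have s: "\<sigma> y1 p = 0" "\<sigma> z1 p = 0" using c by (simp_all add: \<sigma>_def)
 then have s': "\<sigma> p y1 = 0" "\<sigma> p z1 = 0" using \<sigma>_skew[of p y1] \<sigma>_skew[of p z1] by simp_all
 obtain E where E: "dual [p, y1, z1, w, z2] E" using ind by (auto simp: indep_def)
 have "tri (pb p) (flat y1) (E 0) (E 1) = - 1" unfolding tri_pb_flat using E by (simp add: s' dual_5)
 moreover have "tri (pb p) (flat y1) (E 0) (E 1) = \<sigma> z1 y1"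
  unfolding kw tri_add tri_T3 \<sigma>_def[symmetric] using E by (simp add: s' dual_5)
 ultimately have "\<sigma> y1 z1 = 1" using \<sigma>_skew[of y1 z1] by simp
 then show ?thesis unfolding gx yz vv_T3 s' by simp
qed

text \<open>For \<open>g = p \<and> y \<and> z\<close> with \<open>p = vv g\<close> one has \<open>\<sigma> y z = 1\<close>, and so \<open>g - p \<and> \<beta>\<close>, which has the factor \<open>p\<close>, is contracted to zero by
 the covectors of both \<open>y\<close> and \<open>z\<close>. An indecomposable trivector with a factor admits only one such covector.\<close>

lemma companion_exists:
 assumes g: "g \<in> cone3" and v: "vv g \<noteq> 0"
 shows "g - pb (vv g) \<in> cone3"
proof -
 define p where "p = vv g"
 have p0: "p \<noteq> 0" using v by (simp add: p_def)
 obtain x y z where gx: "g = T3 x y z" using g by (auto simp: cone3_def)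
 have T: "T3 x y z \<noteq> 0"
 proof
  assume "T3 x y z = 0"
  then have "vv g = 0" unfolding gx by (simp add: vv_def vec_eq_iff)
  then show False using v by blast
 qed
 have "kills p (T3 x y z)" using kills_vv[OF g] unfolding p_def gx .
 then obtain y1 z1 where "T3 x y z = T3 p y1 z1"
  using T3_span[OF T, of p] T3_with_factor[of p _ x _ y _ z] p0 by blast
 then have yz: "g = T3 p y1 z1" unfolding gx .
 have T1: "T3 p y1 z1 \<noteq> 0" using T yz gx by simp
 have "p = \<sigma> y1 z1 *s p - \<sigma> p z1 *s y1 + \<sigma> p y1 *s z1" using vv_T3[of p y1 z1] unfolding yz[symmetric] p_def[symmetric] .
 then have "(\<sigma> y1 z1 - 1) *s p + (- \<sigma> p z1) *s y1 + \<sigma> p y1 *s z1 = 0"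
  by (simp add: vec_eq_iff algebra_simps)
 from indep3_relation[OF T1 this] have s: "\<sigma> y1 z1 = 1" "\<sigma> p z1 = 0" "\<sigma> p y1 = 0" by auto
 have s': "\<sigma> z1 y1 = - 1" using \<sigma>_skew[of z1 y1] s by simp
 define k where "k = g - pb p"
 have k: "alt k" "kills p k" unfolding k_def yz by (simp_all add: alt_pb) (intro kills_lin(4) kills_T3 kills_pb)
 have c: "contracts (flat y1) k" "contracts (flat z1) k"
  unfolding contracts_def k_def tri_diff tri_pb_flat yz tri_T3 \<sigma>_def[symmetric] by (simp_all add: s s' algebra_simps)
 from k p0 have "k \<in> cone3"
 proof (cases rule: partially_decomposable_cases)
  case (1 a b)
  then show ?thesis by simp
 next
  case (2 a b a' b')
  obtain \<alpha> where \<alpha>: "\<And>q. (\<forall>x\<in>set [p, a, b, a', b']. x \<cdot> q = 0) \<Longrightarrow> \<exists>c. q = c *s \<alpha>"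
   using annihilator_line[OF 2(1)] by auto
  have "\<exists>c. flat y1 = c *s \<alpha>" "\<exists>c. flat z1 = c *s \<alpha>"
   using \<alpha> c contracts_rank5_iff[OF 2(1)] 2(2) by blast+
  then obtain c1 c2 where c12: "flat y1 = c1 *s \<alpha>" "flat z1 = c2 *s \<alpha>" by blast
  have "flat (c2 *s y1 + (- c1) *s z1) = 0" unfolding flat_lin c12 by (simp add: vec_eq_iff)
  then have "c2 *s y1 + (- c1) *s z1 = 0" by (rule flat_zero)
  then have "0 *s p + c2 *s y1 + (- c1) *s z1 = 0" by simp
  then have "c1 = 0" using indep3_relation[OF T1, of 0 c2 "- c1"] by simp
  then have "flat y1 = 0" using c12 by simp
  then have "y1 = 0" by (rule flat_zero)
  then show ?thesis using T1 by (simp add: T3_lin)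
 qed
 then show ?thesis by (simp add: k_def p_def)
qed

end

text \<open>The contraction changes sign under the involution \<open>g \<mapsto> g - p \<and> \<beta>\<close>, so the set where it does not vanish is
 saturated.\<close>

lemma (in odo6) degree_two:
 assumes sy: "symplectic \<beta> flat" and dim: "vec.dim K = 6" and pK: "\<And>p. symplectic.pb \<beta> p \<in> K"
 shows "has_wronski_degree I L 3 2"
proof -
 interpret symplectic \<beta> flat by (rule sy)
 have range: "range pb = K"
 proof -
  have l: "Vector_Spaces.linear (*s) (*s) pb" by unfold_locales (simp_all add: pb_lin)
  have inj: "inj pb"
  proof (rule injI)
   fix p q assume "pb p = pb q"
   then have "pb (p + (- 1) *s q) = 0" unfolding pb_lin by simp
   then have "p + (- 1) *s q = 0" by (rule pb_zero)
   then show "p = q" by (simp add: vec_eq_iff)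
  qed
  have "vec.dim (range pb) = vec.dim (UNIV :: vec6 set)"
   by (rule vec.dim_image_eq[OF l]) (use inj in \<open>simp add: inj_on_subset\<close>)
  also have "\<dots> = 6" using vec_dim_card[where 'a = complex and 'n = 6] by simp
  finally have "vec.dim (range pb) = 6" .
  moreover have "vec.subspace (range pb)"
  proof (rule vec.subspaceI)
   show "0 \<in> range pb" using pb_lin(2)[of 0 0] by (intro range_eqI[of _ _ 0]) simp
  qed (auto simp: pb_lin[symmetric])
  ultimately show ?thesis using dim pK by (intro vec.subspace_dim_equal subspace_K) auto
 qed
 have nd: "pb p \<noteq> T3 a b c" if "p \<noteq> 0" for p a b c
  using K_not_T3[OF pK] pb_zero that by blast
 define D where "D = {g \<in> cone3. vv g \<noteq> 0}"
 have partner: "vv (g - pb (vv g)) = - vv g" if "g \<in> D" for g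
 proof -
  have g: "g \<in> cone3" "vv g \<noteq> 0" using that by (auto simp: D_def)
  have "(g - pb (vv g)) - pb ((- 1) *s vv g) = g" unfolding pb_lin by simp
  then have "vv (g - pb (vv g)) = (- 1) *s vv g"
   using companion_exists[OF g] g by (intro companion_unique nd) (simp_all only: vec.scale_eq_0_iff, simp_all)
  then show ?thesis by simp
 qed
 have fib: "{h \<in> cone3. WR h = WR g} = {g, g - pb (vv g)}" if "g \<in> D" for g
 proof -
  have g: "g \<in> cone3" "vv g \<noteq> 0" using that by (auto simp: D_def)
  show ?thesis
  proof (intro subset_antisym subsetI)
   fix h assume "h \<in> {h \<in> cone3. WR h = WR g}"
   then have h: "h \<in> cone3" "g - h \<in> K" using g(1) by (auto simp: K_def WR_lin cone3_alt)
   then obtain p where p: "g - h = pb p" using range by blast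
   then have hp: "h = g - pb p" by (simp add: algebra_simps)
   show "h \<in> {g, g - pb (vv g)}"
   proof (cases "p = 0")
    case True
    then show ?thesis using hp pb_lin(2)[of 0 0] by simp
   next
    case False
    then have "vv g = p" using companion_unique[OF g(1) _ False nd[OF False]] h(1) hp by simp
    then show ?thesis using hp by simp
   qed
  next
   fix h assume "h \<in> {g, g - pb (vv g)}"
   then show "h \<in> {h \<in> cone3. WR h = WR g}"
    using g companion_exists[OF g] pK[of "vv g"] by (auto simp: WR_lin K_def)
  qed
 qed
 show ?thesis
 proof (rule degree_criterion)
  show "D \<subseteq> cone3 - {0}" unfolding D_def by (auto simp: vv_def vec_eq_iff)
  have "cone3 - D = cone3 \<inter> {g. vv g = 0}" by (auto simp: D_def)
  moreover have "closed {g. vv g = 0}"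
   by (intro closed_Collect_eq differentiable_imp_continuous_on differentiable_everywhere differentiable_vv continuous_on_const)
  ultimately show "closed (cone3 - D)" using closed_cone3 by auto
  show "cone3 - {0} \<subseteq> closure D"
  proof
   fix g assume "g \<in> cone3 - {0}"
   then obtain x y z where g: "g = T3 x y z" "T3 x y z \<noteq> 0" by (auto simp: cone3_def)
   show "g \<in> closure D"
   proof (cases "\<sigma> y z = 0")
    case False
    have "vv g \<noteq> 0"
    proof
     assume "vv g = 0"
     then have "\<sigma> y z *s x + (- \<sigma> x z) *s y + \<sigma> x y *s z = 0" unfolding g vv_T3 by (simp add: vec_eq_iff)
     then show False using indep3_relation[OF g(2)] False by blast
    qed
    then have "g \<in> D" using g by (simp add: D_def)
    then show ?thesis using closure_subset by blast
   next
    case True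
    have "y \<noteq> 0" using g(2) by (auto simp: T3_lin)
    \<comment> \<open>Moving \<open>z\<close> in a direction \<open>w\<close> not orthogonal to \<open>y\<close> makes the contraction nonzero.\<close>
    then obtain w where w: "\<sigma> y w = 1" using \<sigma>_nondegenerate by blast
    define e where "e n = complex_of_real (1 / Suc n)" for n :: nat
    have "(\<lambda>n. e n) \<longlonglongrightarrow> complex_of_real 0" unfolding e_def by (intro tendsto_of_real LIMSEQ_Suc lim_1_over_n)
    then have e: "e \<longlonglongrightarrow> 0" by simp
    define h where "h n = T3 x y (z + e n *s w)" for n
    have "(\<lambda>n. T3 x y (z + e n *s w)) \<longlonglongrightarrow> T3 x y (z + 0 *s w)"
     by (intro tendsto_T3 tendsto_const tendsto_add tendsto_scale e)
    then have h: "h \<longlonglongrightarrow> g" unfolding h_def g by simp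
    then have "\<forall>\<^sub>F n in sequentially. h n \<noteq> 0" using g by (intro tendsto_imp_eventually_ne) auto
    then obtain n0 where n0: "\<And>n. n \<ge> n0 \<Longrightarrow> h n \<noteq> 0" unfolding eventually_sequentially by blast
    have "h (n + n0) \<in> D" for n
    proof -
     let ?z = "z + e (n + n0) *s w"
     have T: "T3 x y ?z \<noteq> 0" using n0[of "n + n0"] by (simp add: h_def)
     have en: "e (n + n0) \<noteq> 0" unfolding e_def of_real_eq_0_iff by simp
     have "vv (T3 x y ?z) \<noteq> 0"
     proof
      assume "vv (T3 x y ?z) = 0"
      then have "\<sigma> y ?z *s x + (- \<sigma> x ?z) *s y + \<sigma> x y *s ?z = 0" unfolding vv_T3 by (simp add: vec_eq_iff)
      then have "\<sigma> y ?z = 0" using indep3_relation[OF T] by blast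
      then show False using True w en by (simp add: \<sigma>_lin)
     qed
     then show ?thesis by (simp add: D_def h_def)
    qed
    then show ?thesis unfolding closure_sequential
     using LIMSEQ_ignore_initial_segment[OF h, of n0] by (intro exI[of _ "\<lambda>n. h (n + n0)"]) simp
   qed
  qed
  show "c *s g \<in> D" if "g \<in> D" "c \<noteq> 0" for g c
   using that cone3_scale by (simp add: D_def vv_scale vec.scale_eq_0_iff)
  show "h \<in> D" if g: "g \<in> D" and h: "h \<in> cone3" "WR h = WR g" for g h
  proof -
   have "h = g \<or> h = g - pb (vv g)" using fib[OF g] h by blast
   then show ?thesis using partner[OF g] g h by (auto simp: D_def)
  qed
  show "finite {h \<in> cone3. WR h = WR g} \<and> card {h \<in> cone3. WR h = WR g} = 2" if g: "g \<in> D" for g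
  proof -
   have "pb (vv g) \<noteq> 0" using pb_zero g by (auto simp: D_def)
   then have "g \<noteq> g - pb (vv g)" by simp
   then show ?thesis unfolding fib[OF g] by simp
  qed
 qed
qed

section \<open>Self-adjoint operators and invariant bilinear forms\<close>

lemma has_vector_derivative_nth:
 assumes "(g has_vector_derivative g') F" shows "((\<lambda>t. (g t :: vec6) $ i) has_vector_derivative g' $ i) F"
 using bounded_linear.has_vector_derivative[OF bounded_linear_vec_nth assms] .

lemma has_vector_derivative_scale:
 fixes f :: "real \<Rightarrow> complex" and g :: "real \<Rightarrow> vec6"
 assumes "(f has_vector_derivative f') (at t within S)" "(g has_vector_derivative g') (at t within S)"
 shows "((\<lambda>t. f t *s g t) has_vector_derivative f' *s g t + f t *s g') (at t within S)"
proof -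
 have "((\<lambda>t. f t * g t $ i) has_vector_derivative f t * g' $ i + f' * g t $ i) (at t within S)" for i
  by (rule has_vector_derivative_mult[OF assms(1) has_vector_derivative_nth[OF assms(2)]])
 from has_vector_derivative_vec_lambda[OF this]
 have "((\<lambda>t. \<chi> i. f t * g t $ i) has_vector_derivative (\<chi> i. f t * g' $ i + f' * g t $ i)) (at t within S)" .
 moreover have "(\<lambda>t. \<chi> i. f t * g t $ i) = (\<lambda>t. f t *s g t)" by (simp add: fun_eq_iff vec_eq_iff)
 moreover have "(\<chi> i. f t * g' $ i + f' * g t $ i) = f' *s g t + f t *s g'" by (simp add: vec_eq_iff add.commute)
 ultimately show ?thesis by simp
qed

definition bilinear6 :: "(vec6 \<Rightarrow> vec6 \<Rightarrow> complex) \<Rightarrow> bool" where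
 "bilinear6 F \<longleftrightarrow> (\<forall>p. linear6 (F p)) \<and> (\<forall>q. linear6 (\<lambda>p. F p q))"

lemma bilinear6D:
 assumes "bilinear6 F"
 shows "F (p + p') q = F p q + F p' q" "F (c *s p) q = c * F p q" "F p (q + q') = F p q + F p q'" "F p (c *s q) = c * F p q"
 using assms unfolding bilinear6_def linear6_def by blast+

lemma bilinear6_zero: "bilinear6 F \<Longrightarrow> F 0 q = 0" "bilinear6 F \<Longrightarrow> F p 0 = 0"
 using bilinear6D(2)[of F 0 0 q] bilinear6D(4)[of F p 0 0] by simp_all

lemma bilinear6_sum:
 assumes F: "bilinear6 F"
 shows "F (\<Sum>i\<in>S. f i) q = (\<Sum>i\<in>S. F (f i) q)" "F p (\<Sum>i\<in>S. f i) = (\<Sum>i\<in>S. F p (f i))"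
 by (induction S rule: infinite_finite_induct; simp add: bilinear6_zero[OF F] bilinear6D[OF F])+

lemma bilinear6_minus:
 assumes F: "bilinear6 F" shows "F (- p) q = - F p q" "F p (- q) = - F p q" "F p (q - q') = F p q - F p q'"
 using bilinear6D(2)[OF F, of "- 1" p q] bilinear6D(4)[OF F, of p "- 1" q] bilinear6D(3)[OF F, of p "q - q'" q'] by simp_all

lemma bilinear6_derivative:
 assumes F: "bilinear6 F" and p: "(p has_vector_derivative p') (at t within S)" and q: "(q has_vector_derivative q') (at t within S)"
 shows "((\<lambda>t. F (p t) (q t)) has_vector_derivative F p' (q t) + F (p t) q') (at t within S)"
proof -
 have e: "F x y = (\<Sum>i\<in>UNIV. \<Sum>j\<in>UNIV. x $ i * y $ j * F (axis i 1) (axis j 1))" for x y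
  using F unfolding bilinear6_def by (intro bilinear_sum[symmetric]) blast+
 have "((\<lambda>t. \<Sum>i\<in>UNIV. \<Sum>j\<in>UNIV. p t $ i * q t $ j * F (axis i 1) (axis j 1)) has_vector_derivative
   (\<Sum>i\<in>UNIV. \<Sum>j\<in>UNIV. (p t $ i * q' $ j + p' $ i * q t $ j) * F (axis i 1) (axis j 1))) (at t within S)"
  by (intro has_vector_derivative_sum has_vector_derivative_mult_left has_vector_derivative_mult has_vector_derivative_nth p q)
 moreover have "(\<Sum>i\<in>UNIV. \<Sum>j\<in>UNIV. (p t $ i * q' $ j + p' $ i * q t $ j) * F (axis i 1) (axis j 1)) = F p' (q t) + F (p t) q'"
  unfolding e[of p' "q t"] e[of "p t" q'] by (simp add: distrib_right sum.distrib add.commute)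
 ultimately show ?thesis unfolding e[of "p _" "q _"] by simp
qed

lemma (in real_interval) derivative_const_on:
 assumes "\<And>s. s \<in> I \<Longrightarrow> f s = c" "t \<in> I" "(f has_vector_derivative D) (at t within I)"
 shows "D = (0 :: complex)"
proof -
 have "deriv_on I f t = D" by (rule deriv_on_eqI[OF assms(3,2)])
 moreover have "deriv_on I f = deriv_on I (\<lambda>_. c)" by (rule deriv_on_cong) (rule assms(1))
 moreover have "deriv_on I (\<lambda>_. c) t = 0" by (rule deriv_on_eqI[OF has_vector_derivative_const assms(2)])
 ultimately show ?thesis by simp
qed

lemma (in real_interval) constant_on:
 assumes "\<And>t. t \<in> I \<Longrightarrow> (f has_vector_derivative 0) (at t within I)" "s \<in> I" "t \<in> I"
 shows "f s = (f t :: vec6)"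
proof -
 have "convex I" using interval by (rule is_interval_convex)
 then obtain c where "\<And>t. t \<in> I \<Longrightarrow> f t = c" using has_vector_derivative_zero_constant[of I f] assms(1) by blast
 then show ?thesis using assms by simp
qed

context odo6
begin

definition coef :: "nat \<Rightarrow> real \<Rightarrow> complex" where
 "coef i t = (if i = 6 then 1 else a i t)"

lemma smooth_coef: "i \<le> 6 \<Longrightarrow> smooth_on I (coef i)"
 unfolding coef_def[abs_def] by (cases "i = 6") (simp_all add: smooth_coeff)

end

text \<open>Besides the evaluation curve of \<open>L\<close> in its own coordinates this covers that of a conjugate operator in the
 coordinates of the original one.\<close>

locale jet_curve = odo6 +
 fixes \<gamma> :: "nat \<Rightarrow> real \<Rightarrow> vec6"
 assumes derivative: "t \<in> I \<Longrightarrow> (\<gamma> j has_vector_derivative \<gamma> (Suc j) t) (at t within I)"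
  and top: "t \<in> I \<Longrightarrow> \<gamma> 6 t = - (\<Sum>j<6. a j t *s \<gamma> j t)"
  and frame: "t \<in> I \<Longrightarrow> \<exists>E. dual (map (\<lambda>j. \<gamma> j t) [0..<6]) E"
begin

lemma frame_expansion:
 assumes "t \<in> I"
 obtains E where "\<And>i j. i < 6 \<Longrightarrow> j < 6 \<Longrightarrow> \<gamma> i t \<cdot> E j = (if i = j then 1 else 0)" "\<And>p. p = (\<Sum>j<6. (p \<cdot> E j) *s \<gamma> j t)"
proof -
 obtain E where E: "dual (map (\<lambda>j. \<gamma> j t) [0..<6]) E" using frame[OF assms] by blast
 show ?thesis
 proof (rule that)
  show "\<gamma> i t \<cdot> E j = (if i = j then 1 else 0)" if "i < 6" "j < 6" for i j using E that by (simp add: dual_def)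
  fix p
  have "p = (\<Sum>i<6. (p \<cdot> E i) *s (map (\<lambda>j. \<gamma> j t) [0..<6] ! i))" using dual_expansion(1)[OF E, of p] by simp
  also have "\<dots> = (\<Sum>j<6. (p \<cdot> E j) *s \<gamma> j t)" by (intro sum.cong) auto
  finally show "p = (\<Sum>j<6. (p \<cdot> E j) *s \<gamma> j t)" .
 qed
qed

lemma pair_derivative: "t \<in> I \<Longrightarrow> ((\<lambda>t. v \<cdot> \<gamma> j t) has_vector_derivative v \<cdot> \<gamma> (Suc j) t) (at t within I)"
 unfolding pair_def by (intro has_vector_derivative_sum has_vector_derivative_mult_right has_vector_derivative_nth derivative)

lemma spanning: "(\<And>t. t \<in> I \<Longrightarrow> v \<cdot> \<gamma> 0 t = 0) \<Longrightarrow> v = 0"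
proof -
 assume z: "\<And>t. t \<in> I \<Longrightarrow> v \<cdot> \<gamma> 0 t = 0"
 have "\<forall>t\<in>I. v \<cdot> \<gamma> j t = 0" for j
 proof (induction j)
  case (Suc j)
  then show ?case using derivative_const_on[of "\<lambda>t. v \<cdot> \<gamma> j t" 0] pair_derivative by blast
 qed (use z in blast)
 then have v: "v \<cdot> \<gamma> j t0 = 0" for j using t0 by blast
 obtain E where E: "\<And>p. p = (\<Sum>j<6. (p \<cdot> E j) *s \<gamma> j t0)" using frame_expansion[OF t0] by metis
 have "p \<cdot> v = 0 \<cdot> v" for p
  by (subst E[of p]) (simp add: pair_sum v pair_commute[of _ v])
 then have "v \<cdot> p = 0 \<cdot> p" for p by (simp add: pair_commute[of _ p] pair_commute[of v])
 then show "v = 0" by (rule pair_eqI)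
qed

lemma nderiv_pair: "t \<in> I \<Longrightarrow> nderiv_on I k (\<lambda>t. if t \<in> I then v \<cdot> \<gamma> 0 t else 0) t = v \<cdot> \<gamma> k t"
proof (induction k arbitrary: t)
 case (Suc k)
 have "nderiv_on I (Suc k) (\<lambda>t. if t \<in> I then v \<cdot> \<gamma> 0 t else 0) t = deriv_on I (\<lambda>t. v \<cdot> \<gamma> k t) t"
  using deriv_on_cong[of I "nderiv_on I k (\<lambda>t. if t \<in> I then v \<cdot> \<gamma> 0 t else 0)" "\<lambda>t. v \<cdot> \<gamma> k t"] Suc.IH by simp
 also have "\<dots> = v \<cdot> \<gamma> (Suc k) t" by (rule deriv_on_eqI[OF pair_derivative]) (use Suc.prems in auto)
 finally show ?case .
qed simp

lemma smooth_pair: "(\<lambda>t. if t \<in> I then v \<cdot> \<gamma> 0 t else 0) \<in> smooth_functions I"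
proof -
 have "nderiv_on I k (\<lambda>t. if t \<in> I then v \<cdot> \<gamma> 0 t else 0) differentiable (at t within I)" if t: "t \<in> I" for k t
 proof (rule differentiable_on_interval_cong[OF _ t])
  show "(\<lambda>t. v \<cdot> \<gamma> k t) differentiable (at t within I)" using pair_derivative[OF t] by (rule differentiableI_vector)
 qed (simp add: nderiv_pair)
 then show ?thesis by (simp add: smooth_functions_def smooth_on_def)
qed

text \<open>The coefficients in Lagrange's bilinear identity: starting from \<open>y\<close> at index \<open>6\<close> they satisfy
 \<open>quasi y j = a\<^sub>j y - (quasi y (j + 1))'\<close> and end with \<open>L\<^sup>* y\<close> at index \<open>0\<close>.\<close>

definition quasi :: "(real \<Rightarrow> complex) \<Rightarrow> nat \<Rightarrow> real \<Rightarrow> complex" where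
 "quasi y j t = (\<Sum>i\<in>{j..6}. (- 1) ^ (i - j) * nderiv_on I (i - j) (\<lambda>s. coef i s * y s) t)"

definition lift :: "(real \<Rightarrow> complex) \<Rightarrow> real \<Rightarrow> vec6" where
 "lift y t = (\<Sum>j<6. quasi y (Suc j) t *s \<gamma> j t)"

lemma quasi_6: "quasi y 6 t = y t" by (simp add: quasi_def coef_def)

lemma quasi_derivative:
 assumes y: "smooth_on I y" and t: "t \<in> I" and j: "j < 6"
 shows "(quasi y (Suc j) has_vector_derivative coef j t * y t - quasi y j t) (at t within I)"
proof -
 have s: "smooth_on I (\<lambda>s. coef i s * y s)" if "i \<le> 6" for i using smooth_coef[OF that] y by (rule smooth_on_mult)
 have "(quasi y (Suc j) has_vector_derivative
   (\<Sum>i\<in>{Suc j..6}. (- 1) ^ (i - Suc j) * nderiv_on I (Suc (i - Suc j)) (\<lambda>s. coef i s * y s) t)) (at t within I)"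
  unfolding quasi_def[abs_def]
  by (intro has_vector_derivative_sum has_vector_derivative_mult_right smooth_on_has_derivative s t) simp
 also have "(\<Sum>i\<in>{Suc j..6}. (- 1) ^ (i - Suc j) * nderiv_on I (Suc (i - Suc j)) (\<lambda>s. coef i s * y s) t) =
   - (\<Sum>i\<in>{Suc j..6}. (- 1) ^ (i - j) * nderiv_on I (i - j) (\<lambda>s. coef i s * y s) t)"
  unfolding sum_negf[symmetric]
 proof (rule sum.cong[OF refl])
  fix i assume "i \<in> {Suc j..6}"
  then have "i - j = Suc (i - Suc j)" by auto
  then show "(- 1) ^ (i - Suc j) * nderiv_on I (Suc (i - Suc j)) (\<lambda>s. coef i s * y s) t =
   - ((- 1) ^ (i - j) * nderiv_on I (i - j) (\<lambda>s. coef i s * y s) t)" by simp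
 qed
 also have "\<dots> = coef j t * y t - quasi y j t"
 proof -
  have "{j..6} = insert j {Suc j..6}" using j by auto
  then show ?thesis by (simp add: quasi_def)
 qed
 finally show ?thesis .
qed

lemma adjoint_quasi: "adjoint_apply I L y t = quasi y 0 t"
proof -
 have "quasi y 0 t = (\<Sum>i<Suc 6. (- 1) ^ i * nderiv_on I i (\<lambda>s. coef i s * y s) t)"
  unfolding quasi_def by (intro sum.cong) auto
 also have "\<dots> = (\<Sum>i<6. (- 1) ^ i * nderiv_on I i (\<lambda>s. coef i s * y s) t) + nderiv_on I 6 y t"
  unfolding sum.lessThan_Suc by (simp add: coef_def)
 also have "(\<Sum>i<6. (- 1) ^ i * nderiv_on I i (\<lambda>s. coef i s * y s) t) = (\<Sum>i<6. (- 1) ^ i * nderiv_on I i (\<lambda>s. a i s * y s) t)"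
  by (intro sum.cong) (auto simp: coef_def)
 finally show ?thesis by (simp add: adjoint_apply_def order6)
qed

text \<open>Lagrange's identity, with the solutions of \<open>L\<close> replaced by the universal one \<open>\<gamma> 0\<close>: the sum telescopes.\<close>

lemma lift_derivative:
 assumes y: "smooth_on I y" and t: "t \<in> I"
 shows "(lift y has_vector_derivative - (adjoint_apply I L y t *s \<gamma> 0 t)) (at t within I)"
proof -
 have "(lift y has_vector_derivative (\<Sum>j<6. (coef j t * y t - quasi y j t) *s \<gamma> j t + quasi y (Suc j) t *s \<gamma> (Suc j) t)) (at t within I)"
  unfolding lift_def[abs_def]
  by (intro has_vector_derivative_sum has_vector_derivative_scale quasi_derivative y t derivative) simp
 also have "(\<Sum>j<6. (coef j t * y t - quasi y j t) *s \<gamma> j t + quasi y (Suc j) t *s \<gamma> (Suc j) t) =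
   (\<Sum>j<6. (coef j t * y t) *s \<gamma> j t) + (\<Sum>j<6. quasi y (Suc j) t *s \<gamma> (Suc j) t - quasi y j t *s \<gamma> j t)"
  unfolding sum.distrib[symmetric] by (intro sum.cong refl) (simp add: vec_eq_iff algebra_simps)
 also have "(\<Sum>j<6. quasi y (Suc j) t *s \<gamma> (Suc j) t - quasi y j t *s \<gamma> j t) = quasi y 6 t *s \<gamma> 6 t - quasi y 0 t *s \<gamma> 0 t"
  by (rule sum_lessThan_telescope)
 also have "(\<Sum>j<6. (coef j t * y t) *s \<gamma> j t) = y t *s (\<Sum>j<6. a j t *s \<gamma> j t)"
  unfolding vec.scale_sum_right by (intro sum.cong) (auto simp: coef_def mult.commute)
 also have "y t *s (\<Sum>j<6. a j t *s \<gamma> j t) + (quasi y 6 t *s \<gamma> 6 t - quasi y 0 t *s \<gamma> 0 t) = - (adjoint_apply I L y t *s \<gamma> 0 t)"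
  unfolding quasi_6 top[OF t] adjoint_quasi by (simp add: vec_eq_iff)
 finally show ?thesis .
qed

text \<open>Differentiating \<open>F (\<gamma> i) (\<gamma> j) = 0\<close> on one antidiagonal \<open>i + j\<close> gives the next one, and alternating signs on
 the antidiagonal \<open>i + j = 5\<close>.\<close>

lemma form_triangular:
 assumes F: "bilinear6 F" and F0: "\<And>j t. t \<in> I \<Longrightarrow> j < 5 \<Longrightarrow> F (\<gamma> 0 t) (\<gamma> j t) = 0" and F5: "\<And>t. t \<in> I \<Longrightarrow> F (\<gamma> 0 t) (\<gamma> 5 t) = C"
 shows "\<forall>t\<in>I. (\<forall>j. i + j < 5 \<longrightarrow> F (\<gamma> i t) (\<gamma> j t) = 0) \<and> (i \<le> 5 \<longrightarrow> F (\<gamma> i t) (\<gamma> (5 - i) t) = (- 1) ^ i * C)"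
proof (induction i)
 case 0
 then show ?case using F0 F5 by simp
next
 case (Suc i)
 have step: "F (\<gamma> (Suc i) t) (\<gamma> j t) + F (\<gamma> i t) (\<gamma> (Suc j) t) = 0" if t: "t \<in> I" and j: "i + j < 5" for t j
  by (rule derivative_const_on[of "\<lambda>t. F (\<gamma> i t) (\<gamma> j t)" 0 t, OF _ t bilinear6_derivative[OF F derivative[OF t] derivative[OF t]]])
   (use Suc.IH j in blast)
 show ?case
 proof (intro ballI conjI allI impI)
  fix t j assume t: "t \<in> I" and j: "Suc i + j < 5"
  then have "F (\<gamma> i t) (\<gamma> (Suc j) t) = 0" using Suc.IH by simp
  then show "F (\<gamma> (Suc i) t) (\<gamma> j t) = 0" using step[OF t, of j] j by simp
 next
  fix t assume t: "t \<in> I" and i: "Suc i \<le> 5"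
  then have "Suc (5 - Suc i) = 5 - i" by simp
  then have "F (\<gamma> (Suc i) t) (\<gamma> (5 - Suc i) t) = - F (\<gamma> i t) (\<gamma> (5 - i) t)"
   using step[OF t, of "5 - Suc i"] i by (simp add: eq_neg_iff_add_eq_0)
  then show "F (\<gamma> (Suc i) t) (\<gamma> (5 - Suc i) t) = (- 1) ^ Suc i * C" using Suc.IH t i by simp
 qed
qed

text \<open>Pairing \<open>\<gamma> j\<close> with the lift of \<open>x\<close> gives \<open>C\<close> times the derivative of order \<open>j\<close> of \<open>x\<close>; at order six the equation
 for \<open>\<gamma> 6\<close> and the lifting identity for \<open>L\<^sup>*\<close> combine to \<open>L x = L\<^sup>* x\<close>.\<close>

lemma self_adjoint_of_form:
 assumes F: "bilinear6 \<omega>" and skew: "\<And>p q. \<omega> q p = - \<omega> p q"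
  and F0: "\<And>j t. t \<in> I \<Longrightarrow> j < 5 \<Longrightarrow> \<omega> (\<gamma> 0 t) (\<gamma> j t) = 0" and F5: "\<And>t. t \<in> I \<Longrightarrow> \<omega> (\<gamma> 0 t) (\<gamma> 5 t) = C" and C: "C \<noteq> 0"
 shows "self_adjoint I L"
 unfolding self_adjoint_def
proof (intro ballI)
 fix x t assume x: "x \<in> smooth_functions I" and tI: "t \<in> I"
 have sx: "smooth_on I x" using x by (simp add: smooth_functions_def)
 have rev: "\<omega> (\<gamma> j t) (\<gamma> 0 t) = 0" if "t \<in> I" "j < 5" for j t using skew[of "\<gamma> j t" "\<gamma> 0 t"] F0[OF that] by simp
 have der: "((\<lambda>t. \<omega> (\<gamma> j t) (lift x t)) has_vector_derivative \<omega> (\<gamma> (Suc j) t) (lift x t) - adjoint_apply I L x t * \<omega> (\<gamma> j t) (\<gamma> 0 t)) (at t within I)"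
  if "t \<in> I" for j t
  using bilinear6_derivative[OF F derivative[OF that] lift_derivative[OF sx that], of j]
  by (simp add: bilinear6_minus[OF F] bilinear6D[OF F])
 have base: "\<omega> (\<gamma> 0 t) (lift x t) = C * x t" if "t \<in> I" for t
 proof -
  have "\<omega> (\<gamma> 0 t) (lift x t) = (\<Sum>j<6. quasi x (Suc j) t * \<omega> (\<gamma> 0 t) (\<gamma> j t))"
   unfolding lift_def bilinear6_sum[OF F] bilinear6D[OF F] ..
  also have "\<dots> = quasi x (Suc 5) t * C"
   unfolding sum_less_numeral using F0[OF that] F5[OF that] by simp
  also have "Suc 5 = 6" by simp
  finally show ?thesis unfolding quasi_6 by simp
 qed
 have eq: "\<forall>t\<in>I. \<omega> (\<gamma> j t) (lift x t) = C * nderiv_on I j x t" if "j \<le> 5" for j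
  using that
 proof (induction j)
  case (Suc j)
  show ?case
  proof
   fix t assume t: "t \<in> I"
   have "((\<lambda>t. \<omega> (\<gamma> j t) (lift x t) - C * nderiv_on I j x t) has_vector_derivative
     (\<omega> (\<gamma> (Suc j) t) (lift x t) - adjoint_apply I L x t * \<omega> (\<gamma> j t) (\<gamma> 0 t)) - C * nderiv_on I (Suc j) x t) (at t within I)"
    by (intro has_vector_derivative_diff der t has_vector_derivative_mult_right smooth_on_has_derivative sx)
   then have "(\<omega> (\<gamma> (Suc j) t) (lift x t) - adjoint_apply I L x t * \<omega> (\<gamma> j t) (\<gamma> 0 t)) - C * nderiv_on I (Suc j) x t = 0"
    by (rule derivative_const_on[rotated 2]) (use Suc t in auto)
   then show "\<omega> (\<gamma> (Suc j) t) (lift x t) = C * nderiv_on I (Suc j) x t" using rev[OF t] Suc.prems by simp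
  qed
 qed (use base in simp)
 have "((\<lambda>t. \<omega> (\<gamma> 5 t) (lift x t) - C * nderiv_on I 5 x t) has_vector_derivative
   (\<omega> (\<gamma> (Suc 5) t) (lift x t) - adjoint_apply I L x t * \<omega> (\<gamma> 5 t) (\<gamma> 0 t)) - C * nderiv_on I (Suc 5) x t) (at t within I)"
  by (intro has_vector_derivative_diff der tI has_vector_derivative_mult_right smooth_on_has_derivative sx)
 then have "(\<omega> (\<gamma> (Suc 5) t) (lift x t) - adjoint_apply I L x t * \<omega> (\<gamma> 5 t) (\<gamma> 0 t)) - C * nderiv_on I (Suc 5) x t = 0"
  by (rule derivative_const_on[rotated 2]) (use eq[of 5] tI in auto)
 moreover have s6: "Suc 5 = 6" by simp
 ultimately have e6: "\<omega> (\<gamma> 6 t) (lift x t) - adjoint_apply I L x t * \<omega> (\<gamma> 5 t) (\<gamma> 0 t) - C * nderiv_on I 6 x t = 0"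
  unfolding s6 by simp
 have "\<omega> (\<gamma> 6 t) (lift x t) = - (\<Sum>j<6. a j t * \<omega> (\<gamma> j t) (lift x t))"
  unfolding top[OF tI] bilinear6_minus[OF F] bilinear6_sum[OF F] bilinear6D[OF F] ..
 also have "\<dots> = - (\<Sum>j<6. a j t * (C * nderiv_on I j x t))" using eq tI by simp
 also have "\<dots> = - (C * (\<Sum>j<6. a j t * nderiv_on I j x t))" by (simp add: sum_distrib_left mult_ac)
 finally have "C * adjoint_apply I L x t = C * (nderiv_on I 6 x t + (\<Sum>j<6. a j t * nderiv_on I j x t))"
  using e6 skew[of "\<gamma> 5 t" "\<gamma> 0 t"] F5[OF tI] by (simp add: algebra_simps)
 then show "adjoint_apply I L x t = odo_apply I L x t" using C by (simp add: odo_apply_def order6)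
qed

text \<open>Conversely the lifts of solutions of a self-adjoint operator are constant, which identifies
 solutions with functionals on solutions.\<close>

lemma form_of_self_adjoint:
 assumes sa: "self_adjoint I L"
 shows "\<exists>\<beta> flat. symplectic \<beta> flat \<and> (\<forall>t\<in>I. \<forall>i j. i + j < 5 \<longrightarrow> \<beta> (\<gamma> i t) (\<gamma> j t) = 0)"
proof -
 define y where "y v = (\<lambda>t. if t \<in> I then v \<cdot> \<gamma> 0 t else 0)" for v
 have ys: "y v \<in> smooth_functions I" "smooth_on I (y v)" for v
  unfolding y_def using smooth_pair[of v] by (auto simp: smooth_functions_def)
 have yn: "nderiv_on I k (y v) t = v \<cdot> \<gamma> k t" if "t \<in> I" for k v t unfolding y_def by (rule nderiv_pair[OF that])
 have adj: "adjoint_apply I L (y v) t = 0" if t: "t \<in> I" for v t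
 proof -
  have "adjoint_apply I L (y v) t = odo_apply I L (y v) t" using sa ys(1) t by (auto simp: self_adjoint_def)
  also have "\<dots> = v \<cdot> \<gamma> 6 t + (\<Sum>j<6. a j t * v \<cdot> \<gamma> j t)" by (simp add: odo_apply_def order6 yn[OF t])
  also have "\<dots> = 0" unfolding top[OF t] by (simp add: pair_sum)
  finally show ?thesis .
 qed
 have d: "(lift (y v) has_vector_derivative 0) (at t within I)" if "t \<in> I" for v t
  using lift_derivative[OF ys(2) that, of v] adj[OF that] by simp
 have lc: "lift (y v) t = lift (y v) t0" if "t \<in> I" for v t
  using constant_on[of "lift (y v)" t t0] d that t0 by blast
 define \<Phi> where "\<Phi> v = lift (y v) t0" for v
 have \<Phi>: "lift (y v) t = \<Phi> v" if "t \<in> I" for v t unfolding \<Phi>_def by (rule lc[OF that])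
 have quasi_lin: "quasi (y (c *s v + d *s w)) j t = c * quasi (y v) j t + d * quasi (y w) j t" if t: "t \<in> I" for c v d w j t
 proof -
  have "nderiv_on I k (\<lambda>s. coef i s * y (c *s v + d *s w) s) t =
   c * nderiv_on I k (\<lambda>s. coef i s * y v s) t + d * nderiv_on I k (\<lambda>s. coef i s * y w s) t" if i: "i \<le> 6" for i k
  proof -
   have s: "smooth_on I (\<lambda>s. coef i s * y v s)" for v using smooth_coef[OF i] ys(2) by (rule smooth_on_mult)
   have "nderiv_on I k (\<lambda>s. coef i s * y (c *s v + d *s w) s) t = nderiv_on I k (\<lambda>s. c * (coef i s * y v s) + d * (coef i s * y w s)) t"
    by (rule nderiv_on_cong[OF _ t]) (simp add: y_def algebra_simps)
   then show ?thesis unfolding nderiv_on_lin[OF s s t] .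
  qed
  then show ?thesis unfolding quasi_def
   by (simp add: sum.distrib[symmetric] sum_distrib_left algebra_simps)
 qed
 have \<Phi>_lin: "\<Phi> (c *s v + d *s w) = c *s \<Phi> v + d *s \<Phi> w" for c v d w
  unfolding \<Phi>_def lift_def quasi_lin[OF t0]
  by (simp add: vec.scale_sum_right vec.scale_left_distrib sum.distrib)
 have coord: "\<Phi> v \<cdot> E 5 = v \<cdot> \<gamma> 0 t"
  if t: "t \<in> I" and E: "\<And>i j. i < 6 \<Longrightarrow> j < 6 \<Longrightarrow> \<gamma> i t \<cdot> E j = (if i = j then 1 else 0)" for E t v
 proof -
  have "\<Phi> v \<cdot> E 5 = (\<Sum>j<6. quasi (y v) (Suc j) t * \<gamma> j t \<cdot> E 5)" unfolding \<Phi>[OF t, symmetric] lift_def pair_sum pair_simps ..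
  also have "\<dots> = quasi (y v) (Suc 5) t" unfolding sum_less_numeral using E by simp
  also have "Suc 5 = 6" by simp
  finally show ?thesis unfolding quasi_6 using t by (simp add: y_def)
 qed
 have \<Phi>_inj: "v = 0" if "\<Phi> v = 0" for v
 proof (rule spanning)
  fix t assume t: "t \<in> I"
  obtain E where "\<And>i j. i < 6 \<Longrightarrow> j < 6 \<Longrightarrow> \<gamma> i t \<cdot> E j = (if i = j then 1 else 0)" using frame_expansion[OF t] by metis
  from coord[OF t this, of v] show "v \<cdot> \<gamma> 0 t = 0" using that by simp
 qed
 have lin: "linear \<Phi>"
  by (rule linearI) (use \<Phi>_lin[of 1 _ 1] \<Phi>_lin[of _ _ 0 0] in \<open>auto simp: scaleR_eq_scale\<close>)
 have inj: "inj \<Phi>"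
  using \<Phi>_inj unfolding linear_injective_0[OF lin] by blast
 have "surj \<Phi>" by (rule linear_injective_imp_surjective[OF lin inj]) (rule refl)
 then obtain \<Psi> where \<Psi>: "\<And>u. \<Phi> (\<Psi> u) = u" by (metis surjD)
 have \<Psi>\<Phi>: "\<Psi> (\<Phi> v) = v" for v using \<Psi>[of "\<Phi> v"] inj by (rule injD[rotated])
 have \<Psi>_lin: "\<Psi> (c *s u + d *s w) = c *s \<Psi> u + d *s \<Psi> w" for c u d w
  using \<Psi>\<Phi>[of "c *s \<Psi> u + d *s \<Psi> w"] unfolding \<Phi>_lin \<Psi> .
 define \<beta> where "\<beta> p u = p \<cdot> \<Psi> u" for p u
 have bil: "bilinear6 \<beta>"
  using \<Psi>_lin[of 1 _ 1] \<Psi>_lin[of _ _ 0 0] unfolding bilinear6_def linear6_def \<beta>_def by simp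
 have \<beta>0: "\<beta> (\<gamma> 0 t) (\<gamma> j t) = (if j = 5 then 1 else 0)" if t: "t \<in> I" and j: "j < 6" for t j
 proof -
  obtain E where E: "\<And>i j. i < 6 \<Longrightarrow> j < 6 \<Longrightarrow> \<gamma> i t \<cdot> E j = (if i = j then 1 else 0)" using frame_expansion[OF t] by metis
  have "\<beta> (\<gamma> 0 t) (\<gamma> j t) = \<Phi> (\<Psi> (\<gamma> j t)) \<cdot> E 5" using coord[OF t E, of "\<Psi> (\<gamma> j t)"] by (simp add: \<beta>_def pair_commute[of "\<gamma> 0 t"])
  then show ?thesis unfolding \<Psi> using E[OF j, of 5] by simp
 qed
 have tri: "\<forall>t\<in>I. (\<forall>j. i + j < 5 \<longrightarrow> \<beta> (\<gamma> i t) (\<gamma> j t) = 0) \<and> (i \<le> 5 \<longrightarrow> \<beta> (\<gamma> i t) (\<gamma> (5 - i) t) = (- 1) ^ i * 1)" for i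
  by (rule form_triangular[OF bil]) (simp_all add: \<beta>0)
 define F where "F p q = \<beta> p q + \<beta> q p" for p q
 have F: "bilinear6 F" using bil unfolding bilinear6_def linear6_def F_def by (auto simp: algebra_simps)
 have F0: "F (\<gamma> 0 t) (\<gamma> j t) = 0" if t: "t \<in> I" and j: "j < 6" for t j
 proof (cases "j = 5")
  case True
  have "\<beta> (\<gamma> 5 t) (\<gamma> 0 t) = - 1" using tri[of 5] t by simp
  then show ?thesis using \<beta>0[OF t j] True by (simp add: F_def)
 next
  case False
  then have "\<beta> (\<gamma> j t) (\<gamma> 0 t) = 0" using tri[of j] t j by simp
  then show ?thesis using \<beta>0[OF t j] False by (simp add: F_def)
 qed
 have "F p u = 0" for p u
 proof -
  define v where "v = vec_of (\<lambda>p. F p u)"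
  have v: "v \<cdot> p = F p u" for p unfolding v_def using F by (intro pair_vec_of) (simp add: bilinear6_def)
  have "v = 0"
  proof (rule spanning)
   fix t assume t: "t \<in> I"
   obtain E where E: "\<And>p. p = (\<Sum>j<6. (p \<cdot> E j) *s \<gamma> j t)" using frame_expansion[OF t] by metis
   have "F (\<gamma> 0 t) u = (\<Sum>j<6. (u \<cdot> E j) * F (\<gamma> 0 t) (\<gamma> j t))"
    by (subst E[of u]) (simp only: bilinear6_sum[OF F] bilinear6D[OF F])
   also have "\<dots> = 0" using F0[OF t] by simp
   finally show "v \<cdot> \<gamma> 0 t = 0" unfolding v .
  qed
  then show ?thesis using v[of p] by simp
 qed
 then have skew: "\<beta> q p = - \<beta> p q" for p q unfolding F_def by (simp add: eq_neg_iff_add_eq_0 add.commute)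
 have "symplectic \<beta> (\<lambda>v. (- 1) *s \<Phi> v)"
 proof
  show "linear6 (\<beta> u)" for u using bil by (simp add: bilinear6_def)
  show "\<beta> w u = - \<beta> u w" for u w by (rule skew)
  show "\<beta> ((- 1) *s \<Phi> p) u = p \<cdot> u" for p u
   unfolding bilinear6D[OF bil] using skew[of "\<Phi> p" u] by (simp add: \<beta>_def \<Psi>\<Phi> pair_commute)
 qed
 then show ?thesis using tri by blast
qed

end

section \<open>Conjugation of operators\<close>

lemma (in real_interval) linear_system_scalar:
 fixes q :: "real \<Rightarrow> complex"
 assumes q: "continuous_on I q"
 shows "linear_system I (\<lambda>t y. q t * y)"
 unfolding linear_system_def
proof (intro conjI ballI allI impI)
 show "linear ((*) (q t))" for t by (rule linearI) (simp_all add: algebra_simps)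
 show "continuous_on I (\<lambda>t. q t * y t)" if "continuous_on I y" for y using q that by (rule continuous_on_mult)
qed (rule interval)

lemma (in real_interval) scalar_unique:
 fixes y :: "real \<Rightarrow> complex"
 assumes "continuous_on I q" "\<And>t. t \<in> I \<Longrightarrow> (y has_vector_derivative q t * y t) (at t within I)" "s \<in> I" "t \<in> I" "y s = 0"
 shows "y t = 0"
proof (rule linear_system_unique[where y = y and t = t and ?t0.0 = s, OF linear_system_scalar[OF assms(1)] _ assms(4,3,5)])
 show "solves_system I (\<lambda>t. (*) (q t)) y" using assms(2) by (simp add: solves_system_def)
qed

lemma (in real_interval) scalar_exists:
 fixes q :: "real \<Rightarrow> complex"
 assumes q: "smooth_on I q" and s: "s \<in> I"
 shows "\<exists>y. smooth_on I y \<and> y s = 1 \<and> (\<forall>t\<in>I. (y has_vector_derivative q t * y t) (at t within I)) \<and> (\<forall>t\<in>I. y t \<noteq> 0)"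
proof -
 note c = smooth_on_continuous[OF q]
 obtain y where y: "y s = 1" "\<And>t. t \<in> I \<Longrightarrow> (y has_vector_derivative q t * y t) (at t within I)"
  using linear_system_exists[OF linear_system_scalar[OF c] s, of 1] unfolding solves_system_def by blast
 have "y t \<noteq> 0" if "t \<in> I" for t
  using scalar_unique[OF c y(2) that s] y(1) by auto
 moreover have "smooth_on I y"
 proof (rule smooth_on_fun_alg[of "insert y {f. smooth_on I f}"])
  show "fun_alg (insert y {f. smooth_on I f}) y" by (rule fun_alg.base) simp
  fix b assume "b \<in> insert y {f. smooth_on I f}"
  then consider "b = y" | "smooth_on I b" by blast
  then show "\<exists>b'. fun_alg (insert y {f. smooth_on I f}) b' \<and> (\<forall>t\<in>I. (b has_vector_derivative b' t) (at t within I))"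
  proof cases
   case 1
   have "fun_alg (insert y {f. smooth_on I f}) (\<lambda>t. q t * y t)"
    by (intro fun_alg.mult fun_alg.base) (use q in auto)
   then show ?thesis using 1 y(2) by blast
  next
   case 2
   have "fun_alg (insert y {f. smooth_on I f}) (deriv_on I b)" using smooth_on_deriv[OF 2] by (intro fun_alg.base) simp
   then show ?thesis using smooth_on_has_derivative0[OF 2] by blast
  qed
 qed
 ultimately show ?thesis using y by blast
qed

text \<open>Functions with a single nonvanishing derivative at a point detect the order of an operator.\<close>

lemma (in real_interval) jet_monomial:
 assumes t: "t \<in> I"
 shows "\<exists>p\<in>smooth_functions I. nderiv_on I m p t \<noteq> 0 \<and> (\<forall>k. k \<noteq> m \<longrightarrow> nderiv_on I k p t = 0)"
proof -
 define p where "p s = (if s \<in> I then (complex_of_real s - complex_of_real t) ^ m else 0)" for s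
 define q :: "nat \<Rightarrow> complex" where "q k = (\<Prod>i<k. of_nat (m - i))" for k
 have d: "((\<lambda>s. q k * (complex_of_real s - complex_of_real t) ^ (m - k)) has_vector_derivative
   q (Suc k) * (complex_of_real s - complex_of_real t) ^ (m - Suc k)) (at s within I)" for k s
 proof -
  have "((\<lambda>z. z - complex_of_real t) has_field_derivative 1) (at (complex_of_real s))"
   by (auto intro!: derivative_eq_intros)
  from DERIV_cmult[OF DERIV_power[OF this, of "m - k"], of "q k"]
  have "((\<lambda>z. q k * (z - complex_of_real t) ^ (m - k)) has_field_derivative
    q k * (of_nat (m - k) * (complex_of_real s - complex_of_real t) ^ (m - Suc k))) (at (complex_of_real s))"
   by simp
  moreover have "(complex_of_real has_vector_derivative 1) (at s within I)"
   using has_vector_derivative_of_real[OF DERIV_ident] by simp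
  ultimately have "((\<lambda>z. q k * (z - complex_of_real t) ^ (m - k)) \<circ> complex_of_real has_vector_derivative
    1 * (q k * (of_nat (m - k) * (complex_of_real s - complex_of_real t) ^ (m - Suc k)))) (at s within I)"
   by (intro field_vector_diff_chain_within) (auto intro: has_field_derivative_at_within)
  then show ?thesis by (simp add: comp_def q_def mult.assoc)
 qed
 have n: "nderiv_on I k p s = q k * (complex_of_real s - complex_of_real t) ^ (m - k)" if "s \<in> I" for k s
  using that
 proof (induction k arbitrary: s)
  case (Suc k)
  have "nderiv_on I (Suc k) p s = deriv_on I (\<lambda>s. q k * (complex_of_real s - complex_of_real t) ^ (m - k)) s"
   using deriv_on_cong[of I "nderiv_on I k p" "\<lambda>s. q k * (complex_of_real s - complex_of_real t) ^ (m - k)"] Suc.IH by simp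
  also have "\<dots> = q (Suc k) * (complex_of_real s - complex_of_real t) ^ (m - Suc k)"
   by (rule deriv_on_eqI[OF d Suc.prems])
  finally show ?case .
 qed (simp add: p_def q_def)
 have "nderiv_on I k p differentiable (at s within I)" if s: "s \<in> I" for k s
  by (rule differentiable_on_interval_cong[OF _ s differentiableI_vector[OF d]]) (simp add: n)
 then have "p \<in> smooth_functions I" by (simp add: smooth_functions_def smooth_on_def p_def)
 moreover have "nderiv_on I m p t \<noteq> 0" unfolding n[OF t] q_def by simp
 moreover have "nderiv_on I k p t = 0" if "k \<noteq> m" for k
 proof (cases "k < m")
  case True
  then show ?thesis unfolding n[OF t] by simp
 next
  case False
  then have "m < k" using that by simp
  then have "q k = 0" unfolding q_def by (intro prod_zero) auto
  then show ?thesis unfolding n[OF t] by simp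
 qed
 ultimately show ?thesis by blast
qed

context odo6
begin

lemma odo_apply_coef: "odo_apply I L x t = (\<Sum>k\<le>6. coef k t * nderiv_on I k x t)"
proof -
 have "(\<Sum>k<6. a k t * nderiv_on I k x t) = (\<Sum>k<6. coef k t * nderiv_on I k x t)"
  by (intro sum.cong) (auto simp: coef_def)
 moreover have "(\<Sum>k\<le>6. coef k t * nderiv_on I k x t) = (\<Sum>k<6. coef k t * nderiv_on I k x t) + coef 6 t * nderiv_on I 6 x t"
  using sum.lessThan_Suc[of "\<lambda>k. coef k t * nderiv_on I k x t" 6] by (simp add: lessThan_Suc_atMost[symmetric])
 ultimately show ?thesis by (simp add: odo_apply_def order6 coef_def add.commute)
qed

text \<open>The coefficients of \<open>\<mu>\<^sup>-\<^sup>1 L \<mu>\<close>, from the Leibniz rule.\<close>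

definition conj_coef :: "(real \<Rightarrow> complex) \<Rightarrow> nat \<Rightarrow> real \<Rightarrow> complex" where
 "conj_coef \<mu> j t = (\<Sum>k\<le>6. coef k t * of_nat (k choose j) * nderiv_on I (k - j) \<mu> t) * (1 / \<mu> t)"

lemma conjugate:
 assumes \<mu>: "smooth_on I \<mu>" "\<And>t. t \<in> I \<Longrightarrow> \<mu> t \<noteq> 0"
 shows "is_odo I (ODO 6 (conj_coef \<mu>))"
  and "smooth_on I x \<Longrightarrow> t \<in> I \<Longrightarrow> odo_apply I (ODO 6 (conj_coef \<mu>)) x t = (1 / \<mu> t) * odo_apply I L (\<lambda>s. \<mu> s * x s) t"
proof -
 have "smooth_on I (conj_coef \<mu> j)" for j
  unfolding conj_coef_def[abs_def]
  by (intro smooth_on_mult smooth_on_sum smooth_on_inverse \<mu> smooth_on_nderiv smooth_on_const smooth_coef) simp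
 then show "is_odo I (ODO 6 (conj_coef \<mu>))" by (simp add: is_odo_def)
 assume x: "smooth_on I x" and t: "t \<in> I"
 have "nderiv_on I k (\<lambda>s. \<mu> s * x s) t = (\<Sum>j\<le>6. of_nat (k choose j) * nderiv_on I j x t * nderiv_on I (k - j) \<mu> t)" if k: "k \<le> 6" for k
 proof -
  have "nderiv_on I k (\<lambda>s. \<mu> s * x s) t = nderiv_on I k (\<lambda>s. x s * \<mu> s) t" by (simp add: mult.commute)
  also have "\<dots> = (\<Sum>j\<le>k. of_nat (k choose j) * nderiv_on I j x t * nderiv_on I (k - j) \<mu> t)" by (rule nderiv_on_mult[OF x \<mu>(1) t])
  also have "\<dots> = (\<Sum>j\<le>6. of_nat (k choose j) * nderiv_on I j x t * nderiv_on I (k - j) \<mu> t)"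
   using k by (intro sum.mono_neutral_left) (auto simp: binomial_eq_0)
  finally show ?thesis .
 qed
 then have "odo_apply I L (\<lambda>s. \<mu> s * x s) t =
   (\<Sum>k\<le>6. coef k t * (\<Sum>j\<le>6. of_nat (k choose j) * nderiv_on I j x t * nderiv_on I (k - j) \<mu> t))"
  unfolding odo_apply_coef by (intro sum.cong) auto
 also have "\<dots> = (\<Sum>j\<le>6. (\<Sum>k\<le>6. coef k t * of_nat (k choose j) * nderiv_on I (k - j) \<mu> t) * nderiv_on I j x t)"
  unfolding sum_distrib_left sum_distrib_right by (subst sum.swap) (simp add: mult_ac)
 finally have "(1 / \<mu> t) * odo_apply I L (\<lambda>s. \<mu> s * x s) t = (\<Sum>j\<le>6. conj_coef \<mu> j t * nderiv_on I j x t)"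
  by (simp add: conj_coef_def sum_distrib_left mult_ac)
 also have "\<dots> = (\<Sum>j<6. conj_coef \<mu> j t * nderiv_on I j x t) + conj_coef \<mu> 6 t * nderiv_on I 6 x t"
  using sum.lessThan_Suc[of "\<lambda>j. conj_coef \<mu> j t * nderiv_on I j x t" 6] by (simp add: lessThan_Suc_atMost[symmetric])
 also have "conj_coef \<mu> 6 t = 1"
 proof -
  have "(\<Sum>k\<le>6. coef k t * of_nat (k choose 6) * nderiv_on I (k - 6) \<mu> t) = (\<Sum>k\<in>{6}. coef k t * of_nat (k choose 6) * nderiv_on I (k - 6) \<mu> t)"
   by (intro sum.mono_neutral_right) (auto simp: binomial_eq_0)
  then show ?thesis using \<mu>(2)[OF t] by (simp add: conj_coef_def coef_def)
 qed
 finally show "odo_apply I (ODO 6 (conj_coef \<mu>)) x t = (1 / \<mu> t) * odo_apply I L (\<lambda>s. \<mu> s * x s) t"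
  by (simp add: odo_apply_def)
qed

lemma equivalent_order:
 assumes \<mu>: "smooth_on I \<mu>" "\<And>t. t \<in> I \<Longrightarrow> \<mu> t \<noteq> 0"
  and eq: "\<And>x t. x \<in> smooth_functions I \<Longrightarrow> t \<in> I \<Longrightarrow> odo_apply I M x t = (1 / \<mu> t) * odo_apply I L (\<lambda>s. \<mu> s * x s) t"
 shows "odo_order M = 6"
proof (rule ccontr)
 assume n: "odo_order M \<noteq> 6"
 define m where "m = max (odo_order M) 6"
 obtain p where p: "p \<in> smooth_functions I" "nderiv_on I m p t0 \<noteq> 0" "\<And>k. k \<noteq> m \<Longrightarrow> nderiv_on I k p t0 = 0"
  using jet_monomial[OF t0, of m] by blast
 have sp: "smooth_on I p" using p(1) by (simp add: smooth_functions_def)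
 have M: "odo_apply I M p t0 = (if odo_order M = m then nderiv_on I m p t0 else 0)"
 proof -
  have "(\<Sum>i<odo_order M. odo_coeff M i t0 * nderiv_on I i p t0) = 0"
   by (rule sum.neutral) (use p(3) in \<open>auto simp: m_def\<close>)
  then show ?thesis unfolding odo_apply_def using p(3) by auto
 qed
 have D: "nderiv_on I k (\<lambda>s. \<mu> s * p s) t0 = (if k = m then \<mu> t0 * nderiv_on I m p t0 else 0)" if k: "k \<le> m" for k
 proof -
  have "nderiv_on I k (\<lambda>s. \<mu> s * p s) t0 = nderiv_on I k (\<lambda>s. p s * \<mu> s) t0" by (simp add: mult.commute)
  also have "\<dots> = (\<Sum>j\<le>k. of_nat (k choose j) * nderiv_on I j p t0 * nderiv_on I (k - j) \<mu> t0)" by (rule nderiv_on_mult[OF sp \<mu>(1) t0])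
  also have "\<dots> = (\<Sum>j\<in>{k}. of_nat (k choose j) * nderiv_on I j p t0 * nderiv_on I (k - j) \<mu> t0)"
   using k p(3) by (intro sum.mono_neutral_right) auto
  finally show ?thesis using p(3)[of k] by auto
 qed
 have L: "odo_apply I L (\<lambda>s. \<mu> s * p s) t0 = (if 6 = m then \<mu> t0 * nderiv_on I m p t0 else 0)"
 proof -
  have "(\<Sum>i<6. a i t0 * nderiv_on I i (\<lambda>s. \<mu> s * p s) t0) = 0"
   by (rule sum.neutral) (use D in \<open>auto simp: m_def\<close>)
  moreover have "nderiv_on I 6 (\<lambda>s. \<mu> s * p s) t0 = (if 6 = m then \<mu> t0 * nderiv_on I m p t0 else 0)"
   using D[of 6] by (simp add: m_def)
  ultimately show ?thesis unfolding odo_apply_def order6 by simp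
 qed
 show False
  using eq[OF p(1) t0] p(2) \<mu>(2)[OF t0] n unfolding M L by (auto simp: m_def max_def split: if_splits)
qed

lemma odo_apply_cong:
 assumes "\<And>s. s \<in> I \<Longrightarrow> x s = y s" "t \<in> I" shows "odo_apply I N x t = odo_apply I N y t"
proof -
 have "nderiv_on I k x t = nderiv_on I k y t" for k by (rule nderiv_on_cong[OF assms])
 then show ?thesis by (simp add: odo_apply_def)
qed

text \<open>The evaluation curve of \<open>\<mu>\<^sup>-\<^sup>1 L \<mu>\<close> in the coordinates of the solution space of \<open>L\<close>.\<close>

definition tw :: "(real \<Rightarrow> complex) \<Rightarrow> nat \<Rightarrow> real \<Rightarrow> vec6" where
 "tw \<nu> j t = (\<chi> i. nderiv_on I j (\<lambda>s. \<nu> s * sol (axis i 1) s) t)"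

lemma tw_cc:
 assumes "smooth_on I \<nu>" "t \<in> I"
 shows "tw \<nu> j t = (\<Sum>k\<le>j. (of_nat (j choose k) * nderiv_on I k \<nu> t) *s cc (j - k) t)"
 unfolding tw_def vec_eq_iff by (simp add: nderiv_on_mult[OF assms(1) smooth_sol assms(2)] cc_def)

lemma cc_tw:
 assumes "smooth_on I \<mu>" "smooth_on I \<nu>" "\<And>t. t \<in> I \<Longrightarrow> \<mu> t * \<nu> t = 1" "t \<in> I"
 shows "cc j t = (\<Sum>k\<le>j. (of_nat (j choose k) * nderiv_on I k \<mu> t) *s tw \<nu> (j - k) t)"
proof -
 have "nderiv_on I j (sol v) t = (\<Sum>k\<le>j. of_nat (j choose k) * nderiv_on I k \<mu> t * nderiv_on I (j - k) (\<lambda>s. \<nu> s * sol v s) t)" for v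
 proof -
  have "nderiv_on I j (sol v) t = nderiv_on I j (\<lambda>s. \<mu> s * (\<nu> s * sol v s)) t"
   by (rule nderiv_on_cong[OF _ assms(4)]) (simp add: mult.assoc[symmetric] assms(3))
  also have "\<dots> = (\<Sum>k\<le>j. of_nat (j choose k) * nderiv_on I k \<mu> t * nderiv_on I (j - k) (\<lambda>s. \<nu> s * sol v s) t)"
   by (rule nderiv_on_mult[OF assms(1) smooth_on_mult[OF assms(2) smooth_sol] assms(4)])
  finally show ?thesis .
 qed
 then show ?thesis unfolding tw_def cc_def vec_eq_iff by simp
qed

lemma tw_jet_curve:
 assumes M: "is_odo I M" and \<mu>: "smooth_on I \<mu>" "\<And>t. t \<in> I \<Longrightarrow> \<mu> t \<noteq> 0"
  and eq: "\<And>x t. x \<in> smooth_functions I \<Longrightarrow> t \<in> I \<Longrightarrow> odo_apply I M x t = (1 / \<mu> t) * odo_apply I L (\<lambda>s. \<mu> s * x s) t"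
 shows "jet_curve I M (tw (\<lambda>t. 1 / \<mu> t))"
proof -
 have o6: "odo_order M = 6" by (rule equivalent_order[OF \<mu> eq])
 interpret N: odo6 I M using M o6 by unfold_locales
 define \<nu> where "\<nu> = (\<lambda>t. 1 / \<mu> t)"
 have \<nu>: "smooth_on I \<nu>" unfolding \<nu>_def using \<mu> by (rule smooth_on_inverse)
 have s: "smooth_on I (\<lambda>s. \<nu> s * sol v s)" for v using \<nu> smooth_sol by (rule smooth_on_mult)
 have sf: "(\<lambda>s. \<nu> s * sol v s) \<in> smooth_functions I" for v using s sol_outside by (simp add: smooth_functions_def)
 have p: "v \<cdot> tw \<nu> j t = nderiv_on I j (\<lambda>s. \<nu> s * sol v s) t" if t: "t \<in> I" for v j t
 proof -
  have "v \<cdot> tw \<nu> j t = (\<Sum>k\<le>j. (of_nat (j choose k) * nderiv_on I k \<nu> t) * v \<cdot> cc (j - k) t)"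
   unfolding tw_cc[OF \<nu> t] by (simp add: pair_sum)
  then show ?thesis unfolding nderiv_on_mult[OF \<nu> smooth_sol t] nderiv_sol[OF t] .
 qed
 show ?thesis
  unfolding \<nu>_def[symmetric]
 proof unfold_locales
  fix t j assume t: "t \<in> I"
  have "((\<lambda>t. nderiv_on I j (\<lambda>s. \<nu> s * sol (axis i 1) s) t) has_vector_derivative nderiv_on I (Suc j) (\<lambda>s. \<nu> s * sol (axis i 1) s) t) (at t within I)" for i
   by (rule smooth_on_has_derivative[OF s t])
  from has_vector_derivative_vec_lambda[OF this]
  show "(tw \<nu> j has_vector_derivative tw \<nu> (Suc j) t) (at t within I)" unfolding tw_def[abs_def] .
 next
  fix t assume t: "t \<in> I"
  have z: "odo_apply I M (\<lambda>s. \<nu> s * sol v s) t = 0" for v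
  proof -
   have "odo_apply I L (\<lambda>s. \<mu> s * (\<nu> s * sol v s)) t = odo_apply I L (sol v) t"
    by (rule odo_apply_cong[OF _ t]) (simp add: \<nu>_def \<mu>(2))
   also have "\<dots> = 0" using sol(1)[of v] t by (simp add: solutions_def)
   finally show ?thesis using eq[OF sf t] by simp
  qed
  show "tw \<nu> 6 t = - (\<Sum>j<6. odo_coeff M j t *s tw \<nu> j t)"
   using z unfolding odo_apply_def o6 by (simp add: tw_def vec_eq_iff eq_neg_iff_add_eq_0)
  have "\<exists>v. \<forall>j<6. v \<cdot> tw \<nu> j t = (if i = j then 1 else 0)" if i: "i < 6" for i
  proof -
   obtain x where x: "x \<in> solutions I M" "\<forall>j<6. nderiv_on I j x t = (axis (ix i) 1 :: vec6) $ ix j"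
    using N.solution_exists[OF t] by blast
   have xs: "x \<in> smooth_functions I" "smooth_on I x" using x(1) N.solutionsD by blast+
   have "(\<lambda>s. \<mu> s * x s) \<in> solutions I L"
   proof -
    have "odo_apply I L (\<lambda>s. \<mu> s * x s) r = 0" if "r \<in> I" for r
    proof -
     have "(1 / \<mu> r) * odo_apply I L (\<lambda>s. \<mu> s * x s) r = 0"
      unfolding eq[OF xs(1) that, symmetric] using x(1) that by (simp add: solutions_def)
     then show ?thesis using \<mu>(2)[OF that] by simp
    qed
    then show ?thesis using smooth_on_mult[OF \<mu>(1) xs(2)] xs(1) by (simp add: solutions_def smooth_functions_def)
   qed
   then obtain v where v: "(\<lambda>s. \<mu> s * x s) = sol v" using sol_surj by blast
   have "v \<cdot> tw \<nu> j t = (if i = j then 1 else 0)" if j: "j < 6" for j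
   proof -
    have "nderiv_on I j (\<lambda>s. \<nu> s * sol v s) t = nderiv_on I j x t"
     by (rule nderiv_on_cong[OF _ t]) (simp add: v[symmetric] \<nu>_def \<mu>(2))
    then show ?thesis unfolding p[OF t] using x(2) j i by (auto simp: axis_def ix_eq_iff)
   qed
   then show ?thesis by blast
  qed
  then obtain E where "\<forall>i<6. \<forall>j<6. E i \<cdot> tw \<nu> j t = (if i = j then 1 else 0)" by metis
  then have "dual (map (\<lambda>j. tw \<nu> j t) [0..<6]) E" by (auto simp: dual_def pair_commute[of "tw _ _ t"])
  then show "\<exists>E. dual (map (\<lambda>j. tw \<nu> j t) [0..<6]) E" by blast
 qed
qed

text \<open>The derivatives of \<open>\<mu> \<gamma>\<close> up to order \<open>j\<close> are combinations of those of \<open>\<gamma>\<close> up to order \<open>j\<close>, so the relations for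
 \<open>i + j < 5\<close> pass from the self-adjoint operator to \<open>L\<close>.\<close>

lemma degree_of_self_adjoint:
 assumes dim: "vec.dim K = 6" and M: "is_odo I M" "self_adjoint I M" "equivalent_odo I L M"
 shows "has_wronski_degree I L 3 2"
proof -
 obtain \<mu> where \<mu>: "smooth_on I \<mu>" "\<And>t. t \<in> I \<Longrightarrow> \<mu> t \<noteq> 0"
  and eq: "\<And>x t. x \<in> smooth_functions I \<Longrightarrow> t \<in> I \<Longrightarrow> odo_apply I M x t = (1 / \<mu> t) * odo_apply I L (\<lambda>s. \<mu> s * x s) t"
  using M(3) unfolding equivalent_odo_def by blast
 define \<nu> where "\<nu> = (\<lambda>t. 1 / \<mu> t)"
 have \<nu>: "smooth_on I \<nu>" unfolding \<nu>_def using \<mu> by (rule smooth_on_inverse)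
 interpret J: jet_curve I M "tw \<nu>" unfolding \<nu>_def by (rule tw_jet_curve[OF M(1) \<mu> eq])
 obtain \<beta> flat where sy: "symplectic \<beta> flat" and B: "\<And>t i j. t \<in> I \<Longrightarrow> i + j < 5 \<Longrightarrow> \<beta> (tw \<nu> i t) (tw \<nu> j t) = 0"
  using J.form_of_self_adjoint[OF M(2)] by blast
 interpret S: symplectic \<beta> flat by (rule sy)
 have bil: "bilinear6 \<beta>" using S.lin S.lin' by (simp add: bilinear6_def)
 have \<beta>c: "\<beta> (cc i t) (cc j t) = 0" if t: "t \<in> I" and ij: "i + j < 5" for t i j
 proof -
  have c: "cc j t = (\<Sum>k\<le>j. (of_nat (j choose k) * nderiv_on I k \<mu> t) *s tw \<nu> (j - k) t)" for j
   by (rule cc_tw[OF \<mu>(1) \<nu> _ t]) (simp add: \<nu>_def \<mu>(2))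
  have "\<beta> (tw \<nu> (i - k) t) (tw \<nu> (j - l) t) = 0" for k l using ij by (intro B t) simp
  then show ?thesis unfolding c bilinear6_sum[OF bil] bilinear6D[OF bil] by simp
 qed
 show ?thesis
 proof (rule degree_two[OF sy dim])
  fix p
  have "tri (S.pb p) (cc 0 t) (cc 1 t) (cc 2 t) = 0" if "t \<in> I" for t
   unfolding S.tri_pb using \<beta>c[OF that] by simp
  then show "S.pb p \<in> K" using S.alt_pb by (simp add: K_def WR_def fun_eq_iff)
 qed
qed

text \<open>Vanishing of \<open>WR (p \<and> \<omega>)\<close> for all \<open>p\<close> means \<open>\<omega> (c\<^sup>(\<^sup>i\<^sup>), c\<^sup>(\<^sup>j\<^sup>)) = 0\<close> for \<open>i < j \<le> 2\<close>. The derivatives of these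
 relations determine the form along the curve up to the function \<open>g\<close>.\<close>

lemma self_adjoint_of_degree:
 assumes dim: "vec.dim K = 6" and d: "\<not> has_wronski_degree I L 3 1"
 shows "\<exists>M. is_odo I M \<and> self_adjoint I M \<and> equivalent_odo I L M"
proof -
 obtain \<omega> where l: "\<And>p. linear6 (\<omega> p)" and skew: "\<And>p q. \<omega> q p = - \<omega> p q" and nz: "\<exists>p q. \<omega> p q \<noteq> 0"
  and pK: "\<And>p. \<exists>k\<in>K. \<forall>q r s. tri k q r s = p \<cdot> q * \<omega> r s - p \<cdot> r * \<omega> q s + p \<cdot> s * \<omega> q r"
  using bivector_of_degree[OF dim d] by blast
 have "linear6 (\<lambda>p. \<omega> p q)" for q
 proof -
  have e: "(\<lambda>p. \<omega> p q) = (\<lambda>p. - \<omega> q p)" using skew by (intro ext)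
  show ?thesis unfolding e using l[of q] by (simp add: linear6_def)
 qed
 then have F: "bilinear6 \<omega>" using l by (simp add: bilinear6_def)
 interpret C: jet_curve I L cc by unfold_locales (fact cc_derivative cc_6 cc_dual_list)+
 define B where "B i j t = \<omega> (cc i t) (cc j t)" for i j t
 have sk: "B j i t = - B i j t" for i j t unfolding B_def by (rule skew)
 have diag: "B i i t = 0" for i t using sk[of i i t] by simp
 have low: "B 0 1 t = 0" "B 0 2 t = 0" "B 1 2 t = 0" if t: "t \<in> I" for t
 proof -
  have e: "p \<cdot> cc 0 t * B 1 2 t - p \<cdot> cc 1 t * B 0 2 t + p \<cdot> cc 2 t * B 0 1 t = 0" for p
  proof -
   obtain k where k: "k \<in> K" "tri k (cc 0 t) (cc 1 t) (cc 2 t) = p \<cdot> cc 0 t * B 1 2 t - p \<cdot> cc 1 t * B 0 2 t + p \<cdot> cc 2 t * B 0 1 t"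
    using pK[of p] unfolding B_def by blast
   have "WR k t = 0" using k(1) by (simp add: K_def)
   then show ?thesis using t k(2) by (simp add: WR_def)
  qed
  obtain E where E: "\<forall>i<6. \<forall>j<6. E i \<cdot> cc j t = (if i = j then 1 else 0)" using cc_dual[OF t] by blast
  show "B 0 1 t = 0" "B 0 2 t = 0" "B 1 2 t = 0" using e[of "E 2"] e[of "E 1"] e[of "E 0"] E by simp_all
 qed
 have der: "(B i j has_vector_derivative B (Suc i) j t + B i (Suc j) t) (at t within I)" if "t \<in> I" for i j t
  unfolding B_def[abs_def] by (rule bilinear6_derivative[OF F cc_derivative[OF that] cc_derivative[OF that]])
 have step: "B (Suc i) j t + B i (Suc j) t = 0" if "\<And>t. t \<in> I \<Longrightarrow> B i j t = 0" "t \<in> I" for i j t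
  by (rule derivative_const_on[OF that(1) that(2) der[OF that(2)]])
 have s12: "Suc 0 = 1" "Suc 1 = 2" "Suc 2 = 3" "Suc 3 = 4" "Suc 4 = 5" "Suc 5 = 6" by simp_all
 have B03: "B 0 3 t = 0" if t: "t \<in> I" for t using step[of 0 2 t, OF low(2) t, unfolded s12] low(3)[OF t] by simp
 have B13: "B 1 3 t = 0" if t: "t \<in> I" for t using step[of 1 2 t, OF low(3) t, unfolded s12] diag[of 2 t] by simp
 have B04: "B 0 4 t = 0" if t: "t \<in> I" for t using step[of 0 3 t, OF B03 t, unfolded s12] B13[OF t] by simp
 define g where "g = B 0 5"
 have B14: "B 1 4 t = - g t" if t: "t \<in> I" for t
  using step[of 0 4 t, OF B04 t, unfolded s12] by (simp add: g_def eq_neg_iff_add_eq_0)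
 have B23: "B 2 3 t = g t" if t: "t \<in> I" for t
  using step[of 1 3 t, OF B13 t, unfolded s12] B14[OF t] by simp
 have dg: "(g has_vector_derivative B 1 5 t + B 0 6 t) (at t within I)" if t: "t \<in> I" for t
  using der[OF t, of 0 5, unfolded s12] by (simp add: g_def)
 \<comment> \<open>The three values of the form with \<open>i + j = 6\<close> are multiples of \<open>g'\<close>; the equation for \<open>c\<^sup>(\<^sup>6\<^sup>)\<close> then yields \<open>3 g' = - a\<^sub>5 g\<close>.\<close>
 have g1: "B 2 4 t + B 1 5 t = - (B 1 5 t + B 0 6 t)" if t: "t \<in> I" for t
 proof -
  have "((\<lambda>t. B 1 4 t + g t) has_vector_derivative (B 2 4 t + B 1 5 t) + (B 1 5 t + B 0 6 t)) (at t within I)"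
   using has_vector_derivative_add[OF der[OF t, of 1 4, unfolded s12] dg[OF t]] .
  then have "(B 2 4 t + B 1 5 t) + (B 1 5 t + B 0 6 t) = 0"
   by (rule derivative_const_on[rotated 2]) (use B14 t in auto)
  then show ?thesis by (simp only: eq_neg_iff_add_eq_0)
 qed
 have g2: "B 2 4 t = B 1 5 t + B 0 6 t" if t: "t \<in> I" for t
 proof -
  have "((\<lambda>t. B 2 3 t - g t) has_vector_derivative (B 3 3 t + B 2 4 t) - (B 1 5 t + B 0 6 t)) (at t within I)"
   using has_vector_derivative_diff[OF der[OF t, of 2 3, unfolded s12] dg[OF t]] .
  then have "(B 3 3 t + B 2 4 t) - (B 1 5 t + B 0 6 t) = 0"
   by (rule derivative_const_on[rotated 2]) (use B23 t in auto)
  then show ?thesis using diag[of 3 t] by simp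
 qed
 have B06: "B 0 6 t = - (a 5 t * g t)" if t: "t \<in> I" for t
 proof -
  have "B 0 6 t = - (\<Sum>j<6. a j t * B 0 j t)"
   unfolding B_def cc_6[OF t] bilinear6_minus[OF F] bilinear6_sum[OF F] bilinear6D[OF F] ..
  also have "(\<Sum>j<6. a j t * B 0 j t) = a 5 t * g t"
   unfolding sum_less_numeral using diag[of 0 t] low[OF t] B03[OF t] B04[OF t] by (simp add: g_def)
  finally show ?thesis .
 qed
 have g': "(g has_vector_derivative (- a 5 t / 3) * g t) (at t within I)" if t: "t \<in> I" for t
 proof -
  have e1: "B 2 4 t + B 1 5 t = - B 2 4 t" using g1[OF t] unfolding g2[OF t, symmetric] .
  have e2: "B 2 4 t = B 1 5 t + B 0 6 t" by (rule g2[OF t])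
  have "B 1 5 t = (B 2 4 t + B 1 5 t) - B 2 4 t" by simp
  then have "B 1 5 t = - 2 * B 2 4 t" unfolding e1 by simp
  moreover have "B 0 6 t = B 2 4 t - B 1 5 t" using e2 by simp
  ultimately have "3 * B 2 4 t = B 0 6 t" by simp
  then have "B 1 5 t + B 0 6 t = (- a 5 t / 3) * g t" using e2 B06[OF t] by (simp add: field_simps)
  then show ?thesis using dg[OF t] by simp
 qed
 have ca: "smooth_on I (a 5)" by (rule smooth_coeff) simp
 have sq: "smooth_on I (\<lambda>t. - a 5 t / 3)" "smooth_on I (\<lambda>t. - a 5 t / 6)"
  using smooth_on_mult[OF smooth_on_const[of "- 1 / 3"] ca] smooth_on_mult[OF smooth_on_const[of "- 1 / 6"] ca] by simp_all
 have g0: "g t0 \<noteq> 0"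
 proof
  assume "g t0 = 0"
  then have "g t = 0" if "t \<in> I" for t
   using scalar_unique[OF smooth_on_continuous[OF sq(1)] g' t0 that] by blast
  then have B0: "B 0 j t = 0" if "t \<in> I" "j < 6" for j t
  proof -
   have "j = 0 \<or> j = 1 \<or> j = 2 \<or> j = 3 \<or> j = 4 \<or> j = 5" using that(2) by auto
   then show ?thesis using diag[of 0 t] low[OF that(1)] B03[OF that(1)] B04[OF that(1)] \<open>\<And>t. t \<in> I \<Longrightarrow> g t = 0\<close>[OF that(1)]
    unfolding g_def by blast
  qed
  have "\<omega> p u = 0" for p u
  proof -
   define v where "v = vec_of (\<lambda>p. \<omega> p u)"
   have v: "v \<cdot> p = \<omega> p u" for p unfolding v_def using F by (intro pair_vec_of) (simp add: bilinear6_def)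
   have "v = 0"
   proof (rule C.spanning)
    fix t assume t: "t \<in> I"
    obtain E where E: "\<And>p. p = (\<Sum>j<6. (p \<cdot> E j) *s cc j t)" using C.frame_expansion[OF t] by metis
    have "\<omega> (cc 0 t) u = (\<Sum>j<6. (u \<cdot> E j) * B 0 j t)"
     unfolding B_def by (subst E[of u]) (simp only: bilinear6_sum[OF F] bilinear6D[OF F])
    then show "v \<cdot> cc 0 t = 0" unfolding v using B0[OF t] by simp
   qed
   then show ?thesis using v[of p] by simp
  qed
  then show False using nz by blast
 qed
 \<comment> \<open>With this exponent \<open>g / \<mu>\<^sup>2\<close> is constant, and it is the value of the form on the conjugate curve.\<close>
 obtain \<mu> where \<mu>: "smooth_on I \<mu>" "\<mu> t0 = 1" "\<And>t. t \<in> I \<Longrightarrow> (\<mu> has_vector_derivative (- a 5 t / 6) * \<mu> t) (at t within I)" "\<And>t. t \<in> I \<Longrightarrow> \<mu> t \<noteq> 0"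
  using scalar_exists[OF sq(2) t0] by blast
 define \<nu> where "\<nu> = (\<lambda>t. 1 / \<mu> t)"
 have \<nu>: "smooth_on I \<nu>" unfolding \<nu>_def using \<mu>(1,4) by (rule smooth_on_inverse)
 have gm: "g t = g t0 * (\<mu> t * \<mu> t)" if t: "t \<in> I" for t
 proof -
  have "((\<lambda>t. g t - g t0 * (\<mu> t * \<mu> t)) has_vector_derivative (- a 5 t / 3) * (g t - g t0 * (\<mu> t * \<mu> t))) (at t within I)" if t: "t \<in> I" for t
  proof -
   have "((\<lambda>t. g t - g t0 * (\<mu> t * \<mu> t)) has_vector_derivative
    (- a 5 t / 3) * g t - g t0 * (\<mu> t * ((- a 5 t / 6) * \<mu> t) + ((- a 5 t / 6) * \<mu> t) * \<mu> t)) (at t within I)"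
    by (intro has_vector_derivative_diff g' t has_vector_derivative_mult_right has_vector_derivative_mult \<mu>(3))
   moreover have "(- a 5 t / 3) * g t - g t0 * (\<mu> t * ((- a 5 t / 6) * \<mu> t) + ((- a 5 t / 6) * \<mu> t) * \<mu> t) = (- a 5 t / 3) * (g t - g t0 * (\<mu> t * \<mu> t))"
    by (simp add: field_simps)
   ultimately show ?thesis by simp
  qed
  then have "g t - g t0 * (\<mu> t * \<mu> t) = 0"
   by (rule scalar_unique[where y = "\<lambda>t. g t - g t0 * (\<mu> t * \<mu> t)", OF smooth_on_continuous[OF sq(1)] _ t0 t]) (simp_all add: \<mu>(2))
  then show ?thesis by simp
 qed
 define M where "M = ODO 6 (conj_coef \<mu>)"
 have eq: "odo_apply I M x t = (1 / \<mu> t) * odo_apply I L (\<lambda>s. \<mu> s * x s) t" if "x \<in> smooth_functions I" "t \<in> I" for x t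
  unfolding M_def by (rule conjugate(2)[OF \<mu>(1,4)]) (use that in \<open>auto simp: smooth_functions_def\<close>)
 have M: "is_odo I M" unfolding M_def by (rule conjugate(1)[OF \<mu>(1,4)])
 interpret J: jet_curve I M "tw \<nu>" unfolding \<nu>_def by (rule tw_jet_curve[OF M \<mu>(1,4) eq])
 have tw0: "tw \<nu> 0 t = \<nu> t *s cc 0 t" if t: "t \<in> I" for t using tw_cc[OF \<nu> t, of 0] by simp
 have form: "\<omega> (tw \<nu> 0 t) (tw \<nu> j t) = \<nu> t * (\<Sum>k\<le>j. of_nat (j choose k) * nderiv_on I k \<nu> t * B 0 (j - k) t)" if t: "t \<in> I" for j t
  unfolding tw0[OF t] tw_cc[OF \<nu> t, of j] bilinear6D[OF F] bilinear6_sum[OF F] B_def by (simp add: sum_distrib_left mult_ac)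
 have B0: "B 0 j t = 0" if "t \<in> I" "j < 5" for j t
 proof -
  have "j = 0 \<or> j = 1 \<or> j = 2 \<or> j = 3 \<or> j = 4" using that(2) by auto
  then show ?thesis using diag[of 0 t] low[OF that(1)] B03[OF that(1)] B04[OF that(1)] by blast
 qed
 have "self_adjoint I M"
 proof (rule J.self_adjoint_of_form[OF F skew _ _ g0])
  fix t j assume "t \<in> I" "j < (5::nat)"
  then show "\<omega> (tw \<nu> 0 t) (tw \<nu> j t) = 0" using form B0 by simp
 next
  fix t assume t: "t \<in> I"
  have "(\<Sum>k\<le>5. of_nat (5 choose k) * nderiv_on I k \<nu> t * B 0 (5 - k) t) = (\<Sum>k\<in>{0}. of_nat (5 choose k) * nderiv_on I k \<nu> t * B 0 (5 - k) t)"
   using B0[OF t] by (intro sum.mono_neutral_right) auto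
  then have "\<omega> (tw \<nu> 0 t) (tw \<nu> 5 t) = \<nu> t * (\<nu> t * g t)" using form[OF t, of 5] by (simp add: g_def)
  then show "\<omega> (tw \<nu> 0 t) (tw \<nu> 5 t) = g t0" unfolding gm[OF t] using \<mu>(4)[OF t] by (simp add: \<nu>_def)
 qed
 moreover have "equivalent_odo I L M" unfolding equivalent_odo_def using \<mu>(1,4) eq by blast
 ultimately show ?thesis using M by blast
qed

end

theorem theorem1p5:
  fixes I :: "real set" and L :: odo
  assumes "is_interval I" and "interior I \<noteq> {}"
    and "is_odo I L" and "odo_order L = 6"
  shows "(cfun.dim (X_perp I L 3) \<le> 5 \<longrightarrow> has_wronski_degree I L 3 1) \<and>
    (cfun.dim (X_perp I L 3) = 6 \<longrightarrow>
      ((\<exists>d>1. has_wronski_degree I L 3 d) \<longleftrightarrow>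
       (\<exists>M. is_odo I M \<and> self_adjoint I M \<and> equivalent_odo I L M)))"
proof -
 interpret odo6 I L using assms by unfold_locales
 show ?thesis
  unfolding dim_X_perp
 proof (intro conjI impI iffI)
  assume "vec.dim K \<le> 5"
  then show "has_wronski_degree I L 3 1" by (rule degree_one_small)
 next
  assume dim: "vec.dim K = 6" and "\<exists>d>1. has_wronski_degree I L 3 d"
  then have "\<not> has_wronski_degree I L 3 1"
   using has_wronski_degree_unique[OF _ _ punctured_nonempty] by blast
  then show "\<exists>M. is_odo I M \<and> self_adjoint I M \<and> equivalent_odo I L M" by (rule self_adjoint_of_degree[OF dim])
 next
  assume dim: "vec.dim K = 6" and "\<exists>M. is_odo I M \<and> self_adjoint I M \<and> equivalent_odo I L M"
  then have "has_wronski_degree I L 3 2" using degree_of_self_adjoint by blast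
  then show "\<exists>d>1. has_wronski_degree I L 3 d" by (intro exI[of _ 2]) simp
 qed
qed

end
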